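(* Let $Z\subseteq\mathbb{Z}+\frac12$ and let $\Gamma$ be the monoid of all monic polynomials in $\mathbb{C}[z]$ whose zero set is contained in $Z$. Let $\mathcal{O}=\{(z-\lambda)\mid\lambda\in\mathbb{Z}\}$. There is a $\mathbb{C}$-algebra isomorphism $$\mathscr{A}^{\mathrm{split}}(\Gamma,\mathcal{O})\cong\mathbb{C}[x_k^+,x_k^-,y_k^+,y_k^-\mid k\in Z]/(\mathrm{Rels}),$$ where the relations are, for all $j,k\in Z$: $$y_j^+x_k^+=y_j^-x_k^+=x_j^+x_k^+\quad\text{if }j<k,$$ $$x_j^-y_k^+=x_j^-y_k^-=x_j^-x_k^-\quad\text{if }j<k,$$ $$x_j^-x_k^+=0\quad\text{if }j\le k,$$ $$y_k^+y_k^-=(x_k^+)^2+(x_k^-)^2.$$ The isomorphism maps the generators $x_k^{\pm}$ and $y_k^{\pm}$ to the two simple and the two non-simple indecomposable classes in $K_0^{\mathrm{split}}(A(z-k)\text{-wmod}_{\mathcal{O}})$ respectively; explicitly $$x_k^+\mapsto[M^{z-k}_{(k,\infty)}],\quad x_k^-\mapsto[M^{z-k}_{(-\infty,k)}],\quad y_k^+\mapsto[M^{z-k}_{\mathbb{R}_k^+}],\quad y_k^-\mapsto[M^{z-k}_{\mathbb{R}_k^-}].$$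
   Context: Let $R=\mathbb{C}[z]$, $\sigma^{1/2}(z)=z-\frac12$, $\sigma(z)=z-1$. For nonzero $t\in\mathbb{C}[z]$, $A(t)$ is the $\mathbb{C}$-algebra generated by $\mathbb{C}[z]$ and $X^+,X^-$ with relations $X^{\pm}r=\sigma^{\pm1}(r)X^{\pm}$ ($r\in\mathbb{C}[z]$) and $X^{\pm}X^{\mp}=\sigma^{\pm1/2}(t)$. A weight module is an $A(t)$-module $M=\bigoplus_{\mathfrak{m}}M_{\mathfrak{m}}$, $M_{\mathfrak{m}}=\{v\mid\mathfrak{m}v=0\}$, over maximal ideals $\mathfrak{m}$ of $\mathbb{C}[z]$; $v\in M_{(z-\lambda)}$ is said to have weight $\lambda$. $A(t)\text{-wmod}_{\mathcal{O}}$ is the category of weight modules with finite-dimensional weight spaces and all weights in $\mathbb{Z}$. $K_0^{\mathrm{split}}$ denotes the split Grothendieck group: generated by classes $[M]$ with relations $[M\oplus M']=[M]+[M']$. If $M$ is a weight $A(t)$-module and $M'$ a weight $A(t')$-module, then $M\otimes_{\mathbb{C}[z]}M'$ is an $A(tt')$-module via $r(v\otimes v')=rv\otimes v'$ and $X^{\pm}(v\otimes v')=X^{\pm}v\otimes X^{\pm}v'$. This makes $$\mathscr{A}^{\mathrm{split}}(\Gamma,\mathcal{O})=\bigoplus_{t\in\Gamma}\mathbb{C}\otimes_{\mathbb{Z}}K_0^{\mathrm{split}}(A(t)\text{-wmod}_{\mathcal{O}})$$ into a commutative associative $\Gamma$-graded $\mathbb{C}$-algebra with $[M][M']=[M\otimes_{\mathbb{C}[z]}M']$;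 its identity is the class of the unique simple object of $A(1)\text{-wmod}_{\mathcal{O}}$. For $k\in\mathbb{Z}+\frac12$, the indecomposable objects of $A(z-k)\text{-wmod}_{\mathcal{O}}$ are, up to isomorphism, the following four modules, all with one-dimensional weight spaces: the simple module $M^{z-k}_{(k,\infty)}$ with weights $\{\lambda\in\mathbb{Z}\mid\lambda>k\}$; the simple module $M^{z-k}_{(-\infty,k)}$ with weights $\{\lambda\in\mathbb{Z}\mid\lambda<k\}$; the module $M^{z-k}_{\mathbb{R}_k^+}$ with set of weights $\mathbb{Z}$, on which $X^+v\ne0$ for $v\neq 0$ of weight $k-\frac12$ and $X^-v=0$ for $v$ of weight $k+\frac12$; and the module $M^{z-k}_{\mathbb{R}_k^-}$ with set of weights $\mathbb{Z}$, on which $X^+v=0$ for $v$ of weight $k-\frac12$ and $X^-v\neq0$ for $v\ne0$ of weight $k+\frac12$.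
   Formalization: The first two families of relations are imposed for j ≤ k instead of j < k: as printed the map is not injective for nonempty Z, since y_k^± x_k^+ = (x_k^+)^2 and x_k^- y_k^± = (x_k^-)^2 hold for the module classes but do not follow from the printed relations. *)

theory Defs
  imports Complex_Main
    "HOL-Library.Poly_Mapping"
    "HOL-Computational_Algebra.Polynomial"
    "HOL-Algebra.QuotRing"
    "HOL-Algebra.Free_Abelian_Groups"
    "HOL-Algebra.Module"
begin

section \<open>Algebraic preliminaries\<close>

definition UNIV_ring :: "'a::ring_1 ring" where
  "UNIV_ring = \<lparr>carrier = UNIV, monoid.mult = (*), monoid.one = 1, ring.zero = 0, ring.add = (+)\<rparr>"

text \<open>Left modules over a possibly noncommutative ring, with the axioms of the library locale
  for modules over commutative rings. The fields \<open>mult\<close> and \<open>one\<close> of a module record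
  play no role.\<close>

locale left_module = R?: ring R + M?: abelian_group M
  for R :: "('r, 's) ring_scheme" (structure) and M :: "('r, 'v) module" (structure) +
  assumes smult_closed:
      "\<lbrakk>a \<in> carrier R; x \<in> carrier M\<rbrakk> \<Longrightarrow> a \<odot>\<^bsub>M\<^esub> x \<in> carrier M"
    and smult_l_distr:
      "\<lbrakk>a \<in> carrier R; b \<in> carrier R; x \<in> carrier M\<rbrakk>
        \<Longrightarrow> (a \<oplus>\<^bsub>R\<^esub> b) \<odot>\<^bsub>M\<^esub> x = a \<odot>\<^bsub>M\<^esub> x \<oplus>\<^bsub>M\<^esub> b \<odot>\<^bsub>M\<^esub> x"
    and smult_r_distr:
      "\<lbrakk>a \<in> carrier R; x \<in> carrier M; y \<in> carrier M\<rbrakk>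
        \<Longrightarrow> a \<odot>\<^bsub>M\<^esub> (x \<oplus>\<^bsub>M\<^esub> y) = a \<odot>\<^bsub>M\<^esub> x \<oplus>\<^bsub>M\<^esub> a \<odot>\<^bsub>M\<^esub> y"
    and smult_assoc1:
      "\<lbrakk>a \<in> carrier R; b \<in> carrier R; x \<in> carrier M\<rbrakk>
        \<Longrightarrow> (a \<otimes>\<^bsub>R\<^esub> b) \<odot>\<^bsub>M\<^esub> x = a \<odot>\<^bsub>M\<^esub> (b \<odot>\<^bsub>M\<^esub> x)"
    and smult_one: "x \<in> carrier M \<Longrightarrow> \<one>\<^bsub>R\<^esub> \<odot>\<^bsub>M\<^esub> x = x"

definition module_iso ::
  "('r, 's) ring_scheme \<Rightarrow> ('r, 'v) module \<Rightarrow> ('r, 'w) module \<Rightarrow> ('v \<Rightarrow> 'w) set" where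
  "module_iso R M N = {f. bij_betw f (carrier M) (carrier N)
     \<and> (\<forall>x\<in>carrier M. \<forall>y\<in>carrier M. f (x \<oplus>\<^bsub>M\<^esub> y) = f x \<oplus>\<^bsub>N\<^esub> f y)
     \<and> (\<forall>a\<in>carrier R. \<forall>x\<in>carrier M. f (a \<odot>\<^bsub>M\<^esub> x) = a \<odot>\<^bsub>N\<^esub> f x)}"

definition simple_module :: "('r, 's) ring_scheme \<Rightarrow> ('r, 'v) module \<Rightarrow> bool" where
  "simple_module R M \<longleftrightarrow> carrier M \<noteq> {\<zero>\<^bsub>M\<^esub>}
     \<and> (\<forall>H. submodule H R M \<longrightarrow> H = {\<zero>\<^bsub>M\<^esub>} \<or> H = carrier M)"

definition indecomposable_module :: "('r, 's) ring_scheme \<Rightarrow> ('r, 'v) module \<Rightarrow> bool" where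
  "indecomposable_module R M \<longleftrightarrow> carrier M \<noteq> {\<zero>\<^bsub>M\<^esub>}
     \<and> (\<forall>H K. submodule H R M \<and> submodule K R M \<and> H \<inter> K = {\<zero>\<^bsub>M\<^esub>}
          \<and> carrier M = H <+>\<^bsub>M\<^esub> K \<longrightarrow> H = {\<zero>\<^bsub>M\<^esub>} \<or> K = {\<zero>\<^bsub>M\<^esub>})"

definition module_of_group :: "('v, 'm) monoid_scheme \<Rightarrow> ('r \<Rightarrow> 'v \<Rightarrow> 'v) \<Rightarrow> ('r, 'v) module" where
  "module_of_group G s = \<lparr>carrier = carrier G,
     monoid.mult = (\<lambda>_ _. undefined), monoid.one = undefined,
     ring.zero = \<one>\<^bsub>G\<^esub>, ring.add = (\<lambda>x y. x \<otimes>\<^bsub>G\<^esub> y), smult = s\<rparr>"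

definition int_module :: "('v, 'm) monoid_scheme \<Rightarrow> (int, 'v) module" where
  "int_module G = module_of_group G (\<lambda>n x. x [^]\<^bsub>G\<^esub> n)"

definition direct_sum :: "('r, 'v) module \<Rightarrow> ('r, 'w) module \<Rightarrow> ('r, 'v \<times> 'w) module" where
  "direct_sum M N = \<lparr>carrier = carrier M \<times> carrier N,
     monoid.mult = (\<lambda>_ _. undefined), monoid.one = undefined,
     ring.zero = (\<zero>\<^bsub>M\<^esub>, \<zero>\<^bsub>N\<^esub>),
     ring.add = (\<lambda>(x, y) (x', y'). (x \<oplus>\<^bsub>M\<^esub> x', y \<oplus>\<^bsub>N\<^esub> y')),
     smult = (\<lambda>a (x, y). (a \<odot>\<^bsub>M\<^esub> x, a \<odot>\<^bsub>N\<^esub> y))\<rparr>"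

subsection \<open>Tensor product over a commutative ring\<close>

definition tensor_rels ::
  "('r, 's) ring_scheme \<Rightarrow> ('r, 'v) module \<Rightarrow> ('r, 'w) module \<Rightarrow> ('v \<times> 'w \<Rightarrow>\<^sub>0 int) set" where
  "tensor_rels R M N =
     {frag_of (x \<oplus>\<^bsub>M\<^esub> x', y) - frag_of (x, y) - frag_of (x', y) | x x' y.
        x \<in> carrier M \<and> x' \<in> carrier M \<and> y \<in> carrier N}
   \<union> {frag_of (x, y \<oplus>\<^bsub>N\<^esub> y') - frag_of (x, y) - frag_of (x, y') | x y y'.
        x \<in> carrier M \<and> y \<in> carrier N \<and> y' \<in> carrier N}
   \<union> {frag_of (r \<odot>\<^bsub>M\<^esub> x, y) - frag_of (x, r \<odot>\<^bsub>N\<^esub> y) | r x y.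
        r \<in> carrier R \<and> x \<in> carrier M \<and> y \<in> carrier N}"

definition tensor_free :: "('r, 'v) module \<Rightarrow> ('r, 'w) module \<Rightarrow> ('v \<times> 'w \<Rightarrow>\<^sub>0 int) monoid" where
  "tensor_free M N = free_Abelian_group (carrier M \<times> carrier N)"

definition tensor_sub ::
  "('r, 's) ring_scheme \<Rightarrow> ('r, 'v) module \<Rightarrow> ('r, 'w) module \<Rightarrow> ('v \<times> 'w \<Rightarrow>\<^sub>0 int) set" where
  "tensor_sub R M N = generate (tensor_free M N) (tensor_rels R M N)"

definition tensor_group ::
  "('r, 's) ring_scheme \<Rightarrow> ('r, 'v) module \<Rightarrow> ('r, 'w) module \<Rightarrow> ('v \<times> 'w \<Rightarrow>\<^sub>0 int) set monoid" where
  "tensor_group R M N = tensor_free M N Mod tensor_sub R M N"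

definition tensor_elem ::
  "('r, 's) ring_scheme \<Rightarrow> ('r, 'v) module \<Rightarrow> ('r, 'w) module \<Rightarrow> 'v \<Rightarrow> 'w \<Rightarrow> ('v \<times> 'w \<Rightarrow>\<^sub>0 int) set" where
  "tensor_elem R M N x y = tensor_sub R M N #>\<^bsub>tensor_free M N\<^esub> frag_of (x, y)"

text \<open>The endomorphism \<open>f \<otimes> id\<close> induced by an \<open>R\<close>-linear \<open>f\<close>; the union is over the
  representatives of a coset, as in \<^const>\<open>rcoset_mult\<close>.\<close>

definition tensor_left ::
  "('r, 's) ring_scheme \<Rightarrow> ('r, 'v) module \<Rightarrow> ('r, 'w) module \<Rightarrow> ('v \<Rightarrow> 'v)
     \<Rightarrow> ('v \<times> 'w \<Rightarrow>\<^sub>0 int) set \<Rightarrow> ('v \<times> 'w \<Rightarrow>\<^sub>0 int) set" where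
  "tensor_left R M N f S =
     (\<Union>p\<in>S. tensor_sub R M N #>\<^bsub>tensor_free M N\<^esub> frag_extend (\<lambda>(x, y). frag_of (f x, y)) p)"

section \<open>The algebras \<open>A(t)\<close>\<close>

text \<open>Words in the letters \<open>z, X\<^sup>+, X\<^sup>-\<close>, written additively so that
  \<open>gwa_word \<Rightarrow>\<^sub>0 complex\<close> is the free associative algebra on these letters.\<close>

datatype gwa_letter = LZ | LPlus | LMinus
datatype gwa_word = GWord "gwa_letter list"

instantiation gwa_word :: monoid_add
begin

definition zero_gwa_word :: gwa_word where "zero_gwa_word = GWord []"

fun plus_gwa_word :: "gwa_word \<Rightarrow> gwa_word \<Rightarrow> gwa_word" where
  "plus_gwa_word (GWord u) (GWord v) = GWord (u @ v)"

instance
proof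
  fix a b c :: gwa_word
  show "a + b + c = a + (b + c)" by (cases a; cases b; cases c) simp
  show "0 + a = a" "a + 0 = a" by (cases a; simp add: zero_gwa_word_def)+
qed

end

type_synonym gwa_free = "gwa_word \<Rightarrow>\<^sub>0 complex"

definition gwa_letter :: "gwa_letter \<Rightarrow> gwa_free" where
  "gwa_letter l = Poly_Mapping.single (GWord [l]) 1"

definition gwa_poly :: "complex poly \<Rightarrow> gwa_free" where
  "gwa_poly r = (\<Sum>i\<le>degree r. Poly_Mapping.single 0 (coeff r i) * gwa_letter LZ ^ i)"

text \<open>The automorphism \<open>\<sigma>\<^sup>a\<close> of \<open>\<complex>[z]\<close>, i.e. \<open>z \<mapsto> z - a\<close>.\<close>

definition sigma_pow :: "complex \<Rightarrow> complex poly \<Rightarrow> complex poly" where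
  "sigma_pow a r = pcompose r [:- a, 1:]"

definition gwa_rels :: "complex poly \<Rightarrow> gwa_free set" where
  "gwa_rels t =
     {gwa_letter LPlus * gwa_poly r - gwa_poly (sigma_pow 1 r) * gwa_letter LPlus | r. True}
   \<union> {gwa_letter LMinus * gwa_poly r - gwa_poly (sigma_pow (- 1) r) * gwa_letter LMinus | r. True}
   \<union> {gwa_letter LPlus * gwa_letter LMinus - gwa_poly (sigma_pow (1/2) t),
      gwa_letter LMinus * gwa_letter LPlus - gwa_poly (sigma_pow (- 1/2) t)}"

definition gwa_ideal :: "complex poly \<Rightarrow> gwa_free set" where
  "gwa_ideal t = Idl\<^bsub>UNIV_ring\<^esub> (gwa_rels t)"

definition GWA :: "complex poly \<Rightarrow> gwa_free set ring" where
  "GWA t = UNIV_ring Quot gwa_ideal t"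

definition gwa_of_poly :: "complex poly \<Rightarrow> complex poly \<Rightarrow> gwa_free set" where
  "gwa_of_poly t r = gwa_ideal t +>\<^bsub>UNIV_ring\<^esub> gwa_poly r"

definition gwa_X :: "complex poly \<Rightarrow> gwa_letter \<Rightarrow> gwa_free set" where
  "gwa_X t l = gwa_ideal t +>\<^bsub>UNIV_ring\<^esub> gwa_letter l"

type_synonym 'v gwa_module = "(gwa_free set, 'v) module"

section \<open>Weight modules\<close>

abbreviation Cz :: "complex poly ring" where
  "Cz \<equiv> UNIV_ring"

text \<open>Restriction of scalars along \<open>\<complex>[z] \<rightarrow> A(t)\<close>.\<close>

definition restrict_poly :: "complex poly \<Rightarrow> 'v gwa_module \<Rightarrow> (complex poly, 'v) module" where
  "restrict_poly t M = \<lparr>carrier = carrier M,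
     monoid.mult = monoid.mult M, monoid.one = monoid.one M,
     ring.zero = ring.zero M, ring.add = ring.add M,
     smult = (\<lambda>r v. gwa_of_poly t r \<odot>\<^bsub>M\<^esub> v)\<rparr>"

definition weight_space :: "complex poly \<Rightarrow> 'v gwa_module \<Rightarrow> complex poly set \<Rightarrow> 'v set" where
  "weight_space t M \<mm> = {v \<in> carrier M. \<forall>r\<in>\<mm>. gwa_of_poly t r \<odot>\<^bsub>M\<^esub> v = \<zero>\<^bsub>M\<^esub>}"

definition weight_module :: "complex poly \<Rightarrow> 'v gwa_module \<Rightarrow> bool" where
  "weight_module t M \<longleftrightarrow> left_module (GWA t) M \<and>
     (\<forall>v\<in>carrier M. \<exists>!f.
        (\<forall>\<mm>. if maximalideal \<mm> Cz then f \<mm> \<in> weight_space t M \<mm> else f \<mm> = \<zero>\<^bsub>M\<^esub>)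
        \<and> finite {\<mm>. f \<mm> \<noteq> \<zero>\<^bsub>M\<^esub>}
        \<and> v = finsum M f {\<mm>. f \<mm> \<noteq> \<zero>\<^bsub>M\<^esub>})"

definition weight_ideal :: "complex \<Rightarrow> complex poly set" where
  "weight_ideal l = PIdl\<^bsub>Cz\<^esub> [:- l, 1:]"

definition has_dim :: "complex poly \<Rightarrow> 'v gwa_module \<Rightarrow> 'v set \<Rightarrow> nat \<Rightarrow> bool" where
  "has_dim t M W n \<longleftrightarrow> (\<exists>B. finite B \<and> card B = n \<and> B \<subseteq> W \<and>
     (\<forall>v\<in>W. \<exists>!c::'v \<Rightarrow> complex. c \<in> B \<rightarrow>\<^sub>E UNIV
        \<and> v = finsum M (\<lambda>b. gwa_of_poly t [:c b:] \<odot>\<^bsub>M\<^esub> b) B))"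

definition weights :: "complex poly \<Rightarrow> 'v gwa_module \<Rightarrow> complex set" where
  "weights t M = {l. weight_space t M (weight_ideal l) \<noteq> {\<zero>\<^bsub>M\<^esub>}}"

definition orbit_O :: "complex poly set set" where
  "orbit_O = range (\<lambda>n::int. weight_ideal (of_int n))"

definition in_wmod_O :: "complex poly \<Rightarrow> 'v gwa_module \<Rightarrow> bool" where
  "in_wmod_O t M \<longleftrightarrow> weight_module t M \<and>
     (\<forall>\<mm>. maximalideal \<mm> Cz \<longrightarrow>
        (\<exists>n. has_dim t M (weight_space t M \<mm>) n)
        \<and> (weight_space t M \<mm> \<noteq> {\<zero>\<^bsub>M\<^esub>} \<longrightarrow> \<mm> \<in> orbit_O))"

text \<open>Every object of \<open>A(t)-wmod\<^sub>O\<close> has countable dimension over \<open>\<complex>\<close>, so it is isomorphic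
  to one whose elements lie in the fixed type \<open>nat \<Rightarrow>\<^sub>0 complex\<close>. The set \<open>wmod_O t\<close> is thus a
  small version of the category.\<close>

type_synonym vec = "nat \<Rightarrow>\<^sub>0 complex"

definition wmod_O :: "complex poly \<Rightarrow> vec gwa_module set" where
  "wmod_O t = {M. in_wmod_O t M}"

text \<open>The isomorphism class, inside the small version, of a module with elements of any type.\<close>

definition iso_class :: "complex poly \<Rightarrow> 'v gwa_module \<Rightarrow> vec gwa_module set" where
  "iso_class t M = {N \<in> wmod_O t. module_iso (GWA t) N M \<noteq> {}}"

definition gwa_tensor ::
  "complex poly \<Rightarrow> complex poly \<Rightarrow> 'v gwa_module \<Rightarrow> 'w gwa_module
     \<Rightarrow> ('v \<times> 'w \<Rightarrow>\<^sub>0 int) set gwa_module" where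
  "gwa_tensor t t' M M' =
    (let G = tensor_group Cz (restrict_poly t M) (restrict_poly t' M');
         tens = tensor_elem Cz (restrict_poly t M) (restrict_poly t' M')
     in module_of_group G (SOME s.
          left_module (GWA (t * t')) (module_of_group G s) \<and>
          (\<forall>v\<in>carrier M. \<forall>v'\<in>carrier M'.
             (\<forall>r. s (gwa_of_poly (t * t') r) (tens v v') = tens (gwa_of_poly t r \<odot>\<^bsub>M\<^esub> v) v')
             \<and> (\<forall>l\<in>{LPlus, LMinus}.
                  s (gwa_X (t * t') l) (tens v v')
                    = tens (gwa_X t l \<odot>\<^bsub>M\<^esub> v) (gwa_X t' l \<odot>\<^bsub>M'\<^esub> v')))))"

section \<open>The split Grothendieck group and the algebra \<open>\<A>(\<Gamma>, O)\<close>\<close>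

type_synonym k0 = "(vec gwa_module set \<Rightarrow>\<^sub>0 int) set"

definition K0_free :: "complex poly \<Rightarrow> (vec gwa_module set \<Rightarrow>\<^sub>0 int) monoid" where
  "K0_free t = free_Abelian_group (iso_class t ` wmod_O t)"

definition K0_sub :: "complex poly \<Rightarrow> k0" where
  "K0_sub t = generate (K0_free t)
     {frag_of (iso_class t (direct_sum M M')) - frag_of (iso_class t M) - frag_of (iso_class t M')
        | M M'. M \<in> wmod_O t \<and> M' \<in> wmod_O t}"

definition K0_split :: "complex poly \<Rightarrow> k0 monoid" where
  "K0_split t = K0_free t Mod K0_sub t"

definition K0_class :: "complex poly \<Rightarrow> 'v gwa_module \<Rightarrow> k0" where
  "K0_class t M = K0_sub t #>\<^bsub>K0_free t\<^esub> frag_of (iso_class t M)"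

type_synonym ck0 = "(complex \<times> k0 \<Rightarrow>\<^sub>0 int) set"

abbreviation CC :: "complex ring" where
  "CC \<equiv> UNIV_ring"

abbreviation ZZ :: "int ring" where
  "ZZ \<equiv> UNIV_ring"

definition CK0 :: "complex poly \<Rightarrow> (complex, ck0) module" where
  "CK0 t = module_of_group (tensor_group ZZ (int_module (add_monoid CC)) (int_module (K0_split t)))
     (\<lambda>c. tensor_left ZZ (int_module (add_monoid CC)) (int_module (K0_split t)) ((*) c))"

definition CK0_elem :: "complex poly \<Rightarrow> complex \<Rightarrow> k0 \<Rightarrow> ck0" where
  "CK0_elem t = tensor_elem ZZ (int_module (add_monoid CC)) (int_module (K0_split t))"

definition Gam :: "real set \<Rightarrow> complex poly set" where
  "Gam Z = {t. lead_coeff t = 1 \<and> {a. poly t a = 0} \<subseteq> complex_of_real ` Z}"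

definition split_space :: "real set \<Rightarrow> (complex, complex poly \<Rightarrow> ck0) module" where
  "split_space Z = module_of_group (sum_group (Gam Z) (\<lambda>t. add_monoid (CK0 t)))
     (\<lambda>c a. \<lambda>t\<in>Gam Z. c \<odot>\<^bsub>CK0 t\<^esub> a t)"

text \<open>The class \<open>[M] = 1 \<otimes> [M]\<close> in the summand of degree \<open>t\<close>.\<close>

definition split_class :: "real set \<Rightarrow> complex poly \<Rightarrow> 'v gwa_module \<Rightarrow> complex poly \<Rightarrow> ck0" where
  "split_class Z t M =
     (\<lambda>s\<in>Gam Z. if s = t then CK0_elem t 1 (K0_class t M) else \<zero>\<^bsub>CK0 s\<^esub>)"

text \<open>The classes span, so the bilinear map below is unique on the carrier.\<close>

definition split_mult ::
  "real set \<Rightarrow> (complex poly \<Rightarrow> ck0) \<Rightarrow> (complex poly \<Rightarrow> ck0) \<Rightarrow> (complex poly \<Rightarrow> ck0)" where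
  "split_mult Z = (let V = split_space Z in SOME \<mu>.
     (\<forall>a\<in>carrier V. \<forall>b\<in>carrier V. \<mu> a b \<in> carrier V
        \<and> (\<forall>a'\<in>carrier V. \<mu> (a \<oplus>\<^bsub>V\<^esub> a') b = \<mu> a b \<oplus>\<^bsub>V\<^esub> \<mu> a' b)
        \<and> (\<forall>b'\<in>carrier V. \<mu> a (b \<oplus>\<^bsub>V\<^esub> b') = \<mu> a b \<oplus>\<^bsub>V\<^esub> \<mu> a b')
        \<and> (\<forall>c. \<mu> (c \<odot>\<^bsub>V\<^esub> a) b = c \<odot>\<^bsub>V\<^esub> \<mu> a b \<and> \<mu> a (c \<odot>\<^bsub>V\<^esub> b) = c \<odot>\<^bsub>V\<^esub> \<mu> a b))
     \<and> (\<forall>t\<in>Gam Z. \<forall>t'\<in>Gam Z. \<forall>M\<in>wmod_O t. \<forall>M'\<in>wmod_O t'.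
          \<mu> (split_class Z t M) (split_class Z t' M') = split_class Z (t * t') (gwa_tensor t t' M M')))"

definition split_one :: "real set \<Rightarrow> complex poly \<Rightarrow> ck0" where
  "split_one Z = (THE u. \<exists>M\<in>wmod_O 1. simple_module (GWA 1) M \<and> u = split_class Z 1 M)"

definition split_algebra :: "real set \<Rightarrow> (complex, complex poly \<Rightarrow> ck0) module" where
  "split_algebra Z = (split_space Z)\<lparr>monoid.mult := split_mult Z, monoid.one := split_one Z\<rparr>"

section \<open>The indecomposable modules over \<open>A(z - k)\<close>\<close>

definition lin :: "real \<Rightarrow> complex poly" where
  "lin k = [:- complex_of_real k, 1:]"

definition one_dim_weights :: "complex poly \<Rightarrow> 'v gwa_module \<Rightarrow> bool" where
  "one_dim_weights t M \<longleftrightarrow> (\<forall>l\<in>weights t M. has_dim t M (weight_space t M (weight_ideal l)) 1)"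

definition X_nonzero_at :: "complex poly \<Rightarrow> 'v gwa_module \<Rightarrow> gwa_letter \<Rightarrow> real \<Rightarrow> bool" where
  "X_nonzero_at t M l a \<longleftrightarrow> (\<forall>v\<in>weight_space t M (weight_ideal (complex_of_real a)).
     v \<noteq> \<zero>\<^bsub>M\<^esub> \<longrightarrow> gwa_X t l \<odot>\<^bsub>M\<^esub> v \<noteq> \<zero>\<^bsub>M\<^esub>)"

definition X_zero_at :: "complex poly \<Rightarrow> 'v gwa_module \<Rightarrow> gwa_letter \<Rightarrow> real \<Rightarrow> bool" where
  "X_zero_at t M l a \<longleftrightarrow> (\<forall>v\<in>weight_space t M (weight_ideal (complex_of_real a)).
     gwa_X t l \<odot>\<^bsub>M\<^esub> v = \<zero>\<^bsub>M\<^esub>)"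

text \<open>The four isomorphism classes
  \<open>M\<^sub>(\<^sub>k\<^sub>,\<^sub>\<infinity>\<^sub>)\<close>, \<open>M\<^sub>(\<^sub>-\<^sub>\<infinity>\<^sub>,\<^sub>k\<^sub>)\<close>, \<open>M\<^sub>R\<^sub>k\<^sub>+\<close>, \<open>M\<^sub>R\<^sub>k\<^sub>-\<close>.\<close>

definition M_right :: "real \<Rightarrow> vec gwa_module set" where
  "M_right k = {M \<in> wmod_O (lin k). simple_module (GWA (lin k)) M
     \<and> weights (lin k) M = {of_int n | n::int. real_of_int n > k} \<and> one_dim_weights (lin k) M}"

definition M_left :: "real \<Rightarrow> vec gwa_module set" where
  "M_left k = {M \<in> wmod_O (lin k). simple_module (GWA (lin k)) M
     \<and> weights (lin k) M = {of_int n | n::int. real_of_int n < k} \<and> one_dim_weights (lin k) M}"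

definition M_full_plus :: "real \<Rightarrow> vec gwa_module set" where
  "M_full_plus k = {M \<in> wmod_O (lin k).
     indecomposable_module (GWA (lin k)) M \<and> \<not> simple_module (GWA (lin k)) M
     \<and> weights (lin k) M = \<int> \<and> one_dim_weights (lin k) M
     \<and> X_nonzero_at (lin k) M LPlus (k - 1/2) \<and> X_zero_at (lin k) M LMinus (k + 1/2)}"

definition M_full_minus :: "real \<Rightarrow> vec gwa_module set" where
  "M_full_minus k = {M \<in> wmod_O (lin k).
     indecomposable_module (GWA (lin k)) M \<and> \<not> simple_module (GWA (lin k)) M
     \<and> weights (lin k) M = \<int> \<and> one_dim_weights (lin k) M
     \<and> X_zero_at (lin k) M LPlus (k - 1/2) \<and> X_nonzero_at (lin k) M LMinus (k + 1/2)}"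

section \<open>The presented commutative algebra\<close>

datatype gen = XPlus real | XMinus real | YPlus real | YMinus real

type_synonym gpoly = "(gen \<Rightarrow>\<^sub>0 nat) \<Rightarrow>\<^sub>0 complex"

definition gvars :: "real set \<Rightarrow> gen set" where
  "gvars Z = XPlus ` Z \<union> XMinus ` Z \<union> YPlus ` Z \<union> YMinus ` Z"

definition gpoly_ring :: "real set \<Rightarrow> gpoly ring" where
  "gpoly_ring Z = \<lparr>carrier = {p. \<forall>m\<in>Poly_Mapping.keys p. Poly_Mapping.keys m \<subseteq> gvars Z},
     monoid.mult = (*), monoid.one = 1, ring.zero = 0, ring.add = (+)\<rparr>"

definition gvar :: "gen \<Rightarrow> gpoly" where
  "gvar g = Poly_Mapping.single (Poly_Mapping.single g 1) 1"

abbreviation "xp k \<equiv> gvar (XPlus k)"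
abbreviation "xm k \<equiv> gvar (XMinus k)"
abbreviation "yp k \<equiv> gvar (YPlus k)"
abbreviation "ym k \<equiv> gvar (YMinus k)"

text \<open>The first two families include \<open>j = k\<close>. The relations
  \<open>y\<^sub>k\<^sup>\<plusminus> x\<^sub>k\<^sup>+ = (x\<^sub>k\<^sup>+)\<^sup>2\<close> and \<open>x\<^sub>k\<^sup>- y\<^sub>k\<^sup>\<plusminus> = (x\<^sub>k\<^sup>-)\<^sup>2\<close> hold between the
  classes of modules, because both sides are the class of the simple
  \<open>A((z - k)\<^sup>2)\<close>-module on the same weights; but they do not follow from the remaining relations
  (send \<open>x\<^sub>k\<^sup>+, x\<^sub>k\<^sup>-, y\<^sub>k\<^sup>+, y\<^sub>k\<^sup>-\<close> to \<open>1, 0, 2, 1/2\<close>, respectively to \<open>0, 1, 2, 1/2\<close>, and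
  all other generators to \<open>0\<close>).\<close>

definition gen_rels :: "real set \<Rightarrow> gpoly set" where
  "gen_rels Z =
     {yp j * xp k - xp j * xp k | j k. j \<in> Z \<and> k \<in> Z \<and> j \<le> k}
   \<union> {ym j * xp k - xp j * xp k | j k. j \<in> Z \<and> k \<in> Z \<and> j \<le> k}
   \<union> {xm j * yp k - xm j * xm k | j k. j \<in> Z \<and> k \<in> Z \<and> j \<le> k}
   \<union> {xm j * ym k - xm j * xm k | j k. j \<in> Z \<and> k \<in> Z \<and> j \<le> k}
   \<union> {xm j * xp k | j k. j \<in> Z \<and> k \<in> Z \<and> j \<le> k}
   \<union> {yp k * ym k - (xp k ^ 2 + xm k ^ 2) | k. k \<in> Z}"

definition pres_ideal :: "real set \<Rightarrow> gpoly set" where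
  "pres_ideal Z = Idl\<^bsub>gpoly_ring Z\<^esub> (gen_rels Z)"

definition pres_elem :: "real set \<Rightarrow> gpoly \<Rightarrow> gpoly set" where
  "pres_elem Z p = pres_ideal Z +>\<^bsub>gpoly_ring Z\<^esub> p"

definition pres_algebra :: "real set \<Rightarrow> (complex, gpoly set) module" where
  "pres_algebra Z = (let Q = gpoly_ring Z Quot pres_ideal Z in
     \<lparr>carrier = carrier Q, monoid.mult = monoid.mult Q, monoid.one = monoid.one Q,
     ring.zero = ring.zero Q, ring.add = ring.add Q,
      smult = (\<lambda>c a. pres_elem Z (Poly_Mapping.single 0 c) \<otimes>\<^bsub>Q\<^esub> a)\<rparr>)"

definition calgebra_iso :: "(complex, 'a) module \<Rightarrow> (complex, 'b) module \<Rightarrow> ('a \<Rightarrow> 'b) set" where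
  "calgebra_iso A B = {h \<in> ring_iso A B. algebra CC A \<and> algebra CC B
     \<and> (\<forall>c. \<forall>a\<in>carrier A. h (c \<odot>\<^bsub>A\<^esub> a) = c \<odot>\<^bsub>B\<^esub> h a)}"

end

theory Submission
  imports Defs
    "HOL-Computational_Algebra.Fundamental_Theorem_Algebra"
    "HOL-Library.Nat_Bijection"
    "HOL-Library.Function_Algebras"
    "HOL-Library.Multiset"
begin

text \<open>Up to isomorphism, a weight module is given by a list of diagrams: a diagram records which
  weights occur and along which edges between neighbouring weights \<open>X\<^sup>+\<close> and \<open>X\<^sup>-\<close> act
  as non-zero maps. The diagrams of the indecomposable modules are the connected ones (strings), and
  the tensor product of modules corresponds to the intersection of diagrams. For a connected
  diagram \<open>s\<close>, counting the diagrams containing \<open>s\<close> is additive and multiplicative. These ranks,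
  for all \<open>s\<close> and graded by the zeros of \<open>t\<close>, are well defined by the Krull--Schmidt property and
  embed the split algebra into a product of monoid algebras of multisets of zeros.

  The polynomial ring is mapped to the same product by sending each generator to the rank function of its
  diagram, and the relations are respected. Modulo the relations, every monomial is a sum of normal
  forms, one for each string: for every zero \<open>k\<close> the generator at \<open>k\<close> prescribed by the shape of the
  string near \<open>k\<close>. As the rank functions of distinct strings are linearly independent, the kernel
  is the ideal of the relations, and both images are spanned by the rank functions of strings.\<close>

text \<open>The hard step is the decomposition into strings. A decomposition built weight by weight
  cannot keep its bases fixed: the next break demands a basis adapted to the kernel of
  \<open>U\<close> and to the image of \<open>D\<close>. So the induction hypothesis
  \<open>flex\<close> asserts more, namely that for one ordered basis of the last weight space every
  triangular change of it consists of the end vectors of some decomposition on the left. Triangular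
  changes suffice to adapt a basis, and they can be carried across a break. The scalar on a
  \<open>Dn\<close> edge has to be the value of \<open>t\<close> away from the zeros; at a zero any
  nonzero number gives a module. The choice \<open>hat\<close> is multiplicative in
  \<open>t\<close>, so that tensor products of diagram modules become intersections without any
  rescaling. The multiplication of the split algebra is given by a choice. That ranks are
  multiplicative is derived from its specification alone, and since ranks are faithful, the choice
  is irrelevant.\<close>

lemma UNIV_ring_simps [simp]:
  "carrier UNIV_ring = UNIV" "monoid.mult UNIV_ring = (*)" "monoid.one UNIV_ring = 1"
  "ring.zero UNIV_ring = 0" "ring.add UNIV_ring = (+)"
  by (simp_all add: UNIV_ring_def)

lemma ring_UNIV_ring: "ring (UNIV_ring :: 'a::ring_1 ring)"
proof (rule ringI)
  show "abelian_group (UNIV_ring :: 'a ring)"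
  proof (rule abelian_groupI)
    fix x :: 'a
    show "\<exists>y\<in>carrier UNIV_ring. y \<oplus>\<^bsub>UNIV_ring\<^esub> x = \<zero>\<^bsub>UNIV_ring\<^esub>"
      by (rule bexI[of _ "-x"]) auto
  qed (auto simp: algebra_simps)
  show "monoid (UNIV_ring :: 'a ring)" by (rule monoidI) (auto simp: algebra_simps)
qed (auto simp: algebra_simps)

lemma cring_UNIV_ring: "cring (UNIV_ring :: 'a::comm_ring_1 ring)"
proof (rule cringI)
  show "abelian_group (UNIV_ring :: 'a ring)"
    by (rule ring.is_abelian_group[OF ring_UNIV_ring])
  show "comm_monoid (UNIV_ring :: 'a ring)"
    by (rule comm_monoidI) (auto simp: algebra_simps)
qed (auto simp: algebra_simps)

lemma a_inv_UNIV_ring [simp]: "\<ominus>\<^bsub>UNIV_ring\<^esub> x = - (x :: 'a::ring_1)"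
proof -
  interpret ring "UNIV_ring :: 'a ring" by (rule ring_UNIV_ring)
  show ?thesis using minus_equality[of "-x" x] by simp
qed

section \<open>Finitely supported functions as algebras and vector spaces\<close>

abbreviation (input) "lkp \<equiv> Poly_Mapping.lookup"
abbreviation (input) "single \<equiv> Poly_Mapping.single"
abbreviation (input) "keys \<equiv> Poly_Mapping.keys"

lemma poly_mapping_sum_single: "p = (\<Sum>k\<in>keys p. single k (lkp p k))"
  by (rule poly_mapping_eqI) (auto simp: lookup_sum lookup_single when_def in_keys_iff)

lemma poly_mapping_induct [case_names zero single add]:
  assumes "P 0" "\<And>k v. P (single k v)" "\<And>p q. P p ==> P q ==> P (p + q)"
  shows "P (p :: 'a \<Rightarrow>\<^sub>0 'b::comm_monoid_add)"
proof -
  have "P (\<Sum>k\<in>A. single k (lkp p k))" if "finite A" for A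
    using that by (induction A rule: finite_induct) (auto intro: assms)
  then show ?thesis by (subst poly_mapping_sum_single) simp
qed

text \<open>Scalars of the monoid algebra: \<open>cst c * p\<close> is scalar multiplication. On
  \<open>vec\<close> the addition of indices has no meaning, and products are formed only with such
  constants.\<close>

abbreviation cst :: "'b => 'a::zero \<Rightarrow>\<^sub>0 'b::zero" where "cst \<equiv> single 0"

lemma cst_central: "cst c * p = p * (cst c :: 'a::monoid_add \<Rightarrow>\<^sub>0 'b::comm_ring_1)"
  by (induction p rule: poly_mapping_induct) (auto simp: mult_single algebra_simps)

lemma lookup_cst_mult: "lkp (cst c * p) k = (c :: 'b::comm_ring_1) * lkp p (k :: 'a::monoid_add)"
  by (induction p rule: poly_mapping_induct)
     (auto simp: mult_single lookup_add lookup_single when_def algebra_simps)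

lemma cst_mult_single: "cst a * single k b = single k (a * b :: 'b::comm_ring_1)"
  for k :: "'a::monoid_add"
  by (simp add: mult_single)

subsection \<open>The ring \<open>A(t)\<close>\<close>

lemma gwa_poly_eq_sum:
  assumes "degree r \<le> n"
  shows "gwa_poly r = (\<Sum>i\<le>n. cst (coeff r i) * gwa_letter LZ ^ i)"
  unfolding gwa_poly_def
  by (rule sum.mono_neutral_left) (use assms in \<open>auto simp: coeff_eq_0\<close>)

lemma gwa_poly_pCons: "gwa_poly (pCons c r) = cst c + gwa_letter LZ * gwa_poly r"
proof -
  have "degree (pCons c r) \<le> Suc (degree r)" by (simp add: degree_pCons_le)
  then have "gwa_poly (pCons c r) = (\<Sum>i\<le>Suc (degree r). cst (coeff (pCons c r) i) * gwa_letter LZ ^ i)"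
    by (rule gwa_poly_eq_sum)
  also have "\<dots> = cst c + (\<Sum>i\<le>degree r. cst (coeff r i) * gwa_letter LZ ^ Suc i)"
    by (simp only: sum.atMost_Suc_shift) simp
  also have "(\<Sum>i\<le>degree r. cst (coeff r i) * gwa_letter LZ ^ Suc i)
      = (\<Sum>i\<le>degree r. gwa_letter LZ * (cst (coeff r i) * gwa_letter LZ ^ i))"
    by (rule sum.cong) (simp_all add: cst_central[of _ "gwa_letter LZ"] flip: mult.assoc)
  also have "\<dots> = gwa_letter LZ * gwa_poly r"
    by (simp add: gwa_poly_def sum_distrib_left)
  finally show ?thesis .
qed

lemma gwa_poly_0 [simp]: "gwa_poly 0 = 0" by (simp add: gwa_poly_def)

lemma gwa_poly_const: "gwa_poly [:c:] = cst c" by (simp add: gwa_poly_pCons)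

lemma gwa_poly_1 [simp]: "gwa_poly 1 = 1" by (simp add: one_pCons gwa_poly_const)

lemma gwa_poly_z: "gwa_poly [:0, 1:] = gwa_letter LZ" by (simp add: gwa_poly_pCons)

lemma gwa_poly_add: "gwa_poly (r + s) = gwa_poly r + gwa_poly s"
proof (induction r s rule: poly_induct2)
  case 0 then show ?case by simp
next
  case (pCons a p b q)
  then show ?case by (simp add: gwa_poly_pCons algebra_simps single_add)
qed

lemma gwa_poly_smult: "gwa_poly (Polynomial.smult c r) = cst c * gwa_poly r"
proof (induction r)
  case (pCons a r)
  have "cst c * (gwa_letter LZ * gwa_poly r) = gwa_letter LZ * (cst c * gwa_poly r)"
    by (simp add: cst_central[of _ "gwa_letter LZ"] flip: mult.assoc)
  then show ?case using pCons by (simp add: gwa_poly_pCons distrib_left mult_single)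
qed simp

lemma gwa_poly_mult: "gwa_poly (r * s) = gwa_poly r * gwa_poly s"
  by (induction r) (auto simp: gwa_poly_pCons gwa_poly_add gwa_poly_smult algebra_simps)

text \<open>Words are built by adding letters on the left, the side on which an operator is applied
  last. Statements about an action are thus reduced to single letters.\<close>

lemma gwa_free_induct [case_names const add letter]:
  assumes const: "\<And>c. P (cst c)" and add: "\<And>p q. P p ==> P q ==> P (p + q)"
    and letter: "\<And>l p. P p ==> P (gwa_letter l * p)"
  shows "P (p :: gwa_free)"
proof (induction p rule: poly_mapping_induct)
  case zero
  show ?case using const[of 0] by simp
next
  case (single w c)
  obtain ls where w: "w = GWord ls" by (cases w)
  have "P (single (GWord ls) c)"
  proof (induction ls)
    case Nil
    show ?case using const[of c] by (simp add: zero_gwa_word_def)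
  next
    case (Cons l ls)
    have "single (GWord (l # ls)) c = gwa_letter l * single (GWord ls) c"
      by (simp add: gwa_letter_def mult_single)
    then show ?case using letter[OF Cons] by simp
  qed
  then show ?case by (simp add: w)
qed (rule add)

lemma ideal_gwa: "ideal (gwa_ideal t) UNIV_ring"
  unfolding gwa_ideal_def by (rule ring.genideal_ideal[OF ring_UNIV_ring]) auto

lemma gwa_rels_in_ideal: "q \<in> gwa_rels t ==> q \<in> gwa_ideal t"
  unfolding gwa_ideal_def using ring.genideal_self[OF ring_UNIV_ring, of "gwa_rels t"] by auto

definition gq :: "complex poly => gwa_free => gwa_free set" where
  "gq t p = gwa_ideal t +>\<^bsub>UNIV_ring\<^esub> p"

lemma gwa_of_poly_gq: "gwa_of_poly t r = gq t (gwa_poly r)"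
  and gwa_X_gq: "gwa_X t l = gq t (gwa_letter l)"
  by (simp_all add: gwa_of_poly_def gwa_X_def gq_def)

lemma ring_GWA: "ring (GWA t)"
  unfolding GWA_def by (rule ideal.quotient_is_ring[OF ideal_gwa])

lemma gq_ring_hom: "gq t \<in> ring_hom UNIV_ring (GWA t)"
  unfolding GWA_def gq_def using ideal.rcos_ring_hom[OF ideal_gwa] by simp

lemma carrier_GWA: "carrier (GWA t) = range (gq t)"
  by (auto simp: GWA_def FactRing_def A_RCOSETS_def' gq_def)

lemma gq_closed [simp]: "gq t p \<in> carrier (GWA t)" by (simp add: carrier_GWA)

lemma gq_add: "gq t (p + q) = gq t p \<oplus>\<^bsub>GWA t\<^esub> gq t q"
  and gq_mult: "gq t (p * q) = gq t p \<otimes>\<^bsub>GWA t\<^esub> gq t q"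
  and gq_one: "gq t 1 = \<one>\<^bsub>GWA t\<^esub>"
  using ring_hom_add[OF gq_ring_hom, of p q t] ring_hom_mult[OF gq_ring_hom, of p q t]
    ring_hom_one[OF gq_ring_hom, of t] by simp_all

lemma gq_eqI: "p - q \<in> gwa_ideal t ==> gq t p = gq t q"
proof -
  assume a: "p - q \<in> gwa_ideal t"
  interpret ideal "gwa_ideal t" UNIV_ring by (rule ideal_gwa)
  have "p \<in> gwa_ideal t +>\<^bsub>UNIV_ring\<^esub> q"
    using a by (auto simp: a_r_coset_def' intro!: bexI[of _ "p - q"])
  then show ?thesis unfolding gq_def using a_repr_independence[OF _ _ a_subgroup, of p q] by (simp del: UNIV_ring_simps(5))
qed

lemma gq_mem: "p \<in> gq t q \<longleftrightarrow> p - q \<in> gwa_ideal t"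
  unfolding gq_def by (auto simp: a_r_coset_def' intro!: bexI[of _ "p - q"])

lemma gq_rel:
  "gq t (gwa_letter LPlus * gwa_poly r) = gq t (gwa_poly (sigma_pow 1 r) * gwa_letter LPlus)"
  "gq t (gwa_letter LMinus * gwa_poly r) = gq t (gwa_poly (sigma_pow (- 1) r) * gwa_letter LMinus)"
  "gq t (gwa_letter LPlus * gwa_letter LMinus) = gq t (gwa_poly (sigma_pow (1/2) t))"
  "gq t (gwa_letter LMinus * gwa_letter LPlus) = gq t (gwa_poly (sigma_pow (- 1/2) t))"
  by (rule gq_eqI, rule gwa_rels_in_ideal, force simp: gwa_rels_def)+

lemma poly_sigma_pow: "poly (sigma_pow a r) x = poly r (x - a)"
  by (simp add: sigma_pow_def poly_pcompose)

lemma weight_ideal_eq: "weight_ideal l = {r. poly r l = 0}"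
proof -
  have "weight_ideal l = range (\<lambda>s. s * [:- l, 1:])"
    by (simp add: weight_ideal_def cgenideal_def full_SetCompr_eq)
  also have "\<dots> = {r. poly r l = 0}"
    by (auto simp: poly_eq_0_iff_dvd dvd_def mult.commute)
  finally show ?thesis .
qed

subsection \<open>Modules over \<open>A(t)\<close>\<close>

locale gwa_mod = left_module "GWA t" M for t and M :: "'v gwa_module" (structure)
begin

abbreviation ps :: "complex poly => 'v => 'v" where "ps r v \<equiv> gwa_of_poly t r \<odot>\<^bsub>M\<^esub> v"
abbreviation sc :: "complex => 'v => 'v" where "sc c v \<equiv> ps [:c:] v"
abbreviation X :: "gwa_letter => 'v => 'v" where "X l v \<equiv> gwa_X t l \<odot>\<^bsub>M\<^esub> v"
abbreviation W :: "complex => 'v set" where "W l \<equiv> weight_space t M (weight_ideal l)"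

lemma ps_closed [simp]: "v \<in> carrier M ==> ps r v \<in> carrier M"
  and X_closed [simp]: "v \<in> carrier M ==> X l v \<in> carrier M"
  by (simp_all add: gwa_of_poly_gq gwa_X_gq smult_closed)

lemma ps_add_r: "v \<in> carrier M ==> w \<in> carrier M ==> ps r (v \<oplus>\<^bsub>M\<^esub> w) = ps r v \<oplus>\<^bsub>M\<^esub> ps r w"
  and X_add_r: "v \<in> carrier M ==> w \<in> carrier M ==> X l (v \<oplus>\<^bsub>M\<^esub> w) = X l v \<oplus>\<^bsub>M\<^esub> X l w"
  by (simp_all add: gwa_of_poly_gq gwa_X_gq smult_r_distr)

lemma ps_add: "v \<in> carrier M ==> ps (r + s) v = ps r v \<oplus>\<^bsub>M\<^esub> ps s v"
  and ps_mult: "v \<in> carrier M ==> ps (r * s) v = ps r (ps s v)"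
  and ps_1 [simp]: "v \<in> carrier M ==> ps 1 v = v"
  by (simp_all add: gwa_of_poly_gq gwa_poly_add gq_add smult_l_distr gwa_poly_mult gq_mult
      smult_assoc1 gq_one smult_one)

lemma smult_zero_r [simp]: "a \<in> carrier (GWA t) ==> a \<odot>\<^bsub>M\<^esub> \<zero>\<^bsub>M\<^esub> = \<zero>\<^bsub>M\<^esub>"
  using smult_r_distr[of a "\<zero>\<^bsub>M\<^esub>" "\<zero>\<^bsub>M\<^esub>"] smult_closed[of a "\<zero>\<^bsub>M\<^esub>"]
  by (metis M.add.l_cancel_one' M.zero_closed M.l_zero)

lemma ps_zero_r [simp]: "ps r \<zero>\<^bsub>M\<^esub> = \<zero>\<^bsub>M\<^esub>" and X_zero_r [simp]: "X l \<zero>\<^bsub>M\<^esub> = \<zero>\<^bsub>M\<^esub>"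
  by (simp_all add: gwa_of_poly_gq gwa_X_gq)

lemma ps_0 [simp]: "v \<in> carrier M ==> ps 0 v = \<zero>\<^bsub>M\<^esub>"
  using ps_add[of v 0 0] ps_closed[of v 0] by (metis M.add.l_cancel_one' add.right_neutral)

lemma ps_uminus: "v \<in> carrier M ==> ps (- r) v = \<ominus>\<^bsub>M\<^esub> ps r v"
  using ps_add[of v "-r" r] by (simp add: M.minus_equality)

lemma sc_1 [simp]: "v \<in> carrier M ==> sc 1 v = v"
  using ps_1 by (simp add: one_pCons)

lemma sc_sc: "v \<in> carrier M ==> sc a (sc b v) = sc (a * b) v"
  by (simp add: mult.commute flip: ps_mult)

lemma sc_add: "v \<in> carrier M ==> sc (a + b) v = sc a v \<oplus>\<^bsub>M\<^esub> sc b v"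
  by (simp flip: ps_add)

lemma ps_sc: "v \<in> carrier M ==> ps r (sc c v) = sc c (ps r v)"
  by (simp add: ps_mult[symmetric])

lemma X_ps:
  assumes "v \<in> carrier M"
  shows "X LPlus (ps r v) = ps (sigma_pow 1 r) (X LPlus v)"
    and "X LMinus (ps r v) = ps (sigma_pow (- 1) r) (X LMinus v)"
    and "X LPlus (X LMinus v) = ps (sigma_pow (1/2) t) v"
    and "X LMinus (X LPlus v) = ps (sigma_pow (- 1/2) t) v"
  using assms gq_rel(1,2)[of t r] gq_rel(3,4)[of t]
  by (simp_all add: gwa_of_poly_gq gwa_X_gq smult_assoc1[symmetric] flip: gq_mult)

lemma X_sc: "v \<in> carrier M ==> l \<in> {LPlus, LMinus} ==> X l (sc c v) = sc c (X l v)"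
  by (auto simp: X_ps sigma_pow_def pcompose_pCons)

lemma W_iff: "v \<in> W l \<longleftrightarrow> v \<in> carrier M \<and> ps [:- l, 1:] v = \<zero>\<^bsub>M\<^esub>"
proof
  assume "v \<in> W l" then show "v \<in> carrier M \<and> ps [:- l, 1:] v = \<zero>\<^bsub>M\<^esub>"
    by (simp add: weight_space_def weight_ideal_eq)
next
  assume v: "v \<in> carrier M \<and> ps [:- l, 1:] v = \<zero>\<^bsub>M\<^esub>"
  have "ps r v = \<zero>\<^bsub>M\<^esub>" if rl: "poly r l = 0" for r
  proof -
    obtain s where "r = [:- l, 1:] * s" using rl unfolding poly_eq_0_iff_dvd by (rule dvdE)
    then have "r = s * [:- l, 1:]" by (simp only: mult.commute)
    then show ?thesis using v by (simp only: ps_mult) simp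
  qed
  then show "v \<in> W l" using v by (simp add: weight_space_def weight_ideal_eq)
qed

lemma W_carrier: "v \<in> W l ==> v \<in> carrier M" by (simp add: W_iff)

text \<open>The difference of \<open>r\<close> and its value at \<open>l\<close> lies in the weight
  ideal.\<close>

lemma W_ps: assumes "v \<in> W l" shows "ps r v = sc (poly r l) v"
proof -
  have v: "v \<in> carrier M" using assms by (simp add: W_iff)
  have "ps (r - [:poly r l:]) v = \<zero>\<^bsub>M\<^esub>" using assms by (simp add: weight_space_def weight_ideal_eq)
  then have "ps ((r - [:poly r l:]) + [:poly r l:]) v = sc (poly r l) v"
    using v by (subst ps_add) auto
  then show ?thesis by simp
qed

lemma W_zero [simp]: "\<zero>\<^bsub>M\<^esub> \<in> W l" by (simp add: W_iff)
lemma W_add: "v \<in> W l ==> w \<in> W l ==> v \<oplus>\<^bsub>M\<^esub> w \<in> W l" by (simp add: W_iff ps_add_r)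
lemma W_sc: "v \<in> W l ==> sc c v \<in> W l" by (simp add: W_iff ps_sc)

text \<open>By the defining relations, \<open>z - (l + 1)\<close> passes through
  \<open>X LPlus\<close>, and \<open>z - (l - 1)\<close> through \<open>X LMinus\<close>, as
  \<open>z - l\<close>.\<close>

lemma X_W:
  shows "v \<in> W l ==> X LPlus v \<in> W (l + 1)" and "v \<in> W l ==> X LMinus v \<in> W (l - 1)"
proof -
  assume v: "v \<in> W l"
  have "ps [:- (l + 1), 1:] (X LPlus v) = X LPlus (ps [:- l, 1:] v)"
    using v by (simp add: X_ps W_carrier sigma_pow_def pcompose_pCons)
  then show "X LPlus v \<in> W (l + 1)" using v by (simp add: W_iff)
  have "ps [:- (l - 1), 1:] (X LMinus v) = X LMinus (ps [:- l, 1:] v)"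
    using v by (simp add: X_ps W_carrier sigma_pow_def pcompose_pCons)
  then show "X LMinus v \<in> W (l - 1)" using v by (simp add: W_iff)
qed

text \<open>The half shifts in the relations place the scalar of the edge between \<open>l\<close>
  and \<open>l + 1\<close> at the midpoint \<open>l + 1/2\<close>. This is why zeros of
  \<open>t\<close> in \<open>\<int> + 1/2\<close> break edges.\<close>

lemma XX_W:
  assumes "v \<in> W l"
  shows "X LPlus (X LMinus v) = sc (poly t (l - 1/2)) v"
    and "X LMinus (X LPlus v) = sc (poly t (l + 1/2)) v"
  using X_ps(3,4)[OF W_carrier[OF assms]] W_ps[OF assms, of "sigma_pow (1/2) t"]
    W_ps[OF assms, of "sigma_pow (- 1/2) t"]
  by (simp_all add: poly_sigma_pow)

end

lemma gwa_modI: "left_module (GWA t) M ==> gwa_mod t M" by (simp add: gwa_mod_def)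

text \<open>Constants, \<open>z\<close> and the two letters generate \<open>A(t)\<close>, and every
  element of \<open>A(t)\<close> is the class of an element of the free algebra.\<close>

lemma gwa_hom_smult:
  assumes M: "left_module (GWA t) M" and N: "left_module (GWA t) N"
    and f: "\<And>v. v \<in> carrier M ==> f v \<in> carrier N"
    and add: "\<And>v w. v \<in> carrier M ==> w \<in> carrier M ==> f (v \<oplus>\<^bsub>M\<^esub> w) = f v \<oplus>\<^bsub>N\<^esub> f w"
    and sc: "\<And>c v. v \<in> carrier M ==> f (gwa_of_poly t [:c:] \<odot>\<^bsub>M\<^esub> v) = gwa_of_poly t [:c:] \<odot>\<^bsub>N\<^esub> f v"
    and z: "\<And>v. v \<in> carrier M ==> f (gwa_of_poly t [:0, 1:] \<odot>\<^bsub>M\<^esub> v) = gwa_of_poly t [:0, 1:] \<odot>\<^bsub>N\<^esub> f v"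
    and X: "\<And>l v. v \<in> carrier M ==> l \<in> {LPlus, LMinus} ==> f (gwa_X t l \<odot>\<^bsub>M\<^esub> v) = gwa_X t l \<odot>\<^bsub>N\<^esub> f v"
    and a: "a \<in> carrier (GWA t)" and v: "v \<in> carrier M"
  shows "f (a \<odot>\<^bsub>M\<^esub> v) = a \<odot>\<^bsub>N\<^esub> f v"
proof -
  interpret M: gwa_mod t M using M by (rule gwa_modI)
  interpret N: gwa_mod t N using N by (rule gwa_modI)
  have "f (gq t p \<odot>\<^bsub>M\<^esub> v) = gq t p \<odot>\<^bsub>N\<^esub> f v" for p
  proof (induction p rule: gwa_free_induct)
    case (const c)
    then show ?case using sc[OF v, of c] by (simp add: gwa_of_poly_gq gwa_poly_const)
  next
    case (add p q)
    then show ?case using v by (simp add: gq_add M.smult_l_distr N.smult_l_distr assms(4) M.smult_closed f)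
  next
    case (letter l p)
    have "f (gq t (gwa_letter l) \<odot>\<^bsub>M\<^esub> w) = gq t (gwa_letter l) \<odot>\<^bsub>N\<^esub> f w" if "w \<in> carrier M" for w
      using X[OF that, of l] z[OF that]
      by (cases l) (auto simp: gwa_of_poly_gq gwa_X_gq gwa_poly_z)
    then show ?case using letter v by (simp add: gq_mult M.smult_assoc1 N.smult_assoc1 M.smult_closed f)
  qed
  then show ?thesis using a by (auto simp: carrier_GWA)
qed

subsection \<open>Isomorphisms\<close>

lemma module_iso_D:
  assumes "f \<in> module_iso R M N"
  shows "bij_betw f (carrier M) (carrier N)"
    and "\<And>x. x \<in> carrier M ==> f x \<in> carrier N"
    and "\<And>x y. x \<in> carrier M ==> y \<in> carrier M ==> f (x \<oplus>\<^bsub>M\<^esub> y) = f x \<oplus>\<^bsub>N\<^esub> f y"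
    and "\<And>a x. a \<in> carrier R ==> x \<in> carrier M ==> f (a \<odot>\<^bsub>M\<^esub> x) = a \<odot>\<^bsub>N\<^esub> f x"
  using assms by (auto simp: module_iso_def bij_betwE)

lemma module_iso_id: "id \<in> module_iso R M M" by (simp add: module_iso_def)

lemma module_iso_comp:
  "f \<in> module_iso R M N ==> g \<in> module_iso R N L ==> g \<circ> f \<in> module_iso R M L"
  unfolding module_iso_def by (auto intro: bij_betw_trans simp: bij_betwE)

lemma module_iso_inv:
  assumes M: "left_module R M" and f: "f \<in> module_iso R M N"
  shows "inv_into (carrier M) f \<in> module_iso R N M"
proof -
  interpret left_module R M by fact
  note D = module_iso_D[OF f]
  let ?g = "inv_into (carrier M) f"
  have g: "bij_betw ?g (carrier N) (carrier M)" by (rule bij_betw_inv_into[OF D(1)])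
  have fg: "f (?g y) = y" if "y \<in> carrier N" for y using D(1) that by (simp add: bij_betw_inv_into_right)
  have gf: "?g (f x) = x" if "x \<in> carrier M" for x using D(1) that by (simp add: bij_betw_inv_into_left)
  have gc: "?g y \<in> carrier M" if "y \<in> carrier N" for y using g that by (simp add: bij_betwE)
  have "?g (x \<oplus>\<^bsub>N\<^esub> y) = ?g x \<oplus>\<^bsub>M\<^esub> ?g y" if "x \<in> carrier N" "y \<in> carrier N" for x y
    using that fg gf[of "?g x \<oplus>\<^bsub>M\<^esub> ?g y"] gc D(3)[of "?g x" "?g y"] by simp
  moreover have "?g (a \<odot>\<^bsub>N\<^esub> x) = a \<odot>\<^bsub>M\<^esub> ?g x" if "a \<in> carrier R" "x \<in> carrier N" for a x
    using that fg gf[of "a \<odot>\<^bsub>M\<^esub> ?g x"] gc D(4)[of a "?g x"] smult_closed by simp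
  ultimately show ?thesis using g by (simp add: module_iso_def)
qed

lemma module_iso_zero:
  assumes "left_module R M" "left_module R N" "f \<in> module_iso R M N"
  shows "f \<zero>\<^bsub>M\<^esub> = \<zero>\<^bsub>N\<^esub>"
proof -
  interpret M: left_module R M by fact
  interpret N: left_module R N by fact
  note D = module_iso_D[OF assms(3)]
  have "f \<zero>\<^bsub>M\<^esub> \<oplus>\<^bsub>N\<^esub> f \<zero>\<^bsub>M\<^esub> = f \<zero>\<^bsub>M\<^esub>" using D(3)[of "\<zero>\<^bsub>M\<^esub>" "\<zero>\<^bsub>M\<^esub>"] by simp
  then show ?thesis using D(2)[of "\<zero>\<^bsub>M\<^esub>"] by (simp add: N.M.add.l_cancel_one')
qed

lemma iso_class_eq:
  assumes "left_module (GWA t) M" "f \<in> module_iso (GWA t) M N"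
  shows "iso_class t M = iso_class t N"
proof -
  have "inv_into (carrier M) f \<in> module_iso (GWA t) N M" by (rule module_iso_inv[OF assms])
  then show ?thesis using assms(2) unfolding iso_class_def by (blast intro: module_iso_comp)
qed

lemma iso_class_self: "M \<in> wmod_O t ==> M \<in> iso_class t M"
  unfolding iso_class_def using module_iso_id by blast

lemma wmod_O_left_module: "M \<in> wmod_O t ==> left_module (GWA t) M"
  by (simp add: wmod_O_def in_wmod_O_def weight_module_def)

lemma iso_class_eq_iff:
  assumes "M \<in> wmod_O t" "N \<in> wmod_O t"
  shows "iso_class t M = iso_class t N \<longleftrightarrow> module_iso (GWA t) M N \<noteq> {}"
proof
  assume "iso_class t M = iso_class t N"
  then have "M \<in> iso_class t N" using iso_class_self[OF assms(1)] by simp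
  then show "module_iso (GWA t) M N \<noteq> {}" by (simp add: iso_class_def)
qed (use iso_class_eq wmod_O_left_module[OF assms(1)] in blast)

section \<open>Diagram modules\<close>

text \<open>A diagram records the weights of a module with weight spaces of dimension at most one
  (\<open>Vx l\<close>: the weight \<open>l\<close> occurs) and the places where \<open>X\<^sup>+\<close> is nonzero from weight \<open>l\<close> to
  \<open>l + 1\<close> (\<open>Up l\<close>) and where \<open>X\<^sup>-\<close> is nonzero from weight \<open>l + 1\<close> to \<open>l\<close> (\<open>Dn l\<close>).
  Tensor products correspond to intersections of diagrams.\<close>

datatype cell = Vx int | Up int | Dn int

type_synonym diag = "cell set"

text \<open>An edge is named by its left end, so a zero \<open>k\<close> in
  \<open>\<int> + 1/2\<close> breaks the edge \<open>\<lfloor>k\<rfloor>\<close>.\<close>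

definition brk :: "complex poly => int set" where
  "brk t = {l. poly t (of_int l + 1/2) = 0}"

text \<open>Away from \<open>A\<close> the two maps along an edge compose to nonzero scalars, so
  both are isomorphisms; on \<open>A\<close> they compose to zero, which between weight spaces of
  dimension at most one leaves at most one arrow.\<close>

definition bdiag :: "int set => diag => bool" where
  "bdiag A D \<longleftrightarrow> (\<forall>l. (Up l \<in> D \<or> Dn l \<in> D) --> Vx l \<in> D \<and> Vx (l + 1) \<in> D)
     \<and> (\<forall>l. l \<notin> A --> (Vx l \<in> D \<longleftrightarrow> Vx (l + 1) \<in> D) \<and> (Vx l \<in> D --> Up l \<in> D \<and> Dn l \<in> D))
     \<and> (\<forall>l\<in>A. \<not> (Up l \<in> D \<and> Dn l \<in> D))"

text \<open>The value at \<open>e\<close> of \<open>t\<close> divided by the largest possible power of \<open>z - e\<close>; in contrast to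
  the value itself, it is never zero, and it is still multiplicative in \<open>t\<close>.\<close>

definition hat :: "complex poly => complex => complex" where
  "hat t e = poly (t div [:- e, 1:] ^ Polynomial.order e t) e"

abbreviation hatl :: "complex poly => int => complex" where "hatl t l \<equiv> hat t (of_int l + 1/2)"

lemma hat_nonroot: "poly t e \<noteq> 0 ==> hat t e = poly t e"
  by (simp add: hat_def order_0I)

lemma hat_decomp:
  assumes "t \<noteq> 0" shows "t = [:- e, 1:] ^ Polynomial.order e t * (t div [:- e, 1:] ^ Polynomial.order e t)"
  using order_1[of e t] by simp

lemma hat_nonzero: assumes "t \<noteq> 0" shows "hat t e \<noteq> 0"
proof
  assume "hat t e = 0"
  then have "[:- e, 1:] dvd t div [:- e, 1:] ^ Polynomial.order e t" by (simp add: hat_def poly_eq_0_iff_dvd)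
  then obtain q where q: "t div [:- e, 1:] ^ Polynomial.order e t = [:- e, 1:] * q" by (rule dvdE)
  have "t = [:- e, 1:] ^ Suc (Polynomial.order e t) * q"
    using hat_decomp[OF assms, of e] unfolding q by (simp only: power_Suc ac_simps)
  then have "[:- e, 1:] ^ Suc (Polynomial.order e t) dvd t" by (metis dvd_triv_left)
  then show False using order_2[OF assms, of e] by simp
qed

lemma hat_mult: assumes "t \<noteq> 0" "t' \<noteq> 0" shows "hat (t * t') e = hat t e * hat t' e"
proof -
  let ?p = "[:- e, 1:]"
  have o: "Polynomial.order e (t * t') = Polynomial.order e t + Polynomial.order e t'" using assms by (simp add: Polynomial.order_mult)
  have d: "?p ^ Polynomial.order e t dvd t" "?p ^ Polynomial.order e t' dvd t'" by (rule order_1)+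
  have "t * t' div ?p ^ Polynomial.order e (t * t') = (t div ?p ^ Polynomial.order e t) * (t' div ?p ^ Polynomial.order e t')"
    unfolding o power_add using d by (simp add: div_mult_div_if_dvd)
  then show ?thesis by (simp add: hat_def)
qed

subsection \<open>Linear extension\<close>

text \<open>The values lie in a monoid algebra so that the same extension serves operators on
  \<open>vec\<close>, the action of the free algebra and the rank map on polynomials.\<close>

definition lext :: "('a => 'b::monoid_add \<Rightarrow>\<^sub>0 complex) => ('a \<Rightarrow>\<^sub>0 complex) => 'b \<Rightarrow>\<^sub>0 complex" where
  "lext f p = (\<Sum>k\<in>keys p. cst (lkp p k) * f k)"

lemma lext_superset:
  assumes "finite A" "keys p \<subseteq> A"
  shows "lext f p = (\<Sum>k\<in>A. cst (lkp p k) * f k)"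
  unfolding lext_def by (rule sum.mono_neutral_left) (use assms in \<open>auto simp: in_keys_iff\<close>)

lemma lext_0 [simp]: "lext f 0 = 0" by (simp add: lext_def)

lemma lext_single: "lext f (single k c) = cst c * f k"
  by (subst lext_superset[of "{k}"]) auto

lemma lext_add: "lext f (p + q) = lext f p + lext f q"
proof -
  let ?A = "keys p \<union> keys q"
  have "lext f (p + q) = (\<Sum>k\<in>?A. cst (lkp (p + q) k) * f k)"
    by (rule lext_superset) (auto simp: Poly_Mapping.keys_add)
  also have "\<dots> = (\<Sum>k\<in>?A. cst (lkp p k) * f k) + (\<Sum>k\<in>?A. cst (lkp q k) * f k)"
    by (simp add: lookup_add single_add distrib_right sum.distrib)
  also have "\<dots> = lext f p + lext f q"
    by (simp add: lext_superset[of ?A p] lext_superset[of ?A q])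
  finally show ?thesis .
qed

lemma lext_cst: "lext f (cst c * p) = cst c * lext f p"
  by (induction p rule: poly_mapping_induct)
     (simp_all add: lext_add lext_single cst_mult_single distrib_left mult.assoc[symmetric] mult_single)

lemma lext_add_fun: "lext (\<lambda>k. f k + g k) p = lext f p + lext g p"
  by (simp add: lext_def distrib_left sum.distrib)

lemma lext_cst_fun: "lext (\<lambda>k. cst c * f k) p = cst c * lext f p"
  by (simp add: lext_def sum_distrib_left mult.assoc[symmetric] mult_single mult.commute)

lemma lext_sum: "lext f (\<Sum>i\<in>I. p i) = (\<Sum>i\<in>I. lext f (p i))"
  by (induction I rule: infinite_finite_induct) (auto simp: lext_add)

lemma lext_cong: "(\<And>k. k \<in> keys p ==> f k = g k) ==> lext f p = lext g p"
  by (auto simp: lext_def intro: sum.cong)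

lemma keys_cst_mult: "keys (cst c * q) \<subseteq> keys q"
  for q :: "'b::monoid_add \<Rightarrow>\<^sub>0 complex"
  by (auto simp: in_keys_iff lookup_cst_mult)

lemma keys_lext: "keys (lext f p) \<subseteq> (\<Union>k\<in>keys p. keys (f k))"
  unfolding lext_def by (rule order_trans[OF keys_sum]) (use keys_cst_mult in blast)

lemma lext_eqI:
  assumes "\<And>p q. h (p + q) = h p + h q" "\<And>c p. h (cst c * p) = cst c * h p"
    "\<And>k. k \<in> keys p ==> h (single k 1) = f k"
  shows "h p = lext f p"
proof -
  have h0: "h 0 = 0" using assms(1)[of 0 0] by simp
  have hs: "h (\<Sum>i\<in>I. q i) = (\<Sum>i\<in>I. h (q i))" for q and I :: "'a set"
    by (induction I rule: infinite_finite_induct) (auto simp: assms(1) h0)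
  have "h p = (\<Sum>k\<in>keys p. h (cst (lkp p k) * single k 1))"
    by (subst poly_mapping_sum_single[of p]) (simp only: hs cst_mult_single mult_1_right)
  then show ?thesis by (simp add: lext_def assms(2,3))
qed

subsection \<open>The module of a list of diagrams\<close>

text \<open>The index of the basis vector of weight \<open>l\<close> in the \<open>i\<close>-th
  diagram of a list. Elements of \<open>vec\<close> are indexed by natural numbers, hence the
  coding.\<close>

definition enc :: "nat => int => nat" where "enc i l = prod_encode (i, int_encode l)"
definition ix :: "nat => nat" where "ix k = fst (prod_decode k)"
definition wt :: "nat => int" where "wt k = int_decode (snd (prod_decode k))"

lemma ix_enc [simp]: "ix (enc i l) = i" and wt_enc [simp]: "wt (enc i l) = l"
  and enc_ix_wt [simp]: "enc (ix k) (wt k) = k"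
  by (simp_all add: enc_def ix_def wt_def)

lemma enc_eq_iff [simp]: "enc i l = enc j m \<longleftrightarrow> i = j \<and> l = m"
  by (metis ix_enc wt_enc)

lemma enc_cases: obtains i l where "k = enc i l" by (metis enc_ix_wt)

definition ev :: "nat => int => vec" where "ev i l = single (enc i l) 1"

text \<open>The arrow that leaves a weight to the left belongs to the edge one below it. Its scalar
  is \<open>hatl\<close> at every edge; away from breaks this is the value of \<open>t\<close> that
  the relations demand when \<open>LPlus\<close> acts with scalar 1.\<close>

fun lop :: "complex poly => diag list => gwa_letter => nat => vec" where
  "lop t Ds LZ k = single k (of_int (wt k))"
| "lop t Ds LPlus k = (if Up (wt k) \<in> Ds ! ix k then ev (ix k) (wt k + 1) else 0)"
| "lop t Ds LMinus k = (if Dn (wt k - 1) \<in> Ds ! ix k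
     then cst (hatl t (wt k - 1)) * ev (ix k) (wt k - 1) else 0)"

fun wact :: "complex poly => diag list => gwa_word => vec => vec" where
  "wact t Ds (GWord ls) v = foldr (\<lambda>l. lext (lop t Ds l)) ls v"

definition fact :: "complex poly => diag list => gwa_free => vec => vec" where
  "fact t Ds q v = lext (\<lambda>w. wact t Ds w v) q"

definition Nb :: "diag list => nat set" where
  "Nb Ds = {k. ix k < length Ds \<and> Vx (wt k) \<in> Ds ! ix k}"

definition Nc :: "diag list => vec set" where
  "Nc Ds = {v. keys v \<subseteq> Nb Ds}"

text \<open>A coset acts through an arbitrary representative. On \<open>Nc Ds\<close> this is
  independent of the choice if the diagrams respect the breaks of \<open>t\<close>; see
  \<open>fact_ideal\<close>.\<close>

definition NM :: "complex poly => diag list => vec gwa_module" where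
  "NM t Ds = \<lparr>carrier = Nc Ds, monoid.mult = (\<lambda>_ _. undefined), monoid.one = undefined,
     ring.zero = 0, ring.add = (+), smult = (\<lambda>S. fact t Ds (SOME q. q \<in> S))\<rparr>"

lemma enc_Nb [simp]: "enc i l \<in> Nb Ds \<longleftrightarrow> i < length Ds \<and> Vx l \<in> Ds ! i"
  by (simp add: Nb_def)

lemma NM_simps [simp]: "carrier (NM t Ds) = Nc Ds" "ring.zero (NM t Ds) = 0" "ring.add (NM t Ds) = (+)"
  by (simp_all add: NM_def)

lemma Nc_0 [simp]: "0 \<in> Nc Ds" by (simp add: Nc_def)
lemma Nc_add: "v \<in> Nc Ds ==> w \<in> Nc Ds ==> v + w \<in> Nc Ds"
  using Poly_Mapping.keys_add[of v w] by (auto simp: Nc_def)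
lemma Nc_sum: "(\<And>i. i \<in> I ==> f i \<in> Nc Ds) ==> sum f I \<in> Nc Ds"
  by (induction I rule: infinite_finite_induct) (auto intro: Nc_add)
lemma Nc_uminus: "v \<in> Nc Ds ==> - v \<in> Nc Ds" by (simp add: Nc_def)
lemma Nc_cst: "v \<in> Nc Ds ==> cst c * v \<in> Nc Ds"
  by (auto simp: Nc_def in_keys_iff lookup_cst_mult)
lemma Nc_single: "k \<in> Nb Ds ==> single k c \<in> Nc Ds"
  by (auto simp: Nc_def)
lemma ev_Nc [simp]: "i < length Ds ==> Vx l \<in> Ds ! i ==> ev i l \<in> Nc Ds"
  by (simp add: Nc_single ev_def)
lemma Nc_D: "v \<in> Nc Ds ==> k \<in> keys v ==> ix k < length Ds \<and> Vx (wt k) \<in> Ds ! ix k"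
  by (auto simp: Nc_def Nb_def)

lemma wact_add: "wact t Ds w (u + v) = wact t Ds w u + wact t Ds w v"
proof -
  obtain ls where w: "w = GWord ls" by (cases w)
  show ?thesis unfolding w by (induction ls) (simp_all add: lext_add)
qed

lemma wact_cst: "wact t Ds w (cst c * v) = cst c * wact t Ds w v"
proof -
  obtain ls where w: "w = GWord ls" by (cases w)
  show ?thesis unfolding w by (induction ls) (simp_all add: lext_cst)
qed

lemma fact_add_r: "fact t Ds q (u + v) = fact t Ds q u + fact t Ds q v"
  by (simp add: fact_def wact_add lext_add_fun)

lemma fact_cst_r: "fact t Ds q (cst c * v) = cst c * fact t Ds q v"
  by (simp add: fact_def wact_cst lext_cst_fun)

lemma fact_add: "fact t Ds (p + q) v = fact t Ds p v + fact t Ds q v"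
  by (simp add: fact_def lext_add)

lemma fact_cst: "fact t Ds (cst c) v = cst c * v"
  by (simp add: fact_def lext_single zero_gwa_word_def)

lemma fact_single_letter:
  "fact t Ds (gwa_letter l * single w c) v = lext (lop t Ds l) (fact t Ds (single w c) v)"
  by (cases w) (simp add: gwa_letter_def mult_single fact_def lext_single lext_cst)

lemma fact_letter_mult: "fact t Ds (gwa_letter l * q) v = lext (lop t Ds l) (fact t Ds q v)"
proof (induction q rule: poly_mapping_induct)
  case zero show ?case by (simp add: fact_def)
next
  case (single k c) show ?case by (rule fact_single_letter)
next
  case (add p q) then show ?case by (simp add: distrib_left fact_add lext_add)
qed

lemma fact_letter: "fact t Ds (gwa_letter l) v = lext (lop t Ds l) v"
  using fact_letter_mult[of t Ds l 1 v] fact_cst[of t Ds 1 v] by simp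

lemma fact_0 [simp]: "fact t Ds 0 v = 0" "fact t Ds q 0 = 0"
  using fact_add[of t Ds 0 0 v] fact_add_r[of t Ds q 0 0] by simp_all

lemma fact_cst_mult: "fact t Ds (cst c * q) v = cst c * fact t Ds q v"
  by (simp add: fact_def lext_cst)

lemma fact_mult: "fact t Ds (p * q) v = fact t Ds p (fact t Ds q v)"
  by (induction p rule: gwa_free_induct)
     (simp_all add: fact_cst_mult fact_cst distrib_right fact_add fact_letter_mult mult.assoc)

lemma fact_poly_single: "fact t Ds (gwa_poly r) (single k c) = single k (poly r (of_int (wt k)) * c)"
  by (induction r)
     (simp_all add: gwa_poly_pCons fact_add fact_cst fact_letter_mult lext_single mult_single cst_mult_single
       algebra_simps single_add)

lemma fact_poly_lookup: "lkp (fact t Ds (gwa_poly r) v) k = poly r (of_int (wt k)) * lkp v k"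
proof (induction v rule: poly_mapping_induct)
  case (single k' c)
  show ?case by (simp add: fact_poly_single lookup_single when_def)
next
  case (add p q) then show ?case by (simp add: fact_add_r lookup_add algebra_simps)
qed simp

lemma fact_uminus: "fact t Ds (- q) v = - fact t Ds q v"
  using fact_add[of t Ds q "-q" v] by (simp add: add_eq_0_iff)

lemma fact_diff: "fact t Ds (p - q) v = fact t Ds p v - fact t Ds q v"
  using fact_add[of t Ds p "-q" v] by (simp add: fact_uminus)

section \<open>The relations of \<open>A(t)\<close> on diagram modules\<close>

definition bds :: "complex poly => diag list => bool" where
  "bds t Ds \<longleftrightarrow> (\<forall>D\<in>set Ds. bdiag (brk t) D)"

lemma bds_nth: "bds t Ds ==> i < length Ds ==> bdiag (brk t) (Ds ! i)"
  by (simp add: bds_def)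

lemma lop_Nc:
  assumes "bds t Ds" "k \<in> Nb Ds" shows "lop t Ds l k \<in> Nc Ds"
proof -
  have "bdiag (brk t) (Ds ! ix k)" using assms by (simp add: bds_nth Nb_def)
  then show ?thesis using assms(2) unfolding bdiag_def
    by (cases l) (force simp: Nb_def ev_def cst_mult_single intro!: Nc_single)+
qed

lemma Nc_iff: "v \<in> Nc Ds \<longleftrightarrow> keys v \<subseteq> Nb Ds" by (simp add: Nc_def)

lemma lext_Nc:
  assumes "\<And>k. k \<in> keys v ==> f k \<in> Nc Ds" shows "lext f v \<in> Nc Ds"
  unfolding lext_def by (rule Nc_sum) (use assms in \<open>auto intro: Nc_cst\<close>)

lemma fact_Nc:
  assumes "bds t Ds" "v \<in> Nc Ds" shows "fact t Ds q v \<in> Nc Ds"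
proof (induction q rule: gwa_free_induct)
  case (const c) show ?case using assms by (simp add: fact_cst Nc_cst)
next
  case (add p q) then show ?case by (simp add: fact_add Nc_add)
next
  case (letter l p) then show ?case
    by (auto simp: fact_letter_mult Nc_iff[of _ Ds, symmetric] intro!: lext_Nc lop_Nc[OF assms(1)] dest: Nc_D simp: Nb_def)
qed

lemma fact_kill:
  assumes "v \<in> Nc Ds" "\<And>k. k \<in> Nb Ds ==> fact t Ds q (single k 1) = 0"
  shows "fact t Ds q v = 0"
proof -
  have "fact t Ds q v = lext (\<lambda>k. 0) v"
    by (rule lext_eqI) (use assms in \<open>auto simp: fact_add_r fact_cst_r Nc_def\<close>)
  then show ?thesis by (simp add: lext_def)
qed

text \<open>The relations that move a polynomial past a letter hold because the letters shift
  weights by one. The other two concern a single edge: either both arrows are present and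
  \<open>hatl\<close> is the value of \<open>t\<close>, or an arrow is missing and this value is
  zero.\<close>

lemma fact_rels:
  assumes bd: "bds t Ds" and q: "q \<in> gwa_rels t" and v: "v \<in> Nc Ds"
  shows "fact t Ds q v = 0"
proof (rule fact_kill[OF v])
  fix k assume k: "k \<in> Nb Ds"
  obtain i l where il: "k = enc i l" by (rule enc_cases)
  have i: "i < length Ds" "Vx l \<in> Ds ! i" using k by (simp_all add: il)
  have D: "bdiag (brk t) (Ds ! i)" by (rule bds_nth[OF bd i(1)])
  have up: "Up l \<in> Ds ! i \<and> Dn l \<in> Ds ! i \<and> hatl t l = poly t (of_int l + 1/2)
      \<or> \<not> (Up l \<in> Ds ! i \<and> Dn l \<in> Ds ! i) \<and> poly t (of_int l + 1/2) = 0" if "Vx l \<in> Ds ! i" for l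
  proof (cases "poly t (of_int l + 1/2) = 0")
    case True
    then have "l \<in> brk t" by (simp add: brk_def)
    then show ?thesis using D True unfolding bdiag_def by blast
  next
    case False
    then have "l \<notin> brk t" by (simp add: brk_def)
    then show ?thesis using that D hat_nonroot[OF False] unfolding bdiag_def by blast
  qed
  \<comment> \<open>The same alternative for the edge on the left of \<open>l\<close>. Away from
    breaks its left end occurs because \<open>l\<close> does.\<close>
  have dn: "Up (l - 1) \<in> Ds ! i \<and> Dn (l - 1) \<in> Ds ! i \<and> hatl t (l - 1) = poly t (of_int l - 1/2)
      \<or> \<not> (Up (l - 1) \<in> Ds ! i \<and> Dn (l - 1) \<in> Ds ! i) \<and> poly t (of_int l - 1/2) = 0"
  proof (cases "poly t (of_int l - 1/2) = 0")
    case True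
    then have "l - 1 \<in> brk t" by (simp add: brk_def)
    then show ?thesis using D True unfolding bdiag_def by blast
  next
    case False
    then have a: "l - 1 \<notin> brk t" by (simp add: brk_def)
    then have "Vx (l - 1) \<in> Ds ! i" using D i(2) unfolding bdiag_def by (metis diff_add_cancel)
    then have "Up (l - 1) \<in> Ds ! i \<and> Dn (l - 1) \<in> Ds ! i" using a D unfolding bdiag_def by blast
    moreover have "of_int (l - 1) + 1/2 = (of_int l - 1/2 :: complex)" by simp
    ultimately show ?thesis using hat_nonroot[OF False] by simp
  qed
  have ops: "lext (lop t Ds LPlus) (single (enc i m) c) = (if Up m \<in> Ds ! i then single (enc i (m + 1)) c else 0)"
    "lext (lop t Ds LMinus) (single (enc i m) c)
       = (if Dn (m - 1) \<in> Ds ! i then single (enc i (m - 1)) (c * hatl t (m - 1)) else 0)" for m c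
    by (simp_all add: lext_single ev_def cst_mult_single)
  note S = fact_diff fact_mult fact_letter fact_poly_single ops il poly_sigma_pow
  consider (a) r where "q = gwa_letter LPlus * gwa_poly r - gwa_poly (sigma_pow 1 r) * gwa_letter LPlus"
    | (b) r where "q = gwa_letter LMinus * gwa_poly r - gwa_poly (sigma_pow (- 1) r) * gwa_letter LMinus"
    | (c) "q = gwa_letter LPlus * gwa_letter LMinus - gwa_poly (sigma_pow (1/2) t)"
    | (d) "q = gwa_letter LMinus * gwa_letter LPlus - gwa_poly (sigma_pow (- 1/2) t)"
    using q unfolding gwa_rels_def by blast
  then show "fact t Ds q (single k 1) = 0"
  proof cases
    case a then show ?thesis by (simp add: S)
  next
    case b then show ?thesis by (simp add: S)
  next
    case c then show ?thesis using dn by (auto simp: S)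
  next
    case d then show ?thesis using up[OF i(2)] by (auto simp: S)
  qed
qed

lemma inv_add_UNIV: "inv\<^bsub>\<lparr>carrier = UNIV, monoid.mult = (+), one = 0\<rparr>\<^esub> a = - (a :: 'a::ring_1)"
  using a_inv_UNIV_ring[of a] by (simp add: a_inv_def)

text \<open>The elements of the free algebra that kill \<open>Nc Ds\<close> form a two-sided ideal,
  since \<open>Nc Ds\<close> is stable under the action; this ideal contains the relations.\<close>

lemma fact_ideal:
  assumes bd: "bds t Ds" and q: "q \<in> gwa_ideal t" and v: "v \<in> Nc Ds"
  shows "fact t Ds q v = 0"
proof -
  let ?K = "{q. \<forall>v\<in>Nc Ds. fact t Ds q v = 0}"
  have "ideal ?K UNIV_ring"
  proof (rule idealI[OF ring_UNIV_ring])
    show "subgroup ?K (add_monoid UNIV_ring)"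
      by (rule group.subgroupI[OF abelian_group.a_group[OF ring.is_abelian_group[OF ring_UNIV_ring]]])
         (auto simp: fact_add fact_uminus inv_add_UNIV intro: exI[of _ 0])
  qed (auto simp: fact_mult fact_Nc[OF bd])
  then have "gwa_ideal t \<subseteq> ?K" unfolding gwa_ideal_def
    by (rule ring.genideal_minimal[OF ring_UNIV_ring]) (auto simp: fact_rels[OF bd])
  then show ?thesis using q v by auto
qed

lemma NM_smult:
  assumes bd: "bds t Ds" and v: "v \<in> Nc Ds"
  shows "gq t p \<odot>\<^bsub>NM t Ds\<^esub> v = fact t Ds p v"
proof -
  let ?q = "SOME q. q \<in> gq t p"
  have "p \<in> gq t p" using additive_subgroup.zero_closed[OF ideal.axioms(1)[OF ideal_gwa]] by (simp add: gq_mem)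
  then have "?q \<in> gq t p" by (rule someI)
  then have "fact t Ds (?q - p) v = 0" by (intro fact_ideal[OF bd _ v]) (simp add: gq_mem)
  then show ?thesis by (simp add: NM_def fact_diff)
qed

lemma NM_ps: "bds t Ds ==> v \<in> Nc Ds ==> gwa_of_poly t r \<odot>\<^bsub>NM t Ds\<^esub> v = fact t Ds (gwa_poly r) v"
  and NM_X: "bds t Ds ==> v \<in> Nc Ds ==> gwa_X t l \<odot>\<^bsub>NM t Ds\<^esub> v = lext (lop t Ds l) v"
  and NM_sc: "bds t Ds ==> v \<in> Nc Ds ==> gwa_of_poly t [:c:] \<odot>\<^bsub>NM t Ds\<^esub> v = cst c * v"
  by (simp_all add: gwa_of_poly_gq gwa_X_gq NM_smult fact_letter gwa_poly_const fact_cst)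

lemma abelian_group_NM: "abelian_group (NM t Ds)"
proof (rule abelian_groupI)
  fix x assume "x \<in> carrier (NM t Ds)"
  then show "\<exists>y\<in>carrier (NM t Ds). y \<oplus>\<^bsub>NM t Ds\<^esub> x = \<zero>\<^bsub>NM t Ds\<^esub>"
    by (intro bexI[of _ "-x"]) (auto simp: Nc_uminus)
qed (auto simp: Nc_add algebra_simps)

lemma left_module_NM: assumes "bds t Ds" shows "left_module (GWA t) (NM t Ds)"
proof -
  have "gq t 1 \<odot>\<^bsub>NM t Ds\<^esub> x = x" if "x \<in> Nc Ds" for x
    using NM_smult[OF assms that, of 1] fact_cst[of t Ds 1 x] by simp
  then show ?thesis
    unfolding left_module_def left_module_axioms_def
    using ring_GWA abelian_group_NM assms
    by (auto simp: carrier_GWA NM_smult fact_Nc Nc_add fact_add_r fact_add fact_mult gq_one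
        simp flip: gq_add gq_mult)
qed

lemma finsum_NM:
  assumes "\<And>i. i \<in> A ==> f i \<in> Nc Ds" "finite A"
  shows "finsum (NM t Ds) f A = sum f A"
proof -
  interpret abelian_group "NM t Ds" by (rule abelian_group_NM)
  show ?thesis using assms(2,1)
    by (induction A rule: finite_induct) auto
qed

subsection \<open>Weight spaces\<close>

lemma weight_ideal_inj: "weight_ideal a = weight_ideal b \<longleftrightarrow> a = b"
proof
  assume "weight_ideal a = weight_ideal b"
  moreover have "[:- a, 1:] \<in> weight_ideal a" by (simp add: weight_ideal_eq)
  ultimately have "[:- a, 1:] \<in> weight_ideal b" by simp
  then show "a = b" by (simp add: weight_ideal_eq)
qed simp

lemma ideal_weight_ideal: "ideal (weight_ideal l) Cz"
  unfolding weight_ideal_def by (rule cring.cgenideal_ideal[OF cring_UNIV_ring]) simp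

lemma maximal_weight_ideal: "maximalideal (weight_ideal l) Cz"
proof (rule maximalidealI[OF ideal_weight_ideal])
  have "1 \<notin> weight_ideal l" by (simp add: weight_ideal_eq)
  then show "carrier Cz \<noteq> weight_ideal l" by auto
next
  fix J assume J: "ideal J Cz" and sub: "weight_ideal l \<subseteq> J" "J \<subseteq> carrier Cz"
  interpret J: ideal J Cz by fact
  show "J = weight_ideal l \<or> J = carrier Cz"
  proof (rule disjCI)
    assume "J \<noteq> carrier Cz"
    have "r \<in> weight_ideal l" if r: "r \<in> J" for r
    proof (rule ccontr)
      assume "r \<notin> weight_ideal l"
      then have n: "poly r l \<noteq> 0" by (simp add: weight_ideal_eq)
      \<comment> \<open>Adding \<open>r\<close> leaves a nonzero constant in \<open>J\<close>, hence
        a unit.\<close>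
      have "[:poly r l:] - r \<in> J" using sub by (auto simp: weight_ideal_eq)
      then have c: "[:poly r l:] \<in> J" using additive_subgroup.a_closed[OF ideal.axioms(1)[OF J] _ r] by fastforce
      have "[:1 / poly r l:] * [:poly r l:] \<in> J" using J.I_l_closed[OF c, of "[:1 / poly r l:]"] by simp
      then have "1 \<in> J" using n by (simp add: one_pCons)
      then have "J = carrier Cz" using J.one_imp_carrier by simp
      with \<open>J \<noteq> carrier Cz\<close> show False ..
    qed
    then show "J = weight_ideal l" using sub by auto
  qed
qed

text \<open>A nonzero coordinate at \<open>k\<close> forces every polynomial of the ideal to vanish
  at the weight of \<open>k\<close>; maximality then identifies the ideal.\<close>

lemma NM_weight_space_keys:
  assumes bd: "bds t Ds" and m: "maximalideal \<mm> Cz" and v: "v \<in> weight_space t (NM t Ds) \<mm>"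
    and k: "k \<in> keys v"
  shows "\<mm> = weight_ideal (of_int (wt k))"
proof -
  interpret m: maximalideal \<mm> Cz by fact
  have vN: "v \<in> Nc Ds" using v by (simp add: weight_space_def)
  have "poly r (of_int (wt k)) = 0" if "r \<in> \<mm>" for r
  proof -
    have "fact t Ds (gwa_poly r) v = 0"
      using v that vN by (auto simp: weight_space_def NM_ps[OF bd])
    then have "poly r (of_int (wt k)) * lkp v k = 0" using fact_poly_lookup[of t Ds r v k] by simp
    then show ?thesis using k by (simp add: in_keys_iff)
  qed
  then have "\<mm> \<subseteq> weight_ideal (of_int (wt k))" by (auto simp: weight_ideal_eq)
  moreover have "1 \<notin> weight_ideal (of_int (wt k))" by (simp add: weight_ideal_eq)
  then have "weight_ideal (of_int (wt k)) \<noteq> carrier Cz" by auto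
  ultimately show ?thesis using m.I_maximal[OF ideal_weight_ideal[of "of_int (wt k)"]] by auto
qed

lemma NM_weight_space:
  assumes "bds t Ds"
  shows "weight_space t (NM t Ds) (weight_ideal c) = {v \<in> Nc Ds. \<forall>k\<in>keys v. of_int (wt k) = c}"
proof (intro equalityI subsetI)
  fix v assume "v \<in> weight_space t (NM t Ds) (weight_ideal c)"
  then show "v \<in> {v \<in> Nc Ds. \<forall>k\<in>keys v. of_int (wt k) = c}"
    using NM_weight_space_keys[OF assms maximal_weight_ideal]
    by (auto simp: weight_space_def weight_ideal_inj)
next
  fix v assume v: "v \<in> {v \<in> Nc Ds. \<forall>k\<in>keys v. of_int (wt k) = c}"
  have "fact t Ds (gwa_poly r) v = 0" if "poly r c = 0" for r
    using v that by (intro poly_mapping_eqI) (auto simp: fact_poly_lookup in_keys_iff)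
  then show "v \<in> weight_space t (NM t Ds) (weight_ideal c)"
    using v by (simp add: weight_space_def weight_ideal_eq NM_ps[OF assms])
qed

lemma has_dim_NM:
  assumes bd: "bds t Ds" and W: "W = {v \<in> Nc Ds. \<forall>k\<in>keys v. k \<in> A}"
    and A: "A \<subseteq> Nb Ds" "finite A"
  shows "has_dim t (NM t Ds) W (card A)"
proof -
  let ?s = "\<lambda>k. single k (1::complex) :: vec"
  have inj: "inj_on ?s A" by (auto simp: inj_on_def dest: arg_cong[where f = keys])
  have sum: "finsum (NM t Ds) (\<lambda>b. gwa_of_poly t [:c b:] \<odot>\<^bsub>NM t Ds\<^esub> b) (?s ` A)
      = (\<Sum>k\<in>A. single k (c (?s k)))" for c
  proof -
    have "finsum (NM t Ds) (\<lambda>b. gwa_of_poly t [:c b:] \<odot>\<^bsub>NM t Ds\<^esub> b) (?s ` A)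
      = (\<Sum>b\<in>?s ` A. gwa_of_poly t [:c b:] \<odot>\<^bsub>NM t Ds\<^esub> b)"
      using A by (intro finsum_NM) (auto simp: NM_sc[OF bd] Nc_single Nc_cst subsetD)
    also have "\<dots> = (\<Sum>k\<in>A. single k (c (?s k)))"
      using A by (auto simp: sum.reindex[OF inj] NM_sc[OF bd] Nc_single subsetD cst_mult_single intro!: sum.cong)
    finally show ?thesis .
  qed
  have lk: "lkp (\<Sum>k\<in>A. single k (f k)) j = (if j \<in> A then f j else 0)" for f :: "nat => complex" and j
    using A(2) by (simp add: lookup_sum lookup_single when_def)
  have "\<exists>!c. c \<in> ?s ` A \<rightarrow>\<^sub>E UNIV \<and> v = finsum (NM t Ds) (\<lambda>b. gwa_of_poly t [:c b:] \<odot>\<^bsub>NM t Ds\<^esub> b) (?s ` A)"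
    if v: "v \<in> W" for v
  proof (rule ex1I)
    let ?c = "restrict (\<lambda>b. lkp v (inv_into A ?s b)) (?s ` A)"
    show "?c \<in> ?s ` A \<rightarrow>\<^sub>E UNIV \<and> v = finsum (NM t Ds) (\<lambda>b. gwa_of_poly t [:?c b:] \<odot>\<^bsub>NM t Ds\<^esub> b) (?s ` A)"
      using v unfolding sum W by (auto simp: in_keys_iff lk inv_into_f_f[OF inj] intro!: poly_mapping_eqI)
  next
    fix c assume c: "c \<in> ?s ` A \<rightarrow>\<^sub>E UNIV \<and> v = finsum (NM t Ds) (\<lambda>b. gwa_of_poly t [:c b:] \<odot>\<^bsub>NM t Ds\<^esub> b) (?s ` A)"
    then have v: "v = (\<Sum>k\<in>A. single k (c (?s k)))" unfolding sum by simp
    show "c = restrict (\<lambda>b. lkp v (inv_into A ?s b)) (?s ` A)"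
    proof (rule ext)
      fix b show "c b = restrict (\<lambda>b. lkp v (inv_into A ?s b)) (?s ` A) b"
      proof (cases "b \<in> ?s ` A")
        case True then show ?thesis unfolding v by (auto simp: lk inv_into_f_f[OF inj])
      next
        case False then show ?thesis using c by (auto simp: PiE_def extensional_def)
      qed
    qed
  qed
  moreover have "?s ` A \<subseteq> W" using A by (auto simp: W Nc_single subsetD)
  ultimately show ?thesis
    unfolding has_dim_def using A(2) card_image[OF inj] by (intro exI[of _ "?s ` A"]) auto
qed

lemma finite_Nb_wt: "finite {k \<in> Nb Ds. of_int (wt k) = (c::complex)}"
proof (cases "\<exists>l::int. c = of_int l")
  case True
  then obtain l where l: "c = of_int l" by blast
  have "{k \<in> Nb Ds. of_int (wt k) = c} \<subseteq> (\<lambda>i. enc i l) ` {..<length Ds}"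
    by (auto simp: l Nb_def image_iff) (metis enc_ix_wt lessThan_iff)
  then show ?thesis using finite_surj[OF finite_lessThan] by blast
next
  case False
  then have "{k \<in> Nb Ds. of_int (wt k) = c} = {}" by auto
  then show ?thesis by (simp only: finite.emptyI)
qed

definition wpart :: "vec => complex => vec" where
  "wpart v c = (\<Sum>k\<in>{k \<in> keys v. of_int (wt k) = c}. single k (lkp v k))"

lemma lookup_wpart: "lkp (wpart v c) k = (if of_int (wt k) = c then lkp v k else 0)"
  by (simp add: wpart_def lookup_sum lookup_single when_def in_keys_iff)

lemma wpart_W: "bds t Ds ==> v \<in> Nc Ds ==> wpart v c \<in> weight_space t (NM t Ds) (weight_ideal c)"
  by (auto simp: NM_weight_space Nc_def in_keys_iff lookup_wpart split: if_splits)

lemma weight_module_NM: assumes bd: "bds t Ds" shows "weight_module t (NM t Ds)"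
  unfolding weight_module_def
proof (intro conjI ballI left_module_NM[OF bd])
  fix v assume "v \<in> carrier (NM t Ds)"
  then have v: "v \<in> Nc Ds" by simp
  let ?W = "weight_space t (NM t Ds)"
  let ?good = "\<lambda>f. (\<forall>\<mm>. if maximalideal \<mm> Cz then f \<mm> \<in> ?W \<mm> else f \<mm> = \<zero>\<^bsub>NM t Ds\<^esub>)
        \<and> finite {\<mm>. f \<mm> \<noteq> \<zero>\<^bsub>NM t Ds\<^esub>} \<and> v = finsum (NM t Ds) f {\<mm>. f \<mm> \<noteq> \<zero>\<^bsub>NM t Ds\<^esub>}"
  \<comment> \<open>The components are the parts of \<open>v\<close> of a fixed weight. Every set
    that is not a weight ideal gets 0, the default that the definition of a weight module prescribes
    off the maximal ideals.\<close>
  define g where "g \<mm> = (if \<exists>c. \<mm> = weight_ideal c then wpart v (THE c. \<mm> = weight_ideal c) else 0)" for \<mm>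
  have g: "g (weight_ideal c) = wpart v c" for c by (auto simp: g_def weight_ideal_inj)
  have gl: "lkp (g \<mm>) k = (if \<mm> = weight_ideal (of_int (wt k)) then lkp v k else 0)" for \<mm> k
  proof (cases "\<exists>c. \<mm> = weight_ideal c")
    case True
    then obtain c where c: "\<mm> = weight_ideal c" by blast
    show ?thesis unfolding c g by (simp add: lookup_wpart weight_ideal_inj eq_commute)
  next
    case False
    then show ?thesis unfolding g_def by auto
  qed
  have g0: "g \<mm> \<noteq> 0 ==> \<exists>k\<in>keys v. \<mm> = weight_ideal (of_int (wt k))" for \<mm>
  proof -
    assume n: "g \<mm> \<noteq> 0"
    then obtain c where c: "\<mm> = weight_ideal c" by (auto simp: g_def split: if_splits)
    obtain k where "lkp (wpart v c) k \<noteq> 0" using n unfolding c g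
      by (metis lookup_zero poly_mapping_eqI)
    then show ?thesis by (auto simp: lookup_wpart c in_keys_iff split: if_splits)
  qed
  have fin: "finite {\<mm>. g \<mm> \<noteq> 0}"
    by (rule finite_subset[of _ "(\<lambda>k. weight_ideal (of_int (wt k))) ` keys v"]) (use g0 in auto)
  have gW: "g \<mm> \<in> ?W \<mm>" if "maximalideal \<mm> Cz" for \<mm>
    using wpart_W[OF bd v] by (auto simp: g_def weight_ideal_inj) (auto simp: weight_space_def NM_ps[OF bd])
  have gN: "g \<mm> \<in> Nc Ds" for \<mm>
    using wpart_W[OF bd v] by (auto simp: g_def weight_space_def)
  have vs: "v = finsum (NM t Ds) g {\<mm>. g \<mm> \<noteq> 0}"
  proof -
    have "finsum (NM t Ds) g {\<mm>. g \<mm> \<noteq> 0} = sum g {\<mm>. g \<mm> \<noteq> 0}" using gN fin by (intro finsum_NM) auto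
    moreover have "lkp (sum g {\<mm>. g \<mm> \<noteq> 0}) k = lkp v k" for k
    proof -
      have "weight_ideal (of_int (wt k)) \<in> {\<mm>. g \<mm> \<noteq> 0}" if "lkp v k \<noteq> 0"
      proof -
        have "lkp (wpart v (of_int (wt k))) k \<noteq> 0" using that by (simp add: lookup_wpart)
        then show ?thesis by (auto simp: g)
      qed
      then show ?thesis using fin by (auto simp: lookup_sum gl)
    qed
    ultimately show ?thesis by (metis poly_mapping_eqI)
  qed
  have nz: "g \<mm> = 0" if "\<not> maximalideal \<mm> Cz" for \<mm>
    using that maximal_weight_ideal by (auto simp: g_def)
  show "\<exists>!f. ?good f"
  proof (rule ex1I[of _ g])
    show "?good g" using gW nz fin vs by simp
  next
    fix f assume f: "?good f"
    have fW: "if maximalideal \<mm> Cz then f \<mm> \<in> ?W \<mm> else f \<mm> = 0" for \<mm> using f by simp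
    have fN: "f \<mm> \<in> Nc Ds" for \<mm> using fW[of \<mm>] by (auto simp: weight_space_def split: if_splits)
    \<comment> \<open>A coordinate can occur only in the component of its own weight, so the
      components of \<open>v\<close> are forced.\<close>
    have fl: "lkp (f \<mm>) k \<noteq> 0 ==> \<mm> = weight_ideal (of_int (wt k))" for \<mm> k
      using fW[of \<mm>] NM_weight_space_keys[OF bd, of \<mm> "f \<mm>" k]
      by (auto simp: in_keys_iff split: if_splits)
    have v: "v = sum f {\<mm>. f \<mm> \<noteq> 0}" using f fN by (auto simp: finsum_NM)
    have "lkp (f (weight_ideal (of_int (wt k)))) k = lkp v k" for k
    proof -
      have "lkp v k = (\<Sum>\<mm>\<in>{\<mm>. f \<mm> \<noteq> 0}. lkp (f \<mm>) k)" by (subst v) (simp add: lookup_sum)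
      also have "\<dots> = (\<Sum>\<mm>\<in>{\<mm>. f \<mm> \<noteq> 0}. if \<mm> = weight_ideal (of_int (wt k)) then lkp (f \<mm>) k else 0)"
        using fl by (intro sum.cong) auto
      also have "\<dots> = lkp (f (weight_ideal (of_int (wt k)))) k" using f by (auto simp: sum.delta')
      finally show ?thesis by simp
    qed
    then have a: "lkp (f \<mm>) k = (if \<mm> = weight_ideal (of_int (wt k)) then lkp v k else 0)" for \<mm> k
      using fl[of \<mm> k] by auto
    show "f = g"
    proof (rule ext, rule poly_mapping_eqI)
      fix \<mm> k
      show "lkp (f \<mm>) k = lkp (g \<mm>) k"
        unfolding a gl ..
    qed
  qed
qed

lemma NM_wmod: assumes bd: "bds t Ds" shows "NM t Ds \<in> wmod_O t"
proof -
  have "(\<exists>n. has_dim t (NM t Ds) (weight_space t (NM t Ds) \<mm>) n) \<and>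
        (weight_space t (NM t Ds) \<mm> \<noteq> {\<zero>\<^bsub>NM t Ds\<^esub>} --> \<mm> \<in> orbit_O)" if m: "maximalideal \<mm> Cz" for \<mm>
  proof (cases "\<exists>v\<in>weight_space t (NM t Ds) \<mm>. v \<noteq> 0")
    case True
    then obtain v k where v: "v \<in> weight_space t (NM t Ds) \<mm>" "k \<in> keys v"
      by (metis keys_eq_empty ex_in_conv poly_mapping_eqI lookup_zero in_keys_iff)
    have mm: "\<mm> = weight_ideal (of_int (wt k))" by (rule NM_weight_space_keys[OF bd m v])
    have "has_dim t (NM t Ds) (weight_space t (NM t Ds) \<mm>) (card {j \<in> Nb Ds. of_int (wt j) = (of_int (wt k) :: complex)})"
      unfolding mm by (rule has_dim_NM[OF bd _ _ finite_Nb_wt]) (auto simp: NM_weight_space[OF bd] Nc_def)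
    then show ?thesis by (auto simp: orbit_O_def mm)
  next
    case False
    then have z: "weight_space t (NM t Ds) \<mm> = {0}" by (auto simp: weight_space_def NM_ps[OF bd])
    have "has_dim t (NM t Ds) {0} (card ({} :: nat set))"
      by (rule has_dim_NM[OF bd]) (auto simp: Nc_def)
    then show ?thesis using z by auto
  qed
  then show ?thesis unfolding wmod_O_def in_wmod_O_def using weight_module_NM[OF bd] by auto
qed

section \<open>Decomposition into strings\<close>

text \<open>The edges between any two vertices carry arrows, and arrows bring their end points
  along, so the vertices form a nonempty interval.\<close>

definition con :: "diag => bool" where
  "con D \<longleftrightarrow> (\<exists>l. Vx l \<in> D) \<and> (\<forall>l. (Up l \<in> D \<or> Dn l \<in> D) --> Vx l \<in> D \<and> Vx (l + 1) \<in> D)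
     \<and> (\<forall>l m n. l \<le> m \<and> m < n \<and> Vx l \<in> D \<and> Vx n \<in> D --> Up m \<in> D \<or> Dn m \<in> D)"

locale complex_space = vector_space scale for scale :: "complex => 'b::ab_group_add => 'b"
begin

subsection \<open>Ordered bases and triangular changes of basis\<close>

text \<open>The order of a list is read from right to left: every vector is compared with the span of
  the vectors whose indices come after its own.\<close>

fun lind :: "'i list => ('i => 'b) => bool" where
  "lind [] g = True"
| "lind (x # L) g = (lind L g \<and> g x \<notin> span (g ` set L))"

fun tri :: "('i => 'b) => ('i => 'b) => 'i list => bool" where
  "tri g g' [] = True"
| "tri g g' (x # L) = (tri g g' L \<and> (\<exists>c. c \<noteq> 0 \<and> g' x - scale c (g x) \<in> span (g ` set L)))"

lemma span_cong_ins: "span A = span B ==> span (insert x A) = span (insert x B)"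
  by (auto simp: span_breakdown_eq)

lemma span_insert_tri:
  assumes "c \<noteq> 0" "y - scale c x \<in> span A" shows "span (insert y A) = span (insert x A)"
proof -
  have "y \<in> span (insert x A)" using assms(2) by (auto simp: span_breakdown_eq)
  moreover have "x \<in> span (insert y A)"
  proof -
    have "scale (- 1 / c) (y - scale c x) \<in> span A" using assms(2) by (rule span_scale)
    then have "x - scale (1 / c) y \<in> span A" using assms(1) by (simp add: scale_right_diff_distrib)
    then show ?thesis by (auto simp: span_breakdown_eq)
  qed
  ultimately show ?thesis
    by (intro equalityI span_minimal subspace_span insert_subsetI)
       (auto intro: span_base span_mono[THEN subsetD])
qed

lemma tri_span: "tri g g' L ==> span (g' ` set L) = span (g ` set L)"
proof (induction L)
  case (Cons x L)
  then obtain c where c: "c \<noteq> 0" "g' x - scale c (g x) \<in> span (g ` set L)" by auto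
  have e: "span (g' ` set L) = span (g ` set L)" using Cons by simp
  have "span (insert (g' x) (g' ` set L)) = span (insert (g' x) (g ` set L))"
    by (rule span_cong_ins[OF e])
  also have "\<dots> = span (insert (g x) (g ` set L))" by (rule span_insert_tri[OF c])
  finally show ?case by simp
qed simp

lemma tri_lind: "tri g g' L ==> lind L g ==> lind L g'"
proof (induction L)
  case (Cons x L)
  then obtain c where c: "c \<noteq> 0" "g' x - scale c (g x) \<in> span (g ` set L)" by auto
  have "g x \<in> span (g ` set L)" if "g' x \<in> span (g ` set L)"
  proof -
    have "scale c (g x) \<in> span (g ` set L)" using span_diff[OF that c(2)] by simp
    then have "scale (1 / c) (scale c (g x)) \<in> span (g ` set L)" by (rule span_scale)
    then show ?thesis using c(1) by simp
  qed
  then show ?case using Cons tri_span[of g g' L] by auto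
qed simp

lemma tri_refl: "(\<And>x. x \<in> set L ==> g' x = g x) ==> tri g g' L"
  by (induction L) (auto intro!: exI[of _ 1] span_zero)

lemma tri_trans: "tri g g' L ==> tri g' g'' L ==> tri g g'' L"
proof (induction L)
  case (Cons x L)
  then obtain c where c: "c \<noteq> 0" "g' x - scale c (g x) \<in> span (g ` set L)" by auto
  obtain d where d: "d \<noteq> 0" "g'' x - scale d (g' x) \<in> span (g' ` set L)" using Cons by auto
  have "g'' x - scale d (g' x) \<in> span (g ` set L)" using d(2) tri_span[of g g' L] Cons by simp
  moreover have "scale d (g' x - scale c (g x)) \<in> span (g ` set L)" using c(2) by (rule span_scale)
  ultimately have "(g'' x - scale d (g' x)) + scale d (g' x - scale c (g x)) \<in> span (g ` set L)"
    by (rule span_add)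
  then have "g'' x - scale (d * c) (g x) \<in> span (g ` set L)" by (simp add: scale_right_diff_distrib)
  then show ?case using Cons c d by (auto intro!: exI[of _ "d * c"])
qed simp

lemma lind_filter: "lind L g ==> lind (filter p L) g"
  by (induction L) (auto dest: span_mono[THEN subsetD, rotated])

lemma lind_cong: "(\<And>x. x \<in> set L ==> g x = g' x) ==> lind L g = lind L g'"
  by (induction L) (auto simp: image_def cong: conj_cong)

lemma tri_cong: "(\<And>x. x \<in> set L ==> g x = h x) ==> (\<And>x. x \<in> set L ==> g' x = h' x) ==> tri g g' L = tri h h' L"
proof (induction L)
  case (Cons x L)
  then have "g ` set L = h ` set L" by (intro image_cong) auto
  with Cons show ?case by simp
qed simp

text \<open>The tails of a filtered list lie in the tails of the list, so changes on two sublists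
  can be made at the same time. At a break, the vectors that survive under \<open>U\<close> and
  those hit by \<open>D\<close> are changed separately.\<close>

lemma tri_filter2:
  assumes "tri g g' (filter p L)" "tri g g' (filter q L)"
    "\<And>x. x \<in> set L ==> \<not> p x ==> \<not> q x ==> g' x = g x"
  shows "tri g g' L"
  using assms
proof (induction L)
  case (Cons x L)
  have sub: "span (g ` set (filter r L)) \<subseteq> span (g ` set L)" for r by (rule span_mono) auto
  have t: "tri g g' L" using Cons by (auto split: if_splits)
  show ?case
  proof (cases "p x \<or> q x")
    case True
    then obtain r where r: "r x" "tri g g' (filter r (x # L))" using Cons.prems(1,2) by blast
    then obtain c where "c \<noteq> 0" "g' x - scale c (g x) \<in> span (g ` set (filter r L))" by auto
    then show ?thesis using sub[of r] t by auto
  next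
    case False
    then have "g' x - scale 1 (g x) = 0" using Cons.prems by simp
    then show ?thesis using t span_zero by (auto intro!: exI[of _ 1])
  qed
qed simp

lemma tri_append: "tri g g' (L @ L') ==> tri g g' L'"
  by (induction L) auto

lemma lind_indep: "lind L g ==> distinct L ==> independent (g ` set L) \<and> inj_on g (set L)"
proof (induction L)
  case (Cons x L)
  then show ?case by (auto simp: independent_insertI intro: span_base)
qed (simp add: independent_empty)

lemma indep_lind: "independent (g ` set L) ==> inj_on g (set L) ==> distinct L ==> lind L g"
proof (induction L)
  case (Cons x L)
  have n: "g x \<notin> g ` set L" using Cons.prems by (auto simp: inj_on_def)
  have "independent (insert (g x) (g ` set L))" using Cons.prems by simp
  then have "g x \<notin> span (g ` set L)" "independent (g ` set L)" using n by (simp_all add: independent_insert)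
  then show ?case using Cons by (simp add: inj_on_def)
qed simp

text \<open>The new vectors get the indices from \<open>n\<close> on, because indices are the names
  of strings and the old strings keep theirs.\<close>

lemma lind_extend:
  fixes L :: "nat list" and K :: "'b set"
  assumes L: "lind L g" "distinct L" "set L \<subseteq> {..<n}"
    and K: "subspace K" "g ` set L \<subseteq> K" "K \<subseteq> span F" "finite F"
  obtains N g' n' where "lind (N @ L) g'" "distinct (N @ L)" "set N = {n..<n'}" "n \<le> n'"
    "\<And>x. x < n ==> g' x = g x" "span (g' ` set (N @ L)) = K"
proof -
  let ?S = "g ` set L"
  have S: "independent ?S" "inj_on g (set L)" using lind_indep[OF L(1,2)] by auto
  obtain B where B: "?S \<subseteq> B" "B \<subseteq> K" "independent B" "K \<subseteq> span B"
    using maximal_independent_subset_extend[OF K(2) S(1)] by blast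
  have "finite B" using independent_span_bound[OF K(4) B(3)] B(2) K(3) by auto
  then obtain xs where xs: "set xs = B - ?S" "distinct xs" using finite_distinct_list[of "B - ?S"] by auto
  let ?n' = "n + length xs"
  define g' where "g' i = (if i < n then g i else xs ! (i - n))" for i
  let ?N = "[n..<?n']"
  have gL: "g' ` set L = ?S" using L(3) by (auto simp: g'_def image_def)
  have gN: "g' ` set ?N = B - ?S"
  proof -
    have "set ?N = (\<lambda>j. n + j) ` {..<length xs}"
      by (simp add: image_add_atLeastLessThan lessThan_atLeast0 add.commute)
    then have "g' ` set ?N = (\<lambda>j. g' (n + j)) ` {..<length xs}" by (simp only: image_image)
    also have "\<dots> = (\<lambda>j. xs ! j) ` {..<length xs}" by (simp add: g'_def)
    also have "\<dots> = set xs" by (auto simp: set_conv_nth)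
    finally show ?thesis using xs by simp
  qed
  have im: "g' ` set (?N @ L) = B" using gL gN B(1) by (simp only: set_append image_Un) blast
  have d: "distinct (?N @ L)" using L by auto
  have "inj_on g' (set L)" using S(2) L(3) by (auto simp: inj_on_def g'_def subset_iff)
  moreover have "inj_on g' (set ?N)" using xs(2) by (auto simp: inj_on_def g'_def nth_eq_iff_index_eq)
  ultimately have "inj_on g' (set (?N @ L))" using gL gN unfolding set_append inj_on_Un by blast
  then have "lind (?N @ L) g'" using B(3) d by (intro indep_lind) (auto simp only: im)
  moreover have "span (g' ` set (?N @ L)) = K"
    unfolding im using B(2,4) K(1) by (simp add: span_minimal subset_antisym)
  ultimately show thesis using that[of ?N g' ?n'] d by (auto simp: g'_def)
qed

subsection \<open>Adapting a basis to a map and to a subspace\<close>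

definition lin :: "('b => 'b) => bool" where
  "lin a \<longleftrightarrow> (\<forall>x y. a (x + y) = a x + a y) \<and> (\<forall>c x. a (scale c x) = scale c (a x))"

lemma lin_add: "lin a ==> a (x + y) = a x + a y" by (simp add: lin_def)
lemma lin_scale: "lin a ==> a (scale c x) = scale c (a x)" by (simp add: lin_def)
lemma lin_0: "lin a ==> a 0 = 0" using lin_scale[of a 0 0] by simp
lemma lin_diff: "lin a ==> a (x - y) = a x - a y" using lin_add[of a "x - y" y] by (simp add: algebra_simps)
lemma lin_span: "lin a ==> span (a ` S) = a ` span S"
proof -
  assume "lin a"
  then interpret Vector_Spaces.linear scale scale a
    by unfold_locales (auto simp: lin_add lin_scale)
  show ?thesis by (rule span_image)
qed

text \<open>Echelon form, built from the right end: if the image of a vector depends on the images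
  of its successors, subtracting a combination of these puts the vector into the kernel; otherwise
  its index joins \<open>A\<close>.\<close>

lemma adapt_map:
  assumes "lin a" "distinct L"
  shows "\<exists>A g'. A \<subseteq> set L \<and> tri g g' L \<and> (\<forall>x\<in>set L - A. a (g' x) = 0)
    \<and> lind (filter (\<lambda>x. x \<in> A) L) (\<lambda>x. a (g' x))"
  using assms(2)
proof (induction L)
  case Nil show ?case by (intro exI[of _ "{}"]) auto
next
  case (Cons x L)
  then obtain A g' where IH: "A \<subseteq> set L" "tri g g' L" "\<forall>x\<in>set L - A. a (g' x) = 0"
      "lind (filter (\<lambda>x. x \<in> A) L) (\<lambda>x. a (g' x))" by auto
  have x: "x \<notin> set L" using Cons.prems by simp
  have eqL: "(\<lambda>y. if y = x then z else f y) ` set L = f ` set L" for f :: "'a => 'b" and z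
    using x by (auto simp: image_def)
  show ?case
  proof (cases "a (g x) \<in> span ((\<lambda>y. a (g y)) ` set L)")
    case True
    then have "a (g x) \<in> a ` span (g ` set L)" using lin_span[OF assms(1), of "g ` set L"] by (simp add: image_image)
    then obtain y where y: "y \<in> span (g ` set L)" "a (g x) = a y" by auto
    let ?g' = "\<lambda>z. if z = x then g x - y else g' z"
    have "tri g ?g' L" using IH(2) by (subst tri_cong[of L g g _ g']) (use x in auto)
    moreover have "\<exists>c. c \<noteq> 0 \<and> g x - y - scale c (g x) \<in> span (g ` set L)"
      using y(1) by (intro exI[of _ 1]) (simp add: span_neg)
    moreover have "lind (filter (\<lambda>x. x \<in> A) L) (\<lambda>x. a (?g' x))"
      using IH(4) by (subst lind_cong[of _ _ "\<lambda>x. a (g' x)"]) (use x in auto)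
    moreover have "x \<notin> A" using IH(1) x by auto
    ultimately show ?thesis using IH(1,3) y(2) assms(1)
      by (intro exI[of _ A] exI[of _ ?g']) (auto simp: lin_diff)
  next
    case False
    let ?A = "insert x A" and ?g' = "\<lambda>z. if z = x then g x else g' z"
    have "tri g ?g' L" using IH(2) by (subst tri_cong[of L g g _ g']) (use x in auto)
    moreover have fe: "filter (\<lambda>z. z \<in> ?A) L = filter (\<lambda>z. z \<in> A) L" using x by (intro filter_cong) auto
    have l: "lind (filter (\<lambda>x. x \<in> A) L) (\<lambda>x. a (?g' x))"
      using IH(4) by (subst lind_cong[of _ _ "\<lambda>x. a (g' x)"]) (use x in auto)
    have "a (g x) \<notin> span ((\<lambda>z. a (?g' z)) ` set (filter (\<lambda>z. z \<in> A) L))"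
    proof
      assume "a (g x) \<in> span ((\<lambda>z. a (?g' z)) ` set (filter (\<lambda>z. z \<in> A) L))"
      moreover have "(\<lambda>z. a (?g' z)) ` set (filter (\<lambda>z. z \<in> A) L) \<subseteq> a ` g' ` set L" using x by auto
      ultimately have "a (g x) \<in> span (a ` g' ` set L)" using span_mono by blast
      also have "\<dots> = a ` span (g ` set L)" by (simp add: lin_span[OF assms(1)] tri_span[OF IH(2)])
      also have "\<dots> = span ((\<lambda>y. a (g y)) ` set L)" by (simp add: lin_span[OF assms(1), symmetric] image_image)
      finally show False using False by simp
    qed
    then have "lind (filter (\<lambda>z. z \<in> ?A) (x # L)) (\<lambda>z. a (?g' z))" using l fe by simp
    moreover have "\<exists>c. c \<noteq> 0 \<and> ?g' x - scale c (g x) \<in> span (g ` set L)"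
      by (rule exI[of _ 1]) (simp add: span_zero)
    ultimately show ?thesis using IH(1,3) x by (intro exI[of _ ?A] exI[of _ ?g']) auto
  qed
qed

text \<open>In echelon form the coefficients at \<open>A\<close> of a kernel vector vanish, since
  the images there are independent.\<close>

lemma kernel_span:
  assumes "lin a" "lind (filter (\<lambda>x. x \<in> A) L) (\<lambda>x. a (g x))" "\<And>x. x \<in> set L ==> x \<notin> A ==> a (g x) = 0"
    "v \<in> span (g ` set L)" "a v = 0"
  shows "v \<in> span (g ` set (filter (\<lambda>x. x \<notin> A) L))"
  using assms(2-5)
proof (induction L arbitrary: v)
  case (Cons x L)
  obtain c where c: "v - scale c (g x) \<in> span (g ` set L)" using Cons.prems(3) by (auto simp: span_breakdown_eq)
  let ?v = "v - scale c (g x)"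
  show ?case
  proof (cases "x \<in> A")
    case True
    have "a ?v \<in> span (a ` g ` set L)" unfolding lin_span[OF assms(1)] using c by blast
    also have "span (a ` g ` set L) \<subseteq> span ((\<lambda>x. a (g x)) ` set (filter (\<lambda>x. x \<in> A) L))"
    proof (rule span_minimal[OF _ subspace_span], safe)
      fix y assume y: "y \<in> set L"
      show "a (g y) \<in> span ((\<lambda>x. a (g x)) ` set (filter (\<lambda>x. x \<in> A) L))"
        using y Cons.prems(2)[of y] by (cases "y \<in> A") (auto intro: span_base simp: span_zero)
    qed
    finally have s: "- scale c (a (g x)) \<in> span ((\<lambda>x. a (g x)) ` set (filter (\<lambda>x. x \<in> A) L))"
      using Cons.prems(4) by (simp add: lin_diff[OF assms(1)] lin_scale[OF assms(1)])
    have "c = 0"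
    proof (rule ccontr)
      assume "c \<noteq> 0"
      then have "a (g x) \<in> span ((\<lambda>x. a (g x)) ` set (filter (\<lambda>x. x \<in> A) L))"
        using span_scale[OF s, of "- 1 / c"] by simp
      then show False using Cons.prems(1) True by simp
    qed
    then show ?thesis using c True Cons by simp
  next
    case False
    then have ax: "a (g x) = 0" using Cons.prems(2) by simp
    then have "a ?v = 0" using Cons.prems(4) by (simp add: lin_diff[OF assms(1)] lin_scale[OF assms(1)])
    then have "?v \<in> span (g ` set (filter (\<lambda>x. x \<notin> A) L))" using Cons c False by simp
    then show ?thesis using False by (auto simp: span_breakdown_eq)
  qed
qed simp

text \<open>A vector is replaced by an element of \<open>J\<close> with the same leading term
  whenever there is one. All other vectors stay as they are.\<close>

lemma adapt_subspace:
  assumes "subspace J" "distinct L"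
  shows "\<exists>B g'. B \<subseteq> set L \<and> tri g g' L \<and> (\<forall>x\<in>B. g' x \<in> J) \<and> (\<forall>x\<in>set L - B. g' x = g x)
    \<and> (\<forall>v\<in>J. v \<in> span (g ` set L) --> v \<in> span (g' ` B))"
  using assms(2)
proof (induction L)
  case Nil show ?case by (intro exI[of _ "{}"]) auto
next
  case (Cons x L)
  then obtain B g' where IH: "B \<subseteq> set L" "tri g g' L" "\<forall>x\<in>B. g' x \<in> J" "\<forall>x\<in>set L - B. g' x = g x"
      "\<forall>v\<in>J. v \<in> span (g ` set L) --> v \<in> span (g' ` B)" by auto
  have x: "x \<notin> set L" "x \<notin> B" using Cons.prems IH(1) by auto
  show ?case
  proof (cases "\<exists>j\<in>J. j - g x \<in> span (g ` set L)")
    case True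
    then obtain j where j: "j \<in> J" "j - g x \<in> span (g ` set L)" by blast
    let ?g' = "\<lambda>z. if z = x then j else g' z"
    have t: "tri g ?g' L" using IH(2) by (subst tri_cong[of L g g _ g']) (use x in auto)
    have im: "?g' ` insert x B = insert j (g' ` B)" using x by (auto simp: image_def)
    have "v \<in> span (?g' ` insert x B)" if v: "v \<in> J" "v \<in> span (g ` set (x # L))" for v
    proof -
      obtain c where c: "v - scale c (g x) \<in> span (g ` set L)" using v(2) by (auto simp: span_breakdown_eq)
      have "v - scale c (g x) - scale c (j - g x) \<in> span (g ` set L)"
        by (rule span_diff[OF c span_scale[OF j(2)]])
      then have "v - scale c j \<in> span (g ` set L)" by (simp add: scale_right_diff_distrib)
      moreover have "v - scale c j \<in> J" using assms(1) v(1) j(1) by (simp add: subspace_diff subspace_scale)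
      ultimately have "v - scale c j \<in> span (g' ` B)" using IH(5) by blast
      then show ?thesis unfolding im by (auto simp: span_breakdown_eq)
    qed
    moreover have "\<exists>c. c \<noteq> 0 \<and> ?g' x - scale c (g x) \<in> span (g ` set L)"
      using j by (intro exI[of _ 1]) simp
    ultimately show ?thesis using IH t j x by (intro exI[of _ "insert x B"] exI[of _ ?g']) auto
  next
    case False
    let ?g' = "\<lambda>z. if z = x then g x else g' z"
    have t: "tri g ?g' L" using IH(2) by (subst tri_cong[of L g g _ g']) (use x in auto)
    have im: "?g' ` B = g' ` B" using x by (auto simp: image_def)
    have "v \<in> span (?g' ` B)" if v: "v \<in> J" "v \<in> span (g ` set (x # L))" for v
    proof -
      obtain c where c: "v - scale c (g x) \<in> span (g ` set L)" using v(2) by (auto simp: span_breakdown_eq)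
      have "c = 0"
      proof (rule ccontr)
        assume n: "c \<noteq> 0"
        have "scale (1 / c) (v - scale c (g x)) \<in> span (g ` set L)" by (rule span_scale[OF c])
        then have "scale (1 / c) v - g x \<in> span (g ` set L)" using n by (simp add: scale_right_diff_distrib)
        moreover have "scale (1 / c) v \<in> J" using assms(1) v(1) by (simp add: subspace_scale)
        ultimately show False using False by blast
      qed
      then show ?thesis using c v IH(5) unfolding im by simp
    qed
    moreover have "\<exists>c. c \<noteq> 0 \<and> ?g' x - scale c (g x) \<in> span (g ` set L)"
      by (rule exI[of _ 1]) (simp add: span_zero)
    ultimately show ?thesis using IH t x by (intro exI[of _ B] exI[of _ ?g']) auto
  qed
qed

text \<open>The error terms of the change lie in the span of the images of later vectors, so they
  can be lifted.\<close>

lemma tri_lift: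
  assumes "lin a" "tri (\<lambda>x. a (g x)) v L" "distinct L"
  shows "\<exists>g'. tri g g' L \<and> (\<forall>x\<in>set L. a (g' x) = v x)"
  using assms(2,3)
proof (induction L)
  case (Cons x L)
  then obtain g' where IH: "tri g g' L" "\<forall>x\<in>set L. a (g' x) = v x" by auto
  obtain c where c: "c \<noteq> 0" "v x - scale c (a (g x)) \<in> span ((\<lambda>x. a (g x)) ` set L)" using Cons.prems by auto
  then have "v x - scale c (a (g x)) \<in> a ` span (g ` set L)"
    by (simp add: lin_span[OF assms(1), symmetric] image_image)
  then obtain y where y: "y \<in> span (g ` set L)" "v x - scale c (a (g x)) = a y" by auto
  let ?g' = "\<lambda>z. if z = x then scale c (g x) + y else g' z"
  have "tri g ?g' L" using IH(1) by (subst tri_cong[of L g g _ g']) (use Cons.prems in auto)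
  moreover have "v x = a (scale c (g x) + y)" using y(2)
    by (simp add: lin_add[OF assms(1)] lin_scale[OF assms(1)] algebra_simps)
  ultimately show ?case using IH c(1) y(1) Cons.prems by (intro exI[of _ ?g']) auto
qed simp

text \<open>Errors from \<open>L\<close> disappear under \<open>b\<close>. This dictates the order
  of the new basis at a break: vectors with nonzero image under \<open>D\<close> come before those
  in its kernel.\<close>

lemma tri_push:
  assumes "lin b" "tri h v (K @ L)" "\<And>x. x \<in> set K ==> b (h x) = g x" "\<And>x. x \<in> set L ==> b (h x) = 0"
  shows "tri g (\<lambda>x. b (v x)) K"
  using assms(2,3)
proof (induction K)
  case (Cons x K)
  obtain c where c: "c \<noteq> 0" "v x - scale c (h x) \<in> span (h ` set (K @ L))" using Cons.prems by auto
  have "b (v x - scale c (h x)) \<in> span (b ` h ` set (K @ L))" using c(2) by (simp add: lin_span[OF assms(1)])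
  also have "span (b ` h ` set (K @ L)) \<subseteq> span (g ` set K)"
  proof (rule span_minimal[OF _ subspace_span], safe)
    fix y assume "y \<in> set (K @ L)"
    then show "b (h y) \<in> span (g ` set K)" using Cons.prems(2)[of y] assms(4)[of y]
      by (auto intro: span_base simp: span_zero)
  qed
  finally show ?case using Cons c(1)
    by (auto simp: lin_diff[OF assms(1)] lin_scale[OF assms(1)] intro!: exI[of _ c])
qed simp

end

text \<open>\<open>U l\<close> and \<open>D l\<close> are the two maps along the edge
  \<open>l\<close>, and both their products are the scalar \<open>tau l\<close>. The scalar
  \<open>eta\<close> normalises \<open>D\<close> on strings: it is forced to be \<open>tau\<close>
  away from \<open>A\<close> and is any nonzero number on \<open>A\<close>.\<close>

locale chain_rep = complex_space scale for scale :: "complex => 'b::ab_group_add => 'b" +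
  fixes W :: "int => 'b set" and U D :: "int => 'b => 'b" and tau eta :: "int => complex" and A :: "int set"
  assumes sub: "subspace (W l)" and fin: "\<exists>F. finite F \<and> W l \<subseteq> span F"
    and linU: "lin (U l)" and linD: "lin (D l)"
    and U_W: "v \<in> W l ==> U l v \<in> W (l + 1)" and D_W: "v \<in> W (l + 1) ==> D l v \<in> W l"
    and DU: "v \<in> W l ==> D l (U l v) = scale (tau l) v"
    and UD: "v \<in> W (l + 1) ==> U l (D l v) = scale (tau l) v"
    and A: "l \<in> A \<longleftrightarrow> tau l = 0" and finA: "finite A"
    and eta: "eta l \<noteq> 0" "l \<notin> A ==> eta l = tau l"
begin

section \<open>Cutting a representation of the line into strings\<close>

definition basis :: "'i set => ('i => 'b) => 'b set => bool" where
  "basis I g V \<longleftrightarrow> inj_on g I \<and> independent (g ` I) \<and> span (g ` I) = V"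

lemma basis_lind: "distinct L ==> basis (set L) g V \<longleftrightarrow> lind L g \<and> span (g ` set L) = V"
  using lind_indep[of L g] indep_lind[of g L] by (auto simp: basis_def)

lemma basis_map:
  assumes "basis I g V" "lin f" "\<And>v. v \<in> V ==> f v \<in> V'" "\<And>v. v \<in> V' ==> h v \<in> V"
    "\<And>v. v \<in> V ==> h (f v) = v" "\<And>v. v \<in> V' ==> f (h v) = v"
  shows "basis I (\<lambda>i. f (g i)) V'"
proof -
  interpret Vector_Spaces.linear scale scale f
    using assms(2) by unfold_locales (auto simp: lin_add lin_scale)
  have V: "span (g ` I) = V" using assms(1) by (simp add: basis_def)
  have inj: "inj_on f (span (g ` I))" unfolding V using assms(5) by (metis inj_onI)
  have gV: "g ` I \<subseteq> V" using V span_superset by blast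
  have "inj_on (f \<circ> g) I"
    using assms(1) inj gV unfolding basis_def V by (intro comp_inj_on) (auto intro: inj_on_subset)
  moreover have "independent (f ` g ` I)"
    using assms(1) by (intro independent_injective_image inj) (simp add: basis_def)
  moreover have "span (f ` g ` I) = V'"
    unfolding lin_span[OF assms(2)] V using assms(3,4,6) by force
  ultimately show ?thesis by (simp add: basis_def image_image comp_def)
qed

text \<open>A decomposition into strings of the part of the representation on the weights up to \<open>l\<close>.\<close>

definition win :: "int => nat => (nat => diag) => (nat => int => 'b) => bool" where
  "win l n S b \<longleftrightarrow>
     (\<forall>i<n. (\<exists>m. Vx m \<in> S i) \<and> (\<forall>m. Vx m \<in> S i --> m \<le> l)
       \<and> (\<forall>m. Up m \<in> S i \<or> Dn m \<in> S i --> Vx m \<in> S i \<and> Vx (m + 1) \<in> S i)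
       \<and> (\<forall>m<l. m \<notin> A --> (Vx m \<in> S i \<longleftrightarrow> Vx (m + 1) \<in> S i) \<and> (Vx m \<in> S i --> Up m \<in> S i \<and> Dn m \<in> S i))
       \<and> (\<forall>m\<in>A. \<not> (Up m \<in> S i \<and> Dn m \<in> S i))
       \<and> (\<forall>m p q. m \<le> p \<and> p < q \<and> Vx m \<in> S i \<and> Vx q \<in> S i --> Up p \<in> S i \<or> Dn p \<in> S i))
   \<and> (\<forall>m\<le>l. basis {i. i < n \<and> Vx m \<in> S i} (\<lambda>i. b i m) (W m))
   \<and> (\<forall>i<n. \<forall>m<l. Vx m \<in> S i --> U m (b i m) = (if Up m \<in> S i then b i (m + 1) else 0))
   \<and> (\<forall>i<n. \<forall>m<l. Vx (m + 1) \<in> S i --> D m (b i (m + 1)) = (if Dn m \<in> S i then scale (eta m) (b i m) else 0))"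

lemma winD:
  assumes "win l n S b"
  shows "i < n ==> \<exists>m. Vx m \<in> S i" and "i < n ==> Vx m \<in> S i ==> m \<le> l"
    and "i < n ==> Up m \<in> S i \<or> Dn m \<in> S i ==> Vx m \<in> S i \<and> Vx (m + 1) \<in> S i"
    and "i < n ==> m < l ==> m \<notin> A ==> (Vx m \<in> S i \<longleftrightarrow> Vx (m + 1) \<in> S i) \<and> (Vx m \<in> S i --> Up m \<in> S i \<and> Dn m \<in> S i)"
    and "i < n ==> m \<in> A ==> \<not> (Up m \<in> S i \<and> Dn m \<in> S i)"
    and "i < n ==> m \<le> p ==> p < q ==> Vx m \<in> S i ==> Vx q \<in> S i ==> Up p \<in> S i \<or> Dn p \<in> S i"
    and "m \<le> l ==> basis {i. i < n \<and> Vx m \<in> S i} (\<lambda>i. b i m) (W m)"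
    and "i < n ==> m < l ==> Vx m \<in> S i ==> U m (b i m) = (if Up m \<in> S i then b i (m + 1) else 0)"
    and "i < n ==> m < l ==> Vx (m + 1) \<in> S i ==> D m (b i (m + 1)) = (if Dn m \<in> S i then scale (eta m) (b i m) else 0)"
  using assms unfolding win_def by blast+

text \<open>The alive strings are those which reach the weight \<open>l\<close>. The flexibility in the choice of
  their end vectors is what makes the induction on \<open>l\<close> work.\<close>

definition flex :: "int => bool" where
  "flex l \<longleftrightarrow> (\<exists>L n w. distinct L \<and> set L \<subseteq> {..<n} \<and> lind L w \<and> span (w ` set L) = W l \<and>
     (\<forall>w'. tri w w' L --> (\<exists>S b. win l n S b \<and> {i. i < n \<and> Vx l \<in> S i} = set L \<and> (\<forall>i\<in>set L. b i l = w' i))))"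

text \<open>The inverse of \<open>U l\<close> away from breaks; at a break merely the normalised
  \<open>D l\<close>, which still satisfies \<open>D_invU\<close>.\<close>

definition invU :: "int => 'b => 'b" where "invU l v = scale (1 / eta l) (D l v)"

lemma invU:
  assumes "l \<notin> A"
  shows "v \<in> W l ==> invU l (U l v) = v" and "v \<in> W (l + 1) ==> U l (invU l v) = v"
    and "v \<in> W (l + 1) ==> invU l v \<in> W l" and "lin (invU l)"
  using assms eta[of l] DU UD D_W sub[of l] linU[of l] linD[of l]
  by (simp_all add: invU_def lin_scale subspace_scale) (simp add: lin_def invU_def scale_right_distrib mult.commute)

lemma D_invU: "D l v = scale (eta l) (invU l v)"
  using eta(1)[of l] by (simp add: invU_def)

lemma basis_U: assumes "l \<notin> A" "basis I g (W l)" shows "basis I (\<lambda>i. U l (g i)) (W (l + 1))"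
  by (rule basis_map[OF assms(2) linU, where h = "invU l"]) (simp_all add: U_W invU[OF assms(1)])

lemma basis_invU: assumes "l \<notin> A" "basis I g (W (l + 1))" shows "basis I (\<lambda>i. invU l (g i)) (W l)"
  by (rule basis_map[OF assms(2) invU(4)[OF assms(1)], where h = "U l"]) (simp_all add: U_W invU[OF assms(1)])

lemma exists_basis: "\<exists>(L :: nat list) n w. distinct L \<and> set L = {..<n} \<and> lind L w \<and> span (w ` set L) = W l"
proof -
  obtain F where F: "finite F" "W l \<subseteq> span F" using fin by blast
  show ?thesis
  proof (rule lind_extend[of "[]" "\<lambda>_. 0" 0 "W l" F])
    fix N g' and n' :: nat
    assume "lind (N @ []) g'" "distinct (N @ [])" "set N = {0..<n'}" "span (g' ` set (N @ [])) = W l"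
    then show ?thesis by (intro exI[of _ N] exI[of _ n'] exI[of _ g']) (auto simp: atLeast0LessThan)
  qed (use sub F in auto)
qed

primrec lext_left :: "int => ('i => 'b) => 'i => nat => 'b" where
  "lext_left l w i 0 = w i"
| "lext_left l w i (Suc k) = invU (l - int k - 1) (lext_left l w i k)"

text \<open>No edge to the left of \<open>l\<close> is a break, so any basis of \<open>W l\<close>
  is transported leftwards by isomorphisms, and every string is alive.\<close>

lemma flex_base: assumes l: "\<And>a. a \<in> A ==> l \<le> a" shows "flex l"
proof -
  obtain L :: "nat list" and n w where L: "distinct L" "set L = {..<n}" "lind L w" "span (w ` set L) = W l"
    using exists_basis by blast
  have "\<exists>S b. win l n S b \<and> {i. i < n \<and> Vx l \<in> S i} = set L \<and> (\<forall>i\<in>set L. b i l = w' i)" if t: "tri w w' L" for w'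
  proof -
    let ?S = "\<lambda>i::nat. Vx ` {..l} \<union> Up ` {..<l} \<union> Dn ` {..<l}"
    let ?b = "\<lambda>i m. lext_left l w' i (nat (l - m))"
    have S: "Vx m \<in> ?S i \<longleftrightarrow> m \<le> l" "Up m \<in> ?S i \<longleftrightarrow> m < l" "Dn m \<in> ?S i \<longleftrightarrow> m < l" for m i by auto
    have nA: "m \<notin> A" if "m < l" for m using l[of m] that by auto
    have step: "?b i m = invU m (?b i (m + 1))" if "m < l" for m i
    proof -
      have "nat (l - m) = Suc (nat (l - (m + 1)))" using that by simp
      then show ?thesis using that by simp
    qed
    have B: "basis (set L) (\<lambda>i. lext_left l w' i k) (W (l - int k))" for k
    proof (induction k)
      case 0
      have "lind L w'" "span (w' ` set L) = W l" using tri_lind[OF t L(3)] tri_span[OF t] L(4) by auto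
      then show ?case by (simp add: basis_lind[OF L(1)])
    next
      case (Suc k)
      have "basis (set L) (\<lambda>i. invU (l - int k - 1) (lext_left l w' i k)) (W (l - int k - 1))"
        by (rule basis_invU) (use Suc nA in auto)
      then show ?case by (simp add: algebra_simps)
    qed
    have B': "basis {i. i < n} (\<lambda>i. ?b i m) (W m)" if "m \<le> l" for m
      using B[of "nat (l - m)"] that L(2) by (simp add: lessThan_def)
    have bW: "?b i m \<in> W m" if "m \<le> l" "i < n" for i m
      using B'[OF that(1)] that(2) by (auto simp: basis_def intro: span_base)
    have "win l n ?S ?b"
      unfolding win_def S using B' step nA bW
      by (auto simp: invU D_invU intro: exI[of _ l])
    then show ?thesis using L(2) by (intro exI[of _ ?S] exI[of _ ?b]) auto
  qed
  then show ?thesis unfolding flex_def using L by blast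
qed

text \<open>\<open>U l\<close> carries the ordered basis and its triangular changes to
  \<open>l + 1\<close>; each alive string gains a vertex and both arrows of the edge.\<close>

lemma flex_step_iso: assumes "flex l" "l \<notin> A" shows "flex (l + 1)"
proof -
  obtain L n w where L: "distinct L" "set L \<subseteq> {..<n}" "lind L w" "span (w ` set L) = W l"
    and ex: "\<And>w'. tri w w' L ==> \<exists>S b. win l n S b \<and> {i. i < n \<and> Vx l \<in> S i} = set L \<and> (\<forall>i\<in>set L. b i l = w' i)"
    using assms(1) unfolding flex_def by blast
  let ?w = "\<lambda>i. U l (w i)"
  have Bw: "basis (set L) ?w (W (l + 1))" by (rule basis_U[OF assms(2)]) (simp add: basis_lind L)
  have "\<exists>S b. win (l + 1) n S b \<and> {i. i < n \<and> Vx (l + 1) \<in> S i} = set L \<and> (\<forall>i\<in>set L. b i (l + 1) = v i)"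
    if t: "tri ?w v L" for v
  proof -
    \<comment> \<open>A prescribed change at \<open>l + 1\<close> is pulled back to
      \<open>l\<close>, where the hypothesis applies.\<close>
    obtain w' where w': "tri w w' L" "\<forall>x\<in>set L. U l (w' x) = v x" using tri_lift[OF linU t L(1)] by blast
    obtain S b where S: "win l n S b" "{i. i < n \<and> Vx l \<in> S i} = set L" "\<forall>i\<in>set L. b i l = w' i"
      using ex[OF w'(1)] by blast
    note d = winD[OF S(1)]
    define S' where "S' i = (if i \<in> set L then S i \<union> {Vx (l + 1), Up l, Dn l} else S i)" for i
    let ?b = "\<lambda>i m. if m = l + 1 then v i else b i m"
    have up: "\<not> (Up m \<in> S i \<or> Dn m \<in> S i)" if "i < n" "l \<le> m" for i m using d(2,3)[of i] that by force
    have L': "i < n ==> Vx l \<in> S i \<longleftrightarrow> i \<in> set L" for i using S(2) by auto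
    have sub: "c \<in> S i ==> c \<in> S' i" for c i by (simp add: S'_def)
    have i1: "i < n ==> Vx m \<in> S' i \<longleftrightarrow> (Vx m \<in> S i \<and> m \<le> l) \<or> (m = l + 1 \<and> i \<in> set L)" for i m using d(2)[of i m] by (auto simp: S'_def)
    have i2: "i < n ==> Up m \<in> S' i \<longleftrightarrow> (Up m \<in> S i \<and> m < l) \<or> (m = l \<and> i \<in> set L)"
         and i3: "i < n ==> Dn m \<in> S' i \<longleftrightarrow> (Dn m \<in> S i \<and> m < l) \<or> (m = l \<and> i \<in> set L)" for i m
      using up[of i m] by (cases "l \<le> m"; auto simp: S'_def)+
    have v: "basis (set L) v (W (l + 1))"
      using Bw tri_lind[OF t] tri_span[OF t] by (simp add: basis_lind[OF L(1)])
    have Bw': "basis (set L) w' (W l)" using L tri_lind[OF w'(1)] tri_span[OF w'(1)] by (simp add: basis_lind)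
    then have w'W: "w' i \<in> W l" if "i \<in> set L" for i using that by (auto simp: basis_def intro: span_base)
    have ln: "\<And>i. i \<in> set L ==> i < n" using L(2) by auto
    have "win (l + 1) n S' ?b"
      unfolding win_def
    proof (intro conjI allI impI ballI)
      fix i assume i: "i < n"
      show "\<exists>m. Vx m \<in> S' i" using d(1)[OF i] sub by blast
      fix m show "Vx m \<in> S' i ==> m \<le> l + 1" using i1[OF i] by auto
      show "Up m \<in> S' i \<or> Dn m \<in> S' i ==> Vx m \<in> S' i" "Up m \<in> S' i \<or> Dn m \<in> S' i ==> Vx (m + 1) \<in> S' i"
        unfolding i1[OF i] i2[OF i] i3[OF i] using d(3)[OF i, of m] L'[OF i] by auto
      show "m < l + 1 ==> m \<notin> A ==> (Vx m \<in> S' i) = (Vx (m + 1) \<in> S' i)"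
        unfolding i1[OF i] using d(4)[OF i, of m] L'[OF i] by (cases "m = l") auto
      show "m < l + 1 ==> m \<notin> A ==> Vx m \<in> S' i ==> Up m \<in> S' i" "m < l + 1 ==> m \<notin> A ==> Vx m \<in> S' i ==> Dn m \<in> S' i"
        unfolding i1[OF i] i2[OF i] i3[OF i] using d(4)[OF i, of m] L'[OF i] by (cases "m = l"; auto)+
      fix p q assume a: "m \<le> p \<and> p < q \<and> Vx m \<in> S' i \<and> Vx q \<in> S' i"
      show "Up p \<in> S' i \<or> Dn p \<in> S' i"
      proof (cases "q = l + 1")
        case True
        then have iL: "i \<in> set L" using a i1[OF i, of q] by auto
        have "Vx m \<in> S i" using a i1[OF i, of m] True by auto
        then show ?thesis using a True iL L'[OF i] d(6)[OF i, of m p l] i2[OF i, of p] i3[OF i, of p] by (cases "p = l") auto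
      next
        case False
        then have "q \<le> l" "Vx q \<in> S i" "Vx m \<in> S i" using a i1[OF i, of q] i1[OF i, of m] by auto
        then have "Up p \<in> S i \<or> Dn p \<in> S i" using d(6)[OF i, of m p q] a by auto
        then show ?thesis using sub by blast
      qed
    next
      fix i m assume i: "i < n" and m: "m \<in> A"
      have "m \<noteq> l" using m assms(2) by auto
      then show "\<not> (Up m \<in> S' i \<and> Dn m \<in> S' i)" unfolding i2[OF i] i3[OF i] using d(5)[OF i m] by auto
    next
      fix m assume m: "m \<le> l + 1"
      show "basis {i. i < n \<and> Vx m \<in> S' i} (\<lambda>i. ?b i m) (W m)"
      proof (cases "m = l + 1")
        case True
        have "{i. i < n \<and> Vx m \<in> S' i} = set L" using True i1 ln by auto
        then show ?thesis using v True by simp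
      next
        case False
        have "{i. i < n \<and> Vx m \<in> S' i} = {i. i < n \<and> Vx m \<in> S i}" using False i1 m by auto
        then show ?thesis using d(7)[of m] m False by simp
      qed
    next
      fix i m assume i: "i < n" and m: "m < l + 1" and V: "Vx m \<in> S' i"
      show "U m (?b i m) = (if Up m \<in> S' i then ?b i (m + 1) else 0)"
      proof (cases "m = l")
        case True
        then have "i \<in> set L" using V L'[OF i] i1[OF i, of m] by auto
        then show ?thesis using True S(3) w'(2) i2[OF i, of l] by simp
      next
        case False
        then show ?thesis using m V d(8)[OF i, of m] i1[OF i, of m] i2[OF i, of m] by auto
      qed
    next
      fix i m assume i: "i < n" and m: "m < l + 1" and V: "Vx (m + 1) \<in> S' i"
      show "D m (?b i (m + 1)) = (if Dn m \<in> S' i then scale (eta m) (?b i m) else 0)"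
      proof (cases "m = l")
        case True
        then have iL: "i \<in> set L" using V i1[OF i, of "m + 1"] by auto
        have "D l (v i) = scale (eta l) (w' i)" using w'(2) iL w'W[OF iL] assms(2) by (metis D_invU invU(1))
        then show ?thesis using True S(3) iL i3[OF i, of l] by simp
      next
        case False
        then show ?thesis using m V d(9)[OF i, of m] i1[OF i, of "m + 1"] i3[OF i, of m] by auto
      qed
    qed
    moreover have "{i. i < n \<and> Vx (l + 1) \<in> S' i} = set L" using i1[of _ "l + 1"] ln by auto
    ultimately show ?thesis by (intro exI[of _ S'] exI[of _ ?b]) simp
  qed
  then show ?thesis
    unfolding flex_def using Bw L by (intro exI[of _ L] exI[of _ n] exI[of _ ?w]) (auto simp: basis_lind)
qed

lemma lind_lift:
  assumes "lin f" "lind K (\<lambda>x. f (h x))" "lind L h" "\<And>x. x \<in> set L ==> f (h x) = 0"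
  shows "lind (K @ L) h"
  using assms(2)
proof (induction K)
  case (Cons x K)
  have "h x \<notin> span (h ` set (K @ L))"
  proof
    assume "h x \<in> span (h ` set (K @ L))"
    then have "f (h x) \<in> span (f ` h ` set (K @ L))" by (simp add: lin_span[OF assms(1)])
    also have "span (f ` h ` set (K @ L)) \<subseteq> span ((\<lambda>x. f (h x)) ` set K)"
    proof (rule span_minimal[OF _ subspace_span], safe)
      fix y assume "y \<in> set (K @ L)"
      then show "f (h y) \<in> span ((\<lambda>x. f (h x)) ` set K)" using assms(4)[of y]
        by (auto intro: span_base simp: span_zero)
    qed
    finally show False using Cons.prems by simp
  qed
  then show ?case using Cons by simp
qed (simp add: assms(3))

text \<open>At a break, \<open>U l\<close> and \<open>f\<close>, a multiple of \<open>D l\<close>,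
  compose to zero both ways. The adapted basis at \<open>l\<close> has three kinds of indices: on
  \<open>A1\<close> the images under \<open>U l\<close> are independent; \<open>B\<close> indexes a
  basis of the image of \<open>f\<close>, inside the kernel of \<open>U l\<close>; the remaining
  strings end at \<open>l\<close> or earlier. At \<open>l + 1\<close> the strings of
  \<open>A1\<close> go on with \<open>Up\<close>, those of \<open>B\<close> with \<open>Dn\<close>,
  and \<open>N\<close> names the strings that start there.\<close>

lemma flex_step_break: assumes "flex l" "l \<in> A" shows "flex (l + 1)"
proof -
  obtain L n w where L: "distinct L" "set L \<subseteq> {..<n}" "lind L w" "span (w ` set L) = W l"
    and ex: "\<And>w'. tri w w' L ==> \<exists>S b. win l n S b \<and> {i. i < n \<and> Vx l \<in> S i} = set L \<and> (\<forall>i\<in>set L. b i l = w' i)"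
    using assms(1) unfolding flex_def by blast
  have tau: "tau l = 0" using assms(2) A by blast
  define f where "f = invU l"
  have f: "lin f" "\<And>v. v \<in> W (l + 1) ==> f v \<in> W l" "\<And>v. v \<in> W l ==> f (U l v) = 0" "\<And>v. v \<in> W (l + 1) ==> U l (f v) = 0"
    using linD[of l] linU[of l] sub[of l] D_W DU UD tau
    by (auto simp: f_def invU_def lin_scale subspace_scale) (simp add: lin_def invU_def scale_right_distrib mult.commute)
  obtain A1 w1 where A1: "A1 \<subseteq> set L" "tri w w1 L" "\<forall>x\<in>set L - A1. U l (w1 x) = 0"
      "lind (filter (\<lambda>x. x \<in> A1) L) (\<lambda>x. U l (w1 x))"
    using adapt_map[OF linU L(1)] by blast
  define K where "K = filter (\<lambda>x. x \<notin> A1) L"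
  have sJ: "subspace (f ` W (l + 1))"
  proof -
    interpret Vector_Spaces.linear scale scale f using f(1) by unfold_locales (auto simp: lin_add lin_scale)
    show ?thesis by (rule subspace_image[OF sub])
  qed
  \<comment> \<open>The second adaptation takes place within the kernel of \<open>U l\<close>, so
    the first one survives.\<close>
  obtain B w2 where B: "B \<subseteq> set K" "tri w1 w2 K" "\<forall>x\<in>B. w2 x \<in> f ` W (l + 1)" "\<forall>x\<in>set K - B. w2 x = w1 x"
      "\<forall>v\<in>f ` W (l + 1). v \<in> span (w1 ` set K) --> v \<in> span (w2 ` B)"
    using adapt_subspace[OF sJ, of K w1] L(1) by (auto simp: K_def)
  have AB: "A1 \<inter> B = {}" "B \<subseteq> set L" "set K = set L - A1" using B(1) by (auto simp: K_def)
  define w3 where "w3 x = (if x \<in> set K then w2 x else w1 x)" for x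
  have t3: "tri w1 w3 L"
  proof (rule tri_filter2)
    have "tri w1 w3 K" using B(2) by (subst tri_cong[of K w1 w1 _ w2]) (auto simp: w3_def)
    then show "tri w1 w3 (filter (\<lambda>x. x \<notin> A1) L)" "tri w1 w3 (filter (\<lambda>x. x \<notin> A1) L)" by (simp_all add: K_def)
  qed (auto simp: w3_def AB)
  have tw3: "tri w w3 L" by (rule tri_trans[OF A1(2) t3])
  have w3A: "w3 x = w1 x" if "x \<in> A1" for x using that by (simp add: w3_def AB)
  have w3W: "w3 x \<in> W l" if "x \<in> set L" for x
    using that tri_span[OF tw3] L(4) span_base[of "w3 x" "w3 ` set L"] by auto
  have w3B: "w3 x \<in> f ` W (l + 1)" if "x \<in> B" for x using that B(1,3) by (auto simp: w3_def)
  have Uw3: "U l (w3 x) = 0" if "x \<in> set L" "x \<notin> A1" for x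
  proof (cases "x \<in> B")
    case True then show ?thesis using w3B[OF True] f(4) by auto
  next
    case False then show ?thesis using that A1(3) B(4) AB by (simp add: w3_def)
  qed
  \<comment> \<open>The image of \<open>f\<close> lies in the kernel of \<open>U l\<close>, which by
    the echelon form is spanned by the vectors with index in \<open>K\<close>. Within this span, the
    adaptation to the image of \<open>f\<close> leaves only \<open>B\<close>.\<close>
  have imf: "f v \<in> span (w3 ` B)" if v: "v \<in> W (l + 1)" for v
  proof -
    have "f v \<in> span (w1 ` set L)" using f(2)[OF v] tri_span[OF A1(2)] L(4) by simp
    then have "f v \<in> span (w1 ` set K)" unfolding K_def
      using kernel_span[OF linU A1(4) _ _ f(4)[OF v]] A1(3) by blast
    then have "f v \<in> span (w2 ` B)" using B(5) v by blast
    moreover have "w3 ` B = w2 ` B" using B(1) by (intro image_cong) (auto simp: w3_def)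
    ultimately show ?thesis by simp
  qed
  have "\<forall>x\<in>B. \<exists>y. y \<in> W (l + 1) \<and> f y = w3 x" using w3B by force
  then obtain u where u: "\<And>x. x \<in> B ==> u x \<in> W (l + 1)" "\<And>x. x \<in> B ==> f (u x) = w3 x" by metis
  define LA where "LA = filter (\<lambda>x. x \<in> A1) L"
  define LB where "LB = filter (\<lambda>x. x \<in> B) L"
  have sLA: "set LA = A1" and sLB: "set LB = B" using A1(1) AB by (auto simp: LA_def LB_def)
  define Kf where "Kf = {v \<in> W (l + 1). f v = 0}"
  have sKf: "subspace Kf"
    using sub[of "l + 1"] f(1) unfolding Kf_def subspace_def by (auto simp: lin_0 lin_add lin_scale)
  obtain F where F: "finite F" "W (l + 1) \<subseteq> span F" using fin by blast
  have lA: "lind LA (\<lambda>x. U l (w3 x))"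
    using A1(4) unfolding LA_def by (subst lind_cong[of _ _ "\<lambda>x. U l (w1 x)"]) (auto simp: w3A)
  \<comment> \<open>The images under \<open>U l\<close> are completed to a basis of the kernel of
    \<open>f\<close>; the added vectors are the starts of new strings.\<close>
  obtain N g n' where N: "lind (N @ LA) g" "distinct (N @ LA)" "set N = {n..<n'}" "n \<le> n'"
      "\<And>x. x < n ==> g x = U l (w3 x)" "span (g ` set (N @ LA)) = Kf"
  proof (rule lind_extend[OF lA _ _ sKf])
    show "(\<lambda>x. U l (w3 x)) ` set LA \<subseteq> Kf"
      using A1(1) w3W f(3) U_W by (auto simp: sLA Kf_def)
    show "Kf \<subseteq> span F" using F(2) by (auto simp: Kf_def)
  qed (use L sLA A1(1) F in \<open>auto simp: LA_def\<close>)
  define h where "h x = (if x \<in> B then u x else g x)" for x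
  have ln: "x \<in> A1 ==> x < n" "x \<in> B ==> x < n" for x using A1(1) AB L(2) by auto
  have hNA: "h x = g x" if "x \<in> set (N @ LA)" for x using that AB N(3) ln(2)[of x] by (auto simp: h_def sLA)
  have hA: "h x = U l (w3 x)" if "x \<in> A1" for x using that hNA[of x] N(5)[of x] ln by (simp add: sLA)
  have imh: "h ` set (N @ LA) = g ` set (N @ LA)" using hNA by (intro image_cong) auto
  have hK: "f (h x) = 0" "h x \<in> W (l + 1)" if "x \<in> set (N @ LA)" for x
  proof -
    have "h x \<in> Kf" using that hNA[OF that] N(6) span_base[of "g x" "g ` set (N @ LA)"] by auto
    then show "f (h x) = 0" "h x \<in> W (l + 1)" by (auto simp: Kf_def)
  qed
  have hB: "f (h x) = w3 x" "h x \<in> W (l + 1)" if "x \<in> B" for x using that u by (simp_all add: h_def)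
  \<comment> \<open>A change of a vector in \<open>LB\<close> may involve the kernel of
    \<open>f\<close>, which is invisible at \<open>l\<close>. A change in \<open>LA\<close>, which
    comes last, stays in the image of \<open>U l\<close> and can be lifted. With this order every
    triangular change is induced by one at \<open>l\<close>.\<close>
  define L' where "L' = LB @ N @ LA"
  have lindL': "lind L' h"
    unfolding L'_def
  proof (rule lind_lift[OF f(1)])
    have "lind L w3" by (rule tri_lind[OF tw3 L(3)])
    then have "lind LB w3" unfolding LB_def by (rule lind_filter)
    then show "lind LB (\<lambda>x. f (h x))" by (subst lind_cong[of _ _ w3]) (auto simp: sLB hB)
    show "lind (N @ LA) h" using N(1) by (subst lind_cong[of _ _ g]) (auto simp: hNA)
  qed (use hK in auto)
  have spanL': "span (h ` set L') = W (l + 1)"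
  proof
    show "span (h ` set L') \<subseteq> W (l + 1)"
      by (rule span_minimal[OF _ sub]) (use hK hB in \<open>auto simp: L'_def sLB\<close>)
    show "W (l + 1) \<subseteq> span (h ` set L')"
    proof
      \<comment> \<open>Subtracting a combination of the lifts with the same image under
        \<open>f\<close> leaves a vector of \<open>Kf\<close>.\<close>
      fix v assume v: "v \<in> W (l + 1)"
      have "w3 ` B = f ` h ` B" using hB by (auto simp: image_image)
      then have "f v \<in> f ` span (h ` B)" using imf[OF v] lin_span[OF f(1), of "h ` B"] by simp
      then obtain y where y: "y \<in> span (h ` B)" "f v = f y" by auto
      have "span (h ` B) \<subseteq> W (l + 1)" by (rule span_minimal[OF _ sub]) (use hB in auto)
      then have "v - y \<in> Kf" using y v sub[of "l + 1"] by (auto simp: Kf_def lin_diff[OF f(1)] subspace_diff)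
      then have "v - y \<in> span (h ` set (N @ LA))" using N(6) imh by simp
      then have "v - y \<in> span (h ` set L')" by (rule span_mono[THEN subsetD, rotated]) (auto simp: L'_def)
      moreover have "y \<in> span (h ` set L')"
        using y(1) by (rule span_mono[THEN subsetD, rotated]) (auto simp: L'_def sLB)
      ultimately have "(v - y) + y \<in> span (h ` set L')" by (rule span_add)
      then show "v \<in> span (h ` set L')" by simp
    qed
  qed
  have "x \<notin> {n..<n'}" if "x \<in> B" for x using ln(2)[OF that] by simp
  then have dL': "distinct L'" using N(2,3) L(1) AB by (auto simp: L'_def LB_def sLA sLB)
  have subL': "set L' \<subseteq> {..<n'}" using ln N(3,4) by (fastforce simp: L'_def sLA sLB)
  have sL': "set L' = B \<union> {n..<n'} \<union> A1" by (auto simp: L'_def sLA sLB N(3))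
  have "\<exists>S b. win (l + 1) n' S b \<and> {i. i < n' \<and> Vx (l + 1) \<in> S i} = set L' \<and> (\<forall>i\<in>set L'. b i (l + 1) = v i)"
    if t: "tri h v L'" for v
  proof -
    have tNA: "tri h v (N @ LA)" using t unfolding L'_def by (rule tri_append)
    then have "tri h v LA" by (rule tri_append)
    then have "tri (\<lambda>x. U l (w3 x)) v LA" by (subst tri_cong[of LA _ h v v]) (auto simp: hA sLA)
    then obtain w4 where w4: "tri w3 w4 LA" "\<forall>x\<in>set LA. U l (w4 x) = v x"
      using tri_lift[OF linU, of l w3 v LA] L(1) distinct_filter[OF L(1)] unfolding LA_def by blast
    have tB: "tri w3 (\<lambda>x. f (v x)) LB"
      using t unfolding L'_def by (rule tri_push[OF f(1)]) (use hB hK in \<open>auto simp: sLB\<close>)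
    \<comment> \<open>The change at \<open>l\<close> that produces \<open>v\<close>: lifted along
      \<open>U l\<close> on \<open>A1\<close>, pushed down by \<open>f\<close> on \<open>B\<close>,
      none elsewhere.\<close>
    define w' where "w' x = (if x \<in> A1 then w4 x else if x \<in> B then f (v x) else w3 x)" for x
    have "tri w3 w' L"
    proof (rule tri_filter2)
      show "tri w3 w' (filter (\<lambda>x. x \<in> A1) L)"
        using w4(1) unfolding LA_def by (subst tri_cong[of _ w3 w3 _ w4]) (auto simp: w'_def)
      show "tri w3 w' (filter (\<lambda>x. x \<in> B) L)"
        using tB AB unfolding LB_def by (subst tri_cong[of _ w3 w3 _ "\<lambda>x. f (v x)"]) (auto simp: w'_def)
    qed (auto simp: w'_def)
    then have tw': "tri w w' L" by (rule tri_trans[OF tw3])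
    obtain S b where S: "win l n S b" "{i. i < n \<and> Vx l \<in> S i} = set L" "\<forall>i\<in>set L. b i l = w' i"
      using ex[OF tw'] by blast
    note d = winD[OF S(1)]
    have vB: "basis (set L') v (W (l + 1))"
      using tri_lind[OF t lindL'] tri_span[OF t] spanL' by (simp add: basis_lind[OF dL'])
    then have vW: "v x \<in> W (l + 1)" if "x \<in> set L'" for x using that by (auto simp: basis_def intro: span_base)
    have vK: "f (v x) = 0" if "x \<in> {n..<n'} \<union> A1" for x
    proof -
      have "span (v ` set (N @ LA)) = Kf" using tri_span[OF tNA] imh N(6) by simp
      then have "v x \<in> Kf" using that span_base[of "v x" "v ` set (N @ LA)"] N(3) sLA by auto
      then show ?thesis by (simp add: Kf_def)
    qed
    have Uw': "U l (w' x) = (if x \<in> A1 then v x else 0)" if "x \<in> set L" for x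
      using that w4(2) Uw3 f(4)[OF vW] AB by (auto simp: w'_def sLA sL')
    define S' where "S' i = (if n \<le> i then {Vx (l + 1)} else if i \<in> A1 then S i \<union> {Vx (l + 1), Up l}
        else if i \<in> B then S i \<union> {Vx (l + 1), Dn l} else S i)" for i
    let ?b = "\<lambda>i m. if m = l + 1 then v i else b i m"
    have up: "\<not> (Up m \<in> S i \<or> Dn m \<in> S i)" if "i < n" "l \<le> m" for i m using d(2,3)[of i] that by force
    have L'': "i < n ==> Vx l \<in> S i \<longleftrightarrow> i \<in> set L" for i using S(2) by auto
    have ss: "i < n ==> c \<in> S i ==> c \<in> S' i" for c i by (simp add: S'_def)
    have i1: "Vx m \<in> S' i \<longleftrightarrow> (i < n \<and> Vx m \<in> S i \<and> m \<le> l) \<or> (m = l + 1 \<and> i \<in> set L')" if "i < n'" for i m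
      using that d(2)[of i m] ln[of i] by (auto simp: S'_def sL')
    have i2: "Up m \<in> S' i \<longleftrightarrow> (i < n \<and> Up m \<in> S i \<and> m < l) \<or> (m = l \<and> i \<in> A1)"
     and i3: "Dn m \<in> S' i \<longleftrightarrow> (i < n \<and> Dn m \<in> S i \<and> m < l) \<or> (m = l \<and> i \<in> B)" if "i < n'" for i m
      using that up[of i m] ln[of i] AB(1) by (cases "l \<le> m"; auto simp: S'_def)+
    have AL: "i \<in> A1 ==> i \<in> set L" "i \<in> B ==> i \<in> set L" for i using A1(1) AB(2) by auto
    have nn: "i \<in> set L' ==> i < n'" "i < n ==> i < n'" for i using N(4) ln by (auto simp: sL' intro: less_le_trans)
    have "win (l + 1) n' S' ?b"
      unfolding win_def
    proof (intro conjI allI impI ballI)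
      fix i assume i: "i < n'"
      show "\<exists>m. Vx m \<in> S' i" using d(1)[of i] ss[of i] by (cases "i < n") (auto simp: S'_def)
      fix m show "Vx m \<in> S' i ==> m \<le> l + 1" using i1[OF i] by auto
      show "Up m \<in> S' i \<or> Dn m \<in> S' i ==> Vx m \<in> S' i" "Up m \<in> S' i \<or> Dn m \<in> S' i ==> Vx (m + 1) \<in> S' i"
        unfolding i1[OF i] i2[OF i] i3[OF i] using d(3)[of i m] L''[of i] AL[of i] ln[of i] by (auto simp: sL')
      show "m < l + 1 ==> m \<notin> A ==> (Vx m \<in> S' i) = (Vx (m + 1) \<in> S' i)"
        unfolding i1[OF i] using d(4)[of i m] assms(2) by (cases "m = l") auto
      show "m < l + 1 ==> m \<notin> A ==> Vx m \<in> S' i ==> Up m \<in> S' i" "m < l + 1 ==> m \<notin> A ==> Vx m \<in> S' i ==> Dn m \<in> S' i"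
        unfolding i1[OF i] i2[OF i] i3[OF i] using d(4)[of i m] assms(2) by (cases "m = l"; auto)+
      fix p q assume a: "m \<le> p \<and> p < q \<and> Vx m \<in> S' i \<and> Vx q \<in> S' i"
      then have Sm: "i < n" "Vx m \<in> S i" "m \<le> l" using i1[OF i, of m] i1[OF i, of q] by auto
      show "Up p \<in> S' i \<or> Dn p \<in> S' i"
      proof (cases "q = l + 1")
        case True
        then have iL: "i \<in> A1 \<union> B" using a i1[OF i, of q] Sm by (auto simp: sL')
        then show ?thesis using a True L''[OF Sm(1)] AL[of i] d(6)[OF Sm(1), of m p l] i2[OF i, of p] i3[OF i, of p] Sm
          by (cases "p = l") auto
      next
        case False
        then have "Vx q \<in> S i" using a i1[OF i, of q] by auto
        then have "Up p \<in> S i \<or> Dn p \<in> S i" using d(6)[OF Sm(1), of m p q] a Sm by auto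
        then show ?thesis using ss[OF Sm(1)] by blast
      qed
    next
      fix i m assume i: "i < n'" and m: "m \<in> A"
      show "\<not> (Up m \<in> S' i \<and> Dn m \<in> S' i)" unfolding i2[OF i] i3[OF i] using d(5)[of i m] m AB(1) by auto
    next
      fix m assume m: "m \<le> l + 1"
      show "basis {i. i < n' \<and> Vx m \<in> S' i} (\<lambda>i. ?b i m) (W m)"
      proof (cases "m = l + 1")
        case True
        have "{i. i < n' \<and> Vx m \<in> S' i} = set L'" using True i1 nn by auto
        then show ?thesis using vB True by simp
      next
        case False
        have "{i. i < n' \<and> Vx m \<in> S' i} = {i. i < n \<and> Vx m \<in> S i}" using False i1 m nn by auto
        then show ?thesis using d(7)[of m] m False by simp
      qed
    next
      fix i m assume i: "i < n'" and m: "m < l + 1" and V: "Vx m \<in> S' i"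
      then have V': "i < n" "Vx m \<in> S i" using i1[OF i, of m] by auto
      show "U m (?b i m) = (if Up m \<in> S' i then ?b i (m + 1) else 0)"
      proof (cases "m = l")
        case True
        then have "i \<in> set L" using V' L'' by auto
        then show ?thesis using True S(3) Uw' i2[OF i, of l] by auto
      next
        case False
        then show ?thesis using m V' d(8)[OF V'(1), of m] i2[OF i, of m] ln(1)[of i] by auto
      qed
    next
      fix i m assume i: "i < n'" and m: "m < l + 1" and V: "Vx (m + 1) \<in> S' i"
      show "D m (?b i (m + 1)) = (if Dn m \<in> S' i then scale (eta m) (?b i m) else 0)"
      proof (cases "m = l")
        case True
        then have iL: "i \<in> set L'" using V i1[OF i, of "m + 1"] by auto
        have D: "D l (v i) = scale (eta l) (f (v i))" by (simp add: D_invU f_def)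
        show ?thesis
        proof (cases "i \<in> B")
          case True
          then have "b i l = f (v i)" using S(3) AL AB(1) by (auto simp: w'_def)
          then show ?thesis using \<open>m = l\<close> True i3[OF i, of l] D by simp
        next
          case False
          then have "f (v i) = 0" using iL vK by (auto simp: sL')
          then show ?thesis using \<open>m = l\<close> False i3[OF i, of l] D by auto
        qed
      next
        case False
        then have V': "i < n" "Vx (m + 1) \<in> S i" using V i1[OF i, of "m + 1"] by auto
        then show ?thesis using False m d(9)[OF V'(1), of m] i3[OF i, of m] by auto
      qed
    qed
    moreover have "{i. i < n' \<and> Vx (l + 1) \<in> S' i} = set L'" using i1[of _ "l + 1"] nn by auto
    ultimately show ?thesis by (intro exI[of _ S'] exI[of _ ?b]) simp
  qed
  then show ?thesis
    unfolding flex_def using dL' lindL' spanL' subL' by (intro exI[of _ L'] exI[of _ n'] exI[of _ h]) auto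
qed

lemma flex_all: assumes "\<And>a. a \<in> A ==> l0 \<le> a" "l0 \<le> l" shows "flex l"
  using assms(2)
proof (induction l rule: int_ge_induct)
  case base show ?case by (rule flex_base[OF assms(1)])
next
  case (step l) then show ?case using flex_step_iso flex_step_break by blast
qed

primrec rext :: "int => 'b => nat => 'b" where
  "rext l w 0 = w"
| "rext l w (Suc k) = U (l + int k) (rext l w k)"

text \<open>All breaks lie in a finite window. Applied at its right end with the unchanged basis,
  \<open>flex\<close> gives the strings up to there; beyond it the alive ones continue through
  isomorphisms.\<close>

theorem string_decomposition:
  "\<exists>(n::nat) S b. (\<forall>i<n. bdiag A (S i) \<and> con (S i)) \<and> (\<forall>m. basis {i. i < n \<and> Vx m \<in> S i} (\<lambda>i. b i m) (W m))
    \<and> (\<forall>i<n. \<forall>m. Vx m \<in> S i --> U m (b i m) = (if Up m \<in> S i then b i (m + 1) else 0))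
    \<and> (\<forall>i<n. \<forall>m. Vx (m + 1) \<in> S i --> D m (b i (m + 1)) = (if Dn m \<in> S i then scale (eta m) (b i m) else 0))"
proof -
  obtain l0 l where l: "\<And>a. a \<in> A ==> l0 \<le> a \<and> a < l" "l0 \<le> l"
  proof (cases "A = {}")
    case True then show ?thesis using that[of 0 0] by simp
  next
    case False
    have "Min A \<le> a \<and> a < Max A + 1" if "a \<in> A" for a
      using that finA Max_ge[OF finA that] Min_le[OF finA that] by simp
    moreover have "Min A \<le> Max A + 1" using Max_ge[OF finA Min_in[OF finA False]] by linarith
    ultimately show ?thesis using that by blast
  qed
  have "flex l" by (rule flex_all[of l0]) (use l in auto)
  then obtain L n w S b where S: "win l n S b"
    unfolding flex_def by (blast intro: tri_refl)
  note d = winD[OF S]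
  have nA: "m \<notin> A" if "l \<le> m" for m using l(1)[of m] that by auto
  define S' where "S' i = S i \<union> (if Vx l \<in> S i then Vx ` {l<..} \<union> Up ` {l..} \<union> Dn ` {l..} else {})" for i
  define b' where "b' i m = (if m \<le> l then b i m else rext l (b i l) (nat (m - l)))" for i m
  have up: "\<not> (Up m \<in> S i \<or> Dn m \<in> S i)" if "i < n" "l \<le> m" for i m using d(2,3)[of i] that by force
  have i1: "Vx m \<in> S' i \<longleftrightarrow> (if m \<le> l then Vx m \<in> S i else Vx l \<in> S i)" if "i < n" for i m
    using d(2)[OF that, of m] by (auto simp: S'_def)
  have i2: "Up m \<in> S' i \<longleftrightarrow> (if m < l then Up m \<in> S i else Vx l \<in> S i)"
   and i3: "Dn m \<in> S' i \<longleftrightarrow> (if m < l then Dn m \<in> S i else Vx l \<in> S i)" if "i < n" for i m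
    using up[OF that, of m] by (auto simp: S'_def)
  have b'r: "b' i m = rext l (b i l) (nat (m - l))" if "l \<le> m" for i m using that by (simp add: b'_def)
  have step: "b' i (m + 1) = U m (b' i m)" if "l \<le> m" for i m
  proof -
    have "nat (m + 1 - l) = Suc (nat (m - l))" using that by simp
    then show ?thesis using that by (simp add: b'r)
  qed
  let ?I = "{i. i < n \<and> Vx l \<in> S i}"
  have B: "basis ?I (\<lambda>i. rext l (b i l) k) (W (l + int k))" for k
  proof (induction k)
    case 0 show ?case using d(7)[of l] by simp
  next
    case (Suc k)
    have "basis ?I (\<lambda>i. U (l + int k) (rext l (b i l) k)) (W (l + int k + 1))"
      by (rule basis_U) (use Suc nA in auto)
    then show ?case by (simp add: algebra_simps)
  qed
  have B': "basis {i. i < n \<and> Vx m \<in> S' i} (\<lambda>i. b' i m) (W m)" for m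
  proof (cases "m \<le> l")
    case True
    then have "{i. i < n \<and> Vx m \<in> S' i} = {i. i < n \<and> Vx m \<in> S i}" using i1 by auto
    then show ?thesis using d(7)[OF True] True by (simp add: b'_def)
  next
    case False
    then have "{i. i < n \<and> Vx m \<in> S' i} = ?I" using i1 by auto
    then show ?thesis using B[of "nat (m - l)"] False by (simp add: b'_def)
  qed
  have bW: "b' i m \<in> W m" if "i < n" "Vx m \<in> S' i" for i m
    using B'[of m] that by (auto simp: basis_def intro: span_base)
  have "bdiag A (S' i)" if i: "i < n" for i
    unfolding bdiag_def
  proof (intro conjI allI impI ballI)
    fix m
    show "Up m \<in> S' i \<or> Dn m \<in> S' i ==> Vx m \<in> S' i" "Up m \<in> S' i \<or> Dn m \<in> S' i ==> Vx (m + 1) \<in> S' i"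
      unfolding i1[OF i] i2[OF i] i3[OF i] using d(3)[OF i, of m] by (auto split: if_splits)
    show "m \<notin> A ==> (Vx m \<in> S' i) = (Vx (m + 1) \<in> S' i)"
      unfolding i1[OF i] using d(4)[OF i, of m] by (cases "m = l") auto
    show "m \<notin> A ==> Vx m \<in> S' i ==> Up m \<in> S' i" "m \<notin> A ==> Vx m \<in> S' i ==> Dn m \<in> S' i"
      unfolding i1[OF i] i2[OF i] i3[OF i] using d(4)[OF i, of m] by (auto split: if_splits)
  next
    fix m assume "m \<in> A"
    then show "\<not> (Up m \<in> S' i \<and> Dn m \<in> S' i)"
      unfolding i2[OF i] i3[OF i] using d(5)[OF i, of m] l(1)[of m] by auto
  qed
  moreover have "con (S' i)" if i: "i < n" for i
    unfolding con_def
  proof (intro conjI allI impI)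
    show "\<exists>m. Vx m \<in> S' i" using d(1)[OF i] by (auto simp: S'_def)
    fix m
    show "Up m \<in> S' i \<or> Dn m \<in> S' i ==> Vx m \<in> S' i" "Up m \<in> S' i \<or> Dn m \<in> S' i ==> Vx (m + 1) \<in> S' i"
      unfolding i1[OF i] i2[OF i] i3[OF i] using d(3)[OF i, of m] by (auto split: if_splits)
    fix p q assume a: "m \<le> p \<and> p < q \<and> Vx m \<in> S' i \<and> Vx q \<in> S' i"
    show "Up p \<in> S' i \<or> Dn p \<in> S' i"
    proof (cases "p < l")
      case False
      then show ?thesis using a i1[OF i, of q] i2[OF i, of p] by auto
    next
      case True
      then have "Vx m \<in> S i" using a i1[OF i, of m] by auto
      moreover have "Vx (min q l) \<in> S i" using a i1[OF i, of q] by (auto simp: min_def)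
      ultimately show ?thesis using d(6)[OF i, of m p "min q l"] a True i2[OF i, of p] i3[OF i, of p] by auto
    qed
  qed
  moreover have "U m (b' i m) = (if Up m \<in> S' i then b' i (m + 1) else 0)" if "i < n" "Vx m \<in> S' i" for i m
    using that i1[OF that(1), of m] i2[OF that(1), of m] step[of m i] d(8)[OF that(1), of m]
    by (cases "m < l") (auto simp: b'_def split: if_splits)
  moreover have "D m (b' i (m + 1)) = (if Dn m \<in> S' i then scale (eta m) (b' i m) else 0)"
    if "i < n" "Vx (m + 1) \<in> S' i" for i m
  proof (cases "m < l")
    case True
    then show ?thesis using that i1[OF that(1), of "m + 1"] i3[OF that(1), of m] d(9)[OF that(1), of m] by (simp add: b'_def)
  next
    case False
    then have V: "Vx l \<in> S i" using that i1[OF that(1), of "m + 1"] by auto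
    then have "Vx m \<in> S' i" using False i1[OF that(1), of m] by auto
    then have "b' i m \<in> W m" using bW that(1) by blast
    then show ?thesis using step[of m i] False V i3[OF that(1), of m] invU(1)[OF nA] by (simp add: D_invU)
  qed
  ultimately have "(\<forall>i<n. bdiag A (S' i) \<and> con (S' i)) \<and> (\<forall>m. basis {i. i < n \<and> Vx m \<in> S' i} (\<lambda>i. b' i m) (W m))
    \<and> (\<forall>i<n. \<forall>m. Vx m \<in> S' i --> U m (b' i m) = (if Up m \<in> S' i then b' i (m + 1) else 0))
    \<and> (\<forall>i<n. \<forall>m. Vx (m + 1) \<in> S' i --> D m (b' i (m + 1)) = (if Dn m \<in> S' i then scale (eta m) (b' i m) else 0))"
    using B' by simp
  then show ?thesis by blast
qed

end

subsection \<open>Modules with a basis of diagram type\<close>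

text \<open>Lagrange interpolation, with factors normalised at \<open>c\<close>.\<close>

lemma poly_separating:
  fixes c :: complex
  assumes "finite S" shows "\<exists>r. \<forall>m\<in>S. poly r m = (if m = c then 1 else 0)"
proof -
  let ?r = "\<Prod>m\<in>S - {c}. Polynomial.smult (1 / (c - m)) [:- m, 1:]"
  have "poly ?r m = (if m = c then 1 else 0)" if "m \<in> S" for m
  proof (cases "m = c")
    case True then show ?thesis by (auto simp: poly_prod intro!: prod.neutral simp flip: diff_divide_distrib split: if_splits)
  next
    case False then show ?thesis using assms that by (auto simp: poly_prod intro!: prod_zero bexI[of _ m])
  qed
  then show ?thesis by blast
qed

text \<open>On a single vector the projection to a weight is the action of a polynomial, so
  submodules and homomorphisms respect weight components. The polynomial depends only on
  \<open>v\<close> and \<open>c\<close>, not on \<open>t\<close> and \<open>Ds\<close>.\<close>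

lemma wpart_poly: "\<exists>r. \<forall>t Ds. fact t Ds (gwa_poly r) v = wpart v c"
proof -
  obtain r where r: "\<forall>m\<in>(\<lambda>k. of_int (wt k)) ` keys v. poly r m = (if m = c then 1 else 0)"
    using poly_separating[of "(\<lambda>k. of_int (wt k)) ` keys v" c] by auto
  have "fact t Ds (gwa_poly r) v = wpart v c" for t Ds
  proof (rule poly_mapping_eqI)
    fix k show "lkp (fact t Ds (gwa_poly r) v) k = lkp (wpart v c) k"
      using r by (cases "lkp v k = 0") (auto simp: fact_poly_lookup lookup_wpart in_keys_iff)
  qed
  then show ?thesis by blast
qed

lemma additive_finsum:
  assumes "abelian_group M" "abelian_group N" "\<And>v. v \<in> carrier M ==> f v \<in> carrier N"
    "\<And>v w. v \<in> carrier M ==> w \<in> carrier M ==> f (v \<oplus>\<^bsub>M\<^esub> w) = f v \<oplus>\<^bsub>N\<^esub> f w"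
    "h \<in> A \<rightarrow> carrier M"
  shows "f (finsum M h A) = finsum N (\<lambda>i. f (h i)) A"
proof -
  interpret M: abelian_group M by fact
  interpret N: abelian_group N by fact
  have "f \<zero>\<^bsub>M\<^esub> \<oplus>\<^bsub>N\<^esub> f \<zero>\<^bsub>M\<^esub> = f \<zero>\<^bsub>M\<^esub>" using assms(4)[of "\<zero>\<^bsub>M\<^esub>" "\<zero>\<^bsub>M\<^esub>"] by simp
  then have f0: "f \<zero>\<^bsub>M\<^esub> = \<zero>\<^bsub>N\<^esub>" using assms(3)[of "\<zero>\<^bsub>M\<^esub>"] by (simp add: N.add.l_cancel_one')
  show ?thesis using assms(5)
  proof (induction A rule: infinite_finite_induct)
    case (infinite A) then show ?case by (simp add: f0 M.finsum_infinite N.finsum_infinite)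
  next
    case empty then show ?case by (simp add: f0)
  next
    case (insert x F) then show ?case
      using assms(3,4) by (simp add: Pi_iff)
  qed
qed

context gwa_mod
begin

definition mext :: "(nat => 'v) => vec => 'v" where
  "mext g p = finsum M (\<lambda>k. sc (lkp p k) (g k)) (keys p)"

lemma mext_superset:
  assumes "finite A" "keys p \<subseteq> A" "\<And>k. k \<in> A ==> g k \<in> carrier M"
  shows "mext g p = finsum M (\<lambda>k. sc (lkp p k) (g k)) A"
  unfolding mext_def
  by (rule M.add.finprod_mono_neutral_cong_left) (use assms in \<open>auto simp: in_keys_iff\<close>)

lemma mext_closed: "(\<And>k. k \<in> keys p ==> g k \<in> carrier M) ==> mext g p \<in> carrier M"
  unfolding mext_def by (rule M.finsum_closed) auto

lemma mext_single: "g k \<in> carrier M ==> mext g (single k c) = sc c (g k)"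
  by (subst mext_superset[of "{k}"]) auto

lemma mext_add:
  assumes "\<And>k. k \<in> keys p \<union> keys q ==> g k \<in> carrier M"
  shows "mext g (p + q) = mext g p \<oplus>\<^bsub>M\<^esub> mext g q"
proof -
  let ?A = "keys p \<union> keys q"
  have "mext g (p + q) = finsum M (\<lambda>k. sc (lkp (p + q) k) (g k)) ?A"
    by (rule mext_superset) (use assms Poly_Mapping.keys_add[of p q] in auto)
  also have "\<dots> = finsum M (\<lambda>k. sc (lkp p k) (g k) \<oplus>\<^bsub>M\<^esub> sc (lkp q k) (g k)) ?A"
    by (rule M.finsum_cong') (use assms in \<open>auto simp: lookup_add sc_add\<close>)
  also have "\<dots> = finsum M (\<lambda>k. sc (lkp p k) (g k)) ?A \<oplus>\<^bsub>M\<^esub> finsum M (\<lambda>k. sc (lkp q k) (g k)) ?A"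
    by (rule M.finsum_addf) (use assms in auto)
  also have "finsum M (\<lambda>k. sc (lkp p k) (g k)) ?A = mext g p"
    by (rule mext_superset[symmetric]) (use assms in auto)
  also have "finsum M (\<lambda>k. sc (lkp q k) (g k)) ?A = mext g q"
    by (rule mext_superset[symmetric]) (use assms in auto)
  finally show ?thesis .
qed

lemma smult_finsum:
  assumes "a \<in> carrier (GWA t)" "h \<in> A \<rightarrow> carrier M"
  shows "a \<odot>\<^bsub>M\<^esub> finsum M h A = finsum M (\<lambda>i. a \<odot>\<^bsub>M\<^esub> h i) A"
  by (rule additive_finsum) (use assms M.abelian_group_axioms smult_closed smult_r_distr in auto)

lemma ps_finsum: "h \<in> A \<rightarrow> carrier M ==> ps r (finsum M h A) = finsum M (\<lambda>i. ps r (h i)) A"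
  and X_finsum: "h \<in> A \<rightarrow> carrier M ==> X l (finsum M h A) = finsum M (\<lambda>i. X l (h i)) A"
  by (simp_all add: smult_finsum gwa_of_poly_gq gwa_X_gq)

lemma NM_additive_eq:
  assumes p: "p \<in> Nc Ds" and f: "\<And>v. v \<in> Nc Ds ==> f v \<in> carrier M" and g: "\<And>v. v \<in> Nc Ds ==> g v \<in> carrier M"
    and fa: "\<And>v w. v \<in> Nc Ds ==> w \<in> Nc Ds ==> f (v + w) = f v \<oplus>\<^bsub>M\<^esub> f w"
    and ga: "\<And>v w. v \<in> Nc Ds ==> w \<in> Nc Ds ==> g (v + w) = g v \<oplus>\<^bsub>M\<^esub> g w"
    and e: "\<And>k c. k \<in> Nb Ds ==> f (single k c) = g (single k c)"
  shows "f p = g p"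
proof -
  have f0: "f 0 = \<zero>\<^bsub>M\<^esub>" and g0: "g 0 = \<zero>\<^bsub>M\<^esub>"
    using fa[of 0 0] ga[of 0 0] f[of 0] g[of 0] by (simp_all add: M.add.l_cancel_one')
  have "f (\<Sum>k\<in>A. single k (lkp p k)) = g (\<Sum>k\<in>A. single k (lkp p k))"
    if "finite A" "A \<subseteq> Nb Ds" for A
    using that
  proof (induction A rule: finite_induct)
    case (insert x A)
    have "(\<Sum>k\<in>A. single k (lkp p k)) \<in> Nc Ds" using insert by (intro Nc_sum Nc_single) auto
    then show ?case using insert fa ga e by (simp add: Nc_single)
  qed (simp add: f0 g0)
  then show ?thesis using p by (subst (1 2) poly_mapping_sum_single) (simp add: Nc_def)
qed

text \<open>Independence is asked for in one weight at a time. This gives injectivity because the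
  kernel of the induced map is stable under polynomials and so, by \<open>wpart_poly\<close>,
  contains the weight components of its elements.\<close>

theorem NM_iso:
  assumes bd: "bds t Ds"
    and bW: "\<And>i l. i < length Ds ==> Vx l \<in> Ds ! i ==> b i l \<in> W (of_int l)"
    and bP: "\<And>i l. i < length Ds ==> Vx l \<in> Ds ! i ==> X LPlus (b i l) = (if Up l \<in> Ds ! i then b i (l + 1) else \<zero>\<^bsub>M\<^esub>)"
    and bM: "\<And>i l. i < length Ds ==> Vx l \<in> Ds ! i ==>
      X LMinus (b i l) = (if Dn (l - 1) \<in> Ds ! i then sc (hatl t (l - 1)) (b i (l - 1)) else \<zero>\<^bsub>M\<^esub>)"
    and gen: "\<And>H. subgroup H (add_monoid M) ==>
      (\<And>c i l. i < length Ds ==> Vx l \<in> Ds ! i ==> sc c (b i l) \<in> H) ==> carrier M \<subseteq> H"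
    and ind: "\<And>c l i. finsum M (\<lambda>i. sc (c i) (b i l)) {i. i < length Ds \<and> Vx l \<in> Ds ! i} = \<zero>\<^bsub>M\<^esub> ==>
      i < length Ds ==> Vx l \<in> Ds ! i ==> c i = 0"
  shows "\<exists>f\<in>module_iso (GWA t) (NM t Ds) M. \<forall>i l. i < length Ds --> Vx l \<in> Ds ! i --> f (ev i l) = b i l"
proof -
  define g where "g k = b (ix k) (wt k)" for k
  let ?f = "mext g"
  have gW: "g k \<in> W (of_int (wt k))" if "k \<in> Nb Ds" for k using bW that by (simp add: g_def Nb_def)
  have gc: "g k \<in> carrier M" if "k \<in> Nb Ds" for k using W_carrier[OF gW[OF that]] .
  have fc: "?f v \<in> carrier M" if "v \<in> Nc Ds" for v
    by (rule mext_closed) (use that gc in \<open>auto simp: Nc_def\<close>)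
  have fa: "?f (v + w) = ?f v \<oplus>\<^bsub>M\<^esub> ?f w" if "v \<in> Nc Ds" "w \<in> Nc Ds" for v w
    by (rule mext_add) (use that gc in \<open>auto simp: Nc_def\<close>)
  have fs: "?f (single k c) = sc c (g k)" if "k \<in> Nb Ds" for k c
    by (rule mext_single[of g k, OF gc[OF that]])
  have f0: "?f 0 = \<zero>\<^bsub>M\<^esub>" by (simp add: mext_def)
  have hom: "?f (a \<odot>\<^bsub>NM t Ds\<^esub> v) = a \<odot>\<^bsub>M\<^esub> ?f v" if a: "a \<in> carrier (GWA t)" and v: "v \<in> Nc Ds" for a v
  proof (rule gwa_hom_smult[OF left_module_NM[OF bd] left_module_axioms _ _ _ _ _ a])
    fix c v assume "v \<in> carrier (NM t Ds)"
    then have v: "v \<in> Nc Ds" by simp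
    show "?f (gwa_of_poly t [:c:] \<odot>\<^bsub>NM t Ds\<^esub> v) = sc c (?f v)"
      unfolding NM_sc[OF bd v]
      by (rule NM_additive_eq[OF v])
        (auto simp: fc Nc_cst distrib_left fa ps_add_r cst_mult_single fs sc_sc gc)
    show "?f (gwa_of_poly t [:0, 1:] \<odot>\<^bsub>NM t Ds\<^esub> v) = ps [:0, 1:] (?f v)"
      unfolding NM_ps[OF bd v]
    proof (rule NM_additive_eq[OF v])
      fix k c assume k: "k \<in> Nb Ds"
      have z: "ps [:0, 1:] (g k) = sc (of_int (wt k)) (g k)" using W_ps[OF gW[OF k], of "[:0, 1:]"] by simp
      have "ps [:0, 1:] (?f (single k c)) = sc c (ps [:0, 1:] (g k))"
        unfolding fs[OF k] by (rule ps_sc[OF gc[OF k]])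
      also have "\<dots> = sc (c * of_int (wt k)) (g k)" unfolding z by (rule sc_sc[OF gc[OF k]])
      finally show "?f (fact t Ds (gwa_poly [:0, 1:]) (single k c)) = ps [:0, 1:] (?f (single k c))"
        by (simp add: fact_poly_single fs[OF k] mult.commute)
    qed (auto simp: fc fact_Nc[OF bd] fact_add_r fa ps_add_r)
    fix l assume l: "l \<in> {LPlus, LMinus}"
    show "?f (gwa_X t l \<odot>\<^bsub>NM t Ds\<^esub> v) = X l (?f v)"
      unfolding NM_X[OF bd v]
    proof (rule NM_additive_eq[OF v])
      fix k c assume k: "k \<in> Nb Ds"
      then have k': "ix k < length Ds" "Vx (wt k) \<in> Ds ! ix k" by (auto simp: Nb_def)
      note D = bds_nth[OF bd k'(1), unfolded bdiag_def]
      have P: "Up (wt k) \<in> Ds ! ix k ==> enc (ix k) (wt k + 1) \<in> Nb Ds" using D k' by auto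
      have Q: "Dn (wt k - 1) \<in> Ds ! ix k ==> enc (ix k) (wt k - 1) \<in> Nb Ds" using D k' by auto
      have Xk: "X l (sc c (g k)) = sc c (X l (g k))" by (rule X_sc[OF gc[OF k] l])
      show "?f (lext (lop t Ds l) (single k c)) = X l (?f (single k c))"
      proof (cases "l = LPlus")
        case True
        then show ?thesis using P fs[OF P, of c] bP[OF k'] Xk
          by (auto simp: lext_single fs[OF k] f0 ev_def cst_mult_single g_def)
      next
        case False
        then have "l = LMinus" using l by simp
        then show ?thesis using Q fs[OF Q] bM[OF k'] Xk gc[OF Q]
          by (auto simp: lext_single fs[OF k] f0 ev_def cst_mult_single g_def sc_sc)
      qed
    next
      fix v assume v: "v \<in> Nc Ds"
      have "lext (lop t Ds l) v \<in> Nc Ds" using fact_Nc[OF bd v, of "gwa_letter l"] by (simp add: fact_letter)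
      then show "?f (lext (lop t Ds l) v) \<in> carrier M" by (rule fc)
      fix w assume w: "w \<in> Nc Ds"
      show "?f (lext (lop t Ds l) (v + w)) = ?f (lext (lop t Ds l) v) \<oplus>\<^bsub>M\<^esub> ?f (lext (lop t Ds l) w)"
        using fact_Nc[OF bd v, of "gwa_letter l"] fact_Nc[OF bd w, of "gwa_letter l"]
        by (simp add: lext_add fa fact_letter)
    qed (auto simp: fc fa X_add_r)
  qed (use v in \<open>auto simp: fc fa\<close>)
  have inj0: "p = 0" if p: "p \<in> Nc Ds" and f: "?f p = \<zero>\<^bsub>M\<^esub>" for p
  proof (rule ccontr)
    assume "p \<noteq> 0"
    then obtain k where k: "k \<in> keys p" by (metis keys_eq_empty ex_in_conv)
    let ?l = "wt k" and ?q = "wpart p (of_int (wt k))"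
    obtain r where r: "\<And>t Ds. fact t Ds (gwa_poly r) p = ?q" using wpart_poly by blast
    have "?f ?q = ps r (?f p)"
      using hom[OF _ p, of "gwa_of_poly t r"] by (simp add: gwa_of_poly_gq NM_smult[OF bd p] r)
    then have q0: "?f ?q = \<zero>\<^bsub>M\<^esub>" using f by simp
    let ?I = "{i. i < length Ds \<and> Vx ?l \<in> Ds ! i}"
    have "?f ?q = finsum M (\<lambda>k. sc (lkp ?q k) (g k)) ((\<lambda>i. enc i ?l) ` ?I)"
    proof (rule mext_superset)
      show "keys ?q \<subseteq> (\<lambda>i. enc i ?l) ` ?I"
      proof
        fix j assume "j \<in> keys ?q"
        then have "wt j = ?l" "j \<in> keys p" by (auto simp: in_keys_iff lookup_wpart split: if_splits)
        then show "j \<in> (\<lambda>i. enc i ?l) ` ?I" using Nc_D[OF p, of j] by (metis (mono_tags, lifting) enc_ix_wt image_eqI mem_Collect_eq)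
      qed
    qed (auto intro: gc)
    also have "\<dots> = finsum M (\<lambda>i. sc (lkp p (enc i ?l)) (b i ?l)) ?I"
    proof (subst M.finsum_reindex)
      show "(\<lambda>k. sc (lkp ?q k) (g k)) \<in> (\<lambda>i. enc i ?l) ` ?I \<rightarrow> carrier M" using gc by auto
      show "inj_on (\<lambda>i. enc i ?l) ?I" by (auto simp: inj_on_def)
    qed (simp add: lookup_wpart g_def)
    finally have "lkp p (enc i ?l) = 0" if "i < length Ds" "Vx ?l \<in> Ds ! i" for i
      using ind[OF _ that, of "\<lambda>i. lkp p (enc i ?l)"] q0 by simp
    then have "lkp p (enc (ix k) ?l) = 0" using Nc_D[OF p k] by blast
    then show False using k by (simp add: in_keys_iff)
  qed
  have "bij_betw ?f (Nc Ds) (carrier M)"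
    unfolding bij_betw_def
  proof
    show "inj_on ?f (Nc Ds)"
    proof (rule inj_onI)
      fix p q assume pq: "p \<in> Nc Ds" "q \<in> Nc Ds" "?f p = ?f q"
      have d: "p - q \<in> Nc Ds" using Nc_add[OF pq(1) Nc_uminus[OF pq(2)]] by simp
      have "?f (p - q) \<oplus>\<^bsub>M\<^esub> ?f q = ?f q" using fa[OF d pq(2)] pq(3) by simp
      then have "?f (p - q) = \<zero>\<^bsub>M\<^esub>" using fc d pq(2) by (simp add: M.add.r_cancel_one)
      then show "p = q" using inj0[OF d] by simp
    qed
    have "subgroup (?f ` Nc Ds) (add_monoid M)"
    proof (rule group.subgroupI[OF M.a_group])
      show "?f ` Nc Ds \<subseteq> carrier (add_monoid M)" using fc by auto
      show "?f ` Nc Ds \<noteq> {}" using Nc_0 by blast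
    next
      fix a assume "a \<in> ?f ` Nc Ds"
      then obtain p where p: "p \<in> Nc Ds" "a = ?f p" by auto
      have "?f (- p) \<oplus>\<^bsub>M\<^esub> ?f p = \<zero>\<^bsub>M\<^esub>" using fa[OF Nc_uminus[OF p(1)] p(1)] by (simp add: f0)
      then have "\<ominus>\<^bsub>M\<^esub> a = ?f (- p)" using p fc Nc_uminus M.minus_equality by auto
      then show "inv\<^bsub>add_monoid M\<^esub> a \<in> ?f ` Nc Ds" using Nc_uminus[OF p(1)] by (auto simp: a_inv_def)
    next
      fix a b assume "a \<in> ?f ` Nc Ds" "b \<in> ?f ` Nc Ds"
      then obtain p q where pq: "p \<in> Nc Ds" "a = ?f p" "q \<in> Nc Ds" "b = ?f q" by auto
      then have "a \<oplus>\<^bsub>M\<^esub> b = ?f (p + q)" by (simp add: fa)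
      then show "a \<otimes>\<^bsub>add_monoid M\<^esub> b \<in> ?f ` Nc Ds" using Nc_add[OF pq(1,3)] by auto
    qed
    then have "carrier M \<subseteq> ?f ` Nc Ds"
    proof (rule gen)
      fix c i l assume "i < length Ds" "Vx l \<in> Ds ! i"
      then show "sc c (b i l) \<in> ?f ` Nc Ds" using fs[of "enc i l" c] Nc_single[of "enc i l" Ds c] by (force simp: g_def)
    qed
    then show "?f ` Nc Ds = carrier M" using fc by auto
  qed
  then have "?f \<in> module_iso (GWA t) (NM t Ds) M"
    using fa hom by (simp add: module_iso_def)
  moreover have "?f (ev i l) = b i l" if "i < length Ds" "Vx l \<in> Ds ! i" for i l
    using fs[of "enc i l" 1] that bW[THEN W_carrier] by (simp add: ev_def g_def)
  ultimately show ?thesis by blast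
qed

end

subsection \<open>Weight modules are sums of strings\<close>

lemma (in chain_rep) basis_coords:
  assumes "finite I" "basis I g V" "v \<in> V" shows "\<exists>c. v = (\<Sum>i\<in>I. scale (c i) (g i))"
proof -
  have "v \<in> span (g ` I)" using assms by (simp add: basis_def)
  then obtain u where "v = (\<Sum>x\<in>g ` I. scale (u x) x)" using assms(1) by (auto simp: span_finite)
  also have "\<dots> = (\<Sum>i\<in>I. scale (u (g i)) (g i))" using assms(2) by (simp add: basis_def sum.reindex)
  finally show ?thesis by (rule exI[of _ "\<lambda>i. u (g i)"])
qed

lemma (in chain_rep) basis_zero:
  assumes "finite I" "basis I g V" "(\<Sum>i\<in>I. scale (c i) (g i)) = 0" "i \<in> I" shows "c i = 0"
proof -
  let ?u = "\<lambda>x. c (inv_into I g x)"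
  have inj: "inj_on g I" using assms(2) by (simp add: basis_def)
  have "(\<Sum>x\<in>g ` I. scale (?u x) x) = 0" using assms(3) inj by (simp add: sum.reindex)
  then have "?u (g i) = 0"
    using independentD[of "g ` I" "g ` I" ?u "g i"] assms by (simp add: basis_def)
  then show ?thesis using inj assms(4) by simp
qed

lemma finite_brk: assumes "t \<noteq> 0" shows "finite (brk t)"
proof -
  have "finite {x. poly t x = 0}" by (rule poly_roots_finite[OF assms])
  then have "finite ((\<lambda>l::int. of_int l + 1/2 :: complex) -` {x. poly t x = 0})"
    by (rule finite_vimageI) (auto simp: inj_on_def)
  then show ?thesis by (simp add: brk_def vimage_def)
qed

lemma sum_fun_apply: "(\<Sum>a\<in>A. f a) x = (\<Sum>a\<in>A. f a x)"
  for f :: "'a => 'b => 'c::comm_monoid_add"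
  by (induction A rule: infinite_finite_induct) auto

lemma finsum_subgroup:
  assumes "abelian_group M" "subgroup H (add_monoid M)" "\<And>i. i \<in> A ==> f i \<in> H"
  shows "finsum M f A \<in> H"
proof -
  interpret abelian_group M by fact
  interpret H: subgroup H "add_monoid M" by fact
  show ?thesis using assms(3)
  proof (induction A rule: infinite_finite_induct)
    case (infinite A) then show ?case using H.one_closed by (simp add: finsum_infinite)
  next
    case empty then show ?case using H.one_closed by simp
  next
    case (insert x F)
    then show ?case using H.m_closed[of "f x" "finsum M f F"] H.subset
      by (subst finsum_insert) (auto simp: subset_iff)
  qed
qed

lemma wmod_gen:
  assumes M: "in_wmod_O t M" and H: "subgroup H (add_monoid M)"
    and W: "\<And>l v. v \<in> weight_space t M (weight_ideal (of_int l)) ==> v \<in> H"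
  shows "carrier M \<subseteq> H"
proof
  fix v assume v: "v \<in> carrier M"
  interpret gwa_mod t M using M by (simp add: in_wmod_O_def weight_module_def gwa_modI)
  have "\<exists>f. (\<forall>\<mm>. if maximalideal \<mm> Cz then f \<mm> \<in> weight_space t M \<mm> else f \<mm> = \<zero>\<^bsub>M\<^esub>)
      \<and> v = finsum M f {\<mm>. f \<mm> \<noteq> \<zero>\<^bsub>M\<^esub>}"
    using M v unfolding in_wmod_O_def weight_module_def by blast
  then obtain f where f: "\<And>\<mm>. if maximalideal \<mm> Cz then f \<mm> \<in> weight_space t M \<mm> else f \<mm> = \<zero>\<^bsub>M\<^esub>"
      "v = finsum M f {\<mm>. f \<mm> \<noteq> \<zero>\<^bsub>M\<^esub>}" by auto
  have "f \<mm> \<in> H" if "f \<mm> \<noteq> \<zero>\<^bsub>M\<^esub>" for \<mm>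
  proof -
    have m: "maximalideal \<mm> Cz" "f \<mm> \<in> weight_space t M \<mm>" using f(1)[of \<mm>] that by (auto split: if_splits)
    then have "\<mm> \<in> orbit_O" using M that unfolding in_wmod_O_def by blast
    then show ?thesis using m(2) W by (auto simp: orbit_O_def)
  qed
  then show "v \<in> H" unfolding f(2) by (intro finsum_subgroup[OF M.abelian_group_axioms H]) auto
qed

text \<open>The linear algebra of \<open>complex_space\<close> lives on a whole type, while
  \<open>M\<close> has only a carrier set. So every weight space is replaced by its space of
  coordinates \<open>S l\<close>, the functions \<open>'a => complex\<close> supported on a chosen
  basis \<open>B l\<close>. \<open>Lc\<close> and \<open>co\<close> pass between the two, and
  \<open>U\<close>, \<open>D\<close> are the two letters in coordinates.\<close>

theorem wmod_decomposition:
  assumes M: "in_wmod_O t M" and t: "t \<noteq> 0"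
  shows "\<exists>Ds. bds t Ds \<and> (\<forall>D\<in>set Ds. con D) \<and> module_iso (GWA t) (NM t Ds) M \<noteq> {}"
proof -
  interpret gwa_mod t M using M by (simp add: in_wmod_O_def weight_module_def gwa_modI)
  let ?W = "\<lambda>l::int. W (of_int l)"
  have "\<exists>B. finite B \<and> B \<subseteq> ?W l \<and> (\<forall>v\<in>?W l. \<exists>!c::'a => complex. c \<in> B \<rightarrow>\<^sub>E UNIV \<and> v = finsum M (\<lambda>b. sc (c b) b) B)" for l
  proof -
    obtain n where "has_dim t M (?W l) n"
      using M maximal_weight_ideal[of "of_int l"] unfolding in_wmod_O_def by blast
    then show ?thesis unfolding has_dim_def by (elim exE conjE) (intro exI conjI)
  qed
  then have "\<forall>l. \<exists>B. finite B \<and> B \<subseteq> ?W l \<and> (\<forall>v\<in>?W l. \<exists>!c::'a => complex. c \<in> B \<rightarrow>\<^sub>E UNIV \<and> v = finsum M (\<lambda>b. sc (c b) b) B)"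
    by (rule allI)
  from choice[OF this] obtain B where
    B0: "\<forall>l. finite (B l) \<and> B l \<subseteq> ?W l \<and> (\<forall>v\<in>?W l. \<exists>!c::'a => complex. c \<in> B l \<rightarrow>\<^sub>E UNIV \<and> v = finsum M (\<lambda>b. sc (c b) b) (B l))" ..
  have B: "finite (B l)" "B l \<subseteq> ?W l" for l using B0 by simp_all
  have B3: "\<exists>!c::'a => complex. c \<in> B l \<rightarrow>\<^sub>E UNIV \<and> v = finsum M (\<lambda>b. sc (c b) b) (B l)" if "v \<in> ?W l" for v l
    using B0[THEN spec, of l, THEN conjunct2, THEN conjunct2] that by (rule bspec)
  define Lc where "Lc l c = finsum M (\<lambda>b. sc (c b) b) (B l)" for l and c :: "'a => complex"
  define S where "S l = {c :: 'a => complex. \<forall>b. b \<notin> B l --> c b = 0}" for l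
  define scale :: "complex => ('a => complex) => 'a => complex" where "scale a c = (\<lambda>x. a * c x)" for a c
  have Bc: "b \<in> carrier M" if "b \<in> B l" for b l using B(2) that W_carrier by blast
  have LcW: "Lc l c \<in> ?W l" for l c
  proof -
    have "subgroup (?W l) (add_monoid M)"
    proof (rule group.subgroupI[OF M.a_group])
      fix a assume a: "a \<in> ?W l"
      have "\<ominus>\<^bsub>M\<^esub> a = sc (- 1) a" using W_carrier[OF a] ps_uminus[of a 1] by (simp add: one_pCons)
      then show "inv\<^bsub>add_monoid M\<^esub> a \<in> ?W l" using W_sc[OF a] by (simp add: a_inv_def)
    next
      show "?W l \<noteq> {}" using W_zero by blast
    qed (use W_add W_carrier in auto)
    then show ?thesis unfolding Lc_def
      by (rule finsum_subgroup[OF M.abelian_group_axioms]) (use B(2) W_sc in blast)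
  qed
  have Lcc: "Lc l c \<in> carrier M" for l c using LcW W_carrier by blast
  have Lc_add: "Lc l (c + d) = Lc l c \<oplus>\<^bsub>M\<^esub> Lc l d" for l c d
  proof -
    have "Lc l (c + d) = finsum M (\<lambda>b. sc (c b) b \<oplus>\<^bsub>M\<^esub> sc (d b) b) (B l)"
      unfolding Lc_def by (rule M.finsum_cong') (auto simp: sc_add Bc)
    also have "\<dots> = Lc l c \<oplus>\<^bsub>M\<^esub> Lc l d" unfolding Lc_def by (rule M.finsum_addf) (auto simp: Bc)
    finally show ?thesis .
  qed
  have Lc_sc: "Lc l (scale a c) = sc a (Lc l c)" for l a c
    unfolding Lc_def scale_def by (subst ps_finsum) (auto simp: Bc sc_sc intro!: M.finsum_cong')
  have Lc_inj: "c = d" if "c \<in> S l" "d \<in> S l" "Lc l c = Lc l d" for l c d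
  proof -
    have *: "restrict c (B l) \<in> B l \<rightarrow>\<^sub>E UNIV \<and> Lc l c = finsum M (\<lambda>b. sc (restrict c (B l) b) b) (B l)" for c
      unfolding Lc_def by (auto intro!: M.finsum_cong' simp: Bc)
    have "restrict c (B l) = restrict d (B l)" using B3[OF LcW[of l c]] *[of c] *[of d] that(3) by auto
    then have "restrict c (B l) b = restrict d (B l) b" for b by simp
    then have "b \<in> B l ==> c b = d b" for b by (metis restrict_apply')
    moreover have "b \<notin> B l ==> c b = d b" for b using that(1,2) by (simp add: S_def)
    ultimately have "c b = d b" for b by blast
    then show ?thesis by blast
  qed
  have Lc_surj: "\<exists>c\<in>S l. Lc l c = v" if v: "v \<in> ?W l" for l v
  proof -
    obtain c :: "'a => complex" where c: "v = finsum M (\<lambda>b. sc (c b) b) (B l)" using B3[OF v] by blast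
    have "Lc l (\<lambda>b. if b \<in> B l then c b else 0) = v"
      unfolding Lc_def c by (auto intro!: M.finsum_cong' simp: Bc)
    then show ?thesis by (intro bexI[of _ "\<lambda>b. if b \<in> B l then c b else 0"]) (auto simp: S_def)
  qed
  define co where "co l v = (THE c. c \<in> S l \<and> Lc l c = v)" for l v
  have co_eq: "co l v = c" if "c \<in> S l" "Lc l c = v" for l v c
    unfolding co_def using that Lc_inj by blast
  have co: "co l v \<in> S l" "Lc l (co l v) = v" if "v \<in> ?W l" for l v
    using Lc_surj[OF that] co_eq by auto
  have S_add: "c + d \<in> S l" "scale a c \<in> S l" if "c \<in> S l" "d \<in> S l" for l c d a
    using that by (auto simp: S_def scale_def)
  have co_add: "co l (v \<oplus>\<^bsub>M\<^esub> w) = co l v + co l w" if "v \<in> ?W l" "w \<in> ?W l" for l v w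
    by (rule co_eq) (use co[OF that(1)] co[OF that(2)] S_add in \<open>auto simp: Lc_add\<close>)
  have co_sc: "co l (sc a v) = scale a (co l v)" if "v \<in> ?W l" for l a v
    by (rule co_eq) (use co[OF that] S_add in \<open>auto simp: Lc_sc\<close>)
  have XP: "X LPlus v \<in> ?W (l + 1)" if "v \<in> ?W l" for v l using X_W(1)[OF that] by simp
  have XM: "X LMinus v \<in> ?W l" if "v \<in> ?W (l + 1)" for v l using X_W(2)[OF that] by simp
  define U where "U l c = co (l + 1) (X LPlus (Lc l c))" for l c
  define D where "D l c = co l (X LMinus (Lc (l + 1) c))" for l c
  have LU: "Lc (l + 1) (U l c) = X LPlus (Lc l c)" for l c unfolding U_def by (rule co(2)[OF XP[OF LcW]])
  have LD: "Lc l (D l c) = X LMinus (Lc (l + 1) c)" for l c unfolding D_def by (rule co(2)[OF XM[OF LcW]])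
  have vs: "vector_space scale"
    by unfold_locales (auto simp: scale_def algebra_simps fun_eq_iff)
  interpret V: complex_space scale by (rule complex_space.intro[OF vs])
  interpret C: chain_rep scale S U D "\<lambda>l. poly t (of_int l + 1/2)" "hatl t" "brk t"
  proof
    fix l
    show "V.subspace (S l)" by (auto simp: V.subspace_def S_def scale_def)
    show "\<exists>F. finite F \<and> S l \<subseteq> V.span F"
    proof (intro exI conjI subsetI)
      let ?F = "(\<lambda>b x. if x = b then 1 else 0 :: complex) ` B l"
      show "finite ?F" using B(1) by simp
      fix c assume "c \<in> S l"
      then have "c = (\<Sum>b\<in>B l. scale (c b) (\<lambda>x. if x = b then 1 else 0))"
        using B(1)[of l] by (auto simp: fun_eq_iff sum_fun_apply scale_def S_def if_distrib cong: if_cong)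
      also have "\<dots> \<in> V.span ?F" by (intro V.span_sum V.span_scale V.span_base) auto
      finally show "c \<in> V.span ?F" .
    qed
    show "V.lin (U l)"
      unfolding V.lin_def U_def
      by (auto simp: Lc_add X_add_r Lcc Lc_sc X_sc co_add[OF XP[OF LcW] XP[OF LcW]] co_sc[OF XP[OF LcW]])
    show "V.lin (D l)"
      unfolding V.lin_def D_def
      by (auto simp: Lc_add X_add_r Lcc Lc_sc X_sc co_add[OF XM[OF LcW] XM[OF LcW]] co_sc[OF XM[OF LcW]])
    show "hatl t l \<noteq> 0" by (rule hat_nonzero[OF t])
    show "l \<in> brk t \<longleftrightarrow> poly t (of_int l + 1/2) = 0" by (simp add: brk_def)
    show "l \<notin> brk t ==> hatl t l = poly t (of_int l + 1/2)" by (simp add: brk_def hat_nonroot)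
    show "finite (brk t)" by (rule finite_brk[OF t])
    fix v
    show "U l v \<in> S (l + 1)" unfolding U_def by (rule co(1)[OF XP[OF LcW]])
    show "D l v \<in> S l" unfolding D_def by (rule co(1)[OF XM[OF LcW]])
    show "D l (U l v) = scale (poly t (of_int l + 1/2)) v" if "v \<in> S l"
    proof -
      have "D l (U l v) = co l (X LMinus (X LPlus (Lc l v)))" unfolding D_def[of l "U l v"] LU ..
      also have "\<dots> = co l (sc (poly t (of_int l + 1/2)) (Lc l v))" unfolding XX_W(2)[OF LcW] ..
      also have "\<dots> = scale (poly t (of_int l + 1/2)) v" unfolding co_sc[OF LcW] using co_eq[OF that] by simp
      finally show ?thesis .
    qed
    show "U l (D l v) = scale (poly t (of_int l + 1/2)) v" if "v \<in> S (l + 1)"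
    proof -
      have e: "complex_of_int (l + 1) - 1/2 = of_int l + 1/2" by simp
      have "U l (D l v) = co (l + 1) (X LPlus (X LMinus (Lc (l + 1) v)))" unfolding U_def[of l "D l v"] LD ..
      also have "\<dots> = co (l + 1) (sc (poly t (of_int (l + 1) - 1/2)) (Lc (l + 1) v))" unfolding XX_W(1)[OF LcW] ..
      also have "\<dots> = scale (poly t (of_int l + 1/2)) v" unfolding co_sc[OF LcW] e using co_eq[OF that] by simp
      finally show ?thesis .
    qed
  qed
  obtain n :: nat and T b where T: "\<And>i. i < n ==> bdiag (brk t) (T i) \<and> con (T i)"
    "\<And>m. C.basis {i. i < n \<and> Vx m \<in> T i} (\<lambda>i. b i m) (S m)"
    "\<And>i m. i < n ==> Vx m \<in> T i ==> U m (b i m) = (if Up m \<in> T i then b i (m + 1) else 0)"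
    "\<And>i m. i < n ==> Vx (m + 1) \<in> T i ==> D m (b i (m + 1)) = (if Dn m \<in> T i then scale (hatl t m) (b i m) else 0)"
    using C.string_decomposition by blast
  define Ds where "Ds = map T [0..<n]"
  have len: "length Ds = n" and nth: "i < n ==> Ds ! i = T i" for i by (simp_all add: Ds_def)
  define c where "c i l = Lc l (b i l)" for i l
  have cc: "c i l \<in> carrier M" for i l by (simp add: c_def Lcc)
  have bS: "b i l \<in> S l" if "i < n" "Vx l \<in> T i" for i l
    using T(2)[of l] that by (auto simp: C.basis_def intro: V.span_base)
  have Lc0: "Lc l 0 = \<zero>\<^bsub>M\<^esub>" for l
    unfolding Lc_def by (rule M.add.finprod_one_eqI) (auto simp: Bc)
  have Lc_sum: "Lc l (\<Sum>i\<in>I. scale (a i) (b i l)) = finsum M (\<lambda>i. sc (a i) (c i l)) I" for l a I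
  proof (induction I rule: infinite_finite_induct)
    case (infinite I) then show ?case by (simp only: sum.infinite Lc0 M.finsum_infinite not_False_eq_True)
  next
    case empty show ?case by (simp only: sum.empty Lc0 M.finsum_empty)
  next
    case (insert x F)
    show ?case
      unfolding sum.insert[OF insert(1,2)] Lc_add Lc_sc insert(3)
      by (subst M.finsum_insert) (use insert cc in \<open>auto simp: c_def\<close>)
  qed
  have finI: "finite {i. i < n \<and> Vx l \<in> T i}" for l by simp
  have bd: "bds t Ds" and cn: "\<forall>D\<in>set Ds. con D" using T(1) by (auto simp: bds_def Ds_def)
  have "\<exists>f\<in>module_iso (GWA t) (NM t Ds) M. \<forall>i l. i < length Ds --> Vx l \<in> Ds ! i --> f (ev i l) = c i l"
  proof (rule NM_iso[OF bd])
    fix i l assume il: "i < length Ds" "Vx l \<in> Ds ! i"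
    then have i: "i < n" and V: "Vx l \<in> T i" by (auto simp: len nth)
    show "c i l \<in> ?W l" by (simp add: c_def LcW)
    have "X LPlus (c i l) = Lc (l + 1) (U l (b i l))" by (simp add: LU c_def)
    then show "X LPlus (c i l) = (if Up l \<in> Ds ! i then c i (l + 1) else \<zero>\<^bsub>M\<^esub>)"
      unfolding T(3)[OF i V] nth[OF i] by (cases "Up l \<in> T i") (simp_all only: c_def Lc0 if_True if_False)
    have "X LMinus (c i l) = Lc (l - 1) (D (l - 1) (b i l))" by (simp add: LD c_def)
    also have "D (l - 1) (b i l) = (if Dn (l - 1) \<in> T i then scale (hatl t (l - 1)) (b i (l - 1)) else 0)"
      using T(4)[OF i, of "l - 1"] V by simp
    finally show "X LMinus (c i l) = (if Dn (l - 1) \<in> Ds ! i then sc (hatl t (l - 1)) (c i (l - 1)) else \<zero>\<^bsub>M\<^esub>)"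
      by (cases "Dn (l - 1) \<in> T i") (simp_all only: nth[OF i] c_def Lc0 Lc_sc if_True if_False)
  next
    fix H assume H: "subgroup H (add_monoid M)"
      and cH: "\<And>a i l. i < length Ds ==> Vx l \<in> Ds ! i ==> sc a (c i l) \<in> H"
    show "carrier M \<subseteq> H"
    proof (rule wmod_gen[OF M H])
      fix l v assume v: "v \<in> ?W l"
      obtain a where a: "co l v = (\<Sum>i\<in>{i. i < n \<and> Vx l \<in> T i}. scale (a i) (b i l))"
        using C.basis_coords[OF finI T(2) co(1)[OF v]] by blast
      have "v = finsum M (\<lambda>i. sc (a i) (c i l)) {i. i < n \<and> Vx l \<in> T i}"
        using co(2)[OF v] unfolding a Lc_sum by simp
      also have "\<dots> \<in> H" by (rule finsum_subgroup[OF M.abelian_group_axioms H]) (auto simp: len nth intro: cH)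
      finally show "v \<in> H" .
    qed
  next
    fix a :: "nat => complex" and l i
    assume z: "finsum M (\<lambda>i. sc (a i) (c i l)) {i. i < length Ds \<and> Vx l \<in> Ds ! i} = \<zero>\<^bsub>M\<^esub>"
      and i: "i < length Ds" "Vx l \<in> Ds ! i"
    let ?s = "\<Sum>i\<in>{i. i < n \<and> Vx l \<in> T i}. scale (a i) (b i l)"
    have I: "{i. i < length Ds \<and> Vx l \<in> Ds ! i} = {i. i < n \<and> Vx l \<in> T i}" by (auto simp: len nth)
    have "Lc l ?s = Lc l 0" using z unfolding I Lc_sum Lc0 .
    moreover have "?s \<in> S l" by (rule V.subspace_sum[OF C.sub]) (use bS V.subspace_scale[OF C.sub] in auto)
    moreover have "0 \<in> S l" by (simp add: S_def)
    ultimately have "?s = 0" using Lc_inj by blast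
    then show "a i = 0" by (rule C.basis_zero[OF finI T(2)]) (use i len nth in auto)
  qed
  then show ?thesis using bd cn by blast
qed

section \<open>Multiplicities of strings\<close>

abbreviation cu :: "diag => int => complex" where "cu D l \<equiv> of_bool (Up l \<in> D)"
abbreviation cd :: "diag => int => complex" where "cd D l \<equiv> of_bool (Dn l \<in> D)"

text \<open>Homomorphisms \<open>F\<close> and \<open>G\<close> in opposite directions between two strings, whose composition is
  nonzero in some weight, can only exist between equal strings.\<close>

lemma string_sub:
  assumes D: "con D"
    and F: "\<And>l. F l \<noteq> 0 ==> Vx l \<in> D \<and> Vx l \<in> E" and G: "\<And>l. G l \<noteq> 0 ==> Vx l \<in> D \<and> Vx l \<in> E"
    and FU: "\<And>l. cu D l * F (l + 1) = cu E l * (F l :: complex)" and FD: "\<And>l. cd D l * F l = cd E l * F (l + 1)"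
    and GU: "\<And>l. cu E l * G (l + 1) = cu D l * (G l :: complex)" and GD: "\<And>l. cd E l * G l = cd D l * G (l + 1)"
    and n: "F m \<noteq> 0" "G m \<noteq> 0"
  shows "D \<subseteq> E"
proof -
  define K where "K l \<longleftrightarrow> F l \<noteq> 0 \<and> G l \<noteq> 0" for l
  \<comment> \<open>An arrow of \<open>D\<close> makes one of the two commutation equations nonzero,
    which forces the same arrow into \<open>E\<close>; then the equation of the other map carries
    its value along as well.\<close>
  have up: "K (l + 1)" if "K l" "Up l \<in> D \<or> Dn l \<in> D" for l
    using that FU[of l] FD[of l] GU[of l] GD[of l] by (auto simp: K_def of_bool_def split: if_splits)
  have down: "K l" if "K (l + 1)" "Up l \<in> D \<or> Dn l \<in> D" for l
    using that FU[of l] FD[of l] GU[of l] GD[of l] by (auto simp: K_def of_bool_def split: if_splits)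
  have edge: "(Up l \<in> D --> Up l \<in> E) \<and> (Dn l \<in> D --> Dn l \<in> E)" if "K l" for l
    using that FU[of l] FD[of l] GU[of l] GD[of l] by (auto simp: K_def of_bool_def split: if_splits)
  have m: "K m" "Vx m \<in> D" using n F by (auto simp: K_def)
  have "K l" if "Vx l \<in> D" for l
  proof (cases "m \<le> l")
    case True
    then have "Vx l \<in> D --> K l"
    proof (induction l rule: int_ge_induct)
      case (step l)
      show ?case
      proof
        assume v: "Vx (l + 1) \<in> D"
        then have e: "Up l \<in> D \<or> Dn l \<in> D" using D step.hyps m(2) unfolding con_def by (metis zless_add1_eq)
        then have "Vx l \<in> D" using D unfolding con_def by blast
        then show "K (l + 1)" using step.IH up e by blast
      qed
    qed (simp add: m)
    then show ?thesis using that by simp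
  next
    case False
    then have "l \<le> m" by simp
    then have "Vx l \<in> D --> K l"
    proof (induction l rule: int_le_induct)
      case (step l)
      show ?case
      proof
        assume v: "Vx (l - 1) \<in> D"
        have "l - 1 \<le> l - 1 \<and> l - 1 < m" using step.hyps by simp
        then have e: "Up (l - 1) \<in> D \<or> Dn (l - 1) \<in> D" using D v m(2) unfolding con_def by blast
        then have "Vx (l - 1 + 1) \<in> D" using D unfolding con_def by blast
        then have "K (l - 1 + 1)" using step.IH by simp
        then show "K (l - 1)" using down e by blast
      qed
    qed (simp add: m)
    then show ?thesis using that by simp
  qed
  then have "c \<in> E" if "c \<in> D" for c
    using that edge F D unfolding con_def K_def by (cases c) blast+
  then show ?thesis by blast
qed

section \<open>Homomorphisms between diagram modules\<close>

lemma lookup_lop: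
  "lkp (lext (lop t Ds LPlus) v) (enc j (l + 1)) = (if Up l \<in> Ds ! j then lkp v (enc j l) else 0)"
  "lkp (lext (lop t Ds LMinus) v) (enc j l) = (if Dn l \<in> Ds ! j then hatl t l * lkp v (enc j (l + 1)) else 0)"
proof -
  show "lkp (lext (lop t Ds LPlus) v) (enc j (l + 1)) = (if Up l \<in> Ds ! j then lkp v (enc j l) else 0)"
  proof (induction v rule: poly_mapping_induct)
    case (single k c)
    obtain i m where k: "k = enc i m" by (rule enc_cases)
    show ?case by (auto simp: k lext_single ev_def cst_mult_single lookup_single when_def)
  next
    case (add p q) then show ?case by (simp add: lext_add lookup_add)
  qed simp
  show "lkp (lext (lop t Ds LMinus) v) (enc j l) = (if Dn l \<in> Ds ! j then hatl t l * lkp v (enc j (l + 1)) else 0)"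
  proof (induction v rule: poly_mapping_induct)
    case (single k c)
    obtain i m where k: "k = enc i m" by (rule enc_cases)
    show ?case by (auto simp: k lext_single ev_def cst_mult_single lookup_single when_def)
  next
    case (add p q) then show ?case by (simp add: lext_add lookup_add algebra_simps)
  qed simp
qed

locale NM_hom =
  fixes t Ds Es and f :: "vec => vec"
  assumes t: "t \<noteq> 0" and Ds: "bds t Ds" and Es: "bds t Es"
    and closed: "\<And>v. v \<in> Nc Ds ==> f v \<in> Nc Es"
    and add: "\<And>v w. v \<in> Nc Ds ==> w \<in> Nc Ds ==> f (v + w) = f v + f w"
    and smult: "\<And>a v. a \<in> carrier (GWA t) ==> v \<in> Nc Ds ==> f (a \<odot>\<^bsub>NM t Ds\<^esub> v) = a \<odot>\<^bsub>NM t Es\<^esub> f v"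
begin

text \<open>The matrix of \<open>f\<close> in weight \<open>l\<close>, set to 0 where
  \<open>ev i l\<close> is not in the module and the value of \<open>f\<close> is arbitrary.\<close>

definition Fm :: "int => nat => nat => complex" where
  "Fm l j i = (if Vx l \<in> Ds ! i then lkp (f (ev i l)) (enc j l) else 0)"

lemma hom_fact: "v \<in> Nc Ds ==> f (fact t Ds q v) = fact t Es q (f v)"
  using smult[of "gq t q" v] by (simp add: NM_smult Ds Es closed)

lemma hom_X: "v \<in> Nc Ds ==> f (lext (lop t Ds l) v) = lext (lop t Es l) (f v)"
  using hom_fact[of v "gwa_letter l"] by (simp add: fact_letter)

lemma hom_cst: "v \<in> Nc Ds ==> f (cst c * v) = cst c * f v"
  using hom_fact[of v "cst c"] by (simp add: fact_cst)

lemma hom_0: "f 0 = 0" using add[of 0 0] by simp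

lemma hom_sum: "(\<And>i. i \<in> I ==> h i \<in> Nc Ds) ==> f (sum h I) = (\<Sum>i\<in>I. f (h i))"
  by (induction I rule: infinite_finite_induct) (auto simp: hom_0 add Nc_sum)

lemma Fm_nonzero:
  assumes "Fm l j i \<noteq> 0" "i < length Ds" shows "Vx l \<in> Ds ! i \<and> j < length Es \<and> Vx l \<in> Es ! j"
proof -
  have V: "Vx l \<in> Ds ! i" "lkp (f (ev i l)) (enc j l) \<noteq> 0" using assms by (auto simp: Fm_def split: if_splits)
  then show ?thesis using Nc_D[OF closed, of "ev i l" "enc j l"] assms by (simp add: in_keys_iff)
qed

text \<open>The scalar \<open>hatl t l\<close> is nonzero and the same for both lists, so it
  cancels; what remains of the compatibility with the letters involves only the presence of
  arrows.\<close>

lemma Fm_edges: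
  assumes i: "i < length Ds"
  shows "cu (Ds ! i) l * Fm (l + 1) j i = cu (Es ! j) l * Fm l j i"
    and "cd (Ds ! i) l * Fm l j i = cd (Es ! j) l * Fm (l + 1) j i"
proof -
  note D = bds_nth[OF Ds i, unfolded bdiag_def]
  show "cu (Ds ! i) l * Fm (l + 1) j i = cu (Es ! j) l * Fm l j i"
  proof (cases "Vx l \<in> Ds ! i")
    case True
    have "lext (lop t Ds LPlus) (ev i l) = (if Up l \<in> Ds ! i then ev i (l + 1) else 0)"
      by (simp add: ev_def lext_single)
    then have "lkp (f (if Up l \<in> Ds ! i then ev i (l + 1) else 0)) (enc j (l + 1))
        = lkp (lext (lop t Es LPlus) (f (ev i l))) (enc j (l + 1))"
      using hom_X[of "ev i l" LPlus] i True by simp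
    then show ?thesis using D True unfolding lookup_lop by (auto simp: Fm_def hom_0 of_bool_def split: if_splits)
  next
    case False
    then have "Up l \<notin> Ds ! i" using D by blast
    then show ?thesis using False by (simp add: Fm_def)
  qed
  show "cd (Ds ! i) l * Fm l j i = cd (Es ! j) l * Fm (l + 1) j i"
  proof (cases "Vx (l + 1) \<in> Ds ! i")
    case True
    have "lext (lop t Ds LMinus) (ev i (l + 1)) = (if Dn l \<in> Ds ! i then cst (hatl t l) * ev i l else 0)"
      by (simp add: ev_def lext_single)
    then have "lkp (f (if Dn l \<in> Ds ! i then cst (hatl t l) * ev i l else 0)) (enc j l)
        = lkp (lext (lop t Es LMinus) (f (ev i (l + 1)))) (enc j l)"
      using hom_X[of "ev i (l + 1)" LMinus] i True by simp
    then show ?thesis using D True i hat_nonzero[OF t, of "of_int l + 1/2"] unfolding lookup_lop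
      by (auto simp: Fm_def hom_0 hom_cst lookup_cst_mult of_bool_def split: if_splits)
  next
    case False
    then have "Dn l \<notin> Ds ! i" using D by blast
    then show ?thesis using False by (simp add: Fm_def)
  qed
qed

text \<open>\<open>z - l\<close> kills \<open>ev i l\<close> and hence its image, so only
  coordinates of weight \<open>l\<close> survive.\<close>

lemma hom_ev:
  assumes i: "i < length Ds" "Vx l \<in> Ds ! i"
  shows "f (ev i l) = (\<Sum>j<length Es. single (enc j l) (Fm l j i))"
proof (rule poly_mapping_eqI)
  fix k
  obtain j m where k: "k = enc j m" by (rule enc_cases)
  have "fact t Ds (gwa_poly [:- of_int l, 1:]) (ev i l) = 0" by (simp add: ev_def fact_poly_single)
  then have "fact t Es (gwa_poly [:- of_int l, 1:]) (f (ev i l)) = 0"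
    using hom_fact[of "ev i l" "gwa_poly [:- of_int l, 1:]"] i by (simp add: hom_0)
  then have "lkp (fact t Es (gwa_poly [:- of_int l, 1:]) (f (ev i l))) k = 0" by simp
  then have w: "m = l \<or> lkp (f (ev i l)) k = 0" unfolding fact_poly_lookup by (auto simp: k)
  have "lkp (f (ev i l)) k = 0" if "\<not> j < length Es"
    using that closed[of "ev i l"] i Nc_D[of "f (ev i l)" Es k] by (auto simp: k in_keys_iff)
  then show "lkp (f (ev i l)) k = lkp (\<Sum>j<length Es. single (enc j l) (Fm l j i)) k"
    using w i by (cases "l = m") (auto simp: k lookup_sum lookup_single when_def Fm_def)
qed

end

lemma NM_hom_iso:
  assumes "t \<noteq> 0" "bds t Ds" "bds t Es" "f \<in> module_iso (GWA t) (NM t Ds) (NM t Es)"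
  shows "NM_hom t Ds Es f"
  using assms module_iso_D[OF assms(4)] by unfold_locales auto

text \<open>Fix a string \<open>S\<close> and one of its weights \<open>l\<close>. By
  \<open>string_sub\<close>, a product of opposite matrix entries in weight \<open>l\<close>
  vanishes unless the two strings coincide. So the diagonal entries at \<open>S\<close> of both
  identities, \<open>?g\<close> after \<open>f\<close> and \<open>f\<close> after \<open>?g\<close>,
  are sums over copies of \<open>S\<close> only. Adding them up in the two orders counts the copies
  on either side.\<close>

theorem krull_schmidt:
  assumes t: "t \<noteq> 0" and Ds: "bds t Ds" "\<forall>D\<in>set Ds. con D" and Es: "bds t Es" "\<forall>D\<in>set Es. con D"
    and iso: "module_iso (GWA t) (NM t Ds) (NM t Es) \<noteq> {}"
  shows "mset Ds = mset Es"
proof (rule multiset_eqI)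
  fix S
  obtain f where f: "f \<in> module_iso (GWA t) (NM t Ds) (NM t Es)" using iso by blast
  let ?g = "inv_into (Nc Ds) f"
  have g: "?g \<in> module_iso (GWA t) (NM t Es) (NM t Ds)"
    using module_iso_inv[OF left_module_NM[OF Ds(1)] f] by simp
  interpret F: NM_hom t Ds Es f by (rule NM_hom_iso[OF t Ds(1) Es(1) f])
  interpret G: NM_hom t Es Ds ?g by (rule NM_hom_iso[OF t Es(1) Ds(1) g])
  have bij: "bij_betw f (Nc Ds) (Nc Es)" using module_iso_D(1)[OF f] by simp
  have gf: "?g (f v) = v" if "v \<in> Nc Ds" for v using bij that by (simp add: bij_betw_inv_into_left)
  have fg: "f (?g v) = v" if "v \<in> Nc Es" for v using bij that by (simp add: bij_betw_inv_into_right)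
  show "count (mset Ds) S = count (mset Es) S"
  proof (cases "con S")
    case False
    then show ?thesis using Ds(2) Es(2) by (metis count_eq_zero_iff set_mset_mset)
  next
    case True
    then obtain l where l: "Vx l \<in> S" by (auto simp: con_def)
    define I where "I = {i. i < length Ds \<and> Ds ! i = S}"
    define J where "J = {j. j < length Es \<and> Es ! j = S}"
    have fin: "finite I" "finite J" by (auto simp: I_def J_def)
    have eq: "Ds ! i = Es ! j" if "F.Fm l j i * G.Fm l i j \<noteq> 0" "i < length Ds" "j < length Es" for i j
    proof -
      have c: "con (Ds ! i)" "con (Es ! j)" using that Ds(2) Es(2) by auto
      have "Ds ! i \<subseteq> Es ! j"
        by (rule string_sub[OF c(1), where F = "\<lambda>l. F.Fm l j i" and G = "\<lambda>l. G.Fm l i j" and m = l])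
          (use that F.Fm_nonzero G.Fm_nonzero F.Fm_edges G.Fm_edges in auto)
      moreover have "Es ! j \<subseteq> Ds ! i"
        by (rule string_sub[OF c(2), where G = "\<lambda>l. F.Fm l j i" and F = "\<lambda>l. G.Fm l i j" and m = l])
          (use that F.Fm_nonzero G.Fm_nonzero F.Fm_edges G.Fm_edges in auto)
      ultimately show ?thesis by blast
    qed
    have one: "(\<Sum>j\<in>J. F.Fm l j i * G.Fm l i j) = 1" if "i \<in> I" for i
    proof -
      have i: "i < length Ds" "Ds ! i = S" "Vx l \<in> Ds ! i" using that l by (auto simp: I_def)
      have z: "F.Fm l j i = 0 \<or> j < length Es \<and> Vx l \<in> Es ! j" for j using F.Fm_nonzero[of l j i] i by blast
      have "ev i l = ?g (f (ev i l))" using i gf by simp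
      also have "\<dots> = (\<Sum>j<length Es. ?g (single (enc j l) (F.Fm l j i)))"
        unfolding F.hom_ev[OF i(1,3)]
        by (rule G.hom_sum) (use z in \<open>metis (full_types) Nc_0 Nc_single enc_Nb single_zero\<close>)
      also have "\<dots> = (\<Sum>j<length Es. cst (F.Fm l j i) * ?g (ev j l))"
      proof (rule sum.cong[OF refl])
        fix j show "?g (single (enc j l) (F.Fm l j i)) = cst (F.Fm l j i) * ?g (ev j l)"
          using z[of j] G.hom_cst[of "ev j l" "F.Fm l j i"] Nc_single[of "enc j l" Es 1] by (auto simp: ev_def cst_mult_single G.hom_0)
      qed
      finally have "lkp (ev i l) (enc i l) = lkp (\<Sum>j<length Es. cst (F.Fm l j i) * ?g (ev j l)) (enc i l)" by simp
      then have "1 = (\<Sum>j<length Es. F.Fm l j i * lkp (?g (ev j l)) (enc i l))"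
        by (simp add: ev_def lookup_sum lookup_cst_mult)
      also have "\<dots> = (\<Sum>j<length Es. F.Fm l j i * G.Fm l i j)"
        by (rule sum.cong[OF refl]) (use z in \<open>force simp: G.Fm_def\<close>)
      also have "\<dots> = (\<Sum>j\<in>J. F.Fm l j i * G.Fm l i j)"
        by (rule sum.mono_neutral_right) (use eq[OF _ i(1)] i(2) in \<open>auto simp: J_def\<close>)
      finally show ?thesis by simp
    qed
    have one': "(\<Sum>i\<in>I. F.Fm l j i * G.Fm l i j) = 1" if "j \<in> J" for j
    proof -
      have j: "j < length Es" "Es ! j = S" "Vx l \<in> Es ! j" using that l by (auto simp: J_def)
      have z: "G.Fm l i j = 0 \<or> i < length Ds \<and> Vx l \<in> Ds ! i" for i using G.Fm_nonzero[of l i j] j by blast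
      have "ev j l = f (?g (ev j l))" using j fg by simp
      also have "\<dots> = (\<Sum>i<length Ds. f (single (enc i l) (G.Fm l i j)))"
        unfolding G.hom_ev[OF j(1,3)]
        by (rule F.hom_sum) (use z in \<open>metis (full_types) Nc_0 Nc_single enc_Nb single_zero\<close>)
      also have "\<dots> = (\<Sum>i<length Ds. cst (G.Fm l i j) * f (ev i l))"
      proof (rule sum.cong[OF refl])
        fix i show "f (single (enc i l) (G.Fm l i j)) = cst (G.Fm l i j) * f (ev i l)"
          using z[of i] F.hom_cst[of "ev i l" "G.Fm l i j"] Nc_single[of "enc i l" Ds 1] by (auto simp: ev_def cst_mult_single F.hom_0)
      qed
      finally have "lkp (ev j l) (enc j l) = lkp (\<Sum>i<length Ds. cst (G.Fm l i j) * f (ev i l)) (enc j l)" by simp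
      then have "1 = (\<Sum>i<length Ds. G.Fm l i j * lkp (f (ev i l)) (enc j l))"
        by (simp add: ev_def lookup_sum lookup_cst_mult)
      also have "\<dots> = (\<Sum>i<length Ds. F.Fm l j i * G.Fm l i j)"
        by (rule sum.cong[OF refl]) (use z in \<open>force simp: F.Fm_def\<close>)
      also have "\<dots> = (\<Sum>i\<in>I. F.Fm l j i * G.Fm l i j)"
        by (rule sum.mono_neutral_right) (use eq[OF _ _ j(1)] j(2) in \<open>auto simp: I_def\<close>)
      finally show ?thesis by simp
    qed
    have "of_nat (card I) = (\<Sum>i\<in>I. \<Sum>j\<in>J. F.Fm l j i * G.Fm l i j)" using one by simp
    also have "\<dots> = (\<Sum>j\<in>J. \<Sum>i\<in>I. F.Fm l j i * G.Fm l i j)" by (rule sum.swap)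
    also have "\<dots> = of_nat (card J)" using one' by simp
    finally have "card I = card J" by simp
    moreover have "count (mset xs) S = length (filter (\<lambda>x. x = S) xs)" for xs by (induction xs) auto
    then have "count (mset Ds) S = card I" "count (mset Es) S = card J"
      by (simp_all only: I_def J_def length_filter_conv_card)
    ultimately show ?thesis by simp
  qed
qed

subsection \<open>Relabelling basis vectors, direct sums\<close>

lemma NM_linear_comm:
  assumes Ds: "bds t Ds" and phi: "\<And>k l. k \<in> Nb Ds ==> lext \<phi> (lop t Ds l k) = lext (lop t Es l) (\<phi> k)"
    and v: "v \<in> Nc Ds"
  shows "lext \<phi> (fact t Ds q v) = fact t Es q (lext \<phi> v)"
proof -
  have *: "lext \<phi> (lext (lop t Ds l) w) = lext (lop t Es l) (lext \<phi> w)" if w: "w \<in> Nc Ds" for w l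
  proof -
    have "lext \<phi> (lext (lop t Ds l) w) = lext (\<lambda>k. lext \<phi> (lop t Ds l k)) w"
      by (rule lext_eqI) (auto simp: lext_add lext_cst lext_single)
    also have "\<dots> = lext (\<lambda>k. lext (lop t Es l) (\<phi> k)) w"
      by (rule lext_cong) (use w phi in \<open>auto simp: Nc_def\<close>)
    also have "\<dots> = lext (lop t Es l) (lext \<phi> w)"
      by (rule lext_eqI[symmetric]) (auto simp: lext_add lext_cst lext_single)
    finally show ?thesis .
  qed
  show ?thesis
  proof (induction q rule: gwa_free_induct)
    case (letter l p)
    then show ?case using *[OF fact_Nc[OF Ds v, of p]] by (simp add: fact_letter_mult)
  qed (simp_all add: fact_cst lext_cst fact_add lext_add)
qed

lemma lookup_relabel:
  assumes "inj_on p B" "keys v \<subseteq> B" "k \<in> B"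
  shows "lkp (lext (\<lambda>k. single (p k) 1) v) (p k) = lkp v (k :: nat)"
proof -
  have "lkp (lext (\<lambda>k. single (p k) 1) v) (p k)
      = (\<Sum>j\<in>keys v. lkp v j * (if p j = p k then 1 else 0))"
    by (simp add: lext_def lookup_sum lookup_cst_mult lookup_single when_def)
  also have "\<dots> = (\<Sum>j\<in>keys v. if j = k then lkp v j else 0)"
    using assms by (intro sum.cong) (auto simp: inj_on_def)
  also have "\<dots> = lkp v k" by (simp add: in_keys_iff)
  finally show ?thesis .
qed

text \<open>Basis vectors are renamed without rescaling: the scalars in \<open>lop\<close> depend
  only on the weight.\<close>

lemma NM_relabel:
  fixes p :: "nat => nat"
  assumes Ds: "bds t Ds" and Es: "bds t Es" and p: "bij_betw p (Nb Ds) (Nb Es)"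
    and w: "\<And>k. k \<in> Nb Ds ==> wt (p k) = wt k"
    and U: "\<And>k. k \<in> Nb Ds ==> Up (wt k) \<in> Ds ! ix k \<longleftrightarrow> Up (wt k) \<in> Es ! ix (p k)"
    and U': "\<And>k. k \<in> Nb Ds ==> Up (wt k) \<in> Ds ! ix k ==> p (enc (ix k) (wt k + 1)) = enc (ix (p k)) (wt k + 1)"
    and D: "\<And>k. k \<in> Nb Ds ==> Dn (wt k - 1) \<in> Ds ! ix k \<longleftrightarrow> Dn (wt k - 1) \<in> Es ! ix (p k)"
    and D': "\<And>k. k \<in> Nb Ds ==> Dn (wt k - 1) \<in> Ds ! ix k ==> p (enc (ix k) (wt k - 1)) = enc (ix (p k)) (wt k - 1)"
  shows "module_iso (GWA t) (NM t Ds) (NM t Es) \<noteq> {}"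
proof -
  let ?f = "lext (\<lambda>k. single (p k) (1::complex))"
  have comm: "?f (fact t Ds q v) = fact t Es q (?f v)" if "v \<in> Nc Ds" for q v
  proof (rule NM_linear_comm[OF Ds _ that])
    fix k l assume k: "k \<in> Nb Ds"
    show "?f (lop t Ds l k) = lext (lop t Es l) (single (p k) 1)"
      using w[OF k] U[OF k] U'[OF k] D[OF k] D'[OF k]
      by (cases l) (auto simp: lext_single ev_def lext_cst cst_mult_single simp del: single_of_int)
  qed
  have inj: "inj_on p (Nb Ds)" and im: "p ` Nb Ds = Nb Es" using p by (auto simp: bij_betw_def)
  have cl: "?f v \<in> Nc Es" if "v \<in> Nc Ds" for v
    by (rule lext_Nc) (use that im in \<open>auto simp: Nc_def intro!: Nc_single\<close>)
  have "bij_betw ?f (Nc Ds) (Nc Es)"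
    unfolding bij_betw_def
  proof
    show "inj_on ?f (Nc Ds)"
    proof (rule inj_onI, rule poly_mapping_eqI)
      fix v v' k assume v: "v \<in> Nc Ds" "v' \<in> Nc Ds" "?f v = ?f v'"
      show "lkp v k = lkp v' k"
      proof (cases "k \<in> Nb Ds")
        case True
        then show ?thesis using lookup_relabel[OF inj _ True, of v] lookup_relabel[OF inj _ True, of v'] v by (simp add: Nc_def)
      next
        case False
        then show ?thesis using v by (metis Nc_def in_keys_iff mem_Collect_eq subsetD)
      qed
    qed
    show "?f ` Nc Ds = Nc Es"
    proof
      show "?f ` Nc Ds \<subseteq> Nc Es" using cl by blast
      show "Nc Es \<subseteq> ?f ` Nc Ds"
      proof
        fix v assume v: "v \<in> Nc Es"
        let ?q = "inv_into (Nb Ds) p"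
        let ?v = "lext (\<lambda>k. single (?q k) 1) v"
        have q: "k \<in> Nb Es ==> ?q k \<in> Nb Ds \<and> p (?q k) = k" for k
          using im by (metis f_inv_into_f inv_into_into)
        have "?v \<in> Nc Ds" by (rule lext_Nc) (use v q in \<open>auto simp: Nc_def intro!: Nc_single\<close>)
        moreover have "?f ?v = lext (\<lambda>k. single k 1) v"
        proof (rule lext_eqI)
          fix k assume "k \<in> keys v"
          then show "?f (lext (\<lambda>k. single (?q k) 1) (single k 1)) = single k 1"
            using v q by (auto simp: lext_single Nc_def)
        qed (auto simp: lext_add lext_cst)
        moreover have "lext (\<lambda>k. single k 1) v = v"
          by (rule lext_eqI[of "\<lambda>x. x", symmetric]) auto
        ultimately show "v \<in> ?f ` Nc Ds" by (metis imageI)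
      qed
    qed
  qed
  then have "?f \<in> module_iso (GWA t) (NM t Ds) (NM t Es)"
    by (auto simp: module_iso_def lext_add carrier_GWA NM_smult Ds Es comm cl)
  then show ?thesis by blast
qed

lemma direct_sum_simps [simp]:
  "carrier (direct_sum M N) = carrier M \<times> carrier N"
  "ring.add (direct_sum M N) (x, y) (x', y') = (x \<oplus>\<^bsub>M\<^esub> x', y \<oplus>\<^bsub>N\<^esub> y')"
  "a \<odot>\<^bsub>direct_sum M N\<^esub> (x, y) = (a \<odot>\<^bsub>M\<^esub> x, a \<odot>\<^bsub>N\<^esub> y)"
  by (simp_all add: direct_sum_def)

lemma NM_append:
  assumes Ds: "bds t Ds" and Es: "bds t Es"
    and f: "f \<in> module_iso (GWA t) (NM t Ds) M" and g: "g \<in> module_iso (GWA t) (NM t Es) N"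
  shows "module_iso (GWA t) (NM t (Ds @ Es)) (direct_sum M N) \<noteq> {}"
proof -
  let ?n = "length Ds"
  define p1 where "p1 k = (if ix k < ?n then single k (1::complex) else 0)" for k
  define p2 where "p2 k = (if ix k < ?n then 0 else ev (ix k - ?n) (wt k))" for k
  have bd: "bds t (Ds @ Es)" using Ds Es by (auto simp: bds_def)
  have c1: "lext p1 (fact t (Ds @ Es) q v) = fact t Ds q (lext p1 v)" if "v \<in> Nc (Ds @ Es)" for q v
  proof (rule NM_linear_comm[OF bd _ that])
    fix k l show "lext p1 (lop t (Ds @ Es) l k) = lext (lop t Ds l) (p1 k)"
      by (cases l) (auto simp: p1_def lext_single ev_def cst_mult_single nth_append lext_cst simp del: single_of_int)
  qed
  have c2: "lext p2 (fact t (Ds @ Es) q v) = fact t Es q (lext p2 v)" if "v \<in> Nc (Ds @ Es)" for q v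
  proof (rule NM_linear_comm[OF bd _ that])
    fix k l show "lext p2 (lop t (Ds @ Es) l k) = lext (lop t Es l) (p2 k)"
      by (cases l) (auto simp: p2_def lext_single ev_def cst_mult_single nth_append lext_cst simp del: single_of_int)
  qed
  have n1: "lext p1 v \<in> Nc Ds" if "v \<in> Nc (Ds @ Es)" for v
    by (rule lext_Nc) (use that in \<open>auto simp: p1_def nth_append Nb_def dest!: Nc_D intro!: Nc_single\<close>)
  have n2: "lext p2 v \<in> Nc Es" if "v \<in> Nc (Ds @ Es)" for v
  proof (rule lext_Nc)
    fix k assume "k \<in> keys v"
    then have "ix k < length Ds + length Es \<and> Vx (wt k) \<in> (Ds @ Es) ! ix k" using Nc_D[OF that] by simp
    then show "p2 k \<in> Nc Es" by (auto simp: p2_def nth_append)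
  qed
  have l1: "lkp (lext p1 v) (enc i l) = (if i < ?n then lkp v (enc i l) else 0)" for v i l
  proof (induction v rule: poly_mapping_induct)
    case (single k c) then show ?case by (auto simp: lext_single p1_def cst_mult_single lookup_single when_def)
  qed (auto simp: lext_add lookup_add)
  have l2: "lkp (lext p2 v) (enc i l) = lkp v (enc (i + ?n) l)" for v i l
  proof (induction v rule: poly_mapping_induct)
    case (single k c)
    obtain j m where "k = enc j m" by (rule enc_cases)
    then show ?case by (auto simp: lext_single p2_def ev_def cst_mult_single lookup_single when_def)
  qed (auto simp: lext_add lookup_add)
  let ?h = "\<lambda>v. (f (lext p1 v), g (lext p2 v))"
  note F = module_iso_D[OF f] and G = module_iso_D[OF g]
  have "bij_betw (\<lambda>v. (lext p1 v, lext p2 v)) (Nc (Ds @ Es)) (Nc Ds \<times> Nc Es)"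
    unfolding bij_betw_def
  proof
    show "inj_on (\<lambda>v. (lext p1 v, lext p2 v)) (Nc (Ds @ Es))"
    proof (rule inj_onI, rule poly_mapping_eqI)
      fix v w k assume e: "(lext p1 v, lext p2 v) = (lext p1 w, lext p2 w)"
      obtain i l where k: "k = enc i l" by (rule enc_cases)
      show "lkp v k = lkp w k"
        using l1[of v i l] l1[of w i l] l2[of v "i - ?n" l] l2[of w "i - ?n" l] e
        by (cases "i < ?n") (simp_all add: k)
    qed
    show "(\<lambda>v. (lext p1 v, lext p2 v)) ` Nc (Ds @ Es) = Nc Ds \<times> Nc Es"
    proof (intro equalityI subsetI)
      fix x assume "x \<in> (\<lambda>v. (lext p1 v, lext p2 v)) ` Nc (Ds @ Es)"
      then show "x \<in> Nc Ds \<times> Nc Es" using n1 n2 by auto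
    next
      fix x assume "x \<in> Nc Ds \<times> Nc Es"
      then obtain a b where x: "x = (a, b)" "a \<in> Nc Ds" "b \<in> Nc Es" by auto
      let ?s = "\<lambda>k. ev (ix k + ?n) (wt k)"
      let ?v = "a + lext ?s b"
      have "a \<in> Nc (Ds @ Es)" using x(2) by (auto simp: Nc_def Nb_def nth_append)
      moreover have "lext ?s b \<in> Nc (Ds @ Es)"
        by (rule lext_Nc) (use x(3) in \<open>auto simp: nth_append dest!: Nc_D\<close>)
      ultimately have v: "?v \<in> Nc (Ds @ Es)" by (rule Nc_add)
      have "lext p1 ?v = a"
      proof -
        have "lext p1 (lext ?s b) = lext (\<lambda>k. 0) b"
          by (rule lext_eqI) (auto simp: lext_add lext_cst lext_single p1_def ev_def)
        moreover have "lext p1 a = lext (\<lambda>k. single k 1) a"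
          by (rule lext_cong) (use x(2) in \<open>auto simp: p1_def dest!: Nc_D\<close>)
        moreover have "lext (\<lambda>k. single k 1) a = a"
          by (rule lext_eqI[of "\<lambda>x. x", symmetric]) auto
        ultimately show ?thesis by (simp add: lext_add lext_def[of "\<lambda>k. 0"])
      qed
      moreover have "lext p2 ?v = b"
      proof -
        have "lext p2 (lext ?s b) = lext (\<lambda>k. single k 1) b"
          by (rule lext_eqI) (auto simp: lext_add lext_cst lext_single p2_def ev_def)
        moreover have "lext p2 a = lext (\<lambda>k. 0) a"
          by (rule lext_cong) (use x(2) in \<open>auto simp: p2_def dest!: Nc_D\<close>)
        moreover have "lext (\<lambda>k. single k 1) b = b"
          by (rule lext_eqI[of "\<lambda>x. x", symmetric]) auto
        ultimately show ?thesis by (simp add: lext_add lext_def[of "\<lambda>k. 0"])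
      qed
      ultimately show "x \<in> (\<lambda>v. (lext p1 v, lext p2 v)) ` Nc (Ds @ Es)" using v x(1) by (metis (no_types, lifting) image_eqI)
    qed
  qed
  moreover have "bij_betw (map_prod f g) (Nc Ds \<times> Nc Es) (carrier M \<times> carrier N)"
    using F(1) G(1) by (auto simp: bij_betw_def intro!: map_prod_inj_on map_prod_surj_on)
  ultimately have "bij_betw (map_prod f g \<circ> (\<lambda>v. (lext p1 v, lext p2 v))) (Nc (Ds @ Es)) (carrier M \<times> carrier N)"
    by (rule bij_betw_trans)
  then have "bij_betw ?h (Nc (Ds @ Es)) (carrier M \<times> carrier N)" by (simp add: comp_def)
  then have "?h \<in> module_iso (GWA t) (NM t (Ds @ Es)) (direct_sum M N)"
    using F(3) G(3) F(4) G(4) n1 n2 unfolding module_iso_def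
    by (auto simp: lext_add carrier_GWA NM_smult bd c1 c2) (auto simp: NM_smult[symmetric] Ds Es)
  then show ?thesis by blast
qed

subsection \<open>Connected components\<close>

text \<open>Counting the diagrams that contain \<open>s\<close> turns intersections into products
  for every \<open>s\<close>; additivity over components requires \<open>s\<close> to be connected,
  hence the cut-off.\<close>

definition ind :: "diag => diag => nat" where "ind s D = of_bool (con s \<and> s \<subseteq> D)"

definition linked :: "diag => int => int => bool" where
  "linked D l m \<longleftrightarrow> Vx l \<in> D \<and> Vx m \<in> D \<and> (\<forall>j. min l m \<le> j \<and> j < max l m --> Up j \<in> D \<or> Dn j \<in> D)"

text \<open>An edge is assigned to the component of its left end.\<close>

definition comp_at :: "diag => int => diag" where
  "comp_at D l = {c \<in> D. linked D l (case c of Vx m => m | Up m => m | Dn m => m)}"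

lemma linked_sym: "linked D l m \<longleftrightarrow> linked D m l"
  by (auto simp: linked_def min.commute max.commute)

lemma linked_trans: "linked D l m ==> linked D m n ==> linked D l n"
  unfolding linked_def
  apply (intro conjI allI impI)
    apply blast
   apply blast
  subgoal for j by (cases "min l m \<le> j \<and> j < max l m") (auto simp: min_def max_def split: if_splits)
  done

lemma linked_refl: "Vx l \<in> D ==> linked D l l" by (auto simp: linked_def)

lemma linked_Suc: "bdiag A D ==> Up m \<in> D \<or> Dn m \<in> D ==> linked D m (m + 1)"
proof -
  assume a: "bdiag A D" "Up m \<in> D \<or> Dn m \<in> D"
  have "j = m" if "min m (m + 1) \<le> j \<and> j < max m (m + 1)" for j using that by simp
  then show ?thesis using a unfolding linked_def bdiag_def by blast
qed

lemma comp_at_eq: "linked D l m ==> comp_at D l = comp_at D m"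
  using linked_trans linked_sym unfolding comp_at_def by blast

lemma comp_at_iff:
  "Vx m \<in> comp_at D l \<longleftrightarrow> linked D l m"
  "Up m \<in> comp_at D l \<longleftrightarrow> Up m \<in> D \<and> linked D l m" "Dn m \<in> comp_at D l \<longleftrightarrow> Dn m \<in> D \<and> linked D l m"
  by (auto simp: comp_at_def linked_def)

lemma con_comp_at: assumes D: "bdiag A D" and l: "Vx l \<in> D" shows "con (comp_at D l)"
  unfolding con_def comp_at_iff
proof (intro conjI allI impI)
  show "\<exists>m. linked D l m" using linked_refl[OF l] by blast
  show "linked D l m" if "Up m \<in> D \<and> linked D l m \<or> Dn m \<in> D \<and> linked D l m" for m using that by blast
  show "linked D l (m + 1)" if "Up m \<in> D \<and> linked D l m \<or> Dn m \<in> D \<and> linked D l m" for m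
    using that linked_trans linked_Suc[OF D, of m] by blast
next
  fix m j n assume a: "m \<le> j \<and> j < n \<and> linked D l m \<and> linked D l n"
  then have mn: "linked D m n" using linked_trans linked_sym by blast
  then have "linked D m j"
    using a D unfolding linked_def bdiag_def by auto
  then have "linked D l j" using a linked_trans by blast
  then show "Up j \<in> D \<and> linked D l j \<or> Dn j \<in> D \<and> linked D l j"
    using mn a unfolding linked_def by auto
qed

lemma bdiag_comp_at: assumes D: "bdiag A D" shows "bdiag A (comp_at D l)"
  unfolding bdiag_def comp_at_iff
proof (intro conjI allI impI ballI)
  fix m
  show "Up m \<in> D \<and> linked D l m \<or> Dn m \<in> D \<and> linked D l m ==> linked D l m" by blast
  show "Up m \<in> D \<and> linked D l m \<or> Dn m \<in> D \<and> linked D l m ==> linked D l (m + 1)"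
    using linked_trans linked_Suc[OF D, of m] by blast
  have *: "linked D m (m + 1)" if "m \<notin> A" "Vx m \<in> D \<or> Vx (m + 1) \<in> D"
    using that D linked_Suc[OF D, of m] unfolding bdiag_def by blast
  have v: "linked D l m ==> Vx m \<in> D" "linked D l (m + 1) ==> Vx (m + 1) \<in> D" by (auto simp: linked_def)
  show "m \<notin> A ==> linked D l m = linked D l (m + 1)" using * v linked_trans linked_sym by blast
  show "m \<notin> A ==> linked D l m ==> Up m \<in> D" "m \<notin> A ==> linked D l m ==> Dn m \<in> D"
    using D v unfolding bdiag_def by blast+
  show "m \<in> A ==> \<not> ((Up m \<in> D \<and> linked D l m) \<and> Dn m \<in> D \<and> linked D l m)"
    using D unfolding bdiag_def by blast
qed auto

text \<open>Away from \<open>A\<close> neighbouring vertices are linked, so the component of a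
  vertex depends only on the set of breaks to its left.\<close>

lemma finite_comps: assumes D: "bdiag A D" and A: "finite A" shows "finite (comp_at D ` {l. Vx l \<in> D})"
proof -
  have main: "linked D l m" if "l \<le> m" "Vx l \<in> D" "\<And>a. a \<in> A ==> \<not> (l \<le> a \<and> a < m)" for l m
    using that
  proof (induction m rule: int_ge_induct)
    case base then show ?case by (simp add: linked_refl)
  next
    case (step m)
    then have "linked D l m" by force
    moreover have "m \<notin> A" using step by force
    ultimately have "linked D m (m + 1)" using D linked_Suc[OF D, of m] unfolding bdiag_def linked_def by blast
    then show ?case using \<open>linked D l m\<close> linked_trans by blast
  qed
  have "comp_at D l = comp_at D m" if lm: "Vx l \<in> D" "Vx m \<in> D" "{a \<in> A. a < l} = {a \<in> A. a < m}" for l m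
  proof -
    have e: "a < l \<longleftrightarrow> a < m" if "a \<in> A" for a
      using that lm(3)[THEN eqset_imp_iff, of a] by simp
    show ?thesis
  proof (cases "l \<le> m")
    case True
    have "\<not> (l \<le> a \<and> a < m)" if "a \<in> A" for a using e[OF that] by auto
    then show ?thesis using main[OF True lm(1)] comp_at_eq by blast
  next
    case False
    have "\<not> (m \<le> a \<and> a < l)" if "a \<in> A" for a using e[OF that] by auto
    then have "linked D m l" using main[OF _ lm(2), of l] False by simp
    then show ?thesis using comp_at_eq by simp
  qed
  qed
  then have "\<forall>l m. Vx l \<in> D \<and> Vx m \<in> D \<and> {a \<in> A. a < l} = {a \<in> A. a < m} --> comp_at D l = comp_at D m" by blast
  from function_factors_left_gen[THEN iffD1, OF this]
  obtain h where "\<And>l. Vx l \<in> D ==> comp_at D l = h {a \<in> A. a < l}" by blast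
  then have "comp_at D ` {l. Vx l \<in> D} \<subseteq> h ` Pow A" by auto
  then show ?thesis using A by (meson finite_Pow_iff finite_surj)
qed

text \<open>Passing to components only renames basis vectors, as no arrow leaves a component. A
  connected \<open>s\<close> inside \<open>D\<close> lies in exactly one component, so the count is
  unchanged.\<close>

lemma comps_NM:
  assumes t: "t \<noteq> 0" and D: "bdiag (brk t) D"
  shows "\<exists>Cs. bds t Cs \<and> (\<forall>C\<in>set Cs. con C) \<and> module_iso (GWA t) (NM t [D]) (NM t Cs) \<noteq> {}
    \<and> (\<forall>s. ind s D = (\<Sum>C\<leftarrow>Cs. ind s C))"
proof -
  let ?K = "comp_at D ` {l. Vx l \<in> D}"
  have "finite ?K" by (rule finite_comps[OF D finite_brk[OF t]])
  then obtain Cs where Cs: "set Cs = ?K" "distinct Cs" using finite_distinct_list[of ?K] by auto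
  have bd: "bds t Cs" "\<forall>C\<in>set Cs. con C" using bdiag_comp_at[OF D] con_comp_at[OF D] by (auto simp: bds_def Cs)
  have "\<forall>l. \<exists>i. Vx l \<in> D --> i < length Cs \<and> Cs ! i = comp_at D l"
    using Cs(1) by (metis image_eqI in_set_conv_nth mem_Collect_eq)
  then obtain c where c: "\<And>l. Vx l \<in> D ==> c l < length Cs \<and> Cs ! c l = comp_at D l" by metis
  have cc: "c l = c m" if "linked D l m" for l m
  proof -
    have "Vx l \<in> D" "Vx m \<in> D" using that by (auto simp: linked_def)
    then show ?thesis using c[of l] c[of m] comp_at_eq[OF that] Cs(2) by (metis nth_eq_iff_index_eq)
  qed
  have "module_iso (GWA t) (NM t [D]) (NM t Cs) \<noteq> {}"
  proof (rule NM_relabel[where p = "\<lambda>k. enc (c (wt k)) (wt k)"])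
    show "bds t [D]" using D by (simp add: bds_def)
    show "bij_betw (\<lambda>k. enc (c (wt k)) (wt k)) (Nb [D]) (Nb Cs)"
      unfolding bij_betw_def
    proof (intro conjI equalityI subsetI)
      show "inj_on (\<lambda>k. enc (c (wt k)) (wt k)) (Nb [D])"
        by (rule inj_onI) (auto simp: Nb_def, metis enc_ix_wt)
      fix k assume "k \<in> (\<lambda>k. enc (c (wt k)) (wt k)) ` Nb [D]"
      then show "k \<in> Nb Cs" using c by (auto simp: Nb_def comp_at_iff linked_refl)
    next
      fix k assume k: "k \<in> Nb Cs"
      then have i: "ix k < length Cs" "Vx (wt k) \<in> Cs ! ix k" by (auto simp: Nb_def)
      then obtain l where l: "Vx l \<in> D" "Cs ! ix k = comp_at D l" using Cs(1) nth_mem by blast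
      then have ll: "linked D l (wt k)" using i by (simp add: comp_at_iff)
      then have w: "Vx (wt k) \<in> D" by (simp add: linked_def)
      have "Cs ! c (wt k) = Cs ! ix k" using c[OF w] comp_at_eq[OF ll] l by simp
      then have "c (wt k) = ix k" using nth_eq_iff_index_eq[OF Cs(2), of "c (wt k)" "ix k"] c[OF w] i by simp
      then show "k \<in> (\<lambda>k. enc (c (wt k)) (wt k)) ` Nb [D]"
        using w by (intro image_eqI[of _ _ "enc 0 (wt k)"]) auto
    qed
    fix k assume "k \<in> Nb [D]"
    then have k: "ix k = 0" "Vx (wt k) \<in> D" by (auto simp: Nb_def)
    show "wt (enc (c (wt k)) (wt k)) = wt k" by simp
    show "Up (wt k) \<in> [D] ! ix k \<longleftrightarrow> Up (wt k) \<in> Cs ! ix (enc (c (wt k)) (wt k))"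
      using k c[OF k(2)] linked_refl[OF k(2)] by (simp add: comp_at_iff)
    show "enc (c (wt (enc (ix k) (wt k + 1)))) (wt (enc (ix k) (wt k + 1))) = enc (ix (enc (c (wt k)) (wt k))) (wt k + 1)"
      if "Up (wt k) \<in> [D] ! ix k" using that k cc[OF linked_Suc[OF D, of "wt k"]] by simp
    have lk: "linked D (wt k - 1) (wt k)" if "Dn (wt k - 1) \<in> D" using linked_Suc[OF D, of "wt k - 1"] that by simp
    show "Dn (wt k - 1) \<in> [D] ! ix k \<longleftrightarrow> Dn (wt k - 1) \<in> Cs ! ix (enc (c (wt k)) (wt k))"
      using k c[OF k(2)] lk linked_sym by (auto simp: comp_at_iff)
    show "enc (c (wt (enc (ix k) (wt k - 1)))) (wt (enc (ix k) (wt k - 1))) = enc (ix (enc (c (wt k)) (wt k))) (wt k - 1)"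
      if "Dn (wt k - 1) \<in> [D] ! ix k" using that k cc[OF lk] by simp
  qed (use bd in auto)
  moreover have "ind s D = (\<Sum>C\<leftarrow>Cs. ind s C)" for s
  proof (cases "con s")
    case False then show ?thesis by (simp add: ind_def)
  next
    case True
    then obtain l where l: "Vx l \<in> s" by (auto simp: con_def)
    have "s \<subseteq> comp_at D l" if "s \<subseteq> D"
    proof
      have lk: "linked D l m" if m: "Vx m \<in> s" for m
        unfolding linked_def
      proof (intro conjI allI impI)
        fix j assume "min l m \<le> j \<and> j < max l m"
        then have "Up j \<in> s \<or> Dn j \<in> s" using True l m unfolding con_def
          by (cases "l \<le> m") (auto simp: min_def max_def)
        then show "Up j \<in> D \<or> Dn j \<in> D" using \<open>s \<subseteq> D\<close> by blast
      qed (use l m \<open>s \<subseteq> D\<close> in auto)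
      have cl: "Vx m \<in> s" if "Up m \<in> s \<or> Dn m \<in> s" for m using True that unfolding con_def by blast
      fix c assume c: "c \<in> s"
      then show "c \<in> comp_at D l"
        using lk cl \<open>s \<subseteq> D\<close> by (cases c) (auto simp: comp_at_iff)
    qed
    moreover have "comp_at D l \<subseteq> D" for l by (auto simp: comp_at_def)
    moreover have "C = comp_at D l" if "C \<in> ?K" "s \<subseteq> C" for C
    proof -
      obtain m where m: "C = comp_at D m" using \<open>C \<in> ?K\<close> by blast
      then have "linked D m l" using l that(2) comp_at_iff(1) by blast
      then show ?thesis using comp_at_eq m by blast
    qed
    ultimately have iff: "C \<in> ?K ==> s \<subseteq> C \<longleftrightarrow> C = comp_at D l \<and> s \<subseteq> D" for C by blast
    have "(\<Sum>C\<leftarrow>Cs. ind s C) = (\<Sum>C\<in>?K. ind s C)" using Cs by (simp add: sum_list_distinct_conv_sum_set)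
    also have "\<dots> = (\<Sum>C\<in>?K. if C = comp_at D l then of_bool (s \<subseteq> D) else 0)"
      using iff True by (intro sum.cong) (auto simp: ind_def)
    also have "\<dots> = ind s D" using \<open>finite ?K\<close> l True by (auto simp: ind_def sum.delta)
    finally show ?thesis by simp
  qed
  ultimately show ?thesis using bd by blast
qed

text \<open>Tensor products lead to lists of intersections, and two strings with opposite arrows at
  a common break have a disconnected intersection. Ranks must therefore be computable from such
  lists.\<close>

lemma string_refinement:
  assumes t: "t \<noteq> 0" and Ds: "bds t Ds"
  shows "\<exists>Cs. bds t Cs \<and> (\<forall>C\<in>set Cs. con C) \<and> module_iso (GWA t) (NM t Ds) (NM t Cs) \<noteq> {}
    \<and> (\<forall>s. (\<Sum>D\<leftarrow>Ds. ind s D) = (\<Sum>C\<leftarrow>Cs. ind s C))"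
  using Ds
proof (induction Ds)
  case Nil
  then show ?case using module_iso_id by (intro exI[of _ "[]"]) auto
next
  case (Cons D Ds)
  have D: "bdiag (brk t) D" and Ds: "bds t Ds" and D1: "bds t [D]" using Cons.prems by (auto simp: bds_def)
  obtain Cs where Cs: "bds t Cs" "\<forall>C\<in>set Cs. con C" "module_iso (GWA t) (NM t [D]) (NM t Cs) \<noteq> {}"
    "\<forall>s. ind s D = (\<Sum>C\<leftarrow>Cs. ind s C)" using comps_NM[OF t D] by blast
  obtain Cs' where Cs': "bds t Cs'" "\<forall>C\<in>set Cs'. con C" "module_iso (GWA t) (NM t Ds) (NM t Cs') \<noteq> {}"
    "\<forall>s. (\<Sum>D\<leftarrow>Ds. ind s D) = (\<Sum>C\<leftarrow>Cs'. ind s C)" using Cons.IH[OF Ds] by blast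
  obtain f g where fg: "f \<in> module_iso (GWA t) (NM t [D]) (NM t Cs)" "g \<in> module_iso (GWA t) (NM t Ds) (NM t Cs')"
    using Cs(3) Cs'(3) by blast
  obtain h where h: "h \<in> module_iso (GWA t) (NM t ([D] @ Ds)) (direct_sum (NM t Cs) (NM t Cs'))"
    using NM_append[OF D1 Ds fg] by blast
  obtain h' where h': "h' \<in> module_iso (GWA t) (NM t (Cs @ Cs')) (direct_sum (NM t Cs) (NM t Cs'))"
    using NM_append[OF Cs(1) Cs'(1) module_iso_id module_iso_id] by blast
  have bd: "bds t (Cs @ Cs')" using Cs(1) Cs'(1) by (auto simp: bds_def)
  have "module_iso (GWA t) (NM t ([D] @ Ds)) (NM t (Cs @ Cs')) \<noteq> {}"
    using module_iso_comp[OF h module_iso_inv[OF left_module_NM[OF bd] h']] by blast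
  then show ?case using bd Cs(2,4) Cs'(2,4) by (intro exI[of _ "Cs @ Cs'"]) auto
qed

subsection \<open>The rank of a weight module along a connected diagram\<close>

definition rk :: "complex poly => diag => 'v gwa_module => nat" where
  "rk t s M = (\<Sum>D\<leftarrow>(SOME Ds. bds t Ds \<and> (\<forall>D\<in>set Ds. con D) \<and> module_iso (GWA t) (NM t Ds) M \<noteq> {}). ind s D)"

text \<open>The list chosen in \<open>rk\<close> consists of strings and is unique up to order by
  \<open>krull_schmidt\<close>; a list of arbitrary diagrams is first refined to strings.\<close>

lemma rk_eq:
  assumes t: "t \<noteq> 0" and Ds: "bds t Ds" and iso: "module_iso (GWA t) (NM t Ds) M \<noteq> {}"
  shows "rk t s M = (\<Sum>D\<leftarrow>Ds. ind s D)"
proof -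
  obtain Cs where Cs: "bds t Cs" "\<forall>C\<in>set Cs. con C" "module_iso (GWA t) (NM t Ds) (NM t Cs) \<noteq> {}"
    "\<forall>s. (\<Sum>D\<leftarrow>Ds. ind s D) = (\<Sum>C\<leftarrow>Cs. ind s C)" using string_refinement[OF t Ds] by blast
  let ?P = "\<lambda>Ds. bds t Ds \<and> (\<forall>D\<in>set Ds. con D) \<and> module_iso (GWA t) (NM t Ds) M \<noteq> {}"
  obtain f g where fg: "f \<in> module_iso (GWA t) (NM t Ds) M" "g \<in> module_iso (GWA t) (NM t Ds) (NM t Cs)"
    using iso Cs(3) by blast
  have CM: "f \<circ> inv_into (carrier (NM t Ds)) g \<in> module_iso (GWA t) (NM t Cs) M"
    by (rule module_iso_comp[OF module_iso_inv[OF left_module_NM[OF Ds] fg(2)] fg(1)])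
  then have "?P Cs" using Cs by blast
  then have E: "?P (SOME Ds. ?P Ds)" by (rule someI)
  let ?E = "SOME Ds. ?P Ds"
  obtain h where h: "h \<in> module_iso (GWA t) (NM t ?E) M" using E by blast
  obtain h' where h': "h' \<in> module_iso (GWA t) M (NM t Cs)"
    using module_iso_inv[OF left_module_NM[OF Cs(1)] CM] by blast
  have "h' \<circ> h \<in> module_iso (GWA t) (NM t ?E) (NM t Cs)" by (rule module_iso_comp[OF h h'])
  then have "mset ?E = mset Cs" using E Cs(1,2) by (intro krull_schmidt[OF t]) auto
  moreover have "(\<Sum>D\<leftarrow>xs. ind s D) = sum_mset (image_mset (ind s) (mset xs))" for xs
    by (simp add: sum_mset_sum_list flip: mset_map)
  ultimately have "(\<Sum>D\<leftarrow>?E. ind s D) = (\<Sum>D\<leftarrow>Cs. ind s D)" by simp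
  then show ?thesis unfolding rk_def using Cs(4) by simp
qed

section \<open>Presented abelian groups and tensor products\<close>

text \<open>Abelian groups by generators and relations; both the tensor products and the split
  Grothendieck groups are instances.\<close>

locale presented_group =
  fixes S :: "'a set" and R :: "('a \<Rightarrow>\<^sub>0 int) set"
  assumes R: "R \<subseteq> carrier (free_Abelian_group S)"
begin

definition H where "H = generate (free_Abelian_group S) R"
definition Q where "Q = free_Abelian_group S Mod H"
definition cls where "cls p = H #>\<^bsub>free_Abelian_group S\<^esub> p"

sublocale F: comm_group "free_Abelian_group S" by (rule abelian_free_Abelian_group)

lemma subgroup_H: "subgroup H (free_Abelian_group S)"
  unfolding H_def by (rule F.generate_is_subgroup[OF R])

lemma normal_H: "H \<lhd> free_Abelian_group S" by (rule F.subgroup_imp_normal[OF subgroup_H])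

sublocale Q: comm_group Q unfolding Q_def by (rule F.abelian_FactGroup[OF subgroup_H])

lemma carrier_Q: "carrier Q = cls ` carrier (free_Abelian_group S)"
  by (auto simp: Q_def FactGroup_def RCOSETS_def cls_def)

lemma cls_closed: "keys p \<subseteq> S ==> cls p \<in> carrier Q" by (simp add: carrier_Q)

lemma cls_hom: "cls \<in> hom (free_Abelian_group S) Q"
  using normal.r_coset_hom_Mod[OF normal_H] by (simp add: Q_def cls_def[abs_def])

lemma cls_add: "keys p \<subseteq> S ==> keys q \<subseteq> S ==> cls (p + q) = cls p \<otimes>\<^bsub>Q\<^esub> cls q"
  using hom_mult[OF cls_hom, of p q] by simp

lemma cls_0: "cls 0 = \<one>\<^bsub>Q\<^esub>"
  using cls_add[of 0 0] cls_closed[of 0] by (simp add: Q.l_cancel_one')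

lemma cls_diff: "keys p \<subseteq> S ==> keys q \<subseteq> S ==> cls (p - q) = cls p \<otimes>\<^bsub>Q\<^esub> inv\<^bsub>Q\<^esub> cls q"
proof -
  assume p: "keys p \<subseteq> S" "keys q \<subseteq> S"
  have k: "keys (p - q) \<subseteq> S" using p keys_diff[of p q] by blast
  have "cls p = cls (p - q) \<otimes>\<^bsub>Q\<^esub> cls q" using cls_add[OF k p(2)] by simp
  then show ?thesis using cls_closed p k by (simp add: Q.m_assoc Q.r_inv)
qed

lemma cls_one: "r \<in> H ==> cls r = \<one>\<^bsub>Q\<^esub>"
proof -
  assume r: "r \<in> H"
  then have c: "r \<in> carrier (free_Abelian_group S)" using subgroup.mem_carrier[OF subgroup_H] by blast
  have "cls r = H" unfolding cls_def using F.coset_join2[OF c subgroup_H r] .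
  then show ?thesis by (simp add: Q_def FactGroup_def)
qed

lemma cls_rel: "r \<in> R ==> cls r = \<one>\<^bsub>Q\<^esub>"
  by (rule cls_one) (simp add: H_def generate.incl)

lemma cls_rel3:
  assumes "frag_of a - frag_of b - frag_of c \<in> R" "a \<in> S" "b \<in> S" "c \<in> S"
  shows "cls (frag_of a) = cls (frag_of b) \<otimes>\<^bsub>Q\<^esub> cls (frag_of c)"
proof -
  have k: "keys (frag_of b + frag_of c) \<subseteq> S" using assms Poly_Mapping.keys_add[of "frag_of b" "frag_of c"] by (auto simp: keys_frag_of)
  have "frag_of a - (frag_of b + frag_of c) \<in> R" using assms(1) by (simp add: algebra_simps)
  then have "cls (frag_of a - (frag_of b + frag_of c)) = \<one>\<^bsub>Q\<^esub>" by (rule cls_rel)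
  then have "cls (frag_of a) \<otimes>\<^bsub>Q\<^esub> inv\<^bsub>Q\<^esub> cls (frag_of b + frag_of c) = \<one>\<^bsub>Q\<^esub>"
    using assms k by (subst (asm) cls_diff) (auto simp: keys_frag_of)
  then have "cls (frag_of a) = cls (frag_of b + frag_of c)"
    using assms k cls_closed by (metis Q.inv_closed Q.inv_equality Q.inv_inv empty_subsetI insert_subset keys_frag_of)
  then show ?thesis using assms by (simp add: cls_add keys_frag_of)
qed

lemma cls_rel2:
  assumes "frag_of a - frag_of b \<in> R" "a \<in> S" "b \<in> S" shows "cls (frag_of a) = cls (frag_of b)"
proof -
  have "cls (frag_of a - frag_of b) = \<one>\<^bsub>Q\<^esub>" by (rule cls_rel[OF assms(1)])
  then have "cls (frag_of a) \<otimes>\<^bsub>Q\<^esub> inv\<^bsub>Q\<^esub> cls (frag_of b) = \<one>\<^bsub>Q\<^esub>"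
    using assms by (subst (asm) cls_diff) (auto simp: keys_frag_of)
  then show ?thesis
    using assms cls_closed by (metis Q.inv_closed Q.inv_equality Q.inv_inv empty_subsetI insert_subset keys_frag_of)
qed

lemma Q_induct [consumes 1, case_names one gen diff]:
  assumes "x \<in> carrier Q" "P \<one>\<^bsub>Q\<^esub>" "\<And>s. s \<in> S ==> P (cls (frag_of s))"
    "\<And>a b. a \<in> carrier Q ==> b \<in> carrier Q ==> P a ==> P b ==> P (a \<otimes>\<^bsub>Q\<^esub> inv\<^bsub>Q\<^esub> b)"
  shows "P x"
proof -
  obtain p where p: "x = cls p" "keys p \<subseteq> S" using assms(1) by (auto simp: carrier_Q)
  have "P (cls p)" using p(2)
    by (rule free_Abelian_group_induct) (use assms(2-4) in \<open>auto simp: cls_0 cls_diff cls_closed\<close>)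
  then show ?thesis by (simp add: p(1))
qed

lemma Q_hom_eq:
  assumes "group K" "h \<in> hom Q K" "h' \<in> hom Q K" "\<And>s. s \<in> S ==> h (cls (frag_of s)) = h' (cls (frag_of s))" "x \<in> carrier Q"
  shows "h x = h' x"
proof -
  interpret K: group K by fact
  interpret h: group_hom Q K h by unfold_locales (rule assms(2))
  interpret h': group_hom Q K h' by unfold_locales (rule assms(3))
  show ?thesis using assms(5) by (induction rule: Q_induct) (use assms(4) in auto)
qed

lemma universal:
  assumes "comm_group K" "\<And>s. s \<in> S ==> b s \<in> carrier K"
    and rel: "\<And>h r. h \<in> hom (free_Abelian_group S) K ==> (\<And>s. s \<in> S ==> h (frag_of s) = b s) ==> r \<in> R ==> h r = \<one>\<^bsub>K\<^esub>"
  shows "\<exists>h\<in>hom Q K. \<forall>s\<in>S. h (cls (frag_of s)) = b s"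
proof -
  interpret K: comm_group K by fact
  obtain h where h: "h \<in> hom (free_Abelian_group S) K" "\<And>s. s \<in> S ==> h (frag_of s) = b s"
    using K.free_Abelian_group_universal[of b S] assms(2) by blast
  interpret h: group_hom "free_Abelian_group S" K h by unfold_locales (rule h(1))
  have "H \<subseteq> kernel (free_Abelian_group S) K h"
    unfolding H_def
  proof (rule F.generate_subgroup_incl[OF _ h.subgroup_kernel])
    show "R \<subseteq> kernel (free_Abelian_group S) K h"
      using rel[OF h] R by (auto simp: kernel_def simp del: carrier_free_Abelian_group_iff)
  qed
  then have hH: "h r = \<one>\<^bsub>K\<^esub>" if "r \<in> H" for r using that by (auto simp: kernel_def)
  have "h x = h y" if "x \<in> carrier (free_Abelian_group S)" "y \<in> carrier (free_Abelian_group S)"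
      "H #>\<^bsub>free_Abelian_group S\<^esub> x = H #>\<^bsub>free_Abelian_group S\<^esub> y" for x y
  proof -
    have "x \<in> H #>\<^bsub>free_Abelian_group S\<^esub> y" using F.rcos_self[OF that(1) subgroup_H] that(3) by simp
    then obtain r where r: "r \<in> H" "x = r \<otimes>\<^bsub>free_Abelian_group S\<^esub> y" by (auto simp: r_coset_def)
    then have "h x = h r \<otimes>\<^bsub>K\<^esub> h y" using subgroup.mem_carrier[OF subgroup_H] that(2) h.hom_mult by metis
    then show ?thesis using hH[OF r(1)] that(2) h.hom_closed by simp
  qed
  then obtain g where "g \<in> hom Q K" "\<And>x. x \<in> carrier (free_Abelian_group S) ==> g (cls x) = h x"
    using FactGroup_universal[OF h(1) normal_H] unfolding Q_def cls_def by blast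
  then show ?thesis using h(2) by (intro bexI[of _ g]) auto
qed

end

lemma hom_free_rel3:
  assumes "group K" "h \<in> hom (free_Abelian_group S) K" "a \<in> S" "b \<in> S" "c \<in> S" "h (frag_of a) = h (frag_of b) \<otimes>\<^bsub>K\<^esub> h (frag_of c)"
  shows "h (frag_of a - frag_of b - frag_of c) = \<one>\<^bsub>K\<^esub>"
proof -
  interpret K: group K by fact
  interpret h: group_hom "free_Abelian_group S" K h by (simp add: group_hom_def group_hom_axioms_def assms)
  let ?d = "frag_of a - frag_of b - frag_of c"
  have k: "keys ?d \<subseteq> S" "keys (frag_of b + frag_of c) \<subseteq> S"
    using assms(3-5) keys_diff[of "frag_of a - frag_of b" "frag_of c"] keys_diff[of "frag_of a" "frag_of b"]
      Poly_Mapping.keys_add[of "frag_of b" "frag_of c"]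
    by (auto simp: keys_frag_of)
  have "h (?d + (frag_of b + frag_of c)) = h ?d \<otimes>\<^bsub>K\<^esub> h (frag_of b + frag_of c)"
    using h.hom_mult[of ?d "frag_of b + frag_of c"] k by simp
  moreover have "h (frag_of b + frag_of c) = h (frag_of a)"
    using h.hom_mult[of "frag_of b" "frag_of c"] assms by (simp add: keys_frag_of)
  moreover have "?d + (frag_of b + frag_of c) = frag_of a" by simp
  ultimately have "h (frag_of a) = h ?d \<otimes>\<^bsub>K\<^esub> h (frag_of a)" by simp
  then show ?thesis using h.hom_closed[of ?d] h.hom_closed[of "frag_of a"] k assms(3)
    by (simp add: K.r_cancel_one' keys_frag_of)
qed

lemma hom_free_rel2:
  assumes "group K" "h \<in> hom (free_Abelian_group S) K" "a \<in> S" "b \<in> S" "h (frag_of a) = h (frag_of b)"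
  shows "h (frag_of a - frag_of b) = \<one>\<^bsub>K\<^esub>"
proof -
  interpret K: group K by fact
  interpret h: group_hom "free_Abelian_group S" K h by (simp add: group_hom_def group_hom_axioms_def assms)
  let ?d = "frag_of a - frag_of b"
  have k: "keys ?d \<subseteq> S" using assms(3,4) keys_diff[of "frag_of a" "frag_of b"] by (auto simp: keys_frag_of)
  have "h (?d + frag_of b) = h ?d \<otimes>\<^bsub>K\<^esub> h (frag_of b)"
    using h.hom_mult[of ?d "frag_of b"] k assms by (simp add: keys_frag_of)
  then show ?thesis using h.hom_closed[of ?d] h.hom_closed[of "frag_of b"] k assms
    by (simp add: K.r_cancel_one' keys_frag_of)
qed

text \<open>Covers the tensor product of weight modules over \<open>\<complex>[z]\<close> as well as
  the scalar extension over the integers.\<close>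

locale tensor =
  fixes R :: "('r, 's) ring_scheme" and M :: "('r, 'v) module" and N :: "('r, 'w) module"
  assumes Ma: "\<And>x y. x \<in> carrier M ==> y \<in> carrier M ==> x \<oplus>\<^bsub>M\<^esub> y \<in> carrier M"
    and Na: "\<And>x y. x \<in> carrier N ==> y \<in> carrier N ==> x \<oplus>\<^bsub>N\<^esub> y \<in> carrier N"
    and Ms: "\<And>r x. r \<in> carrier R ==> x \<in> carrier M ==> r \<odot>\<^bsub>M\<^esub> x \<in> carrier M"
    and Ns: "\<And>r x. r \<in> carrier R ==> x \<in> carrier N ==> r \<odot>\<^bsub>N\<^esub> x \<in> carrier N"
begin

abbreviation G where "G \<equiv> tensor_group R M N"
abbreviation tens where "tens \<equiv> tensor_elem R M N"

sublocale P: presented_group "carrier M \<times> carrier N" "tensor_rels R M N"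
proof
  have d: "keys (a - b) \<subseteq> T" if "keys a \<subseteq> T" "keys b \<subseteq> T"
    for a b :: "'v \<times> 'w \<Rightarrow>\<^sub>0 int" and T using that keys_diff[of a b] by blast
  show "tensor_rels R M N \<subseteq> carrier (free_Abelian_group (carrier M \<times> carrier N))"
    unfolding tensor_rels_def
    by (auto simp del: carrier_free_Abelian_group_iff
       simp: carrier_free_Abelian_group_iff[abs_def] intro!: d[THEN subsetD, rotated 2] simp: keys_frag_of Ma Na Ms Ns
       dest!: subsetD[OF keys_diff])
qed

lemma G_eq: "G = P.Q" and tens_eq: "tens x y = P.cls (frag_of (x, y))"
  by (simp_all add: tensor_group_def tensor_free_def tensor_sub_def P.Q_def P.H_def P.cls_def tensor_elem_def)

lemma comm_group_G: "comm_group G" unfolding G_eq by (rule P.Q.comm_group_axioms)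

lemma tens_closed [simp]: "x \<in> carrier M ==> y \<in> carrier N ==> tens x y \<in> carrier G"
  unfolding G_eq tens_eq by (rule P.cls_closed) (simp add: keys_frag_of)

lemma tens_add_l: "x \<in> carrier M ==> x' \<in> carrier M ==> y \<in> carrier N ==> tens (x \<oplus>\<^bsub>M\<^esub> x') y = tens x y \<otimes>\<^bsub>G\<^esub> tens x' y"
  unfolding G_eq tens_eq by (rule P.cls_rel3) (auto simp: tensor_rels_def Ma)

lemma tens_add_r: "x \<in> carrier M ==> y \<in> carrier N ==> y' \<in> carrier N ==> tens x (y \<oplus>\<^bsub>N\<^esub> y') = tens x y \<otimes>\<^bsub>G\<^esub> tens x y'"
  unfolding G_eq tens_eq by (rule P.cls_rel3) (auto simp: tensor_rels_def Na)

lemma tens_balanced: "r \<in> carrier R ==> x \<in> carrier M ==> y \<in> carrier N ==> tens (r \<odot>\<^bsub>M\<^esub> x) y = tens x (r \<odot>\<^bsub>N\<^esub> y)"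
  unfolding tens_eq by (rule P.cls_rel2) (auto simp: tensor_rels_def Ms Ns)

lemma tensor_induct [consumes 1, case_names one tens diff]:
  assumes "x \<in> carrier G" "P \<one>\<^bsub>G\<^esub>" "\<And>x y. x \<in> carrier M ==> y \<in> carrier N ==> P (tens x y)"
    "\<And>a b. a \<in> carrier G ==> b \<in> carrier G ==> P a ==> P b ==> P (a \<otimes>\<^bsub>G\<^esub> inv\<^bsub>G\<^esub> b)"
  shows "P x"
  using assms(1) unfolding G_eq
  by (rule P.Q_induct) (use assms(2-4) in \<open>auto simp: G_eq tens_eq\<close>)

lemma tensor_hom_eq:
  assumes "group K" "h \<in> hom G K" "h' \<in> hom G K"
    "\<And>x y. x \<in> carrier M ==> y \<in> carrier N ==> h (tens x y) = h' (tens x y)" "a \<in> carrier G"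
  shows "h a = h' a"
  by (rule P.Q_hom_eq[OF assms(1) assms(2)[unfolded G_eq] assms(3)[unfolded G_eq] _ assms(5)[unfolded G_eq]])
     (use assms(4) in \<open>auto simp: tens_eq\<close>)

lemma tensor_universal:
  assumes K: "comm_group K" and c: "\<And>x y. x \<in> carrier M ==> y \<in> carrier N ==> b x y \<in> carrier K"
    and l: "\<And>x x' y. x \<in> carrier M ==> x' \<in> carrier M ==> y \<in> carrier N ==> b (x \<oplus>\<^bsub>M\<^esub> x') y = b x y \<otimes>\<^bsub>K\<^esub> b x' y"
    and r: "\<And>x y y'. x \<in> carrier M ==> y \<in> carrier N ==> y' \<in> carrier N ==> b x (y \<oplus>\<^bsub>N\<^esub> y') = b x y \<otimes>\<^bsub>K\<^esub> b x y'"
    and bal: "\<And>a x y. a \<in> carrier R ==> x \<in> carrier M ==> y \<in> carrier N ==> b (a \<odot>\<^bsub>M\<^esub> x) y = b x (a \<odot>\<^bsub>N\<^esub> y)"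
  shows "\<exists>h\<in>hom G K. \<forall>x\<in>carrier M. \<forall>y\<in>carrier N. h (tens x y) = b x y"
proof -
  have gK: "group K" using K by (rule comm_group.axioms)
  have "\<exists>h\<in>hom P.Q K. \<forall>s\<in>carrier M \<times> carrier N. h (P.cls (frag_of s)) = case_prod b s"
  proof (rule P.universal[OF K])
    fix h q assume h: "h \<in> hom (free_Abelian_group (carrier M \<times> carrier N)) K"
      and hs: "\<And>s. s \<in> carrier M \<times> carrier N ==> h (frag_of s) = case_prod b s" and q: "q \<in> tensor_rels R M N"
    consider (a) x x' y where "q = frag_of (x \<oplus>\<^bsub>M\<^esub> x', y) - frag_of (x, y) - frag_of (x', y)" "x \<in> carrier M" "x' \<in> carrier M" "y \<in> carrier N"
      | (b) x y y' where "q = frag_of (x, y \<oplus>\<^bsub>N\<^esub> y') - frag_of (x, y) - frag_of (x, y')" "x \<in> carrier M" "y \<in> carrier N" "y' \<in> carrier N"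
      | (c) r x y where "q = frag_of (r \<odot>\<^bsub>M\<^esub> x, y) - frag_of (x, r \<odot>\<^bsub>N\<^esub> y)" "r \<in> carrier R" "x \<in> carrier M" "y \<in> carrier N"
      using q unfolding tensor_rels_def by blast
    then show "h q = \<one>\<^bsub>K\<^esub>"
    proof cases
      case a show ?thesis unfolding a(1)
        by (rule hom_free_rel3[OF gK h]) (use a Ma hs l in auto)
    next
      case b show ?thesis unfolding b(1)
        by (rule hom_free_rel3[OF gK h]) (use b Na hs r in auto)
    next
      case c show ?thesis unfolding c(1)
        by (rule hom_free_rel2[OF gK h]) (use c Ms Ns hs bal in auto)
    qed
  qed (use c in auto)
  then show ?thesis unfolding G_eq tens_eq by fastforce
qed

end

lemma tensor_restrict_poly:
  assumes "left_module (GWA t) M" "left_module (GWA t') N"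
  shows "tensor Cz (restrict_poly t M) (restrict_poly t' N)"
proof -
  interpret M: gwa_mod t M using assms(1) by (rule gwa_modI)
  interpret N: gwa_mod t' N using assms(2) by (rule gwa_modI)
  show ?thesis by unfold_locales (auto simp: restrict_poly_def)
qed

lemma module_of_group_simps [simp]:
  "carrier (module_of_group G s) = carrier G" "ring.zero (module_of_group G s) = \<one>\<^bsub>G\<^esub>"
  "ring.add (module_of_group G s) = (\<otimes>\<^bsub>G\<^esub>)" "module.smult (module_of_group G s) = s"
  by (simp_all add: module_of_group_def)

lemma abelian_group_module_of_group: "comm_group G ==> abelian_group (module_of_group G s)"
proof -
  assume "comm_group G"
  then interpret comm_group G .
  show ?thesis
  proof (rule abelian_groupI)
    fix x assume "x \<in> carrier (module_of_group G s)"
    then show "\<exists>y\<in>carrier (module_of_group G s). y \<oplus>\<^bsub>module_of_group G s\<^esub> x = \<zero>\<^bsub>module_of_group G s\<^esub>"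
      by (intro bexI[of _ "inv\<^bsub>G\<^esub> x"]) auto
  qed (auto simp: m_ac)
qed

text \<open>Supplies a witness for the action that \<open>gwa_tensor\<close> leaves to a choice: the
  action of a diagram module is carried over to the tensor group.\<close>

lemma transport_module:
  assumes N: "left_module R N" and G: "comm_group G" and h: "bij_betw h (carrier G) (carrier N)"
    and add: "\<And>x y. x \<in> carrier G ==> y \<in> carrier G ==> h (x \<otimes>\<^bsub>G\<^esub> y) = h x \<oplus>\<^bsub>N\<^esub> h y"
    and s: "s = (\<lambda>a x. inv_into (carrier G) h (a \<odot>\<^bsub>N\<^esub> h x))"
  shows "left_module R (module_of_group G s)"
proof -
  interpret N: left_module R N by fact
  interpret G: comm_group G by fact
  let ?g = "inv_into (carrier G) h"
  have hc: "h x \<in> carrier N" if "x \<in> carrier G" for x using h that by (auto simp: bij_betw_def)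
  have gc: "?g y \<in> carrier G" if "y \<in> carrier N" for y using h that by (metis bij_betw_imp_surj_on inv_into_into)
  have hg: "h (?g y) = y" if "y \<in> carrier N" for y using h that by (simp add: bij_betw_inv_into_right)
  have gh: "?g (h x) = x" if "x \<in> carrier G" for x using h that by (simp add: bij_betw_inv_into_left)
  have ga: "?g (y \<oplus>\<^bsub>N\<^esub> z) = ?g y \<otimes>\<^bsub>G\<^esub> ?g z" if "y \<in> carrier N" "z \<in> carrier N" for y z
    using gh[of "?g y \<otimes>\<^bsub>G\<^esub> ?g z"] add[of "?g y" "?g z"] that gc hg by simp
  show ?thesis
    unfolding left_module_def left_module_axioms_def
    using N.R.ring_axioms abelian_group_module_of_group[OF G]
    by (auto simp: s gc hc N.smult_closed N.smult_l_distr N.smult_r_distr ga hg gh add N.smult_assoc1 N.smult_one)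
qed

subsection \<open>Tensor products of diagram modules\<close>

text \<open>Pairs are numbered in row-major order, as in \<open>bil\<close>.\<close>

definition prodlist :: "diag list => diag list => diag list" where
  "prodlist Ds Es = map (\<lambda>k. Ds ! (k div length Es) \<inter> Es ! (k mod length Es)) [0..<length Ds * length Es]"

lemma length_prodlist [simp]: "length (prodlist Ds Es) = length Ds * length Es" by (simp add: prodlist_def)

lemma prod_index: assumes "i < n" "j < m" shows "i * m + j < n * (m::nat)"
proof -
  have "i * m + j < i * m + m" using assms by simp
  also have "\<dots> = Suc i * m" by simp
  also have "\<dots> \<le> n * m" using assms by (intro mult_le_mono1) simp
  finally show ?thesis .
qed

lemma nth_prodlist:
  assumes "i < length Ds" "j < length Es" shows "prodlist Ds Es ! (i * length Es + j) = Ds ! i \<inter> Es ! j"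
proof -
  have "length Es \<noteq> 0" using assms by auto
  then show ?thesis using prod_index[OF assms] assms by (simp add: prodlist_def)
qed

lemma ind_Int: "ind s (D \<inter> E) = ind s D * ind s E" by (auto simp: ind_def)

lemma sum_list_prodlist: "(\<Sum>C\<leftarrow>prodlist Ds Es. ind s C) = (\<Sum>D\<leftarrow>Ds. ind s D) * (\<Sum>E\<leftarrow>Es. ind s E)"
proof -
  have *: "(\<Sum>k<n * m. a (k div m) * b (k mod m)) = (\<Sum>i<n. a i) * (\<Sum>j<m. b j)" for n m :: nat and a b :: "nat => nat"
  proof (induction n)
    case (Suc n)
    have "(\<Sum>k<Suc n * m. a (k div m) * b (k mod m))
        = (\<Sum>k<n * m. a (k div m) * b (k mod m)) + (\<Sum>k\<in>{n * m..<n * m + m}. a (k div m) * b (k mod m))"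
      by (subst sum.union_disjoint[symmetric]) (auto intro!: sum.cong simp: add.commute)
    also have "(\<Sum>k\<in>{n * m..<n * m + m}. a (k div m) * b (k mod m)) = (\<Sum>j<m. a n * b j)"
    proof -
      have "(\<Sum>k\<in>{n * m..<n * m + m}. a (k div m) * b (k mod m))
          = (\<Sum>j<m. a ((n * m + j) div m) * b ((n * m + j) mod m))"
        by (rule sum.reindex_bij_witness[of _ "\<lambda>j. n * m + j" "\<lambda>k. k - n * m"]) auto
      also have "\<dots> = (\<Sum>j<m. a n * b j)" by (rule sum.cong) auto
      finally show ?thesis .
    qed
    finally show ?case by (simp only: Suc.IH sum.lessThan_Suc distrib_right sum_distrib_left sum.distrib)
  qed simp
  show ?thesis
    using *[where n = "length Ds" and m = "length Es" and a = "\<lambda>i. ind s (Ds ! i)" and b = "\<lambda>j. ind s (Es ! j)"]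
    unfolding prodlist_def by (simp add: ind_Int sum_list_sum_nth atLeast0LessThan)
qed

lemma bdiag_Int: "bdiag A D ==> bdiag B E ==> bdiag (A \<union> B) (D \<inter> E)"
  unfolding bdiag_def by (intro conjI allI impI ballI) (blast+)

lemma brk_mult: "brk (t * t') = brk t \<union> brk t'" by (auto simp: brk_def)

lemma bds_prodlist: "bds t Ds ==> bds t' Es ==> bds (t * t') (prodlist Ds Es)"
proof -
  assume bd: "bds t Ds" "bds t' Es"
  show ?thesis
    unfolding bds_def brk_mult
  proof
    fix C assume "C \<in> set (prodlist Ds Es)"
    then obtain k where k: "k < length Ds * length Es" "C = Ds ! (k div length Es) \<inter> Es ! (k mod length Es)"
      by (auto simp: prodlist_def)
    then have "k div length Es < length Ds" "k mod length Es < length Es"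
      by (auto simp: less_mult_imp_div_less) (metis gr_zeroI mod_less_divisor mult_0_right not_less0)
    then show "bdiag (brk t \<union> brk t') C" unfolding k(2) using bd by (intro bdiag_Int bds_nth)
  qed
qed

text \<open>Over \<open>\<complex>[z]\<close> vectors of different weights have zero tensor product;
  two basis vectors of the same weight give the one at the position of the pair in
  \<open>prodlist\<close>. The number \<open>m\<close> stands for the length of the second
  list.\<close>

definition bil :: "nat => vec => vec => vec" where
  "bil m p q = lext (\<lambda>k. lext (\<lambda>k'. if wt k = wt k' then ev (ix k * m + ix k') (wt k) else 0) q) p"

lemma gwa_closed [simp]: "gwa_of_poly t r \<in> carrier (GWA t)" "gwa_X t l \<in> carrier (GWA t)"
  by (simp_all add: gwa_of_poly_gq gwa_X_gq)

lemma bil_add_l: "bil m (p + p') q = bil m p q + bil m p' q"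
  and bil_add_r: "bil m p (q + q') = bil m p q + bil m p q'"
  and bil_cst_l: "bil m (cst c * p) q = cst c * bil m p q"
  and bil_cst_r: "bil m p (cst c * q) = cst c * bil m p q"
  by (simp_all add: bil_def lext_add lext_add_fun lext_cst lext_cst_fun)

lemma bil_0 [simp]: "bil m 0 q = 0" "bil m p 0 = 0" by (simp_all add: bil_def) (simp add: lext_def)

lemma bil_single:
  "bil m (single (enc i l) a) (single (enc j l') b)
    = (if l = l' then single (enc (i * m + j) l) (a * b) else 0)"
  by (simp add: bil_def lext_single ev_def cst_mult_single)

lemma additive_eq_single:
  fixes f g :: "vec => 'b::monoid_add"
  assumes "\<And>p q. p \<in> Nc Ds ==> q \<in> Nc Ds ==> f (p + q) = f p + f q"
    "\<And>p q. p \<in> Nc Ds ==> q \<in> Nc Ds ==> g (p + q) = g p + g q"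
    "\<And>k c. k \<in> Nb Ds ==> f (single k c) = g (single k c)" "f 0 = 0" "g 0 = 0" "p \<in> Nc Ds"
  shows "f p = g p"
proof -
  have "f (\<Sum>k\<in>A. single k (lkp p k)) = g (\<Sum>k\<in>A. single k (lkp p k))"
    if "finite A" "A \<subseteq> Nb Ds" for A
    using that
  proof (induction A rule: finite_induct)
    case (insert x A)
    have "(\<Sum>k\<in>A. single k (lkp p k)) \<in> Nc Ds" using insert by (intro Nc_sum Nc_single) auto
    then show ?case using insert assms(1-3) by (simp add: Nc_single)
  qed (simp add: assms)
  then show ?thesis using assms(6) by (subst (1 2) poly_mapping_sum_single) (simp add: Nc_def)
qed

lemma additive_eq_single_group:
  assumes G: "comm_group G" and f: "\<And>p. p \<in> Nc Ds ==> f p \<in> carrier G" and g: "\<And>p. p \<in> Nc Ds ==> g p \<in> carrier G"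
    and fa: "\<And>p q. p \<in> Nc Ds ==> q \<in> Nc Ds ==> f (p + q) = f p \<otimes>\<^bsub>G\<^esub> f q"
    and ga: "\<And>p q. p \<in> Nc Ds ==> q \<in> Nc Ds ==> g (p + q) = g p \<otimes>\<^bsub>G\<^esub> g q"
    and e: "\<And>k c. k \<in> Nb Ds ==> f (single k c) = g (single k c)" and p: "p \<in> Nc Ds"
  shows "f p = g p"
proof -
  interpret G: comm_group G by fact
  have f0: "f 0 = \<one>\<^bsub>G\<^esub>" and g0: "g 0 = \<one>\<^bsub>G\<^esub>"
    using fa[of 0 0] ga[of 0 0] f[of 0] g[of 0] by (simp_all add: G.l_cancel_one')
  have "f (\<Sum>k\<in>A. single k (lkp p k)) = g (\<Sum>k\<in>A. single k (lkp p k))"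
    if "finite A" "A \<subseteq> Nb Ds" for A
    using that
  proof (induction A rule: finite_induct)
    case (insert x A)
    have "(\<Sum>k\<in>A. single k (lkp p k)) \<in> Nc Ds" using insert by (intro Nc_sum Nc_single) auto
    then show ?case using insert fa ga e by (simp add: Nc_single)
  qed (simp add: f0 g0)
  then show ?thesis using p by (subst (1 2) poly_mapping_sum_single) (simp add: Nc_def)
qed

text \<open>The target is an abelian group without scalars, so the values on
  \<open>single k c\<close> are prescribed for every \<open>c\<close>, additively in
  \<open>c\<close>, and extended by finite products.\<close>

lemma exists_additive:
  assumes G: "comm_group G" and ph: "\<And>k c. k \<in> B ==> ph k c \<in> carrier G"
    and pa: "\<And>k a b. k \<in> B ==> ph k (a + b) = ph k a \<otimes>\<^bsub>G\<^esub> ph k b"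
  shows "\<exists>g. (\<forall>p. keys p \<subseteq> B --> g p \<in> carrier G)
    \<and> (\<forall>p q. keys p \<subseteq> B --> keys q \<subseteq> B --> g (p + q) = g p \<otimes>\<^bsub>G\<^esub> g q)
    \<and> (\<forall>k\<in>B. \<forall>c :: complex. g (single k c) = ph k c)"
proof -
  interpret G: comm_group G by fact
  define g where "g p = finprod G (\<lambda>k. ph k (lkp p k)) (keys p)" for p
  have p0: "ph k 0 = \<one>\<^bsub>G\<^esub>" if "k \<in> B" for k using pa[OF that, of 0 0] ph[OF that, of 0] by (simp add: G.l_cancel_one')
  have sup: "g p = finprod G (\<lambda>k. ph k (lkp p k)) A" if "finite A" "keys p \<subseteq> A" "A \<subseteq> B" for p A
    unfolding g_def by (rule G.finprod_mono_neutral_cong_left) (use that ph p0 in \<open>auto simp: in_keys_iff\<close>)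
  have "g p \<in> carrier G" if "keys p \<subseteq> B" for p
    unfolding g_def by (rule G.finprod_closed) (use that ph in auto)
  moreover have "g (p + q) = g p \<otimes>\<^bsub>G\<^esub> g q" if pq: "keys p \<subseteq> B" "keys q \<subseteq> B" for p q
  proof -
    let ?A = "keys p \<union> keys q"
    have "g (p + q) = finprod G (\<lambda>k. ph k (lkp (p + q) k)) ?A"
      by (rule sup) (use pq Poly_Mapping.keys_add[of p q] in auto)
    also have "\<dots> = finprod G (\<lambda>k. ph k (lkp p k) \<otimes>\<^bsub>G\<^esub> ph k (lkp q k)) ?A"
      by (rule G.finprod_cong') (use pq ph pa in \<open>auto simp: lookup_add\<close>)
    also have "\<dots> = finprod G (\<lambda>k. ph k (lkp p k)) ?A \<otimes>\<^bsub>G\<^esub> finprod G (\<lambda>k. ph k (lkp q k)) ?A"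
      by (rule G.finprod_multf) (use pq ph in auto)
    also have "finprod G (\<lambda>k. ph k (lkp p k)) ?A = g p" by (rule sup[symmetric]) (use pq in auto)
    also have "finprod G (\<lambda>k. ph k (lkp q k)) ?A = g q" by (rule sup[symmetric]) (use pq in auto)
    finally show ?thesis .
  qed
  moreover have "g (single k c) = ph k c" if "k \<in> B" for k c
    by (subst sup[of "{k}"]) (use that ph in auto)
  ultimately show ?thesis by blast
qed

locale NM_tensor =
  fixes t t' and M :: "'v gwa_module" and M' :: "'w gwa_module" and Ds Es f f'
  assumes t: "t \<noteq> 0" "t' \<noteq> 0" and Ds: "bds t Ds" and Es: "bds t' Es"
    and M: "left_module (GWA t) M" and M': "left_module (GWA t') M'"
    and f: "f \<in> module_iso (GWA t) (NM t Ds) M" and f': "f' \<in> module_iso (GWA t') (NM t' Es) M'"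
begin

abbreviation "m \<equiv> length Es"
abbreviation "Ps \<equiv> prodlist Ds Es"
abbreviation "N \<equiv> NM (t * t') Ps"

lemma bdP: "bds (t * t') Ps" by (rule bds_prodlist[OF Ds Es])

sublocale M: gwa_mod t M by (rule gwa_modI[OF M])
sublocale M': gwa_mod t' M' by (rule gwa_modI[OF M'])
sublocale T: tensor Cz "restrict_poly t M" "restrict_poly t' M'" by (rule tensor_restrict_poly[OF M M'])

lemmas F = module_iso_D[OF f, simplified] and F' = module_iso_D[OF f', simplified]

lemma restrict_poly_simps [simp]:
  "carrier (restrict_poly t M) = carrier M" "ring.add (restrict_poly t M) = ring.add M"
  "r \<odot>\<^bsub>restrict_poly t M\<^esub> v = M.ps r v"
  "carrier (restrict_poly t' M') = carrier M'" "ring.add (restrict_poly t' M') = ring.add M'"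
  "r \<odot>\<^bsub>restrict_poly t' M'\<^esub> w = M'.ps r w"
  by (simp_all add: restrict_poly_def)

definition g where "g = inv_into (Nc Ds) f"
definition g' where "g' = inv_into (Nc Es) f'"

lemma g_iso: "g \<in> module_iso (GWA t) M (NM t Ds)" and g'_iso: "g' \<in> module_iso (GWA t') M' (NM t' Es)"
  using module_iso_inv[OF left_module_NM[OF Ds] f] module_iso_inv[OF left_module_NM[OF Es] f'] by (simp_all add: g_def g'_def)

lemmas Gd = module_iso_D[OF g_iso, simplified] and Gd' = module_iso_D[OF g'_iso, simplified]

lemma fg [simp]: "v \<in> carrier M ==> f (g v) = v" and gf [simp]: "p \<in> Nc Ds ==> g (f p) = p"
  and fg' [simp]: "w \<in> carrier M' ==> f' (g' w) = w" and gf' [simp]: "q \<in> Nc Es ==> g' (f' q) = q"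
  using F(1) F'(1) by (simp_all add: g_def g'_def bij_betw_inv_into_right bij_betw_inv_into_left)

lemma bil_Nc: assumes "p \<in> Nc Ds" "q \<in> Nc Es" shows "bil m p q \<in> Nc Ps"
  unfolding bil_def
proof (intro lext_Nc)
  fix k k' assume k: "k \<in> keys p" "k' \<in> keys q"
  then have "ix k < length Ds \<and> Vx (wt k) \<in> Ds ! ix k" "ix k' < m \<and> Vx (wt k') \<in> Es ! ix k'"
    using assms Nc_D by blast+
  then show "(if wt k = wt k' then ev (ix k * m + ix k') (wt k) else 0) \<in> Nc Ps"
    by (auto simp: nth_prodlist prod_index)
qed

lemma bil_ops:
  assumes p: "p \<in> Nc Ds" and q: "q \<in> Nc Es"
  shows "l \<in> {LPlus, LMinus} ==> lext (lop (t * t') Ps l) (bil m p q) = bil m (lext (lop t Ds l) p) (lext (lop t' Es l) q)"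
    and "fact (t * t') Ps (gwa_poly r) (bil m p q) = bil m (fact t Ds (gwa_poly r) p) q"
    and "bil m (fact t Ds (gwa_poly r) p) q = bil m p (fact t' Es (gwa_poly r) q)"
proof -
  have red: "L p q = L' p q"
    if "\<And>p p' q. L (p + p') q = L p q + L p' q" "\<And>p q q'. L p (q + q') = L p q + L p q'"
      "\<And>p p' q. L' (p + p') q = L' p q + L' p' q" "\<And>p q q'. L' p (q + q') = L' p q + L' p q'"
      "\<And>i l a j l' b. i < length Ds ==> Vx l \<in> Ds ! i ==> j < m ==> Vx l' \<in> Es ! j ==>
        L (single (enc i l) a) (single (enc j l') b) = L' (single (enc i l) a) (single (enc j l') b)"
    for L L' :: "vec => vec => vec"
  proof (rule additive_eq_single[OF _ _ _ _ _ p])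
    have z: "L 0 q = 0" "L' 0 q = 0" "L p 0 = 0" "L' p 0 = 0" for p q
      using that(1)[of 0 0 q] that(3)[of 0 0 q] that(2)[of p 0 0] that(4)[of p 0 0] by simp_all
    show "L 0 q = 0" "L' 0 q = 0" using z by blast+
    fix k c assume k: "k \<in> Nb Ds"
    show "L (single k c) q = L' (single k c) q"
    proof (rule additive_eq_single[OF _ _ _ _ _ q])
      fix k' c' assume k': "k' \<in> Nb Es"
      show "L (single k c) (single k' c') = L' (single k c) (single k' c')"
        using that(5)[of "ix k" "wt k" "ix k'" "wt k'" c c'] k k' by (simp add: Nb_def)
    qed (simp_all add: z that)
  qed (simp_all add: that)
  show "fact (t * t') Ps (gwa_poly r) (bil m p q) = bil m (fact t Ds (gwa_poly r) p) q"
    by (rule red[of "\<lambda>p q. fact (t * t') Ps (gwa_poly r) (bil m p q)"])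
       (simp_all add: bil_add_l bil_add_r fact_add_r bil_single fact_poly_single mult_ac)
  show "bil m (fact t Ds (gwa_poly r) p) q = bil m p (fact t' Es (gwa_poly r) q)"
    by (rule red[of "\<lambda>p q. bil m (fact t Ds (gwa_poly r) p) q"])
       (simp_all add: bil_add_l bil_add_r fact_add_r bil_single fact_poly_single mult_ac)
  assume l: "l \<in> {LPlus, LMinus}"
  show "lext (lop (t * t') Ps l) (bil m p q) = bil m (lext (lop t Ds l) p) (lext (lop t' Es l) q)"
  proof (rule red[of "\<lambda>p q. lext (lop (t * t') Ps l) (bil m p q)"])
    fix i n a j n' b assume ij: "i < length Ds" "j < m"
    \<comment> \<open>The multiplicativity of \<open>hat\<close> enters here; it makes the scalars
      of the two factors combine to the scalar of the intersection.\<close>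
    have h: "hatl (t * t') (n - 1) = hatl t (n - 1) * hatl t' (n - 1)" for n by (rule hat_mult[OF t])
    show "lext (lop (t * t') Ps l) (bil m (single (enc i n) a) (single (enc j n') b))
      = bil m (lext (lop t Ds l) (single (enc i n) a)) (lext (lop t' Es l) (single (enc j n') b))"
      using l ij h[of n]
      by (cases "n = n'") (auto simp: bil_single lext_single nth_prodlist ev_def mult_single mult_ac)
  qed (simp_all add: bil_add_l bil_add_r lext_add)
qed

lemma g_ps: "v \<in> carrier M ==> g (M.ps r v) = fact t Ds (gwa_poly r) (g v)"
  and g_X: "v \<in> carrier M ==> g (M.X l v) = lext (lop t Ds l) (g v)"
  and g'_ps: "w \<in> carrier M' ==> g' (M'.ps r w) = fact t' Es (gwa_poly r) (g' w)"
  and g'_X: "w \<in> carrier M' ==> g' (M'.X l w) = lext (lop t' Es l) (g' w)"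
  using Gd(4)[of "gwa_of_poly t r" v] Gd(4)[of "gwa_X t l" v] Gd'(4)[of "gwa_of_poly t' r" w] Gd'(4)[of "gwa_X t' l" w]
  by (simp_all add: NM_ps NM_X Ds Es Gd(2,3) Gd'(2,3))

text \<open>The universal property gives \<open>h\<close>; its inverse \<open>ga\<close> is
  prescribed on basis vectors by pure tensors. That they are mutually inverse comes down to pure
  tensors of basis vectors, where different weights must give the neutral element.\<close>

lemma exists_iso: "\<exists>h. bij_betw h (carrier T.G) (Nc Ps) \<and> (\<forall>x\<in>carrier T.G. \<forall>y\<in>carrier T.G. h (x \<otimes>\<^bsub>T.G\<^esub> y) = h x + h y)
    \<and> (\<forall>v\<in>carrier M. \<forall>w\<in>carrier M'. h (T.tens v w) = bil m (g v) (g' w))"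
proof -
  interpret N: abelian_group N by (rule abelian_group_NM)
  interpret G: comm_group T.G by (rule T.comm_group_G)
  have "\<exists>h\<in>hom T.G (add_monoid N). \<forall>v\<in>carrier (restrict_poly t M). \<forall>w\<in>carrier (restrict_poly t' M'). h (T.tens v w) = bil m (g v) (g' w)"
    by (rule T.tensor_universal[OF N.a_comm_group])
       (auto simp: bil_Nc Gd(2,3) Gd'(2,3) bil_add_l bil_add_r g_ps g'_ps bil_ops(3))
  then obtain h where h: "h \<in> hom T.G (add_monoid N)" and ht: "\<And>v w. v \<in> carrier M ==> w \<in> carrier M' ==> h (T.tens v w) = bil m (g v) (g' w)"
    by auto
  have hc: "x \<in> carrier T.G ==> h x \<in> Nc Ps" for x using hom_in_carrier[OF h] by simp
  have ha: "h (x \<otimes>\<^bsub>T.G\<^esub> y) = h x + h y" if "x \<in> carrier T.G" "y \<in> carrier T.G" for x y using hom_mult[OF h that] by simp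
  define ph where "ph k c = T.tens (f (single (enc (ix k div m) (wt k)) c)) (f' (ev (ix k mod m) (wt k)))" for k c
  have Pk: "ix k div m < length Ds" "ix k mod m < m" "Vx (wt k) \<in> Ds ! (ix k div m)" "Vx (wt k) \<in> Es ! (ix k mod m)" if "k \<in> Nb Ps" for k
  proof -
    have k: "ix k < length Ds * m" "Vx (wt k) \<in> Ps ! ix k" using that by (auto simp: Nb_def)
    then show 1: "ix k div m < length Ds" "ix k mod m < m"
      by (auto simp: less_mult_imp_div_less) (metis gr_zeroI mod_less_divisor mult_0_right not_less0)
    show "Vx (wt k) \<in> Ds ! (ix k div m)" "Vx (wt k) \<in> Es ! (ix k mod m)"
      using k nth_prodlist[OF 1] by (auto simp: prodlist_def)
  qed
  have fs: "f (single (enc i l) c) \<in> carrier M" if "i < length Ds" "Vx l \<in> Ds ! i" for i l c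
    using that F(2) by (simp add: Nc_single)
  have fs': "f' (single (enc i l) c) \<in> carrier M'" if "i < m" "Vx l \<in> Es ! i" for i l c
    using that F'(2) by (simp add: Nc_single)
  have phc: "ph k c \<in> carrier T.G" if "k \<in> Nb Ps" for k c
    unfolding ph_def ev_def by (rule T.tens_closed) (use Pk[OF that] fs fs' in auto)
  have pha: "ph k (a + b) = ph k a \<otimes>\<^bsub>T.G\<^esub> ph k b" if "k \<in> Nb Ps" for k a b
  proof -
    have "f (single (enc (ix k div m) (wt k)) (a + b)) = f (single (enc (ix k div m) (wt k)) a) \<oplus>\<^bsub>M\<^esub> f (single (enc (ix k div m) (wt k)) b)"
      using F(3)[of "single (enc (ix k div m) (wt k)) a" "single (enc (ix k div m) (wt k)) b"] Pk[OF that]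
      by (simp add: Nc_single single_add)
    then show ?thesis unfolding ph_def ev_def using T.tens_add_l[OF _ _ _] Pk[OF that] fs fs' by simp
  qed
  have "\<exists>g. (\<forall>p. keys p \<subseteq> Nb Ps --> g p \<in> carrier T.G)
    \<and> (\<forall>p q. keys p \<subseteq> Nb Ps --> keys q \<subseteq> Nb Ps --> g (p + q) = g p \<otimes>\<^bsub>T.G\<^esub> g q)
    \<and> (\<forall>k\<in>Nb Ps. \<forall>c :: complex. g (single k c) = ph k c)"
    by (rule exists_additive[OF T.comm_group_G]) (use phc pha in auto)
  then obtain ga where "\<forall>p. keys p \<subseteq> Nb Ps --> ga p \<in> carrier T.G"
    "\<forall>p q. keys p \<subseteq> Nb Ps --> keys q \<subseteq> Nb Ps --> ga (p + q) = ga p \<otimes>\<^bsub>T.G\<^esub> ga q"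
    "\<forall>k\<in>Nb Ps. \<forall>c. ga (single k c) = ph k c" by (elim exE conjE)
  then have ga: "p \<in> Nc Ps ==> ga p \<in> carrier T.G" "p \<in> Nc Ps ==> q \<in> Nc Ps ==> ga (p + q) = ga p \<otimes>\<^bsub>T.G\<^esub> ga q"
    "k \<in> Nb Ps ==> ga (single k c) = ph k c" for p q k c by (simp_all add: Nc_def)
  have ga0: "ga 0 = \<one>\<^bsub>T.G\<^esub>" using ga(1)[of 0] ga(2)[of 0 0] by (simp add: G.l_cancel_one')
  have tens0: "T.tens \<zero>\<^bsub>M\<^esub> w = \<one>\<^bsub>T.G\<^esub>" if "w \<in> carrier M'" for w
    using T.tens_add_l[of "\<zero>\<^bsub>M\<^esub>" "\<zero>\<^bsub>M\<^esub>" w] T.tens_closed[of "\<zero>\<^bsub>M\<^esub>" w] that by (simp add: G.l_cancel_one')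
  have scal: "f (single k (c * a)) = M.sc c (f (single k a))" if "k \<in> Nb Ds" for k a c
    using F(4)[of "gwa_of_poly t [:c:]" "single k a"] Nc_single[OF that, of a]
    by (simp add: NM_sc Ds cst_mult_single)
  have scal': "f' (single k (c * a)) = M'.sc c (f' (single k a))" if "k \<in> Nb Es" for k a c
    using F'(4)[of "gwa_of_poly t' [:c:]" "single k a"] Nc_single[OF that, of a]
    by (simp add: NM_sc Es cst_mult_single)
  have key: "ga (bil m (single (enc i l) a) (single (enc j l') b))
      = T.tens (f (single (enc i l) a)) (f' (single (enc j l') b))"
    if i: "i < length Ds" "Vx l \<in> Ds ! i" and j: "j < m" "Vx l' \<in> Es ! j" for i l a j l' b
  proof (cases "l = l'")
    case True
    have m: "m \<noteq> 0" using j by auto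
    have P: "enc (i * m + j) l \<in> Nb Ps" using i j True by (simp add: prod_index nth_prodlist)
    have "T.tens (f (single (enc i l) a)) (f' (single (enc j l) (b * 1)))
        = T.tens (f (single (enc i l) (b * a))) (f' (single (enc j l) 1))"
      using scal[of "enc i l" b a] scal'[of "enc j l" b 1]
        T.tens_balanced[of "[:b:]" "f (single (enc i l) a)" "f' (single (enc j l) 1)"] fs fs' i j True
      by simp
    then show ?thesis using True m j(1) unfolding bil_single by (simp add: ga(3)[OF P[unfolded True]] ph_def ev_def mult.commute)
  next
    case False
    \<comment> \<open>For different weights the first factor is written as \<open>z - l'\<close>
      applied to \<open>v\<close>; moved across the tensor sign, \<open>z - l'\<close> kills the
      second factor.\<close>
    define v where "v = f (single (enc i l) (a / (of_int l - of_int l')))"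
    define w where "w = f' (single (enc j l') b)"
    have v: "v \<in> carrier M" and w: "w \<in> carrier M'" unfolding v_def w_def using fs[OF i] fs'[OF j] by blast+
    have n: "complex_of_int l - of_int l' \<noteq> 0" using False by simp
    let ?r = "[:- of_int l', 1:] :: complex poly"
    have "M.ps ?r v = f (fact t Ds (gwa_poly ?r) (single (enc i l) (a / (of_int l - of_int l'))))"
      using F(4)[of "gwa_of_poly t ?r" "single (enc i l) (a / (of_int l - of_int l'))"] i
      by (simp add: NM_ps Ds Nc_single v_def)
    also have "fact t Ds (gwa_poly ?r) (single (enc i l) (a / (of_int l - of_int l'))) = single (enc i l) a"
    proof -
      have "(of_int l - of_int l') * (a / (of_int l - of_int l')) = a" using n by (metis nonzero_mult_div_cancel_left times_divide_eq_right)
      then show ?thesis by (simp add: fact_poly_single)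
    qed
    finally have v': "M.ps ?r v = f (single (enc i l) a)" .
    have "M'.ps ?r w = f' (fact t' Es (gwa_poly ?r) (single (enc j l') b))"
      using F'(4)[of "gwa_of_poly t' ?r" "single (enc j l') b"] j
      by (simp add: NM_ps Es Nc_single w_def)
    also have "\<dots> = \<zero>\<^bsub>M'\<^esub>"
      using module_iso_zero[OF left_module_NM[OF Es] M' f'] by (simp add: fact_poly_single)
    finally have w': "M'.ps ?r w = \<zero>\<^bsub>M'\<^esub>" .
    have "T.tens (f (single (enc i l) a)) w = T.tens v \<zero>\<^bsub>M'\<^esub>"
      using T.tens_balanced[of ?r v w] v w unfolding v'[symmetric] w'[symmetric] by simp
    also have "\<dots> = T.tens (M.ps 0 v) w" using T.tens_balanced[of 0 v w] v w by simp
    also have "\<dots> = \<one>\<^bsub>T.G\<^esub>" using v w by (simp add: tens0)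
    finally show ?thesis using False unfolding bil_single by (simp add: ga0 w_def)
  qed
  have gabil: "ga (bil m p q) = T.tens (f p) (f' q)" if p: "p \<in> Nc Ds" and q: "q \<in> Nc Es" for p q
  proof (rule additive_eq_single_group[OF T.comm_group_G _ _ _ _ _ p, where f = "\<lambda>p. ga (bil m p q)"])
    fix k c assume k: "k \<in> Nb Ds"
    show "ga (bil m (single k c) q) = T.tens (f (single k c)) (f' q)"
    proof (rule additive_eq_single_group[OF T.comm_group_G _ _ _ _ _ q, where f = "\<lambda>q. ga (bil m (single k c) q)"])
      fix k' c' assume k': "k' \<in> Nb Es"
      show "ga (bil m (single k c) (single k' c')) = T.tens (f (single k c)) (f' (single k' c'))"
        using key[of "ix k" "wt k" "ix k'" "wt k'" c c'] k k' by (simp add: Nb_def)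
    qed (use k in \<open>auto simp: ga bil_Nc Nc_single bil_add_r F F' T.tens_add_r[simplified]\<close>)
  qed (use q in \<open>auto simp: ga bil_Nc bil_add_l F F' T.tens_add_l[simplified]\<close>)
  have gah: "ga (h x) = x" if "x \<in> carrier T.G" for x
  proof (rule T.tensor_hom_eq[OF G.is_group _ _ _ that, of "\<lambda>x. ga (h x)" "\<lambda>x. x"])
    show "(\<lambda>x. ga (h x)) \<in> hom T.G T.G" by (rule homI) (auto simp: ga hc ha)
    show "(\<lambda>x. x) \<in> hom T.G T.G" by (rule homI) auto
  qed (auto simp: ht gabil Gd(2,3) Gd'(2,3))
  have hga: "h (ga p) = p" if p: "p \<in> Nc Ps" for p
  proof (rule additive_eq_single[OF _ _ _ _ _ p, where f = "\<lambda>p. h (ga p)"])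
    show "h (ga 0) = 0" using ha[of "\<one>\<^bsub>T.G\<^esub>" "\<one>\<^bsub>T.G\<^esub>"] by (simp add: ga0)
    fix k c assume k: "k \<in> Nb Ps"
    have "h (ga (single k c)) = bil m (single (enc (ix k div m) (wt k)) c) (single (enc (ix k mod m) (wt k)) 1)"
      using Pk[OF k] fs fs' by (simp add: ga(3)[OF k] ph_def ht ev_def Nc_single)
    then show "h (ga (single k c)) = single k c" by (simp add: bil_single)
  qed (auto simp: ga ha)
  have "bij_betw h (carrier T.G) (Nc Ps)"
    by (rule bij_betw_byWitness[where f' = ga]) (use gah hga hc ga(1) in auto)
  then show ?thesis using ha ht by blast
qed

text \<open>An action as required exists by transport along \<open>h\<close>. Conversely,
  \<open>h\<close> is linear for any such action, because linearity can be checked for the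
  generators of \<open>A(t * t')\<close> and on pure tensors. So the choice made in
  \<open>gwa_tensor\<close> does not matter.\<close>

theorem gwa_tensor_iso: "module_iso (GWA (t * t')) N (gwa_tensor t t' M M') \<noteq> {}"
proof -
  obtain h where h: "bij_betw h (carrier T.G) (Nc Ps)"
    and ha: "\<And>x y. x \<in> carrier T.G ==> y \<in> carrier T.G ==> h (x \<otimes>\<^bsub>T.G\<^esub> y) = h x + h y"
    and ht: "\<And>v w. v \<in> carrier M ==> w \<in> carrier M' ==> h (T.tens v w) = bil m (g v) (g' w)"
    using exists_iso by blast
  interpret N: abelian_group N by (rule abelian_group_NM)
  have hc: "x \<in> carrier T.G ==> h x \<in> Nc Ps" for x using h by (auto simp: bij_betw_def)
  let ?ok = "\<lambda>s. left_module (GWA (t * t')) (module_of_group T.G s) \<and>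
          (\<forall>v\<in>carrier M. \<forall>v'\<in>carrier M'.
             (\<forall>r. s (gwa_of_poly (t * t') r) (T.tens v v') = T.tens (gwa_of_poly t r \<odot>\<^bsub>M\<^esub> v) v')
             \<and> (\<forall>l\<in>{LPlus, LMinus}. s (gwa_X (t * t') l) (T.tens v v')
                    = T.tens (gwa_X t l \<odot>\<^bsub>M\<^esub> v) (gwa_X t' l \<odot>\<^bsub>M'\<^esub> v')))"
  let ?s = "\<lambda>a x. inv_into (carrier T.G) h (a \<odot>\<^bsub>N\<^esub> h x)"
  have "?ok ?s"
  proof (intro conjI ballI allI)
    show "left_module (GWA (t * t')) (module_of_group T.G ?s)"
      by (rule transport_module[OF left_module_NM[OF bdP] T.comm_group_G]) (use h ha in auto)
    fix v w assume v: "v \<in> carrier M" and w: "w \<in> carrier M'"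
    have b: "bil m (g v) (g' w) \<in> Nc Ps" using v w by (simp add: bil_Nc Gd(2,3) Gd'(2,3))
    have inv: "inv_into (carrier T.G) h (h x) = x" if "x \<in> carrier T.G" for x
      using h that by (simp add: bij_betw_inv_into_left)
    show "?s (gwa_of_poly (t * t') r) (T.tens v w) = T.tens (M.ps r v) w" for r
    proof -
      have "gwa_of_poly (t * t') r \<odot>\<^bsub>N\<^esub> h (T.tens v w) = h (T.tens (M.ps r v) w)"
        using v w b by (simp add: ht NM_ps bdP bil_ops Gd(2,3) Gd'(2,3) g_ps)
      then show ?thesis using inv[of "T.tens (M.ps r v) w"] v w by simp
    qed
    show "?s (gwa_X (t * t') l) (T.tens v w) = T.tens (M.X l v) (M'.X l w)" if "l \<in> {LPlus, LMinus}" for l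
    proof -
      have "gwa_X (t * t') l \<odot>\<^bsub>N\<^esub> h (T.tens v w) = h (T.tens (M.X l v) (M'.X l w))"
        using v w b that by (simp add: ht NM_X bdP bil_ops(1) Gd(2,3) Gd'(2,3) g_X g'_X)
      then show ?thesis using inv[of "T.tens (M.X l v) (M'.X l w)"] v w by simp
    qed
  qed
  then have ok: "?ok (SOME s. ?ok s)" by (rule someI[of ?ok])
  define s where "s = (SOME s. ?ok s)"
  have s: "left_module (GWA (t * t')) (module_of_group T.G s)"
    "\<And>v w r. v \<in> carrier M ==> w \<in> carrier M' ==> s (gwa_of_poly (t * t') r) (T.tens v w) = T.tens (M.ps r v) w"
    "\<And>v w l. v \<in> carrier M ==> w \<in> carrier M' ==> l \<in> {LPlus, LMinus} ==> s (gwa_X (t * t') l) (T.tens v w) = T.tens (M.X l v) (M'.X l w)"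
  proof -
    have o: "?ok s" using ok unfolding s_def .
    note o2 = o[THEN conjunct2, THEN bspec, THEN bspec]
    show "left_module (GWA (t * t')) (module_of_group T.G s)" by (rule o[THEN conjunct1])
    show "s (gwa_of_poly (t * t') r) (T.tens v w) = T.tens (M.ps r v) w" if "v \<in> carrier M" "w \<in> carrier M'" for v w r
      by (rule o2[OF that, THEN conjunct1, THEN spec])
    show "s (gwa_X (t * t') l) (T.tens v w) = T.tens (M.X l v) (M'.X l w)"
      if "v \<in> carrier M" "w \<in> carrier M'" "l \<in> {LPlus, LMinus}" for v w l
      by (rule o2[OF that(1,2), THEN conjunct2, THEN bspec, OF that(3)])
  qed
  have T: "gwa_tensor t t' M M' = module_of_group T.G s" by (simp add: gwa_tensor_def Let_def s_def)
  interpret L: left_module "GWA (t * t')" "module_of_group T.G s" by (rule s(1))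
  interpret LN: left_module "GWA (t * t')" N by (rule left_module_NM[OF bdP])
  have gen: "h (s a x) = a \<odot>\<^bsub>N\<^esub> h x"
    if a: "a \<in> carrier (GWA (t * t'))" and x: "x \<in> carrier T.G"
      and e: "\<And>v w. v \<in> carrier M ==> w \<in> carrier M' ==> h (s a (T.tens v w)) = a \<odot>\<^bsub>N\<^esub> h (T.tens v w)" for a x
  proof (rule T.tensor_hom_eq[OF N.a_group _ _ _ x, of "\<lambda>x. h (s a x)" "\<lambda>x. a \<odot>\<^bsub>N\<^esub> h x"])
    show "(\<lambda>x. h (s a x)) \<in> hom T.G (add_monoid N)"
      by (rule homI) (use a L.smult_closed[OF a] L.smult_r_distr[OF a] in \<open>auto simp: hc ha\<close>)
    show "(\<lambda>x. a \<odot>\<^bsub>N\<^esub> h x) \<in> hom T.G (add_monoid N)"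
      by (rule homI) (use a LN.smult_closed[OF a] LN.smult_r_distr[OF a] in \<open>auto simp: hc ha\<close>)
  qed (use e in auto)
  have ps: "h (s (gwa_of_poly (t * t') r) x) = gwa_of_poly (t * t') r \<odot>\<^bsub>N\<^esub> h x" if "x \<in> carrier T.G" for r x
    by (rule gen[OF _ that]) (simp_all add: s(2) ht NM_ps bdP bil_Nc Gd(2,3) Gd'(2,3) g_ps bil_ops)
  have X: "h (s (gwa_X (t * t') l) x) = gwa_X (t * t') l \<odot>\<^bsub>N\<^esub> h x" if "x \<in> carrier T.G" "l \<in> {LPlus, LMinus}" for l x
    by (rule gen[OF _ that(1)])
       (use that(2) in \<open>simp_all add: s(3) ht NM_X bdP bil_Nc Gd(2,3) Gd'(2,3) g_X g'_X bil_ops(1)\<close>)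
  have "h (a \<odot>\<^bsub>module_of_group T.G s\<^esub> x) = a \<odot>\<^bsub>N\<^esub> h x" if "a \<in> carrier (GWA (t * t'))" "x \<in> carrier T.G" for a x
    by (rule gwa_hom_smult[OF s(1) left_module_NM[OF bdP] _ _ _ _ _ that(1)]) (use ps X hc ha that(2) in auto)
  then have "h \<in> module_iso (GWA (t * t')) (module_of_group T.G s) N"
    using h ha by (simp add: module_iso_def)
  from module_iso_inv[OF s(1) this] show ?thesis unfolding T by blast
qed

end

lemma rk_tensor:
  assumes t: "t \<noteq> 0" "t' \<noteq> 0" and M: "in_wmod_O t M" and M': "in_wmod_O t' M'"
  shows "rk (t * t') s (gwa_tensor t t' M M') = rk t s M * rk t' s M'"
    and "\<exists>Cs. bds (t * t') Cs \<and> module_iso (GWA (t * t')) (NM (t * t') Cs) (gwa_tensor t t' M M') \<noteq> {}"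
proof -
  obtain Ds f where DD: "bds t Ds" "f \<in> module_iso (GWA t) (NM t Ds) M" using wmod_decomposition[OF M t(1)] by blast
  obtain Es f' where EE: "bds t' Es" "f' \<in> module_iso (GWA t') (NM t' Es) M'" using wmod_decomposition[OF M' t(2)] by blast
  interpret NM_tensor t t' M M' Ds Es f f'
    by (rule NM_tensor.intro) (use t DD EE M M' in \<open>simp_all add: in_wmod_O_def weight_module_def\<close>)
  have "rk (t * t') s (gwa_tensor t t' M M') = (\<Sum>C\<leftarrow>prodlist Ds Es. ind s C)"
    by (rule rk_eq[OF _ bdP gwa_tensor_iso]) (use t in simp)
  also have "\<dots> = rk t s M * rk t' s M'"
  proof -
    have "module_iso (GWA t) (NM t Ds) M \<noteq> {}" "module_iso (GWA t') (NM t' Es) M' \<noteq> {}" using DD(2) EE(2) by blast+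
    then show ?thesis using rk_eq[OF t(1) DD(1), of M s] rk_eq[OF t(2) EE(1), of M' s] by (simp add: sum_list_prodlist)
  qed
  finally show "rk (t * t') s (gwa_tensor t t' M M') = rk t s M * rk t' s M'" .
  show "\<exists>Cs. bds (t * t') Cs \<and> module_iso (GWA (t * t')) (NM (t * t') Cs) (gwa_tensor t t' M M') \<noteq> {}"
    using bdP gwa_tensor_iso by blast
qed

section \<open>The split Grothendieck groups\<close>

definition CG :: "complex monoid" where "CG = add_monoid UNIV_ring"

lemma CG_simps [simp]: "carrier CG = UNIV" "\<one>\<^bsub>CG\<^esub> = 0" "x \<otimes>\<^bsub>CG\<^esub> y = x + y"
  by (simp_all add: CG_def)

lemma comm_group_CG: "comm_group CG"
  unfolding CG_def by (rule abelian_group.a_comm_group[OF ring.is_abelian_group[OF ring_UNIV_ring]])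

lemma group_CG: "group CG" using comm_group_CG by (rule comm_group.axioms)

lemma hom_CG_mult: "(\<lambda>x. x * c) \<in> hom CG CG" "(*) c \<in> hom CG CG"
  by (auto intro!: homI simp: algebra_simps)

text \<open>Direct sums and tensor products live on other types than \<open>vec\<close>, so
  membership in \<open>wmod_O\<close> is replaced by isomorphism to a diagram module.\<close>

definition is_wmod :: "complex poly => 'v gwa_module => bool" where
  "is_wmod t M \<longleftrightarrow> (\<exists>Ds. bds t Ds \<and> module_iso (GWA t) (NM t Ds) M \<noteq> {})"

lemma is_wmod_wmod_O: "t \<noteq> 0 ==> M \<in> wmod_O t ==> is_wmod t M"
  using wmod_decomposition[of t M] by (auto simp: is_wmod_def wmod_O_def)

lemma is_wmod_NM: "bds t Ds ==> is_wmod t (NM t Ds)"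
  unfolding is_wmod_def using module_iso_id by blast

lemma iso_class_NM: "bds t Ds ==> module_iso (GWA t) (NM t Ds) M \<noteq> {} ==> iso_class t M = iso_class t (NM t Ds)"
  using iso_class_eq[OF left_module_NM] by blast

lemma iso_class_closed: "is_wmod t M ==> iso_class t M \<in> iso_class t ` wmod_O t"
  unfolding is_wmod_def using iso_class_NM NM_wmod by (metis imageI)

lemma rk_cong:
  assumes t: "t \<noteq> 0" and M: "is_wmod t M" and MN: "iso_class t M = iso_class t N" and N: "N \<in> wmod_O t"
  shows "rk t s M = rk t s N"
proof -
  obtain Ds where Ds: "bds t Ds" "module_iso (GWA t) (NM t Ds) M \<noteq> {}" using M by (auto simp: is_wmod_def)
  have "iso_class t (NM t Ds) = iso_class t N" using iso_class_NM[OF Ds] MN by simp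
  then have "module_iso (GWA t) (NM t Ds) N \<noteq> {}" using iso_class_eq_iff[OF NM_wmod[OF Ds(1)] N] by simp
  then show ?thesis using rk_eq[OF t Ds(1)] Ds(2) by metis
qed

lemma direct_sum_wmod:
  assumes t: "t \<noteq> 0" and M: "M \<in> wmod_O t" "M' \<in> wmod_O t"
  shows "is_wmod t (direct_sum M M')" and "rk t s (direct_sum M M') = rk t s M + rk t s M'"
proof -
  obtain Ds f where Ds: "bds t Ds" "f \<in> module_iso (GWA t) (NM t Ds) M" using is_wmod_wmod_O[OF t M(1)] by (auto simp: is_wmod_def)
  obtain Es f' where Es: "bds t Es" "f' \<in> module_iso (GWA t) (NM t Es) M'" using is_wmod_wmod_O[OF t M(2)] by (auto simp: is_wmod_def)
  have bd: "bds t (Ds @ Es)" using Ds Es by (auto simp: bds_def)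
  have iso: "module_iso (GWA t) (NM t (Ds @ Es)) (direct_sum M M') \<noteq> {}" by (rule NM_append[OF Ds(1) Es(1) Ds(2) Es(2)])
  then show "is_wmod t (direct_sum M M')" using bd by (auto simp: is_wmod_def)
  have "module_iso (GWA t) (NM t Ds) M \<noteq> {}" "module_iso (GWA t) (NM t Es) M' \<noteq> {}" using Ds Es by blast+
  then show "rk t s (direct_sum M M') = rk t s M + rk t s M'"
    using rk_eq[OF t bd iso] rk_eq[OF t Ds(1), of M s] rk_eq[OF t Es(1), of M' s] by simp
qed

section \<open>Ranks and spanning classes for a single \<open>A(t)\<close>\<close>

locale K0_group =
  fixes t :: "complex poly" assumes t: "t \<noteq> 0"
begin

abbreviation "K0_rels \<equiv> {frag_of (iso_class t (direct_sum M M')) - frag_of (iso_class t M) - frag_of (iso_class t M')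
        | M M'. M \<in> wmod_O t \<and> M' \<in> wmod_O t}"

sublocale K: presented_group "iso_class t ` wmod_O t" K0_rels
proof
  have d: "keys (a - b) \<subseteq> T" if "keys a \<subseteq> T" "keys b \<subseteq> T"
    for a b :: "vec gwa_module set \<Rightarrow>\<^sub>0 int" and T using that keys_diff[of a b] by blast
  show "K0_rels \<subseteq> carrier (free_Abelian_group (iso_class t ` wmod_O t))"
  proof
    fix r assume "r \<in> K0_rels"
    then obtain M M' where M: "M \<in> wmod_O t" "M' \<in> wmod_O t"
      "r = frag_of (iso_class t (direct_sum M M')) - frag_of (iso_class t M) - frag_of (iso_class t M')" by blast
    have "keys r \<subseteq> iso_class t ` wmod_O t"
      unfolding M(3) by (intro d) (use M(1,2) iso_class_closed[OF direct_sum_wmod(1)[OF t M(1,2)]] in \<open>auto simp: keys_frag_of\<close>)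
    then show "r \<in> carrier (free_Abelian_group (iso_class t ` wmod_O t))" by simp
  qed
qed

lemma K0_eq: "K0_split t = K.Q" and K0_class_eq: "K0_class t M = K.cls (frag_of (iso_class t M))"
  by (simp_all add: K0_split_def K0_free_def K0_sub_def K.Q_def K.H_def K.cls_def K0_class_def)

lemma comm_group_K0: "comm_group (K0_split t)" unfolding K0_eq by (rule K.Q.comm_group_axioms)

lemma K0_class_closed: "is_wmod t M ==> K0_class t M \<in> carrier (K0_split t)"
  unfolding K0_eq K0_class_eq by (rule K.cls_closed) (simp add: keys_frag_of iso_class_closed)

lemma K0_class_sum:
  assumes "M \<in> wmod_O t" "M' \<in> wmod_O t"
  shows "K0_class t (direct_sum M M') = K0_class t M \<otimes>\<^bsub>K0_split t\<^esub> K0_class t M'"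
  unfolding K0_eq K0_class_eq
  by (rule K.cls_rel3) (use assms iso_class_closed[OF direct_sum_wmod(1)[OF t assms]] in auto)

lemma K0_class_iso: "bds t Ds ==> module_iso (GWA t) (NM t Ds) M \<noteq> {} ==> K0_class t M = K0_class t (NM t Ds)"
  by (simp add: K0_class_def iso_class_NM)

lemma K0_induct [consumes 1, case_names one gen diff]:
  assumes "x \<in> carrier (K0_split t)" "P \<one>\<^bsub>K0_split t\<^esub>" "\<And>M. M \<in> wmod_O t ==> P (K0_class t M)"
    "\<And>a b. a \<in> carrier (K0_split t) ==> b \<in> carrier (K0_split t) ==> P a ==> P b ==> P (a \<otimes>\<^bsub>K0_split t\<^esub> inv\<^bsub>K0_split t\<^esub> b)"
  shows "P x"
  using assms(1) unfolding K0_eq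
  by (rule K.Q_induct) (use assms(2-4) in \<open>auto simp: K0_eq K0_class_eq\<close>)

lemma K0_class_append:
  assumes "bds t Ds" "bds t Es"
  shows "K0_class t (NM t (Ds @ Es)) = K0_class t (NM t Ds) \<otimes>\<^bsub>K0_split t\<^esub> K0_class t (NM t Es)"
proof -
  have "bds t (Ds @ Es)" using assms by (auto simp: bds_def)
  then have "K0_class t (direct_sum (NM t Ds) (NM t Es)) = K0_class t (NM t (Ds @ Es))"
    using NM_append[OF assms module_iso_id module_iso_id] by (rule K0_class_iso)
  then show ?thesis using K0_class_sum NM_wmod assms by metis
qed

lemma K0_class_Nil: "K0_class t (NM t []) = \<one>\<^bsub>K0_split t\<^esub>"
proof -
  interpret comm_group "K0_split t" by (rule comm_group_K0)
  have bd: "bds t []" by (simp add: bds_def)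
  show ?thesis using K0_class_append[OF bd bd] K0_class_closed[OF is_wmod_NM[OF bd]] by (simp add: l_cancel_one')
qed

definition rkc :: "diag => vec gwa_module set => complex" where
  "rkc s c = of_nat (rk t s (SOME M. M \<in> c))"

lemma rkc: assumes M: "is_wmod t M" shows "rkc s (iso_class t M) = of_nat (rk t s M)"
proof -
  obtain M0 where M0: "M0 \<in> wmod_O t" "iso_class t M = iso_class t M0" using iso_class_closed[OF M] by blast
  have "(SOME N. N \<in> iso_class t M0) \<in> iso_class t M0" using iso_class_self[OF M0(1)] by (rule someI)
  then have N: "(SOME N. N \<in> iso_class t M0) \<in> wmod_O t" "module_iso (GWA t) (SOME N. N \<in> iso_class t M0) M0 \<noteq> {}"
    by (auto simp: iso_class_def)
  then have "iso_class t (SOME N. N \<in> iso_class t M0) = iso_class t M0" by (simp add: iso_class_eq_iff[OF _ M0(1)])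
  then show ?thesis using rk_cong[OF t M _ N(1), of s] by (simp add: M0(2) rkc_def)
qed

lemma K0_rank: "\<exists>h\<in>hom (K0_split t) CG. \<forall>M\<in>wmod_O t. h (K0_class t M) = of_nat (rk t s M)"
proof -
  have "\<exists>h\<in>hom K.Q CG. \<forall>c\<in>iso_class t ` wmod_O t. h (K.cls (frag_of c)) = rkc s c"
  proof (rule K.universal[OF comm_group_CG])
    fix h r assume h: "h \<in> hom (free_Abelian_group (iso_class t ` wmod_O t)) CG"
      and hs: "\<And>c. c \<in> iso_class t ` wmod_O t ==> h (frag_of c) = rkc s c" and r: "r \<in> K0_rels"
    obtain M M' where M: "M \<in> wmod_O t" "M' \<in> wmod_O t"
      "r = frag_of (iso_class t (direct_sum M M')) - frag_of (iso_class t M) - frag_of (iso_class t M')" using r by blast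
    show "h r = \<one>\<^bsub>CG\<^esub>"
      unfolding M(3)
    proof (rule hom_free_rel3[OF group_CG h])
      show "iso_class t (direct_sum M M') \<in> iso_class t ` wmod_O t" "iso_class t M \<in> iso_class t ` wmod_O t" "iso_class t M' \<in> iso_class t ` wmod_O t"
        using M(1,2) iso_class_closed[OF direct_sum_wmod(1)[OF t M(1,2)]] by auto
      then show "h (frag_of (iso_class t (direct_sum M M'))) = h (frag_of (iso_class t M)) \<otimes>\<^bsub>CG\<^esub> h (frag_of (iso_class t M'))"
        using direct_sum_wmod[OF t M(1,2)] M(1,2) by (simp add: hs rkc is_wmod_wmod_O t)
    qed
  qed simp
  then obtain h where h: "h \<in> hom K.Q CG" "\<forall>c\<in>iso_class t ` wmod_O t. h (K.cls (frag_of c)) = rkc s c" ..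
  have "h (K0_class t M) = of_nat (rk t s M)" if "M \<in> wmod_O t" for M
    unfolding K0_class_eq using h(2) that by (simp add: rkc is_wmod_wmod_O t)
  then show ?thesis using h(1) unfolding K0_eq by blast
qed

subsection \<open>Scalar extension\<close>

abbreviation "TG \<equiv> tensor_group ZZ (int_module CG) (int_module (K0_split t))"

sublocale KG: comm_group "K0_split t" by (rule comm_group_K0)

lemma int_module_simps [simp]:
  "carrier (int_module G) = carrier G" "ring.add (int_module G) = (\<otimes>\<^bsub>G\<^esub>)" "n \<odot>\<^bsub>int_module G\<^esub> x = x [^]\<^bsub>G\<^esub> n"
  by (simp_all add: int_module_def)

sublocale T: tensor ZZ "int_module CG" "int_module (K0_split t)"
  by unfold_locales simp_all

sublocale TC: comm_group TG by (rule T.comm_group_G)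

lemma comm_group_TG: "comm_group TG" by (rule T.comm_group_G)

lemma CK0_elem_eq: "CK0_elem t c k = T.tens c k"
  by (simp add: CK0_elem_def CG_def)

lemma CK0_elem_closed: "k \<in> carrier (K0_split t) ==> CK0_elem t c k \<in> carrier TG"
  unfolding CK0_elem_eq by (rule T.tens_closed) simp_all

lemma CK0_simps [simp]:
  "carrier (CK0 t) = carrier TG" "ring.add (CK0 t) = (\<otimes>\<^bsub>TG\<^esub>)" "ring.zero (CK0 t) = \<one>\<^bsub>TG\<^esub>"
  by (simp_all add: CK0_def CG_def)

text \<open>\<open>tensor_left\<close> takes a union over the representatives of a coset. Comparison
  with the homomorphism \<open>L\<close> from the universal property shows that all representatives
  yield the same coset, so the union is this coset.\<close>

lemma scale_hom: "\<exists>L\<in>hom TG TG. (\<forall>d k. k \<in> carrier (K0_split t) --> L (T.tens d k) = T.tens (c * d) k)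
    \<and> (\<forall>S\<in>carrier TG. c \<odot>\<^bsub>CK0 t\<^esub> S = L S)"
proof -
  have "\<exists>L\<in>hom TG TG. \<forall>d\<in>carrier (int_module CG). \<forall>k\<in>carrier (int_module (K0_split t)). L (T.tens d k) = T.tens (c * d) k"
  proof (rule T.tensor_universal[OF T.comm_group_G])
    fix n :: int and d k assume k: "k \<in> carrier (int_module (K0_split t))"
    have "c * (d [^]\<^bsub>CG\<^esub> n) = (c * d) [^]\<^bsub>CG\<^esub> n"
      by (rule hom_int_pow[OF hom_CG_mult(2) _ group_CG group_CG]) simp
    then show "T.tens (c * (n \<odot>\<^bsub>int_module CG\<^esub> d)) k = T.tens (c * d) (n \<odot>\<^bsub>int_module (K0_split t)\<^esub> k)"
      using T.tens_balanced[of n "c * d" k] k by simp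
  next
    fix x x' y assume "y \<in> carrier (int_module (K0_split t))"
    then show "T.tens (c * (x \<oplus>\<^bsub>int_module CG\<^esub> x')) y = T.tens (c * x) y \<otimes>\<^bsub>TG\<^esub> T.tens (c * x') y"
      using T.tens_add_l[of "c * x" "c * x'" y] by (simp add: distrib_left)
  qed (use T.tens_add_r T.tens_closed in auto)
  then obtain L where L: "L \<in> hom TG TG" "\<And>d k. k \<in> carrier (K0_split t) ==> L (T.tens d k) = T.tens (c * d) k" by auto
  let ?ext = "frag_extend (\<lambda>(x, y). frag_of ((*) c x, y))"
  have ext: "T.P.cls (?ext p) = L (T.P.cls p) \<and> keys (?ext p) \<subseteq> UNIV \<times> carrier (K0_split t)"
    if "keys p \<subseteq> UNIV \<times> carrier (K0_split t)" for p
    using that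
  proof (induction rule: free_Abelian_group_induct[consumes 1, case_names zero diff gen])
    case zero
    interpret L: group_hom TG TG L by (simp add: group_hom_def group_hom_axioms_def L(1) TC.is_group)
    show ?case using T.P.cls_0 L.hom_one by (simp add: T.G_eq)
  next
    case (diff x y)
    interpret L: group_hom TG TG L by (simp add: group_hom_def group_hom_axioms_def L(1) TC.is_group)
    have k: "keys (?ext x - ?ext y) \<subseteq> UNIV \<times> carrier (K0_split t)"
      using diff keys_diff[of "?ext x" "?ext y"] by blast
    have c: "T.P.cls x \<in> carrier TG" "T.P.cls y \<in> carrier TG"
      unfolding T.G_eq by (rule T.P.cls_closed, use diff in simp)+
    have "T.P.cls (?ext (x - y)) = T.P.cls (?ext x) \<otimes>\<^bsub>TG\<^esub> inv\<^bsub>TG\<^esub> T.P.cls (?ext y)"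
      unfolding frag_extend_diff T.G_eq by (rule T.P.cls_diff) (use diff in simp_all)
    also have "\<dots> = L (T.P.cls x) \<otimes>\<^bsub>TG\<^esub> inv\<^bsub>TG\<^esub> L (T.P.cls y)" using diff by simp
    also have "\<dots> = L (T.P.cls x \<otimes>\<^bsub>TG\<^esub> inv\<^bsub>TG\<^esub> T.P.cls y)"
      by (simp only: L.hom_mult[OF c(1) TC.inv_closed[OF c(2)]] L.hom_inv[OF c(2)])
    also have "T.P.cls x \<otimes>\<^bsub>TG\<^esub> inv\<^bsub>TG\<^esub> T.P.cls y = T.P.cls (x - y)"
      unfolding T.G_eq by (rule T.P.cls_diff[symmetric]) (use diff in simp_all)
    finally show ?case using k unfolding frag_extend_diff by blast
  next
    case (gen a)
    then obtain x y where a: "a = (x, y)" "y \<in> carrier (K0_split t)" by auto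
    have "T.P.cls (frag_of (c * x, y)) = L (T.P.cls (frag_of (x, y)))"
      using L(2)[OF a(2), of x] unfolding T.tens_eq by simp
    then show ?case using a(2) by (simp add: a(1) keys_frag_of)
  qed
  have "c \<odot>\<^bsub>CK0 t\<^esub> S = L S" if S: "S \<in> carrier TG" for S
  proof -
    have ne: "S \<noteq> {}" and sub: "\<And>p. p \<in> S ==> T.P.cls p = S \<and> keys p \<subseteq> UNIV \<times> carrier (K0_split t)"
    proof -
      obtain q where q: "S = T.P.cls q" "q \<in> carrier (free_Abelian_group (carrier (int_module CG) \<times> carrier (int_module (K0_split t))))"
        using S unfolding T.G_eq T.P.carrier_Q by blast
      show "S \<noteq> {}" using T.P.F.rcos_self[OF q(2) T.P.subgroup_H] unfolding q(1) T.P.cls_def by blast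
      fix p assume p: "p \<in> S"
      have "p \<in> carrier (free_Abelian_group (carrier (int_module CG) \<times> carrier (int_module (K0_split t))))"
        using p T.P.F.r_coset_subset_G[OF subgroup.subset[OF T.P.subgroup_H] q(2)] unfolding q(1) T.P.cls_def by blast
      moreover have "T.P.cls p = S" using T.P.F.repr_independence[OF _ q(2) T.P.subgroup_H, of p] p unfolding q(1) T.P.cls_def by simp
      ultimately show "T.P.cls p = S \<and> keys p \<subseteq> UNIV \<times> carrier (K0_split t)" by simp
    qed
    have "c \<odot>\<^bsub>CK0 t\<^esub> S = (\<Union>p\<in>S. T.P.cls (?ext p))"
    proof -
      have "CK0 t = module_of_group TG (\<lambda>c. tensor_left ZZ (int_module CG) (int_module (K0_split t)) ((*) c))"
        by (simp only: CK0_def CG_def)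
      then have "c \<odot>\<^bsub>CK0 t\<^esub> S = tensor_left ZZ (int_module CG) (int_module (K0_split t)) ((*) c) S"
        by (simp only: module_of_group_simps)
      then show ?thesis unfolding tensor_left_def T.P.cls_def T.P.H_def tensor_sub_def tensor_free_def .
    qed
    also have "\<dots> = (\<Union>p\<in>S. L S)" using ext sub by (intro SUP_cong) auto
    also have "\<dots> = L S" using ne by simp
    finally show ?thesis .
  qed
  then show ?thesis using L by blast
qed

lemma smult_tens: "k \<in> carrier (K0_split t) ==> c \<odot>\<^bsub>CK0 t\<^esub> T.tens d k = T.tens (c * d) k"
  using scale_hom[of c] T.tens_closed[of d k] by auto

lemma smult_CK0_closed: "S \<in> carrier TG ==> c \<odot>\<^bsub>CK0 t\<^esub> S \<in> carrier TG"
  using scale_hom[of c] by (auto simp: hom_in_carrier)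

lemma smult_CK0_add: "S \<in> carrier TG ==> S' \<in> carrier TG ==> c \<odot>\<^bsub>CK0 t\<^esub> (S \<otimes>\<^bsub>TG\<^esub> S') = (c \<odot>\<^bsub>CK0 t\<^esub> S) \<otimes>\<^bsub>TG\<^esub> (c \<odot>\<^bsub>CK0 t\<^esub> S')"
  using scale_hom[of c] by (auto simp: hom_mult)

lemma smult_CK0_hom: "(\<lambda>S. c \<odot>\<^bsub>CK0 t\<^esub> S) \<in> hom TG TG"
  by (auto intro!: homI simp: smult_CK0_closed smult_CK0_add)

lemma smult_CK0_one: "c \<odot>\<^bsub>CK0 t\<^esub> \<one>\<^bsub>TG\<^esub> = \<one>\<^bsub>TG\<^esub>"
  using hom_one[OF smult_CK0_hom TC.is_group TC.is_group] .

lemma CK0_rank: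
  "\<exists>f\<in>hom TG CG. (\<forall>c. \<forall>M\<in>wmod_O t. f (T.tens c (K0_class t M)) = c * of_nat (rk t s M))
    \<and> (\<forall>c. \<forall>S\<in>carrier TG. f (c \<odot>\<^bsub>CK0 t\<^esub> S) = c * f S)"
proof -
  obtain h where h: "h \<in> hom (K0_split t) CG" "\<And>M. M \<in> wmod_O t ==> h (K0_class t M) = of_nat (rk t s M)" using K0_rank by blast
  have "\<exists>f\<in>hom TG CG. \<forall>c\<in>carrier (int_module CG). \<forall>k\<in>carrier (int_module (K0_split t)). f (T.tens c k) = c * h k"
  proof (rule T.tensor_universal[OF comm_group_CG])
    fix n :: int and c k assume k: "k \<in> carrier (int_module (K0_split t))"
    have "(c [^]\<^bsub>CG\<^esub> n) * h k = (c * h k) [^]\<^bsub>CG\<^esub> n"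
      by (rule hom_int_pow[OF hom_CG_mult(1) _ group_CG group_CG]) simp
    also have "\<dots> = c * (h k [^]\<^bsub>CG\<^esub> n)"
      by (rule hom_int_pow[OF hom_CG_mult(2) _ group_CG group_CG, symmetric]) simp
    also have "h k [^]\<^bsub>CG\<^esub> n = h (k [^]\<^bsub>K0_split t\<^esub> n)"
      by (rule hom_int_pow[OF h(1) _ KG.is_group group_CG, symmetric]) (use k in simp)
    finally show "(n \<odot>\<^bsub>int_module CG\<^esub> c) * h k = c * h (n \<odot>\<^bsub>int_module (K0_split t)\<^esub> k)" by simp
  qed (use hom_mult[OF h(1)] in \<open>auto simp: algebra_simps\<close>)
  then obtain f where f: "f \<in> hom TG CG" "\<And>c k. k \<in> carrier (K0_split t) ==> f (T.tens c k) = c * h k" by auto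
  have "f (c \<odot>\<^bsub>CK0 t\<^esub> S) = c * f S" if S: "S \<in> carrier TG" for c S
  proof (rule T.tensor_hom_eq[OF group_CG _ _ _ S, where h = "\<lambda>S. f (c \<odot>\<^bsub>CK0 t\<^esub> S)" and h' = "\<lambda>S. c * f S"])
    show "(\<lambda>S. f (c \<odot>\<^bsub>CK0 t\<^esub> S)) \<in> hom TG CG"
      using hom_mult[OF f(1)] by (auto intro!: homI simp: smult_CK0_add smult_CK0_closed)
    show "(\<lambda>S. c * f S) \<in> hom TG CG"
      using hom_mult[OF f(1)] by (auto intro!: homI simp: algebra_simps)
  qed (auto simp: smult_tens f(2))
  moreover have "f (T.tens c (K0_class t M)) = c * of_nat (rk t s M)" if "M \<in> wmod_O t" for c M
    using f(2)[OF K0_class_closed[OF is_wmod_wmod_O[OF t that]]] h(2)[OF that] by simp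
  ultimately show ?thesis using f(1) by blast
qed

text \<open>Every module is a sum of strings, and inverses are absorbed by the sign of the complex
  coefficient, so sums of multiples of classes of strings exhaust the group.\<close>

lemma CK0_induct [consumes 1, case_names zero gen add]:
  assumes x: "x \<in> carrier TG" and zero: "P \<one>\<^bsub>TG\<^esub>"
    and gen: "\<And>c Ds. bds t Ds ==> (\<forall>D\<in>set Ds. con D) ==> length Ds = 1 ==> P (T.tens c (K0_class t (NM t Ds)))"
    and add: "\<And>a b. a \<in> carrier TG ==> b \<in> carrier TG ==> P a ==> P b ==> P (a \<otimes>\<^bsub>TG\<^esub> b)"
  shows "P x"
proof -
  have zl: "T.tens 0 k = \<one>\<^bsub>TG\<^esub>" if "k \<in> carrier (K0_split t)" for k
    using T.tens_add_l[of 0 0 k] T.tens_closed[of 0 k] that by (simp add: TC.l_cancel_one')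
  have zr: "T.tens c \<one>\<^bsub>K0_split t\<^esub> = \<one>\<^bsub>TG\<^esub>" for c
    using T.tens_add_r[of c "\<one>\<^bsub>K0_split t\<^esub>" "\<one>\<^bsub>K0_split t\<^esub>"] T.tens_closed[of c "\<one>\<^bsub>K0_split t\<^esub>"] by (simp add: TC.l_cancel_one')
  have neg_l: "T.tens (- c) k = inv\<^bsub>TG\<^esub> T.tens c k" if "k \<in> carrier (K0_split t)" for c k
    using T.tens_add_l[of "-c" c k] zl[OF that] that by (intro TC.inv_equality[symmetric]) auto
  have neg_r: "T.tens c (inv\<^bsub>K0_split t\<^esub> k) = inv\<^bsub>TG\<^esub> T.tens c k" if "k \<in> carrier (K0_split t)" for c k
    using T.tens_add_r[of c "inv\<^bsub>K0_split t\<^esub> k" k] zr that by (intro TC.inv_equality[symmetric]) auto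
  have strs: "P (T.tens c (K0_class t (NM t Ds)))" if "bds t Ds" "\<forall>D\<in>set Ds. con D" for c Ds
    using that
  proof (induction Ds)
    case Nil then show ?case by (simp add: K0_class_Nil zr zero)
  next
    case (Cons D Ds)
    have b: "bds t [D]" "bds t Ds" using Cons.prems by (auto simp: bds_def)
    have kc: "K0_class t (NM t [D]) \<in> carrier (K0_split t)" "K0_class t (NM t Ds) \<in> carrier (K0_split t)"
      using K0_class_closed is_wmod_NM b by blast+
    have "K0_class t (NM t (D # Ds)) = K0_class t (NM t [D]) \<otimes>\<^bsub>K0_split t\<^esub> K0_class t (NM t Ds)"
      using K0_class_append[OF b] by simp
    then have "T.tens c (K0_class t (NM t (D # Ds))) = T.tens c (K0_class t (NM t [D])) \<otimes>\<^bsub>TG\<^esub> T.tens c (K0_class t (NM t Ds))"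
      using T.tens_add_r[of c] kc by simp
    then show ?case using add gen[OF b(1), of c] Cons b kc by simp
  qed
  have cls: "P (T.tens c (K0_class t M))" if M: "M \<in> wmod_O t" for c M
  proof -
    obtain Ds where Ds: "bds t Ds" "\<forall>D\<in>set Ds. con D" "module_iso (GWA t) (NM t Ds) M \<noteq> {}"
      using wmod_decomposition[of t M] M t by (auto simp: wmod_O_def)
    then show ?thesis using strs[OF Ds(1,2)] K0_class_iso[OF Ds(1,3)] by simp
  qed
  have cls': "\<forall>c. P (T.tens c k)" if "k \<in> carrier (K0_split t)" for k
    using that
  proof (induction rule: K0_induct)
    case one then show ?case by (simp add: zr zero)
  next
    case (gen M) then show ?case by (simp add: cls)
  next
    case (diff a b)
    have "T.tens c (a \<otimes>\<^bsub>K0_split t\<^esub> inv\<^bsub>K0_split t\<^esub> b) = T.tens c a \<otimes>\<^bsub>TG\<^esub> T.tens (- c) b" for c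
      using T.tens_add_r[of c a "inv\<^bsub>K0_split t\<^esub> b"] diff by (simp add: neg_l neg_r)
    then show ?case using add diff by simp
  qed
  \<comment> \<open>The induction rule for tensors produces differences, so the claim is proved
    together with the claim for the inverse.\<close>
  have "P x \<and> P (inv\<^bsub>TG\<^esub> x)"
    using x
  proof (induction rule: T.tensor_induct)
    case one then show ?case using zero by simp
  next
    case (tens c k) then show ?case using cls' by (simp flip: neg_l)
  next
    case (diff a b)
    then show ?case using add by (simp add: TC.inv_mult TC.m_comm)
  qed
  then show ?thesis ..
qed

end

section \<open>The algebra of ranks\<close>

lemma Gam_nonzero: "t \<in> Gam Z ==> t \<noteq> 0" by (auto simp: Gam_def)

lemma K0_group_Gam: "t \<in> Gam Z ==> K0_group t" by (simp add: K0_group_def Gam_nonzero)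

lemma Gam_mult: "t \<in> Gam Z ==> t' \<in> Gam Z ==> t * t' \<in> Gam Z"
  by (auto simp: Gam_def lead_coeff_mult)

lemma Gam_1: "1 \<in> Gam Z" by (simp add: Gam_def)

lemma Gam_lin: "k \<in> Z ==> lin k \<in> Gam Z" by (auto simp: Gam_def lin_def)

text \<open>The zeros of an element of \<open>Gam Z\<close> are real, so nothing is lost by taking
  real parts.\<close>

definition dg :: "complex poly => real multiset" where "dg t = image_mset Re (proots t)"

lemma dg_mult: "t \<noteq> 0 ==> t' \<noteq> 0 ==> dg (t * t') = dg t + dg t'"
  by (simp add: dg_def proots_mult)

lemma dg_1 [simp]: "dg 1 = {#}" by (simp add: dg_def)

lemma dg_lin [simp]: "dg (lin k) = {#k#}" by (simp add: dg_def lin_def)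

lemma dg_lin_roots: "proots [:- x, 1:] = {#x#}" for x :: complex by simp

text \<open>A monic complex polynomial is the product of its linear factors. Hence a degree in
  \<open>Gam Z\<close> can be recovered from its multiset of zeros.\<close>

lemma Gam_eq_prod: assumes "t \<in> Gam Z" shows "t = (\<Prod>k\<in>#dg t. lin k)"
proof -
  have t: "lead_coeff t = 1" using assms by (simp add: Gam_def)
  have "\<forall>x\<in>#proots t. lin (Re x) = [:- x, 1:]"
  proof
    fix x assume "x \<in># proots t"
    then have "poly t x = 0" using Gam_nonzero[OF assms] by simp
    then show "lin (Re x) = [:- x, 1:]" using assms by (auto simp: Gam_def lin_def)
  qed
  then have "(\<Prod>k\<in>#dg t. lin k) = (\<Prod>x\<in>#proots t. [:- x, 1:])"
    unfolding dg_def image_mset.compositionality comp_def by (intro arg_cong[where f = prod_mset] image_mset_cong) blast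
  moreover have "t = Polynomial.smult (lead_coeff t) (\<Prod>x\<in>#proots t. [:- x, 1:])"
  proof -
    obtain A where A: "size A = Polynomial.degree t" "t = Polynomial.smult (lead_coeff t) (\<Prod>x\<in>#A. [:- x, 1:])"
      using alg_closed_imp_factorization[of t] Gam_nonzero[OF assms] by auto
    have "proots (\<Prod>x\<in>#A. [:- x, 1:]) = A" 
    proof (induction A)
      case (add x A)
      have "(\<Prod>x\<in>#A. [:- x, 1:]) \<noteq> 0" by (auto simp: prod_mset_zero_iff)
      then have "proots ([:- x, 1:] * (\<Prod>x\<in>#A. [:- x, 1:])) = proots [:- x, 1:] + proots (\<Prod>x\<in>#A. [:- x, 1:])" by (intro proots_mult) auto
      also have "proots [:- x, 1:] = {#x#}" using dg_lin_roots by blast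
      finally show ?case using add by (simp del: mult_pCons_left)
    qed simp
    then have "proots t = A" using A(2) t by (metis smult_1_left)
    then show ?thesis using A(2) by simp
  qed
  ultimately show ?thesis using t by simp
qed

lemma dg_inj: "t \<in> Gam Z ==> t' \<in> Gam Z ==> dg t = dg t' ==> t = t'"
  using Gam_eq_prod by metis

lemma set_dg: "t \<in> Gam Z ==> set_mset (dg t) \<subseteq> Z"
proof
  fix k assume t: "t \<in> Gam Z" and "k \<in> set_mset (dg t)"
  then obtain x where x: "x \<in># proots t" "k = Re x" by (auto simp: dg_def)
  then have "poly t x = 0" using Gam_nonzero[OF t] by simp
  then show "k \<in> Z" using t x by (auto simp: Gam_def)
qed

lemma Gam_prod: assumes "set_mset d \<subseteq> Z" shows "(\<Prod>k\<in>#d. lin k) \<in> Gam Z" "dg (\<Prod>k\<in>#d. lin k) = d"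
proof -
  have "(\<Prod>k\<in>#d. lin k) \<in> Gam Z \<and> dg (\<Prod>k\<in>#d. lin k) = d" using assms
  proof (induction d)
    case empty then show ?case by (simp add: Gam_1)
  next
    case (add k d)
    then have "lin k \<in> Gam Z" "(\<Prod>k\<in>#d. lin k) \<in> Gam Z" using Gam_lin by auto
    then show ?case using Gam_mult[of "lin k" Z "\<Prod>k\<in>#d. lin k"] dg_mult[OF Gam_nonzero Gam_nonzero, of "lin k" Z "\<Prod>k\<in>#d. lin k" Z] add by auto
  qed
  then show "(\<Prod>k\<in>#d. lin k) \<in> Gam Z" "dg (\<Prod>k\<in>#d. lin k) = d" by auto
qed

text \<open>Evaluating at a maximal diagram isolates its coefficient.\<close>
lemma ind_independent:
  fixes c :: "'i => complex" and d :: "'i => 'm"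
  assumes A: "finite A" and inj: "\<And>i j. i \<in> A ==> j \<in> A ==> d i = d j ==> C i = C j ==> i = j"
    and con: "\<And>i. i \<in> A ==> con (C i)"
    and z: "\<And>s. (\<Sum>i\<in>A. single (d i) (c i * of_nat (ind s (C i)))) = 0" and i: "i \<in> A"
  shows "c i = 0"
proof (rule ccontr)
  assume "c i \<noteq> 0"
  let ?B = "{i \<in> A. c i \<noteq> 0}"
  have "finite (C ` ?B)" "C ` ?B \<noteq> {}" using A i \<open>c i \<noteq> 0\<close> by auto
  then obtain m where m: "m \<in> C ` ?B" "\<forall>b\<in>C ` ?B. m \<subseteq> b --> m = b" using finite_has_maximal by (metis (no_types, lifting))
  then obtain j where j: "j \<in> A" "c j \<noteq> 0" "m = C j" by blast
  have "0 = lkp (\<Sum>i\<in>A. single (d i) (c i * of_nat (ind (C j) (C i)))) (d j)" using z by simp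
  also have "\<dots> = (\<Sum>i\<in>A. if d i = d j then c i * of_nat (ind (C j) (C i)) else 0)"
    by (simp add: lookup_sum lookup_single when_def)
  also have "\<dots> = (\<Sum>i\<in>A. if i = j then c j else 0)"
  proof (rule sum.cong[OF refl])
    fix i assume i: "i \<in> A"
    show "(if d i = d j then c i * of_nat (ind (C j) (C i)) else 0) = (if i = j then c j else 0)"
    proof (cases "i = j")
      case True then show ?thesis using con[OF j(1)] by (simp add: ind_def)
    next
      case False
      then have "c i = 0 \<or> d i \<noteq> d j \<or> \<not> C j \<subseteq> C i" using m(2) i j inj[OF i j(1)] by auto
      then show ?thesis using False by (auto simp: ind_def)
    qed
  qed
  also have "\<dots> = c j" using A j by simp
  finally show False using j by simp
qed

abbreviation CT where "CT t \<equiv> tensor_group ZZ (int_module CG) (int_module (K0_split t))"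

definition ckr :: "complex poly => diag => ck0 => complex" where
  "ckr t s = (SOME f. f \<in> hom (CT t) CG \<and> (\<forall>c. \<forall>M\<in>wmod_O t. f (CK0_elem t c (K0_class t M)) = c * of_nat (rk t s M))
    \<and> (\<forall>c. \<forall>S\<in>carrier (CT t). f (c \<odot>\<^bsub>CK0 t\<^esub> S) = c * f S))"

lemma ckr:
  assumes "t \<noteq> 0"
  shows "ckr t s \<in> hom (CT t) CG" "M \<in> wmod_O t ==> ckr t s (CK0_elem t c (K0_class t M)) = c * of_nat (rk t s M)"
    "S \<in> carrier (CT t) ==> ckr t s (c \<odot>\<^bsub>CK0 t\<^esub> S) = c * ckr t s S"
proof -
  interpret K0_group t by (rule K0_group.intro[OF assms])
  have "\<exists>f. f \<in> hom (CT t) CG \<and> (\<forall>c. \<forall>M\<in>wmod_O t. f (CK0_elem t c (K0_class t M)) = c * of_nat (rk t s M))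
    \<and> (\<forall>c. \<forall>S\<in>carrier (CT t). f (c \<odot>\<^bsub>CK0 t\<^esub> S) = c * f S)"
    using CK0_rank[of s] unfolding CK0_elem_eq by blast
  then have "ckr t s \<in> hom (CT t) CG \<and> (\<forall>c. \<forall>M\<in>wmod_O t. ckr t s (CK0_elem t c (K0_class t M)) = c * of_nat (rk t s M))
    \<and> (\<forall>c. \<forall>S\<in>carrier (CT t). ckr t s (c \<odot>\<^bsub>CK0 t\<^esub> S) = c * ckr t s S)"
    unfolding ckr_def by (rule someI_ex)
  then show "ckr t s \<in> hom (CT t) CG" "M \<in> wmod_O t ==> ckr t s (CK0_elem t c (K0_class t M)) = c * of_nat (rk t s M)"
    "S \<in> carrier (CT t) ==> ckr t s (c \<odot>\<^bsub>CK0 t\<^esub> S) = c * ckr t s S" by blast+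
qed

section \<open>The graded sum over \<open>Gam Z\<close>\<close>

locale split =
  fixes Z :: "real set"
begin

abbreviation "G \<equiv> Gam Z"
abbreviation "V \<equiv> split_space Z"

lemma CT_group: "t \<in> G ==> comm_group (CT t)"
  by (rule K0_group.comm_group_TG[OF K0_group_Gam])

lemma CK0_simps: "t \<in> G ==> carrier (CK0 t) = carrier (CT t)" "t \<in> G ==> ring.add (CK0 t) = (\<otimes>\<^bsub>CT t\<^esub>)"
  "t \<in> G ==> ring.zero (CK0 t) = \<one>\<^bsub>CT t\<^esub>"
  by (simp_all add: K0_group.CK0_simps[OF K0_group_Gam])

lemma group_add_CK0: assumes "t \<in> G" shows "group (add_monoid (CK0 t))"
proof -
  interpret comm_group "CT t" by (rule CT_group[OF assms])
  show ?thesis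
    by (rule groupI) (auto simp: CK0_simps[OF assms] m_assoc intro: bexI[of _ "inv\<^bsub>CT t\<^esub> x" for x])
qed

lemma carrier_V: "carrier V = {x \<in> \<Pi>\<^sub>E t\<in>G. carrier (CT t). finite {t \<in> G. x t \<noteq> \<one>\<^bsub>CT t\<^esub>}}"
proof -
  have "carrier V = {x \<in> \<Pi>\<^sub>E t\<in>G. carrier (add_monoid (CK0 t)). finite {t \<in> G. x t \<noteq> \<one>\<^bsub>add_monoid (CK0 t)\<^esub>}}"
    unfolding split_space_def module_of_group_simps by (rule carrier_sum_group[OF group_add_CK0])
  also have "\<dots> = {x \<in> \<Pi>\<^sub>E t\<in>G. carrier (CT t). finite {t \<in> G. x t \<noteq> \<one>\<^bsub>CT t\<^esub>}}"
    by (auto simp: CK0_simps PiE_iff cong: conj_cong)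
  finally show ?thesis .
qed

lemma zero_V: "\<zero>\<^bsub>V\<^esub> = (\<lambda>t\<in>G. \<one>\<^bsub>CT t\<^esub>)"
  by (rule ext) (simp add: split_space_def CK0_simps restrict_def)

lemma add_V: "x \<oplus>\<^bsub>V\<^esub> y = (\<lambda>t\<in>G. x t \<otimes>\<^bsub>CT t\<^esub> y t)"
  by (rule ext) (simp add: split_space_def CK0_simps restrict_def)

lemma smult_V: "c \<odot>\<^bsub>V\<^esub> x = (\<lambda>t\<in>G. c \<odot>\<^bsub>CK0 t\<^esub> x t)"
  by (simp add: split_space_def)

lemma V_nth: "x \<in> carrier V ==> t \<in> G ==> x t \<in> carrier (CT t)" by (auto simp: carrier_V)

lemma abelian_group_V: "abelian_group V"
proof -
  interpret S: group "sum_group G (\<lambda>t. add_monoid (CK0 t))" by (rule sum_group[OF group_add_CK0])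
  have "comm_group (sum_group G (\<lambda>t. add_monoid (CK0 t)))"
  proof (rule S.group_comm_groupI)
    fix x y assume "x \<in> carrier (sum_group G (\<lambda>t. add_monoid (CK0 t)))" "y \<in> carrier (sum_group G (\<lambda>t. add_monoid (CK0 t)))"
    then have xy: "x \<in> carrier V" "y \<in> carrier V" by (simp_all add: split_space_def)
    have "x t \<oplus>\<^bsub>CK0 t\<^esub> y t = y t \<oplus>\<^bsub>CK0 t\<^esub> x t" if t: "t \<in> G" for t
    proof -
      interpret comm_group "CT t" by (rule CT_group[OF t])
      show ?thesis using V_nth[OF xy(1) t] V_nth[OF xy(2) t] by (simp add: CK0_simps[OF t] m_comm)
    qed
    then show "x \<otimes>\<^bsub>sum_group G (\<lambda>t. add_monoid (CK0 t))\<^esub> y = y \<otimes>\<^bsub>sum_group G (\<lambda>t. add_monoid (CK0 t))\<^esub> x"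
      by (intro ext) (simp add: restrict_def)
  qed
  then show ?thesis unfolding split_space_def by (rule abelian_group_module_of_group)
qed

sublocale V: abelian_group V by (rule abelian_group_V)

lemma smult_closed: assumes "x \<in> carrier V" shows "c \<odot>\<^bsub>V\<^esub> x \<in> carrier V"
proof -
  have "c \<odot>\<^bsub>CK0 t\<^esub> x t \<in> carrier (CT t)" if "t \<in> G" for t
    using K0_group.smult_CK0_closed[OF K0_group_Gam[OF that]] V_nth[OF assms that] by blast
  moreover have "{t \<in> G. c \<odot>\<^bsub>CK0 t\<^esub> x t \<noteq> \<one>\<^bsub>CT t\<^esub>} \<subseteq> {t \<in> G. x t \<noteq> \<one>\<^bsub>CT t\<^esub>}"
    using K0_group.smult_CK0_one[OF K0_group_Gam] by fastforce
  then have "finite {t \<in> G. c \<odot>\<^bsub>CK0 t\<^esub> x t \<noteq> \<one>\<^bsub>CT t\<^esub>}"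
    using assms by (auto simp: carrier_V elim: finite_subset)
  moreover have "{t \<in> G. (\<lambda>t\<in>G. c \<odot>\<^bsub>CK0 t\<^esub> x t) t \<noteq> \<one>\<^bsub>CT t\<^esub>} = {t \<in> G. c \<odot>\<^bsub>CK0 t\<^esub> x t \<noteq> \<one>\<^bsub>CT t\<^esub>}" by auto
  ultimately show ?thesis by (simp add: smult_V carrier_V)
qed

definition emb :: "complex poly => ck0 => complex poly => ck0" where
  "emb t x = (\<lambda>s\<in>G. if s = t then x else \<one>\<^bsub>CT s\<^esub>)"

lemma emb_closed: "t \<in> G ==> x \<in> carrier (CT t) ==> emb t x \<in> carrier V"
proof -
  assume t: "t \<in> G" and x: "x \<in> carrier (CT t)"
  have "{s \<in> G. emb t x s \<noteq> \<one>\<^bsub>CT s\<^esub>} \<subseteq> {t}" by (auto simp: emb_def)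
  then have "finite {s \<in> G. emb t x s \<noteq> \<one>\<^bsub>CT s\<^esub>}" by (rule finite_subset) simp
  moreover have "\<one>\<^bsub>CT s\<^esub> \<in> carrier (CT s)" if "s \<in> G" for s
    using group.is_monoid[OF comm_group.axioms(2)[OF CT_group[OF that]]] by (rule monoid.one_closed)
  ultimately show ?thesis using x by (auto simp: carrier_V emb_def)
qed

lemma emb_add: "t \<in> G ==> emb t (x \<otimes>\<^bsub>CT t\<^esub> y) = emb t x \<oplus>\<^bsub>V\<^esub> emb t y"
proof -
  assume t: "t \<in> G"
  have "\<one>\<^bsub>CT s\<^esub> \<otimes>\<^bsub>CT s\<^esub> \<one>\<^bsub>CT s\<^esub> = \<one>\<^bsub>CT s\<^esub>" if "s \<in> G" for s
  proof -
    interpret comm_group "CT s" by (rule CT_group[OF that])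
    show ?thesis by simp
  qed
  then show ?thesis using t by (intro ext) (simp add: emb_def add_V restrict_def)
qed

lemma emb_one: "emb t \<one>\<^bsub>CT t\<^esub> = \<zero>\<^bsub>V\<^esub>" by (rule ext) (simp add: emb_def zero_V restrict_def)

lemma split_class_emb: "t \<in> G ==> split_class Z t M = emb t (CK0_elem t 1 (K0_class t M))"
  by (rule ext) (simp add: split_class_def emb_def CK0_simps restrict_def)

lemma smult_emb: assumes t: "t \<in> G" shows "c \<odot>\<^bsub>V\<^esub> emb t x = emb t (c \<odot>\<^bsub>CK0 t\<^esub> x)"
  using K0_group.smult_CK0_one[OF K0_group_Gam] by (intro ext) (simp add: smult_V emb_def restrict_def)

lemma smult_split_class:
  assumes "t \<in> G" "is_wmod t M"
  shows "c \<odot>\<^bsub>V\<^esub> split_class Z t M = emb t (CK0_elem t c (K0_class t M))"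
proof -
  interpret K0_group t by (rule K0_group_Gam[OF assms(1)])
  show ?thesis
    using smult_tens[OF K0_class_closed[OF assms(2)], of c 1] by (simp add: split_class_emb assms smult_emb CK0_elem_eq)
qed

lemma CK0_elem_closed: "t \<in> G ==> is_wmod t M ==> CK0_elem t c (K0_class t M) \<in> carrier (CT t)"
  by (rule K0_group.CK0_elem_closed[OF K0_group_Gam K0_group.K0_class_closed[OF K0_group_Gam]])

lemma split_class_closed: "t \<in> G ==> is_wmod t M ==> split_class Z t M \<in> carrier V"
  by (simp add: split_class_emb emb_closed CK0_elem_closed)

lemma is_wmod_string: "bdiag (brk t) C ==> is_wmod t (NM t [C])"
  by (rule is_wmod_NM) (simp add: bds_def)

lemma V_induct [consumes 1, case_names zero gen add]:
  assumes a: "a \<in> carrier V" and zero: "P \<zero>\<^bsub>V\<^esub>"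
    and gen: "\<And>c t C. t \<in> G ==> bdiag (brk t) C ==> con C ==> P (c \<odot>\<^bsub>V\<^esub> split_class Z t (NM t [C]))"
    and add: "\<And>a b. a \<in> carrier V ==> b \<in> carrier V ==> P a ==> P b ==> P (a \<oplus>\<^bsub>V\<^esub> b)"
  shows "P a"
proof -
  have emb: "P (emb t x)" if tG: "t \<in> G" and x: "x \<in> carrier (CT t)" for t x
  proof -
    interpret K0_group t by (rule K0_group_Gam[OF tG])
    show ?thesis using x
    proof (induction rule: CK0_induct)
      case zero then show ?case using assms(2) by (simp add: emb_one)
    next
      case (gen c Ds)
      then obtain C where C: "Ds = [C]" by (metis One_nat_def length_0_conv length_Suc_conv)
      then have "bdiag (brk t) C" "con C" using gen by (auto simp: bds_def)
      then show ?case using assms(3)[OF tG, of C c] smult_split_class[OF tG is_wmod_string] by (simp add: C CK0_elem_eq)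
    next
      case (add x y) then show ?case using assms(4) by (simp add: emb_add tG emb_closed)
    qed
  qed
  \<comment> \<open>Induction on the size of the support: one degree \<open>t\<close> is split off
    at a time.\<close>
  have "\<forall>a\<in>carrier V. card {t \<in> G. a t \<noteq> \<one>\<^bsub>CT t\<^esub>} = n --> P a" for n
  proof (induction n)
    case 0
    have "a = \<zero>\<^bsub>V\<^esub>" if "a \<in> carrier V" "card {t \<in> G. a t \<noteq> \<one>\<^bsub>CT t\<^esub>} = 0" for a
      using that by (auto simp: carrier_V zero_V restrict_def fun_eq_iff PiE_def extensional_def)
    then show ?case using zero by blast
  next
    case (Suc n)
    show ?case
    proof (intro ballI impI)
      fix a assume a: "a \<in> carrier V" and card: "card {t \<in> G. a t \<noteq> \<one>\<^bsub>CT t\<^esub>} = Suc n"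
      then obtain t where t: "t \<in> G" "a t \<noteq> \<one>\<^bsub>CT t\<^esub>" by (metis (mono_tags, lifting) card.empty empty_Collect_eq nat.distinct(1))
      have fin: "finite {t \<in> G. a t \<noteq> \<one>\<^bsub>CT t\<^esub>}" using a by (simp add: carrier_V)
      define b where "b = (\<lambda>s\<in>G. if s = t then \<one>\<^bsub>CT s\<^esub> else a s)"
      have supp: "{s \<in> G. b s \<noteq> \<one>\<^bsub>CT s\<^esub>} = {s \<in> G. a s \<noteq> \<one>\<^bsub>CT s\<^esub>} - {t}" by (auto simp: b_def)
      have oc: "\<one>\<^bsub>CT s\<^esub> \<in> carrier (CT s)" if "s \<in> G" for s
        using group.is_monoid[OF comm_group.axioms(2)[OF CT_group[OF that]]] by (rule monoid.one_closed)
      have b: "b \<in> carrier V" unfolding carrier_V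
      proof (intro CollectI conjI)
        show "b \<in> (\<Pi>\<^sub>E t\<in>G. carrier (CT t))" using V_nth[OF a] oc by (auto simp: b_def)
        show "finite {t \<in> G. b t \<noteq> \<one>\<^bsub>CT t\<^esub>}" unfolding supp using fin by simp
      qed
      have "card {s \<in> G. b s \<noteq> \<one>\<^bsub>CT s\<^esub>} = n" unfolding supp using card fin t by simp
      then have "P b" using Suc b by blast
      have ab: "b s \<otimes>\<^bsub>CT s\<^esub> emb t (a t) s = a s" if s: "s \<in> G" for s
      proof -
        interpret comm_group "CT s" by (rule CT_group[OF s])
        show ?thesis using s l_one[OF V_nth[OF a s]] r_one[OF V_nth[OF a s]] by (cases "s = t") (simp_all add: b_def emb_def)
      qed
      have "b \<oplus>\<^bsub>V\<^esub> emb t (a t) = a"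
        using ab a by (intro ext) (auto simp: add_V carrier_V PiE_def extensional_def restrict_def)
      then show "P a" using add[OF b emb_closed[OF t(1) V_nth[OF a t(1)]] \<open>P b\<close> emb[OF t(1) V_nth[OF a t(1)]]] by simp
    qed
  qed
  then show ?thesis using a by blast
qed

subsection \<open>The rank map\<close>

definition FF :: "(complex poly => ck0) => diag => real multiset \<Rightarrow>\<^sub>0 complex" where
  "FF a s = (\<Sum>t\<in>{t \<in> G. a t \<noteq> \<one>\<^bsub>CT t\<^esub>}. single (dg t) (ckr t s (a t)))"

lemma ckr_one: "t \<in> G ==> ckr t s \<one>\<^bsub>CT t\<^esub> = 0"
  using hom_one[OF ckr(1)[OF Gam_nonzero, of t Z s] comm_group.axioms(2)[OF CT_group] group_CG] by simp

lemma FF_superset: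
  assumes "finite A" "A \<subseteq> G" "{t \<in> G. a t \<noteq> \<one>\<^bsub>CT t\<^esub>} \<subseteq> A"
  shows "FF a s = (\<Sum>t\<in>A. single (dg t) (ckr t s (a t)))"
  unfolding FF_def by (rule sum.mono_neutral_left) (use assms in \<open>auto simp: ckr_one\<close>)

lemma FF_add: assumes a: "a \<in> carrier V" and b: "b \<in> carrier V" shows "FF (a \<oplus>\<^bsub>V\<^esub> b) s = FF a s + FF b s"
proof -
  let ?A = "{t \<in> G. a t \<noteq> \<one>\<^bsub>CT t\<^esub>} \<union> {t \<in> G. b t \<noteq> \<one>\<^bsub>CT t\<^esub>}"
  have fin: "finite ?A" using a b by (simp add: carrier_V)
  have "a t \<otimes>\<^bsub>CT t\<^esub> b t = \<one>\<^bsub>CT t\<^esub>" if "t \<in> G" "t \<notin> ?A" for t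
  proof -
    interpret comm_group "CT t" by (rule CT_group[OF that(1)])
    show ?thesis using that by simp
  qed
  then have "FF (a \<oplus>\<^bsub>V\<^esub> b) s = (\<Sum>t\<in>?A. single (dg t) (ckr t s ((a \<oplus>\<^bsub>V\<^esub> b) t)))"
    by (intro FF_superset fin) (auto simp: add_V)
  also have "\<dots> = (\<Sum>t\<in>?A. single (dg t) (ckr t s (a t)) + single (dg t) (ckr t s (b t)))"
  proof (rule sum.cong[OF refl])
    fix t assume "t \<in> ?A"
    then have t: "t \<in> G" by auto
    show "single (dg t) (ckr t s ((a \<oplus>\<^bsub>V\<^esub> b) t)) = single (dg t) (ckr t s (a t)) + single (dg t) (ckr t s (b t))"
      using hom_mult[OF ckr(1)[OF Gam_nonzero[OF t]] V_nth[OF a t] V_nth[OF b t]] t by (simp add: add_V single_add)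
  qed
  also have "\<dots> = FF a s + FF b s" using fin by (simp add: sum.distrib FF_superset[of ?A a] FF_superset[of ?A b])
  finally show ?thesis .
qed

lemma FF_smult: assumes a: "a \<in> carrier V" shows "FF (c \<odot>\<^bsub>V\<^esub> a) s = cst c * FF a s"
proof -
  let ?A = "{t \<in> G. a t \<noteq> \<one>\<^bsub>CT t\<^esub>}"
  have fin: "finite ?A" using a by (simp add: carrier_V)
  have "{t \<in> G. (c \<odot>\<^bsub>V\<^esub> a) t \<noteq> \<one>\<^bsub>CT t\<^esub>} \<subseteq> ?A"
    using K0_group.smult_CK0_one[OF K0_group_Gam] by (fastforce simp: smult_V)
  then have "FF (c \<odot>\<^bsub>V\<^esub> a) s = (\<Sum>t\<in>?A. single (dg t) (ckr t s ((c \<odot>\<^bsub>V\<^esub> a) t)))"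
    by (intro FF_superset fin) auto
  also have "\<dots> = cst c * FF a s"
    unfolding FF_def sum_distrib_left
    by (rule sum.cong[OF refl]) (auto simp: smult_V ckr(3)[OF Gam_nonzero V_nth[OF a]] cst_mult_single)
  finally show ?thesis .
qed

lemma FF_zero: "FF \<zero>\<^bsub>V\<^esub> s = 0" using FF_add[of "\<zero>\<^bsub>V\<^esub>" "\<zero>\<^bsub>V\<^esub>" s] by simp

lemma FF_emb: "t \<in> G ==> FF (emb t x) s = single (dg t) (ckr t s x)"
  by (subst FF_superset[of "{t}"]) (auto simp: emb_def)

lemma FF_class:
  assumes t: "t \<in> G" and M: "is_wmod t M"
  shows "FF (split_class Z t M) s = single (dg t) (of_nat (rk t s M))"
proof -
  obtain Ds where Ds: "bds t Ds" "module_iso (GWA t) (NM t Ds) M \<noteq> {}" using M by (auto simp: is_wmod_def)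
  have "K0_class t M = K0_class t (NM t Ds)" by (rule K0_group.K0_class_iso[OF K0_group_Gam[OF t] Ds])
  moreover have "rk t s (NM t Ds) = rk t s M"
    using rk_eq[OF Gam_nonzero[OF t] Ds(1) Ds(2), of s] rk_eq[OF Gam_nonzero[OF t] Ds(1), of "NM t Ds" s] module_iso_id by auto
  ultimately show ?thesis
    using ckr(2)[OF Gam_nonzero[OF t] NM_wmod[OF Ds(1)], of s 1] by (simp add: split_class_emb t FF_emb)
qed

lemma FF_gen:
  assumes "t \<in> G" "bdiag (brk t) C"
  shows "FF (c \<odot>\<^bsub>V\<^esub> split_class Z t (NM t [C])) s = single (dg t) (c * of_nat (ind s C))"
proof -
  have "bds t [C]" using assms by (simp add: bds_def)
  then have "rk t s (NM t [C]) = ind s C" using rk_eq[OF Gam_nonzero[OF assms(1)], of "[C]" "NM t [C]"] module_iso_id by auto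
  then show ?thesis using assms
    by (simp add: FF_smult split_class_closed is_wmod_string FF_class cst_mult_single)
qed

definition gel :: "(complex poly \<times> diag => complex) => complex poly \<times> diag => complex poly => ck0" where
  "gel c x = c x \<odot>\<^bsub>V\<^esub> split_class Z (fst x) (NM (fst x) [snd x])"

definition strs where "strs = {(t, C). t \<in> G \<and> bdiag (brk t) C \<and> con C}"

lemma gel_closed: "x \<in> strs ==> gel c x \<in> carrier V"
  by (auto simp: strs_def gel_def intro!: smult_closed split_class_closed is_wmod_string)

lemma gel_add: assumes "x \<in> strs" shows "gel (\<lambda>x. c x + d x) x = gel c x \<oplus>\<^bsub>V\<^esub> gel d x"
proof -
  obtain t C where x: "x = (t, C)" "t \<in> G" "bdiag (brk t) C" using assms by (auto simp: strs_def)
  interpret K0_group t by (rule K0_group_Gam[OF x(2)])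
  have "K0_class t (NM t [C]) \<in> carrier (K0_split t)" by (rule K0_class_closed[OF is_wmod_string[OF x(3)]])
  then have "CK0_elem t (c x + d x) (K0_class t (NM t [C])) = CK0_elem t (c x) (K0_class t (NM t [C])) \<otimes>\<^bsub>CT t\<^esub> CK0_elem t (d x) (K0_class t (NM t [C]))"
    unfolding CK0_elem_eq using T.tens_add_l[of "c x" "d x"] by simp
  then show ?thesis using smult_split_class[OF x(2) is_wmod_string[OF x(3)]] by (simp add: gel_def x(1) emb_add x(2))
qed

lemma gel_0: assumes "x \<in> strs" "c x = 0" shows "gel c x = \<zero>\<^bsub>V\<^esub>"
proof -
  have "gel c x = gel c x \<oplus>\<^bsub>V\<^esub> gel c x" using gel_add[OF assms(1), of c c] assms(2) by (simp add: gel_def)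
  then show ?thesis using gel_closed[OF assms(1), of c] by (metis V.add.r_cancel_one V.zero_closed)
qed

lemma V_finsum: "a \<in> carrier V ==> \<exists>A c. finite A \<and> A \<subseteq> strs \<and> a = finsum V (gel c) A"
proof (induction rule: V_induct)
  case zero then show ?case by (intro exI[of _ "{}"]) auto
next
  case (gen c t C)
  then have x: "(t, C) \<in> strs" by (simp add: strs_def)
  have "c \<odot>\<^bsub>V\<^esub> split_class Z t (NM t [C]) = gel (\<lambda>_. c) (t, C)" by (simp add: gel_def)
  then show ?case using gel_closed[OF x, of "\<lambda>_. c"] x
    by (intro exI[of _ "{(t, C)}"] exI[of _ "\<lambda>_. c"]) auto
next
  case (add a b)
  then obtain A c B d where A: "finite A" "A \<subseteq> strs" "a = finsum V (gel c) A" and B: "finite B" "B \<subseteq> strs" "b = finsum V (gel d) B" by blast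
  let ?c = "\<lambda>x. if x \<in> A then c x else 0" and ?d = "\<lambda>x. if x \<in> B then d x else 0"
  have e: "gel c x = gel ?c x" if "x \<in> A" for x using that by (simp add: gel_def)
  have e': "gel d x = gel ?d x" if "x \<in> B" for x using that by (simp add: gel_def)
  have a: "a = finsum V (gel ?c) (A \<union> B)" unfolding A(3)
    by (rule V.add.finprod_mono_neutral_cong_left) (use A B gel_closed gel_0[of _ ?c] e in \<open>auto simp del: if_split\<close>)
  have b: "b = finsum V (gel ?d) (A \<union> B)" unfolding B(3)
    by (rule V.add.finprod_mono_neutral_cong_left) (use A B gel_closed gel_0[of _ ?d] e' in \<open>auto simp del: if_split\<close>)
  have "a \<oplus>\<^bsub>V\<^esub> b = finsum V (\<lambda>x. gel ?c x \<oplus>\<^bsub>V\<^esub> gel ?d x) (A \<union> B)"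
    unfolding a b by (rule V.finsum_addf[symmetric]) (use A B gel_closed in auto)
  also have "\<dots> = finsum V (gel (\<lambda>x. ?c x + ?d x)) (A \<union> B)"
    by (rule V.finsum_cong') (use A B gel_closed gel_add[of _ ?c ?d] in \<open>auto simp del: if_split\<close>)
  finally show ?case using A B by (intro exI[of _ "A \<union> B"] exI[of _ "\<lambda>x. ?c x + ?d x"]) auto
qed

lemma FF_finsum:
  assumes "finite A" "A \<subseteq> strs"
  shows "FF (finsum V (gel c) A) s = (\<Sum>x\<in>A. single (dg (fst x)) (c x * of_nat (ind s (snd x))))"
  using assms
proof (induction A rule: finite_induct)
  case empty then show ?case by (simp add: FF_zero)
next
  case (insert x A)
  have x: "fst x \<in> G" "bdiag (brk (fst x)) (snd x)" using insert by (auto simp: strs_def)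
  have "FF (finsum V (gel c) (insert x A)) s = FF (gel c x \<oplus>\<^bsub>V\<^esub> finsum V (gel c) A) s"
    using insert gel_closed by (subst V.finsum_insert) auto
  also have "\<dots> = FF (gel c x) s + FF (finsum V (gel c) A) s"
    using insert gel_closed by (intro FF_add V.finsum_closed) auto
  also have "FF (gel c x) s = single (dg (fst x)) (c x * of_nat (ind s (snd x)))"
    unfolding gel_def by (rule FF_gen[OF x])
  finally show ?case using insert by simp
qed

text \<open>An element is a finite combination of classes of strings; if its ranks are zero,
  \<open>ind_independent\<close> makes the coefficients vanish. As \<open>dg\<close> is injective on
  degrees, no two terms share both exponent and string.\<close>

lemma FF_inj0: assumes a: "a \<in> carrier V" and z: "\<And>s. FF a s = 0" shows "a = \<zero>\<^bsub>V\<^esub>"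
proof -
  obtain A c where A: "finite A" "A \<subseteq> strs" "a = finsum V (gel c) A" using V_finsum[OF a] by blast
  have "c x = 0" if "x \<in> A" for x
  proof (rule ind_independent[OF A(1), of "\<lambda>x. dg (fst x)" snd])
    fix x y assume "x \<in> A" "y \<in> A" "dg (fst x) = dg (fst y)" "snd x = snd y"
    moreover have "fst x \<in> G" "fst y \<in> G" using A(2) \<open>x \<in> A\<close> \<open>y \<in> A\<close> by (auto simp: strs_def)
    ultimately show "x = y" using dg_inj[of "fst x" Z "fst y"] by (simp add: prod_eq_iff)
  next
    show "(\<Sum>x\<in>A. single (dg (fst x)) (c x * of_nat (ind s (snd x)))) = 0" for s
      using z[of s] FF_finsum[OF A(1,2)] A(3) by simp
  qed (use A(2) that in \<open>auto simp: strs_def\<close>)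
  then show ?thesis unfolding A(3) by (intro V.add.finprod_one_eqI) (use gel_0 A(2) in auto)
qed

lemma FF_inj: assumes a: "a \<in> carrier V" and b: "b \<in> carrier V" and e: "\<And>s. FF a s = FF b s" shows "a = b"
proof -
  have "FF (a \<ominus>\<^bsub>V\<^esub> b) s = 0" for s
  proof -
    have "FF (a \<ominus>\<^bsub>V\<^esub> b \<oplus>\<^bsub>V\<^esub> b) s = FF (a \<ominus>\<^bsub>V\<^esub> b) s + FF b s" using a b by (intro FF_add) auto
    moreover have "a \<ominus>\<^bsub>V\<^esub> b \<oplus>\<^bsub>V\<^esub> b = a" using a b by (simp add: V.minus_eq V.a_assoc V.l_neg)
    ultimately show ?thesis using e[of s] by simp
  qed
  then have "a \<ominus>\<^bsub>V\<^esub> b = \<zero>\<^bsub>V\<^esub>" using a b by (intro FF_inj0) auto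
  then show ?thesis using a b by (metis V.add.inv_closed V.minus_eq V.minus_minus V.minus_equality V.a_comm)
qed

subsection \<open>The multiplication\<close>

text \<open>The ranks of two strings multiply to the ranks of their intersection, which is a diagram
  for the product of the two polynomials. This provides products in \<open>V\<close> before a
  multiplication is known to exist.\<close>

lemma FF_image_mult:
  assumes a: "a \<in> carrier V" and b: "b \<in> carrier V"
  shows "\<exists>x\<in>carrier V. \<forall>s. FF x s = FF a s * FF b s"
  using a
proof (induction rule: V_induct)
  case zero then show ?case by (intro bexI[of _ "\<zero>\<^bsub>V\<^esub>"]) (auto simp: FF_zero)
next
  case (gen c t C)
  let ?a = "c \<odot>\<^bsub>V\<^esub> split_class Z t (NM t [C])"
  show ?case using b
  proof (induction rule: V_induct)
    case zero then show ?case by (intro bexI[of _ "\<zero>\<^bsub>V\<^esub>"]) (auto simp: FF_zero)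
  next
    case gen': (gen c' t' C')
    let ?x = "(c * c') \<odot>\<^bsub>V\<^esub> split_class Z (t * t') (NM (t * t') [C \<inter> C'])"
    have bd: "bdiag (brk (t * t')) (C \<inter> C')" unfolding brk_mult by (rule bdiag_Int[OF gen(2) gen'(2)])
    have "FF ?x s = FF ?a s * FF (c' \<odot>\<^bsub>V\<^esub> split_class Z t' (NM t' [C'])) s" for s
      using gen gen' bd Gam_mult[OF gen(1) gen'(1)]
      by (simp add: FF_gen mult_single dg_mult Gam_nonzero ind_Int mult_ac)
    moreover have "?x \<in> carrier V"
      using bd Gam_mult[OF gen(1) gen'(1)] by (intro smult_closed split_class_closed is_wmod_string)
    ultimately show ?case by blast
  next
    case (add b b')
    then obtain x x' where "x \<in> carrier V" "\<forall>s. FF x s = FF ?a s * FF b s" "x' \<in> carrier V" "\<forall>s. FF x' s = FF ?a s * FF b' s" by blast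
    then show ?case using add by (intro bexI[of _ "x \<oplus>\<^bsub>V\<^esub> x'"]) (auto simp: FF_add distrib_left)
  qed
next
  case (add a a')
  then obtain x x' where "x \<in> carrier V" "\<forall>s. FF x s = FF a s * FF b s" "x' \<in> carrier V" "\<forall>s. FF x' s = FF a' s * FF b s" by blast
  then show ?case using add by (intro bexI[of _ "x \<oplus>\<^bsub>V\<^esub> x'"]) (auto simp: FF_add distrib_right)
qed

abbreviation mult_spec where
  "mult_spec \<mu> \<equiv> (\<forall>a\<in>carrier V. \<forall>b\<in>carrier V. \<mu> a b \<in> carrier V
        \<and> (\<forall>a'\<in>carrier V. \<mu> (a \<oplus>\<^bsub>V\<^esub> a') b = \<mu> a b \<oplus>\<^bsub>V\<^esub> \<mu> a' b)
        \<and> (\<forall>b'\<in>carrier V. \<mu> a (b \<oplus>\<^bsub>V\<^esub> b') = \<mu> a b \<oplus>\<^bsub>V\<^esub> \<mu> a b')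
        \<and> (\<forall>c. \<mu> (c \<odot>\<^bsub>V\<^esub> a) b = c \<odot>\<^bsub>V\<^esub> \<mu> a b \<and> \<mu> a (c \<odot>\<^bsub>V\<^esub> b) = c \<odot>\<^bsub>V\<^esub> \<mu> a b))
     \<and> (\<forall>t\<in>Gam Z. \<forall>t'\<in>Gam Z. \<forall>M\<in>wmod_O t. \<forall>M'\<in>wmod_O t'.
          \<mu> (split_class Z t M) (split_class Z t' M') = split_class Z (t * t') (gwa_tensor t t' M M'))"

lemma mult_spec_exists: "\<exists>\<mu>. mult_spec \<mu>"
proof -
  \<comment> \<open>The product is pulled back from the ranks, and all laws are verified
    there.\<close>
  define m where "m a b = (SOME x. x \<in> carrier V \<and> (\<forall>s. FF x s = FF a s * FF b s))" for a b
  have m: "m a b \<in> carrier V \<and> (\<forall>s. FF (m a b) s = FF a s * FF b s)" if "a \<in> carrier V" "b \<in> carrier V" for a b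
    unfolding m_def by (rule someI_ex[of "\<lambda>x. x \<in> carrier V \<and> (\<forall>s. FF x s = FF a s * FF b s)"]) (use FF_image_mult[OF that] in blast)
  have "mult_spec m"
  proof (intro conjI ballI allI)
    fix a b assume ab: "a \<in> carrier V" "b \<in> carrier V"
    show "m a b \<in> carrier V" using m ab by blast
    show "m (a \<oplus>\<^bsub>V\<^esub> a') b = m a b \<oplus>\<^bsub>V\<^esub> m a' b" if "a' \<in> carrier V" for a'
      by (rule FF_inj) (use ab that m in \<open>auto simp: FF_add distrib_right\<close>)
    show "m a (b \<oplus>\<^bsub>V\<^esub> b') = m a b \<oplus>\<^bsub>V\<^esub> m a b'" if "b' \<in> carrier V" for b'
      by (rule FF_inj) (use ab that m in \<open>auto simp: FF_add distrib_left\<close>)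
    show "m (c \<odot>\<^bsub>V\<^esub> a) b = c \<odot>\<^bsub>V\<^esub> m a b" for c
      by (rule FF_inj) (use ab m smult_closed in \<open>auto simp: FF_smult mult.assoc\<close>)
    show "m a (c \<odot>\<^bsub>V\<^esub> b) = c \<odot>\<^bsub>V\<^esub> m a b" for c
      by (rule FF_inj) (use ab m smult_closed in \<open>auto simp: FF_smult mult_ac\<close>)
  next
    fix t t' M M' assume t: "t \<in> G" "t' \<in> G" and M: "M \<in> wmod_O t" "M' \<in> wmod_O t'"
    have w: "is_wmod t M" "is_wmod t' M'" using t M is_wmod_wmod_O Gam_nonzero by blast+
    have nz: "t \<noteq> 0" "t' \<noteq> 0" using t Gam_nonzero by blast+
    have tw: "is_wmod (t * t') (gwa_tensor t t' M M')"
      using rk_tensor(2)[OF nz, of M M'] M by (simp add: is_wmod_def wmod_O_def)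
    show "m (split_class Z t M) (split_class Z t' M') = split_class Z (t * t') (gwa_tensor t t' M M')"
    proof (rule FF_inj)
      fix s
      show "FF (m (split_class Z t M) (split_class Z t' M')) s = FF (split_class Z (t * t') (gwa_tensor t t' M M')) s"
        using m[OF split_class_closed[OF t(1) w(1)] split_class_closed[OF t(2) w(2)]] rk_tensor(1)[OF nz, of M M' s] M
        by (simp add: FF_class t w tw Gam_mult mult_single dg_mult nz wmod_O_def)
      show "m (split_class Z t M) (split_class Z t' M') \<in> carrier V"
        using m[OF split_class_closed[OF t(1) w(1)] split_class_closed[OF t(2) w(2)]] by blast
      show "split_class Z (t * t') (gwa_tensor t t' M M') \<in> carrier V" by (rule split_class_closed[OF Gam_mult[OF t] tw])
    qed
  qed
  then show ?thesis by blast
qed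

lemma split_mult_spec: "mult_spec (split_mult Z)"
  unfolding split_mult_def Let_def by (rule someI_ex[OF mult_spec_exists])

lemma split_mult_closed: "a \<in> carrier V ==> b \<in> carrier V ==> split_mult Z a b \<in> carrier V"
  using split_mult_spec by blast

text \<open>Bilinearity reduces the claim to classes of strings, where the specification prescribes
  the class of a tensor product and \<open>rk_tensor\<close> applies. So any multiplication that
  meets the specification has these ranks.\<close>

lemma FF_mult:
  assumes a: "a \<in> carrier V" and b: "b \<in> carrier V"
  shows "FF (split_mult Z a b) s = FF a s * FF b s"
proof -
  let ?m = "split_mult Z"
  note sp = split_mult_spec[THEN conjunct1, THEN bspec, THEN bspec]
  have ml: "?m (x \<oplus>\<^bsub>V\<^esub> x') y = ?m x y \<oplus>\<^bsub>V\<^esub> ?m x' y" if "x \<in> carrier V" "x' \<in> carrier V" "y \<in> carrier V" for x x' y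
    using sp[OF that(1,3)] that(2) by blast
  have mr: "?m x (y \<oplus>\<^bsub>V\<^esub> y') = ?m x y \<oplus>\<^bsub>V\<^esub> ?m x y'" if "x \<in> carrier V" "y \<in> carrier V" "y' \<in> carrier V" for x y y'
    using sp[OF that(1,2)] that(3) by blast
  have sl: "?m (c \<odot>\<^bsub>V\<^esub> x) y = c \<odot>\<^bsub>V\<^esub> ?m x y" "?m x (c \<odot>\<^bsub>V\<^esub> y) = c \<odot>\<^bsub>V\<^esub> ?m x y" if "x \<in> carrier V" "y \<in> carrier V" for x y c
    using sp[OF that] by blast+
  have mc: "?m (split_class Z t M) (split_class Z t' M') = split_class Z (t * t') (gwa_tensor t t' M M')"
    if "t \<in> G" "t' \<in> G" "M \<in> wmod_O t" "M' \<in> wmod_O t'" for t t' M M'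
    using split_mult_spec that by blast
  have z: "?m \<zero>\<^bsub>V\<^esub> y = \<zero>\<^bsub>V\<^esub>" "?m y \<zero>\<^bsub>V\<^esub> = \<zero>\<^bsub>V\<^esub>" if "y \<in> carrier V" for y
    using ml[of "\<zero>\<^bsub>V\<^esub>" "\<zero>\<^bsub>V\<^esub>" y] mr[of y "\<zero>\<^bsub>V\<^esub>" "\<zero>\<^bsub>V\<^esub>"] split_mult_closed[of "\<zero>\<^bsub>V\<^esub>" y] split_mult_closed[of y "\<zero>\<^bsub>V\<^esub>"] that
    by (simp_all add: V.add.l_cancel_one')
  show ?thesis using a
  proof (induction rule: V_induct)
    case zero then show ?case using b by (simp add: z FF_zero)
  next
    case (gen c t C)
    let ?N = "NM t [C]"
    have w: "?N \<in> wmod_O t" "split_class Z t ?N \<in> carrier V"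
      using gen NM_wmod[of t "[C]"] split_class_closed is_wmod_string by (auto simp: bds_def)
    have "FF (?m (split_class Z t ?N) b) s = FF (split_class Z t ?N) s * FF b s" using b
    proof (induction rule: V_induct)
      case zero then show ?case using w by (simp add: z FF_zero)
    next
      case gen': (gen c' t' C')
      let ?N' = "NM t' [C']"
      have w': "?N' \<in> wmod_O t'" "split_class Z t' ?N' \<in> carrier V"
        using gen' NM_wmod[of t' "[C']"] split_class_closed is_wmod_string by (auto simp: bds_def)
      have nz: "t \<noteq> 0" "t' \<noteq> 0" using gen gen' Gam_nonzero by blast+
      have tw: "is_wmod (t * t') (gwa_tensor t t' ?N ?N')"
        using rk_tensor(2)[OF nz, of ?N ?N'] w w' by (simp add: is_wmod_def wmod_O_def)
      have "FF (?m (split_class Z t ?N) (split_class Z t' ?N')) s = FF (split_class Z t ?N) s * FF (split_class Z t' ?N') s"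
        using rk_tensor(1)[OF nz, of ?N ?N' s] w w' gen gen'
        by (simp add: mc FF_class tw Gam_mult is_wmod_string mult_single dg_mult nz wmod_O_def)
      then show ?case using w w' by (simp add: sl FF_smult split_mult_closed mult_ac)
    next
      case (add x y)
      then show ?case using w by (simp add: mr FF_add split_mult_closed distrib_left)
    qed
    then show ?case using w b by (simp add: sl FF_smult split_mult_closed mult_ac)
  next
    case (add x y)
    then show ?case using b by (simp add: ml FF_add split_mult_closed distrib_right)
  qed
qed

end

section \<open>The presented algebra\<close>

lemma int_step_left:
  fixes v w :: int
  assumes "v < w" "P w" "\<not> P v"
  shows "\<exists>l. v \<le> l \<and> l < w \<and> \<not> P l \<and> P (l + 1)"
proof -
  have "\<forall>v. w = v + 1 + int n --> P w --> \<not> P v --> (\<exists>l. v \<le> l \<and> l < w \<and> \<not> P l \<and> P (l + 1))" for n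
  proof (induction n)
    case 0 then show ?case by (intro allI impI) (rule_tac x = v in exI, simp)
  next
    case (Suc n)
    show ?case
    proof (intro allI impI)
      fix v assume v: "w = v + 1 + int (Suc n)" "P w" "\<not> P v"
      show "\<exists>l. v \<le> l \<and> l < w \<and> \<not> P l \<and> P (l + 1)"
      proof (cases "P (v + 1)")
        case True then show ?thesis using v by (intro exI[of _ v]) simp
      next
        case False
        moreover have "w = (v + 1) + 1 + int n" using v by simp
        ultimately obtain l where "v + 1 \<le> l" "l < w" "\<not> P l" "P (l + 1)" using Suc v(2) by blast
        then show ?thesis by (intro exI[of _ l]) simp
      qed
    qed
  qed
  from this[of "nat (w - v - 1)"] show ?thesis using assms by simp
qed

lemma con_convex: "con C ==> Vx a \<in> C ==> Vx c \<in> C ==> a \<le> b ==> b \<le> c ==> Vx b \<in> C"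
  unfolding con_def by (cases "b = c") (simp, meson order_le_less)

text \<open>Away from \<open>A\<close> two neighbouring weights occur together, so a string can end
  only at a break.\<close>

lemma string_left_end:
  assumes C: "con C" "bdiag A C" and v: "Vx w \<in> C" "Vx v \<notin> C" "v < w"
  shows "\<exists>l\<in>A. v \<le> l \<and> (\<forall>u. Vx u \<in> C --> l < u)"
proof -
  obtain l where l: "v \<le> l" "l < w" "Vx l \<notin> C" "Vx (l + 1) \<in> C"
    using int_step_left[OF v(3), of "\<lambda>x. Vx x \<in> C"] v by auto
  have "l \<in> A" using C(2) l by (auto simp: bdiag_def)
  moreover have "l < u" if u: "Vx u \<in> C" for u
    using con_convex[OF C(1) u l(4), of l] l by linarith
  ultimately show ?thesis using l by blast
qed

lemma string_right_end:
  assumes C: "con C" "bdiag A C" and v: "Vx w \<in> C" "Vx v \<notin> C" "w < v"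
  shows "\<exists>l\<in>A. l < v \<and> (\<forall>u. Vx u \<in> C --> u \<le> l)"
proof -
  obtain l where l: "w \<le> l" "l < v" "Vx l \<in> C" "Vx (l + 1) \<notin> C"
    using int_step_left[OF v(3), of "\<lambda>x. Vx x \<notin> C"] v by auto
  have "l \<in> A" using C(2) l by (auto simp: bdiag_def)
  moreover have "u \<le> l" if u: "Vx u \<in> C" for u
    using con_convex[OF C(1) l(3) u, of "l + 1"] l by linarith
  ultimately show ?thesis using l by blast
qed

subsection \<open>Diagrams of the generators\<close>

primrec pos :: "gen => real" where
  "pos (XPlus k) = k" | "pos (XMinus k) = k" | "pos (YPlus k) = k" | "pos (YMinus k) = k"

text \<open>For \<open>k\<close> in \<open>\<int> + 1/2\<close> the weights above \<open>k\<close>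
  are those above \<open>\<lfloor>k\<rfloor>\<close>. Each \<open>Y\<close> diagram lacks a single
  arrow at the break, the one that acts as zero in the corresponding module.\<close>

primrec gd :: "gen => diag" where
  "gd (XPlus k) = {x. case x of Vx l => \<lfloor>k\<rfloor> < l | Up l => \<lfloor>k\<rfloor> < l | Dn l => \<lfloor>k\<rfloor> < l}"
| "gd (XMinus k) = {x. case x of Vx l => l \<le> \<lfloor>k\<rfloor> | Up l => l < \<lfloor>k\<rfloor> | Dn l => l < \<lfloor>k\<rfloor>}"
| "gd (YPlus k) = - {Dn \<lfloor>k\<rfloor>}"
| "gd (YMinus k) = - {Up \<lfloor>k\<rfloor>}"

abbreviation flo :: "real multiset => int set" where "flo d \<equiv> floor ` set_mset d"

lemma bdiag_gd: "bdiag {\<lfloor>pos g\<rfloor>} (gd g)"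
  by (cases g) (auto simp: bdiag_def)

lemma con_gd: "con (gd g)" "con UNIV"
proof -
  have "Vx (\<lfloor>k\<rfloor> + 1) \<in> gd (XPlus k)" "Vx \<lfloor>k\<rfloor> \<in> gd (XMinus k)" for k by auto
  then show "con (gd g)" by (cases g) (auto simp: con_def gt_ex)
qed (auto simp: con_def)

lemma bdiag_UNIV: "bdiag {} UNIV" by (auto simp: bdiag_def)

text \<open>The half line beyond \<open>k\<close> contains no cell with index up to
  \<open>\<lfloor>j\<rfloor>\<close>, and only there do the diagrams of \<open>XPlus j\<close>,
  \<open>YPlus j\<close> and \<open>YMinus j\<close> differ. The situation on the left is
  symmetric.\<close>

lemma gd_Int:
  "j \<le> k ==> gd (YPlus j) \<inter> gd (XPlus k) = gd (XPlus j) \<inter> gd (XPlus k)"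
  "j \<le> k ==> gd (YMinus j) \<inter> gd (XPlus k) = gd (XPlus j) \<inter> gd (XPlus k)"
  "j \<le> k ==> gd (XMinus j) \<inter> gd (YPlus k) = gd (XMinus j) \<inter> gd (XMinus k)"
  "j \<le> k ==> gd (XMinus j) \<inter> gd (YMinus k) = gd (XMinus j) \<inter> gd (XMinus k)"
proof -
  have "\<lfloor>j\<rfloor> \<le> \<lfloor>k\<rfloor>" if "j \<le> k" for j k :: real using that by (rule floor_mono)
  then show "j \<le> k ==> gd (YPlus j) \<inter> gd (XPlus k) = gd (XPlus j) \<inter> gd (XPlus k)"
  "j \<le> k ==> gd (YMinus j) \<inter> gd (XPlus k) = gd (XPlus j) \<inter> gd (XPlus k)"
  "j \<le> k ==> gd (XMinus j) \<inter> gd (YPlus k) = gd (XMinus j) \<inter> gd (XMinus k)"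
  "j \<le> k ==> gd (XMinus j) \<inter> gd (YMinus k) = gd (XMinus j) \<inter> gd (XMinus k)"
    by (fastforce split: cell.splits)+
qed

lemma ind_gd_disjoint: "j \<le> k ==> ind s (gd (XMinus j) \<inter> gd (XPlus k)) = 0"
proof -
  assume "j \<le> k"
  then have "\<lfloor>j\<rfloor> \<le> \<lfloor>k\<rfloor>" by (rule floor_mono)
  then have "x \<notin> gd (XMinus j) \<inter> gd (XPlus k)" for x by (cases x) auto
  then have "gd (XMinus j) \<inter> gd (XPlus k) = {}" by blast
  then show ?thesis by (auto simp: ind_def con_def)
qed

text \<open>Without an arrow across the break at \<open>k\<close>, a connected \<open>s\<close> lies
  entirely on one side of it. This is the source of the relation for
  \<open>yp k * ym k\<close>.\<close>

lemma ind_gd_split: "ind s (gd (YPlus k) \<inter> gd (YMinus k)) = ind s (gd (XPlus k)) + ind s (gd (XMinus k))"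
proof (cases "con s")
  case True
  let ?h = "\<lfloor>k\<rfloor>"
  obtain w where w: "Vx w \<in> s" using True by (auto simp: con_def)
  have e: "Vx l \<in> s" "Vx (l + 1) \<in> s" if "Up l \<in> s \<or> Dn l \<in> s" for l using True that by (auto simp: con_def)
  have R: "s \<subseteq> gd (XPlus k) \<longleftrightarrow> (\<forall>u. Vx u \<in> s --> ?h < u)" using e by (fastforce split: cell.splits)
  have L: "s \<subseteq> gd (XMinus k) \<longleftrightarrow> (\<forall>u. Vx u \<in> s --> u \<le> ?h)" using e by (fastforce split: cell.splits)
  have YY: "s \<subseteq> gd (YPlus k) \<inter> gd (YMinus k) \<longleftrightarrow> Up ?h \<notin> s \<and> Dn ?h \<notin> s" by auto
  have RL: "\<not> (s \<subseteq> gd (XPlus k) \<and> s \<subseteq> gd (XMinus k))" unfolding R L using w by force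
  have "s \<subseteq> gd (YPlus k) \<inter> gd (YMinus k) \<longleftrightarrow> s \<subseteq> gd (XPlus k) \<or> s \<subseteq> gd (XMinus k)"
  proof
    assume a: "s \<subseteq> gd (YPlus k) \<inter> gd (YMinus k)"
    show "s \<subseteq> gd (XPlus k) \<or> s \<subseteq> gd (XMinus k)"
    proof (rule ccontr)
      assume "\<not> ?thesis"
      then obtain u u' where u: "Vx u \<in> s" "\<not> ?h < u" "Vx u' \<in> s" "\<not> u' \<le> ?h" unfolding R L by blast
      then have "u \<le> ?h" "?h < u'" by simp_all
      then have "Up ?h \<in> s \<or> Dn ?h \<in> s" using True u unfolding con_def by blast
      then show False using a YY by blast
    qed
  next
    assume "s \<subseteq> gd (XPlus k) \<or> s \<subseteq> gd (XMinus k)"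
    then show "s \<subseteq> gd (YPlus k) \<inter> gd (YMinus k)" unfolding YY R L using e by force
  qed
  then show ?thesis using RL True unfolding ind_def by auto
qed (simp add: ind_def)

subsection \<open>The rank map on polynomials\<close>

definition md :: "(gen \<Rightarrow>\<^sub>0 nat) => diag" where "md m = (\<Inter>g\<in>keys m. gd g)"

definition mdeg :: "(gen \<Rightarrow>\<^sub>0 nat) => real multiset" where
  "mdeg m = (\<Sum>g\<in>keys m. replicate_mset (lkp m g) (pos g))"

definition EE :: "diag => gpoly => real multiset \<Rightarrow>\<^sub>0 complex" where
  "EE s = lext (\<lambda>m. single (mdeg m) (of_nat (ind s (md m))))"

lemma keys_add_nat: "keys (m + n) = keys m \<union> keys n" for m n :: "'a \<Rightarrow>\<^sub>0 nat"
  by (auto simp: in_keys_iff lookup_add)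

lemma md_add: "md (m + n) = md m \<inter> md n" by (auto simp: md_def keys_add_nat)

lemma mdeg_superset: "finite A ==> keys m \<subseteq> A ==> mdeg m = (\<Sum>g\<in>A. replicate_mset (lkp m g) (pos g))"
  unfolding mdeg_def by (rule sum.mono_neutral_left) (auto simp: in_keys_iff)

lemma replicate_mset_add: "replicate_mset (m + n) x = replicate_mset m x + replicate_mset n x"
  by (induction m) auto

lemma mdeg_add: "mdeg (m + n) = mdeg m + mdeg n"
proof -
  let ?A = "keys m \<union> keys n"
  have "mdeg (m + n) = (\<Sum>g\<in>?A. replicate_mset (lkp (m + n) g) (pos g))" by (rule mdeg_superset) (auto simp: keys_add_nat)
  also have "\<dots> = (\<Sum>g\<in>?A. replicate_mset (lkp m g) (pos g)) + (\<Sum>g\<in>?A. replicate_mset (lkp n g) (pos g))"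
    by (simp add: lookup_add replicate_mset_add sum.distrib)
  finally show ?thesis by (simp add: mdeg_superset[of ?A m] mdeg_superset[of ?A n])
qed

lemma EE_add: "EE s (p + q) = EE s p + EE s q" by (simp add: EE_def lext_add)

lemma EE_cst: "EE s (cst c * p) = cst c * EE s p" unfolding EE_def by (rule lext_cst)

lemma EE_0 [simp]: "EE s 0 = 0" by (simp add: EE_def)

lemma EE_diff: "EE s (p - q) = EE s p - EE s q" using EE_add[of s "p - q" q] by simp

lemma EE_sum: "EE s (sum f A) = (\<Sum>x\<in>A. EE s (f x))" by (simp add: EE_def lext_sum)

lemma EE_mult: "EE s (p * q) = EE s p * EE s q"
proof (induction p rule: poly_mapping_induct)
  case (single m a)
  show ?case
  proof (induction q rule: poly_mapping_induct)
    case (single n b)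
    show ?case by (simp add: EE_def lext_single mult_single mdeg_add md_add ind_Int mult_ac)
  qed (simp_all add: EE_add distrib_left)
qed (simp_all add: EE_add distrib_right)

lemma EE_1: "con s ==> EE s 1 = 1"
proof -
  assume "con s"
  then have "EE s (cst 1) = cst 1" by (simp add: EE_def lext_single mdeg_def md_def ind_def mult_single del: single_one)
  then show ?thesis by simp
qed

lemma EE_gvar: "EE s (gvar g) = single {#pos g#} (of_nat (ind s (gd g)))"
  by (simp add: EE_def gvar_def lext_single mdeg_def md_def)

lemma EE_gen_rels: assumes "r \<in> gen_rels Z" shows "EE s r = 0"
proof -
  have 1: "EE s (gvar g * gvar g') = single ({#pos g#} + {#pos g'#}) (of_nat (ind s (gd g \<inter> gd g')))" for g g'
    by (simp add: EE_mult EE_gvar mult_single ind_Int)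
  have 2: "EE s (yp k * ym k - (xp k ^ 2 + xm k ^ 2)) = 0" for k
    unfolding power2_eq_square EE_diff EE_add 1 Int_absorb ind_gd_split by (simp add: single_add)
  show ?thesis using assms unfolding gen_rels_def
    by (elim UnE CollectE exE conjE) ((simp_all only: EE_diff 1 gd_Int ind_gd_disjoint, simp_all)[5], simp only: 2)
qed

subsection \<open>The polynomial ring\<close>

locale presentation =
  fixes Z :: "real set"
  assumes half: "Z \<subseteq> {of_int n + 1/2 | n::int. True}"
begin

abbreviation "P \<equiv> gpoly_ring Z"
abbreviation "J \<equiv> pres_ideal Z"

lemma P_simps [simp]: "monoid.mult P = (*)" "monoid.one P = 1" "ring.zero P = 0" "ring.add P = (+)"
  by (simp_all add: gpoly_ring_def)

lemma carrier_P: "p \<in> carrier P \<longleftrightarrow> (\<forall>m\<in>keys p. keys m \<subseteq> gvars Z)"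
  by (simp add: gpoly_ring_def)

lemma P_add [intro]: "p \<in> carrier P ==> q \<in> carrier P ==> p + q \<in> carrier P"
  unfolding carrier_P using Poly_Mapping.keys_add[of p q] by blast

lemma P_mult [intro]: assumes "p \<in> carrier P" "q \<in> carrier P" shows "p * q \<in> carrier P"
  unfolding carrier_P
proof
  fix m assume "m \<in> keys (p * q)"
  then obtain a b where "m = a + b" "a \<in> keys p" "b \<in> keys q" using keys_mult[of p q] by blast
  then show "keys m \<subseteq> gvars Z" using assms unfolding carrier_P by (simp add: keys_add_nat)
qed

lemma P_cst [intro, simp]: "cst c \<in> carrier P" by (simp add: carrier_P)
lemma P_0 [intro, simp]: "0 \<in> carrier P" by (simp add: carrier_P)
lemma P_1 [intro, simp]: "1 \<in> carrier P" by (simp add: carrier_P)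
lemma P_uminus [intro]: "p \<in> carrier P ==> - p \<in> carrier P" by (simp add: carrier_P keys_minus)
lemma P_diff [intro]: "p \<in> carrier P ==> q \<in> carrier P ==> p - q \<in> carrier P"
  using P_add[of p "- q"] P_uminus by simp
lemma P_gvar [intro]: "g \<in> gvars Z ==> gvar g \<in> carrier P" by (simp add: carrier_P gvar_def)
lemma cring_P: "cring P"
proof (rule cringI)
  show "abelian_group P"
  proof (rule abelian_groupI)
    fix x assume "x \<in> carrier P"
    then show "\<exists>y\<in>carrier P. y \<oplus>\<^bsub>P\<^esub> x = \<zero>\<^bsub>P\<^esub>" by (intro bexI[of _ "-x"]) auto
  qed (auto simp: algebra_simps)
  show "comm_monoid P" by (rule comm_monoidI) (auto simp: algebra_simps)
qed (auto simp: algebra_simps)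

sublocale P: cring P by (rule cring_P)

lemma gvars_I [intro]: "k \<in> Z ==> XPlus k \<in> gvars Z" "k \<in> Z ==> XMinus k \<in> gvars Z"
  "k \<in> Z ==> YPlus k \<in> gvars Z" "k \<in> Z ==> YMinus k \<in> gvars Z"
  by (auto simp: gvars_def)

lemma gen_rels_P: "gen_rels Z \<subseteq> carrier P"
  unfolding gen_rels_def power2_eq_square by (auto intro!: P_diff P_mult P_add P_gvar)

lemma ideal_J: "ideal J P" unfolding pres_ideal_def by (rule P.genideal_ideal[OF gen_rels_P])

sublocale J: ideal J P by (rule ideal_J)

lemma J_rel: "r \<in> gen_rels Z ==> r \<in> J" unfolding pres_ideal_def using P.genideal_self[OF gen_rels_P] by blast
lemma J_add: "p \<in> J ==> q \<in> J ==> p + q \<in> J" using J.a_closed by simp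
lemma J_mult: "p \<in> J ==> q \<in> carrier P ==> p * q \<in> J" using J.I_r_closed by simp
lemma J_0 [simp]: "0 \<in> J" using J.zero_closed by simp
definition cg :: "gpoly => gpoly => bool" where "cg p q \<longleftrightarrow> p - q \<in> J"

lemma cg_refl [simp]: "cg p p" by (simp add: cg_def)
lemma cg_trans [trans]: "cg p q ==> cg q r ==> cg p r" using J_add[of "p - q" "q - r"] by (simp add: cg_def)
lemma cg_add: "cg p q ==> cg p' q' ==> cg (p + p') (q + q')" using J_add[of "p - q" "p' - q'"] by (simp add: cg_def algebra_simps)
lemma cg_mult: "cg p q ==> r \<in> carrier P ==> cg (p * r) (q * r)" using J_mult[of "p - q" r] by (simp add: cg_def algebra_simps)
lemma cg_mult_left: "cg p q ==> r \<in> carrier P ==> cg (r * p) (r * q)" using cg_mult by (simp add: mult.commute)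
lemma cg_rel: "p - q \<in> gen_rels Z ==> cg p q" by (simp add: cg_def J_rel)

lemma EE_J: assumes "p \<in> J" shows "EE s p = 0"
proof -
  have "ideal {p \<in> carrier P. EE s p = 0} P"
  proof (rule idealI[OF P.ring_axioms])
    show "subgroup {p \<in> carrier P. EE s p = 0} (add_monoid P)"
    proof (rule P.add.subgroupI)
      fix p assume p: "p \<in> {p \<in> carrier P. EE s p = 0}"
      have "\<ominus>\<^bsub>P\<^esub> p = - p" using P.minus_equality[of "- p" p] p by auto
      then show "\<ominus>\<^bsub>P\<^esub> p \<in> {p \<in> carrier P. EE s p = 0}"
        using p EE_diff[of s 0 p] by auto
    qed (auto simp: EE_add intro!: exI[of _ 0])
  qed (auto simp: EE_mult)
  moreover have "gen_rels Z \<subseteq> {p \<in> carrier P. EE s p = 0}" using EE_gen_rels gen_rels_P by auto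
  ultimately have "J \<subseteq> {p \<in> carrier P. EE s p = 0}" unfolding pres_ideal_def by (rule P.genideal_minimal)
  then show ?thesis using assms by blast
qed

lemma EE_cg: "cg p q ==> EE s p = EE s q" using EE_J[of "p - q" s] by (simp add: cg_def EE_diff)

text \<open>Monomials are built by multiplying with one generator at a time, the step that
  \<open>nf_gvar\<close> handles.\<close>

lemma P_induct [consumes 1, case_names one add cst gvar]:
  assumes p: "p \<in> carrier P" and one: "Q 1" and add: "\<And>p q. Q p ==> Q q ==> Q (p + q)"
    and cst: "\<And>c p. Q p ==> Q (cst c * p)" and gvar: "\<And>g p. g \<in> gvars Z ==> Q p ==> Q (p * gvar g)"
  shows "Q p"
proof -
  have pw: "Q (q * gvar g ^ n)" if "g \<in> gvars Z" "Q q" for q g n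
    by (induction n) (use that gvar[OF that(1)] in \<open>auto simp: mult.assoc[symmetric] mult.commute[of "gvar g"] power_Suc2 simp del: power_Suc\<close>)
  have sg: "gvar g ^ n = single (single g n) 1" for g n
    by (induction n) (simp_all add: gvar_def mult_single flip: single_add)
  have mon: "Q (single (\<Sum>g\<in>A. single g (f g)) 1)" if "finite A" "A \<subseteq> gvars Z" for A f
    using that
  proof (induction A rule: finite_induct)
    case empty then show ?case using one by simp
  next
    case (insert g A)
    have "single (\<Sum>g\<in>insert g A. single g (f g)) (1::complex)
        = single (\<Sum>g\<in>A. single g (f g)) 1 * gvar g ^ f g"
      using insert by (simp add: sg mult_single add.commute)
    then show ?case using insert pw by simp
  qed
  have Q0: "Q 0" using cst[OF one, of 0] by simp
  have "Q (\<Sum>m\<in>keys p. single m (lkp p m))"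
  proof -
    have "Q (\<Sum>m\<in>A. single m (lkp p m))" if "finite A" "A \<subseteq> keys p" for A
      using that
    proof (induction A rule: finite_induct)
      case (insert m A)
      have "Q (single (\<Sum>g\<in>keys m. single g (lkp m g)) 1)"
        using insert p by (intro mon) (auto simp: carrier_P)
      then have "Q (single m 1)" by (simp only: poly_mapping_sum_single[symmetric])
      then have "Q (single m (lkp p m))" using cst[of "single m 1" "lkp p m"] by (simp add: mult_single)
      then show ?case using insert add by simp
    qed (use Q0 in simp)
    then show ?thesis by simp
  qed
  then show ?thesis by (simp only: poly_mapping_sum_single[symmetric])
qed

end

subsection \<open>Normal forms\<close>

text \<open>In the first two cases the string lies on one side of the break; otherwise it crosses
  the break, and the arrow found there decides. If both arrows are there, which excludes
  \<open>\<lfloor>k\<rfloor>\<close> from the breaks of the string, the value is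
  \<open>YPlus k\<close> by default.\<close>

definition tau :: "diag => real => gen" where
  "tau C k = (if \<forall>u. Vx u \<in> C --> \<lfloor>k\<rfloor> < u then XPlus k
     else if \<forall>u. Vx u \<in> C --> u \<le> \<lfloor>k\<rfloor> then XMinus k
     else if Up \<lfloor>k\<rfloor> \<in> C then YPlus k else YMinus k)"

definition nf :: "real multiset => diag => gpoly" where
  "nf d C = (\<Prod>k\<in>#d. gvar (tau C k))"

lemma nf_add [simp]: "nf (add_mset k d) C = gvar (tau C k) * nf d C" and nf_empty [simp]: "nf {#} C = 1"
  by (simp_all add: nf_def)

lemma pos_tau [simp]: "pos (tau C k) = k" by (simp add: tau_def)

lemma tau_right: "\<forall>u. Vx u \<in> C --> \<lfloor>k\<rfloor> < u ==> tau C k = XPlus k"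
  by (simp add: tau_def)

lemma tau_left: "Vx w \<in> C ==> \<forall>u. Vx u \<in> C --> u \<le> \<lfloor>k\<rfloor> ==> tau C k = XMinus k"
  unfolding tau_def by (metis linorder_not_le)

lemma tau_inside:
  assumes "Vx u \<in> C" "u \<le> \<lfloor>k\<rfloor>" "Vx w \<in> C" "\<lfloor>k\<rfloor> < w"
  shows "tau C k = (if Up \<lfloor>k\<rfloor> \<in> C then YPlus k else YMinus k)"
proof -
  have 1: "\<not> (\<forall>u. Vx u \<in> C --> \<lfloor>k\<rfloor> < u)" using assms(1,2) by (meson linorder_not_le)
  have 2: "\<not> (\<forall>u. Vx u \<in> C --> u \<le> \<lfloor>k\<rfloor>)"
  proof
    assume "\<forall>u. Vx u \<in> C --> u \<le> \<lfloor>k\<rfloor>"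
    then have "w \<le> \<lfloor>k\<rfloor>" using assms(3) by blast
    then show False using assms(4) by simp
  qed
  show ?thesis unfolding tau_def if_not_P[OF 1] if_not_P[OF 2] by (rule refl)
qed

lemma bdiag_insert: "bdiag A C ==> \<not> (Up h \<in> C \<and> Dn h \<in> C) ==> bdiag (insert h A) C"
  unfolding bdiag_def insert_iff by blast

lemma con_edge: "con C ==> Vx l \<in> C ==> Vx (l + 1) \<in> C ==> Up l \<in> C \<or> Dn l \<in> C"
  unfolding con_def by (meson order_refl less_add_one)

lemma con_inside:
  assumes "con C" "Vx u \<in> C" "u \<le> h" "Vx w \<in> C" "h < w"
  shows "Vx h \<in> C" "Vx (h + 1) \<in> C"
  using con_convex[OF assms(1,2,4), of h] con_convex[OF assms(1,2,4), of "h + 1"] assms(3,5) by simp_all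

text \<open>A half line meets a string in an interval. Removing one arrow at the break disconnects
  nothing as long as the opposite arrow is present.\<close>

lemma con_cut:
  assumes C: "con C"
  shows "Vx (\<lfloor>k\<rfloor> + 1) \<in> C ==> con (C \<inter> gd (XPlus k))"
    and "Vx \<lfloor>k\<rfloor> \<in> C ==> con (C \<inter> gd (XMinus k))"
    and "Up \<lfloor>k\<rfloor> \<in> C ==> con (C \<inter> gd (YPlus k))"
    and "Dn \<lfloor>k\<rfloor> \<in> C ==> con (C \<inter> gd (YMinus k))"
proof -
  have v: "\<exists>l. Vx l \<in> C" and e: "\<And>l. Up l \<in> C \<or> Dn l \<in> C ==> Vx l \<in> C \<and> Vx (l + 1) \<in> C"
    and i: "\<And>l m n. l \<le> m ==> m < n ==> Vx l \<in> C ==> Vx n \<in> C ==> Up m \<in> C \<or> Dn m \<in> C"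
    using C unfolding con_def by blast+
  {
    assume a: "Vx (\<lfloor>k\<rfloor> + 1) \<in> C"
    show "con (C \<inter> gd (XPlus k))"
      unfolding con_def
    proof (intro conjI allI impI)
      show "\<exists>l. Vx l \<in> C \<inter> gd (XPlus k)" using a by (intro exI[of _ "\<lfloor>k\<rfloor> + 1"]) simp
    next
      fix l m n assume "l \<le> m \<and> m < n \<and> Vx l \<in> C \<inter> gd (XPlus k) \<and> Vx n \<in> C \<inter> gd (XPlus k)"
      then show "Up m \<in> C \<inter> gd (XPlus k) \<or> Dn m \<in> C \<inter> gd (XPlus k)" using i[of l m n] by auto
    qed (use e in auto)
  next
    assume a: "Vx \<lfloor>k\<rfloor> \<in> C"
    show "con (C \<inter> gd (XMinus k))"
      unfolding con_def
    proof (intro conjI allI impI)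
      show "\<exists>l. Vx l \<in> C \<inter> gd (XMinus k)" using a by (intro exI[of _ "\<lfloor>k\<rfloor>"]) simp
    next
      fix l m n assume "l \<le> m \<and> m < n \<and> Vx l \<in> C \<inter> gd (XMinus k) \<and> Vx n \<in> C \<inter> gd (XMinus k)"
      then show "Up m \<in> C \<inter> gd (XMinus k) \<or> Dn m \<in> C \<inter> gd (XMinus k)" using i[of l m n] by auto
    qed (use e in auto)
  next
    assume a: "Up \<lfloor>k\<rfloor> \<in> C"
    show "con (C \<inter> gd (YPlus k))"
      unfolding con_def
    proof (intro conjI allI impI)
      fix l m n assume "l \<le> m \<and> m < n \<and> Vx l \<in> C \<inter> gd (YPlus k) \<and> Vx n \<in> C \<inter> gd (YPlus k)"
      then show "Up m \<in> C \<inter> gd (YPlus k) \<or> Dn m \<in> C \<inter> gd (YPlus k)" using i[of l m n] a by auto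
    qed (use e v in auto)
  next
    assume a: "Dn \<lfloor>k\<rfloor> \<in> C"
    show "con (C \<inter> gd (YMinus k))"
      unfolding con_def
    proof (intro conjI allI impI)
      fix l m n assume "l \<le> m \<and> m < n \<and> Vx l \<in> C \<inter> gd (YMinus k) \<and> Vx n \<in> C \<inter> gd (YMinus k)"
      then show "Up m \<in> C \<inter> gd (YMinus k) \<or> Dn m \<in> C \<inter> gd (YMinus k)" using i[of l m n] a by auto
    qed (use e v in auto)
  }
qed

text \<open>A string ends only at breaks, and the factor of a break at an end is the half line that
  ends there. Within the interval, an arrow is missing only at a break that the string crosses, and
  there the \<open>Y\<close> factor lacks the same arrow.\<close>

lemma Int_tau:
  assumes C: "con C" and b: "bdiag (flo d) C"
  shows "(\<Inter>k\<in>set_mset d. gd (tau C k)) = C"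
proof
  have e: "\<And>l. Up l \<in> C \<or> Dn l \<in> C ==> Vx l \<in> C \<and> Vx (l + 1) \<in> C" using C unfolding con_def by blast
  have "C \<subseteq> gd (tau C k)" if k: "k \<in># d" for k
  proof
    fix x assume x: "x \<in> C"
    have "\<not> (Up \<lfloor>k\<rfloor> \<in> C \<and> Dn \<lfloor>k\<rfloor> \<in> C)" using b k by (auto simp: bdiag_def)
    obtain w where w: "Vx w \<in> C" using C by (auto simp: con_def)
    consider "\<forall>u. Vx u \<in> C --> \<lfloor>k\<rfloor> < u" | "\<forall>u. Vx u \<in> C --> u \<le> \<lfloor>k\<rfloor>"
      | u w where "Vx u \<in> C" "u \<le> \<lfloor>k\<rfloor>" "Vx w \<in> C" "\<lfloor>k\<rfloor> < w" by (meson linorder_not_less)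
    then show "x \<in> gd (tau C k)"
    proof cases
      case 1 then show ?thesis using x e by (cases x) (auto simp: tau_right)
    next
      case 2 then show ?thesis using x e w by (cases x) (force simp: tau_left)+
    next
      case 3 then show ?thesis using x \<open>\<not> (Up \<lfloor>k\<rfloor> \<in> C \<and> Dn \<lfloor>k\<rfloor> \<in> C)\<close> by (auto simp: tau_inside)
    qed
  qed
  then show "C \<subseteq> (\<Inter>k\<in>set_mset d. gd (tau C k))" by blast
  obtain w where w: "Vx w \<in> C" using C by (auto simp: con_def)
  have vx: "Vx v \<in> C" if v: "\<And>k. k \<in># d ==> Vx v \<in> gd (tau C k)" for v
  proof (rule ccontr)
    assume n: "Vx v \<notin> C"
    then have "v < w \<or> w < v" using w by (metis linorder_neqE)
    then show False
    proof
      assume "v < w"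
      then obtain k where k: "k \<in># d" "v \<le> \<lfloor>k\<rfloor>" "\<forall>u. Vx u \<in> C --> \<lfloor>k\<rfloor> < u" using string_left_end[OF C b w n] by blast
      then show False using v[OF k(1)] by (simp add: tau_def)
    next
      assume "w < v"
      then obtain k where k: "k \<in># d" "\<lfloor>k\<rfloor> < v" "\<forall>u. Vx u \<in> C --> u \<le> \<lfloor>k\<rfloor>" using string_right_end[OF C b w n] by blast
      then have "\<not> \<lfloor>k\<rfloor> < w" using w by force
      then show False using v[OF k(1)] k w by (auto simp: tau_def split: if_splits)
    qed
  qed
  have gdv: "Vx l \<in> gd g \<and> Vx (l + 1) \<in> gd g" if "Up l \<in> gd g \<or> Dn l \<in> gd g" for l g
    using that by (cases g) auto
  show "(\<Inter>k\<in>set_mset d. gd (tau C k)) \<subseteq> C"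
  proof
    fix x assume x: "x \<in> (\<Inter>k\<in>set_mset d. gd (tau C k))"
    have ed: "x \<in> C" if l: "x = Up l \<or> x = Dn l" for l
    proof -
      have v: "Vx l \<in> C" "Vx (l + 1) \<in> C" using x l gdv by (auto intro!: vx)
      show ?thesis
      proof (cases "l \<in> flo d")
        case False
        then have "Up l \<in> C \<and> Dn l \<in> C" using b v unfolding bdiag_def by blast
        then show ?thesis using l by blast
      next
        case True
        then obtain k where k: "k \<in># d" "l = \<lfloor>k\<rfloor>" by blast
        have "\<not> (\<forall>u. Vx u \<in> C --> \<lfloor>k\<rfloor> < u)" "\<not> (\<forall>u. Vx u \<in> C --> u \<le> \<lfloor>k\<rfloor>)" using v k by force+
        then have t: "tau C k = (if Up l \<in> C then YPlus k else YMinus k)" by (simp only: tau_def if_False k(2))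
        have "x \<in> gd (tau C k)" using x k by blast
        then show ?thesis using l t con_edge[OF C v] k by (auto split: if_splits)
      qed
    qed
    show "x \<in> C"
    proof (cases x)
      case (Vx v) then show ?thesis using x by (auto intro!: vx)
    qed (use ed in blast)+
  qed
qed

lemma EE_prod: "con s ==> EE s (\<Prod>k\<in>#d. gvar (f k)) = single (image_mset (\<lambda>k. pos (f k)) d) (of_nat (ind s (\<Inter>k\<in>set_mset d. gd (f k))))"
proof (induction d)
  case empty then show ?case by (simp add: EE_1 ind_def)
next
  case (add k d) then show ?case by (simp add: EE_mult EE_gvar mult_single ind_Int)
qed

lemma EE_nf: assumes C: "con C" "bdiag (flo d) C" shows "EE s (nf d C) = single d (of_nat (ind s C))"
proof (cases "con s")
  case True
  then show ?thesis unfolding nf_def by (simp add: EE_prod Int_tau[OF C])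
next
  case False
  then show ?thesis by (simp add: EE_def lext_def ind_def)
qed

section \<open>Reduction of polynomials to normal forms\<close>

context presentation
begin

lemma floor_half: "k \<in> Z ==> k = of_int \<lfloor>k\<rfloor> + 1 / 2"
  using half by (auto simp: floor_add)

lemma floor_le_iff': "j \<in> Z ==> k \<in> Z ==> \<lfloor>j\<rfloor> \<le> \<lfloor>k\<rfloor> \<longleftrightarrow> j \<le> k"
  using floor_half[of j] floor_half[of k] by (metis add_le_cancel_right of_int_le_iff)

lemma tau_gvars [intro]: "k \<in> Z ==> tau C k \<in> gvars Z" by (auto simp: tau_def)

lemma nf_P: "set_mset d \<subseteq> Z ==> nf d C \<in> carrier P" by (induction d) auto

definition strg :: "real multiset \<times> diag => bool" where
  "strg x \<longleftrightarrow> set_mset (fst x) \<subseteq> Z \<and> con (snd x) \<and> bdiag (flo (fst x)) (snd x)"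

abbreviation nfs :: "(real multiset \<times> diag => complex) => real multiset \<times> diag => gpoly" where
  "nfs c x \<equiv> cst (c x) * nf (fst x) (snd x)"

definition NFS :: "gpoly => bool" where
  "NFS p \<longleftrightarrow> (\<exists>A c. finite A \<and> (\<forall>x\<in>A. strg x) \<and> cg p (sum (nfs c) A))"

lemma NFS_cg: "cg p q ==> NFS q ==> NFS p" unfolding NFS_def using cg_trans by blast

lemma NFS_0: "NFS 0" unfolding NFS_def by (intro exI[of _ "{}"]) simp

lemma NFS_nf: "strg (d, C) ==> NFS (nf d C)"
  unfolding NFS_def by (intro exI[of _ "{(d, C)}"] exI[of _ "\<lambda>_. 1"]) simp

lemma NFS_cst: assumes "NFS p" shows "NFS (cst c * p)"
proof -
  obtain A f where A: "finite A" "\<forall>x\<in>A. strg x" "cg p (sum (nfs f) A)" using assms by (auto simp: NFS_def)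
  have "cg (cst c * p) (cst c * sum (nfs f) A)" by (rule cg_mult_left[OF A(3)]) simp
  also have "cst c * sum (nfs f) A = sum (nfs (\<lambda>x. c * f x)) A"
    by (simp add: sum_distrib_left mult.assoc[symmetric] mult_single)
  finally have "cg (cst c * p) (sum (nfs (\<lambda>x. c * f x)) A)" .
  then show ?thesis unfolding NFS_def using A by (intro exI[of _ A] exI[of _ "\<lambda>x. c * f x"]) simp
qed

lemma NFS_add: assumes "NFS p" "NFS q" shows "NFS (p + q)"
proof -
  obtain A f where A: "finite A" "\<forall>x\<in>A. strg x" "cg p (sum (nfs f) A)" using assms by (auto simp: NFS_def)
  obtain B g where B: "finite B" "\<forall>x\<in>B. strg x" "cg q (sum (nfs g) B)" using assms by (auto simp: NFS_def)
  let ?f = "\<lambda>x. if x \<in> A then f x else 0" and ?g = "\<lambda>x. if x \<in> B then g x else 0"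
  have "sum (nfs f) A = sum (nfs ?f) (A \<union> B)" by (rule sum.mono_neutral_cong_left) (use A B in auto)
  moreover have "sum (nfs g) B = sum (nfs ?g) (A \<union> B)" by (rule sum.mono_neutral_cong_left) (use A B in auto)
  ultimately have "sum (nfs f) A + sum (nfs g) B = sum (nfs (\<lambda>x. ?f x + ?g x)) (A \<union> B)"
    by (simp only: single_add distrib_right sum.distrib)
  then have "cg (p + q) (sum (nfs (\<lambda>x. ?f x + ?g x)) (A \<union> B))" using cg_add[OF A(3) B(3)] by simp
  then show ?thesis unfolding NFS_def using A B by (intro exI[of _ "A \<union> B"] exI[of _ "\<lambda>x. ?f x + ?g x"]) auto
qed

lemma rel_cg:
  assumes "j \<in> Z" "k \<in> Z" "j \<le> k"
  shows "cg (yp j * xp k) (xp j * xp k)" "cg (ym j * xp k) (xp j * xp k)"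
    "cg (xm j * yp k) (xm j * xm k)" "cg (xm j * ym k) (xm j * xm k)" "cg (xm j * xp k) 0"
  by (rule cg_rel, use assms in \<open>unfold gen_rels_def, blast\<close>)+ (rule cg_rel, use assms in \<open>unfold gen_rels_def diff_zero, blast\<close>)

lemma rel_YY: "k \<in> Z ==> cg (yp k * ym k) (xp k * xp k + xm k * xm k)"
  by (rule cg_rel) (unfold gen_rels_def power2_eq_square, blast)

text \<open>The factor \<open>e\<close> acts as a catalyst: it is moved along the product and allows
  one factor at a time to be exchanged.\<close>

lemma prod_absorb:
  assumes e: "e \<in> carrier P" and d: "\<And>l. l \<in># d ==> f l \<in> carrier P \<and> g l \<in> carrier P \<and> cg (f l * e) (g l * e)"
  shows "cg ((\<Prod>l\<in>#d. f l) * e) ((\<Prod>l\<in>#d. g l) * e)"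
  using d
proof (induction d)
  case (add l d)
  have g: "(\<Prod>l\<in>#d. g l) \<in> carrier P" using add.prems by (induction d) auto
  have "cg (f l * ((\<Prod>l\<in>#d. f l) * e)) (f l * ((\<Prod>l\<in>#d. g l) * e))" using add by (intro cg_mult_left) auto
  also have "f l * ((\<Prod>l\<in>#d. g l) * e) = (\<Prod>l\<in>#d. g l) * (f l * e)" by (simp add: mult_ac)
  also have "cg \<dots> ((\<Prod>l\<in>#d. g l) * (g l * e))" using add g by (intro cg_mult_left) auto
  finally show ?case by (simp add: mult_ac)
qed simp

text \<open>Since the string has a vertex beyond \<open>k\<close>, positions up to \<open>k\<close>
  have the factor \<open>xp\<close>, \<open>yp\<close> or \<open>ym\<close>; in the presence of
  \<open>xp k\<close> the relations turn each of these into \<open>xp\<close>. Positions beyond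
  \<open>k\<close> do not notice the cut.\<close>

lemma tau_cut_right:
  assumes v: "Vx (\<lfloor>k\<rfloor> + 1) \<in> C" and l: "l \<in> Z" and k: "k \<in> Z"
  shows "cg (gvar (tau C l) * xp k) (gvar (tau (C \<inter> gd (XPlus k)) l) * xp k)"
proof (cases "\<lfloor>l\<rfloor> \<le> \<lfloor>k\<rfloor>")
  case True
  then have lk: "l \<le> k" using floor_le_iff' l k by blast
  have "tau (C \<inter> gd (XPlus k)) l = XPlus l" using True by (auto simp: tau_def)
  moreover have "\<not> (\<forall>u. Vx u \<in> C --> u \<le> \<lfloor>l\<rfloor>)" using v True by force
  then have "tau C l \<in> {XPlus l, YPlus l, YMinus l}" by (auto simp: tau_def)
  ultimately show ?thesis using rel_cg[OF l k lk] by auto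
next
  case False
  let ?D = "C \<inter> gd (XPlus k)"
  have D: "Vx u \<in> ?D \<longleftrightarrow> Vx u \<in> C \<and> \<lfloor>k\<rfloor> < u" "Up u \<in> ?D \<longleftrightarrow> Up u \<in> C \<and> \<lfloor>k\<rfloor> < u" for u by auto
  have 1: "\<not> (\<forall>u. Vx u \<in> C --> \<lfloor>l\<rfloor> < u)" "\<not> (\<forall>u. Vx u \<in> ?D --> \<lfloor>l\<rfloor> < u)"
  proof -
    have "Vx (\<lfloor>k\<rfloor> + 1) \<in> C \<and> \<lfloor>k\<rfloor> < \<lfloor>k\<rfloor> + 1 \<and> \<not> \<lfloor>l\<rfloor> < \<lfloor>k\<rfloor> + 1" using v False by simp
    then show "\<not> (\<forall>u. Vx u \<in> C --> \<lfloor>l\<rfloor> < u)" "\<not> (\<forall>u. Vx u \<in> ?D --> \<lfloor>l\<rfloor> < u)" unfolding D by blast+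
  qed
  have 2: "(\<forall>u. Vx u \<in> ?D --> u \<le> \<lfloor>l\<rfloor>) \<longleftrightarrow> (\<forall>u. Vx u \<in> C --> u \<le> \<lfloor>l\<rfloor>)" unfolding D using False by force
  have 3: "Up \<lfloor>l\<rfloor> \<in> ?D \<longleftrightarrow> Up \<lfloor>l\<rfloor> \<in> C" using False by auto
  have "tau ?D l = tau C l" unfolding tau_def 2 3 using 1 by (simp only: if_False)
  then show ?thesis by simp
qed

lemma tau_cut_left:
  assumes v: "Vx \<lfloor>k\<rfloor> \<in> C" and l: "l \<in> Z" and k: "k \<in> Z"
  shows "cg (gvar (tau C l) * xm k) (gvar (tau (C \<inter> gd (XMinus k)) l) * xm k)"
proof (cases "\<lfloor>k\<rfloor> \<le> \<lfloor>l\<rfloor>")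
  case True
  then have lk: "k \<le> l" using floor_le_iff' l k by blast
  have n: "\<not> (\<forall>u. Vx u \<in> C --> \<lfloor>l\<rfloor> < u)" using v True by force
  have "tau (C \<inter> gd (XMinus k)) l = XMinus l" using v True by (intro tau_left[of "\<lfloor>k\<rfloor>"]) auto
  moreover have "tau C l \<in> {XMinus l, YPlus l, YMinus l}" using n by (auto simp: tau_def)
  ultimately show ?thesis using rel_cg[OF k l lk] by (auto simp: mult.commute)
next
  case False
  let ?D = "C \<inter> gd (XMinus k)"
  have D: "Vx u \<in> ?D \<longleftrightarrow> Vx u \<in> C \<and> u \<le> \<lfloor>k\<rfloor>" for u by auto
  have 1: "\<not> (\<forall>u. Vx u \<in> C --> u \<le> \<lfloor>l\<rfloor>)" "\<not> (\<forall>u. Vx u \<in> ?D --> u \<le> \<lfloor>l\<rfloor>)"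
    unfolding D using False v by blast+
  have 2: "(\<forall>u. Vx u \<in> ?D --> \<lfloor>l\<rfloor> < u) \<longleftrightarrow> (\<forall>u. Vx u \<in> C --> \<lfloor>l\<rfloor> < u)" unfolding D using False by force
  have 3: "Up \<lfloor>l\<rfloor> \<in> ?D \<longleftrightarrow> Up \<lfloor>l\<rfloor> \<in> C" using False by auto
  have "tau ?D l = tau C l" unfolding tau_def 2 3 using 1 by (simp only: if_False)
  then show ?thesis by simp
qed

lemma nf_cut_right:
  assumes d: "set_mset d \<subseteq> Z" and k: "k \<in> Z" and v: "Vx (\<lfloor>k\<rfloor> + 1) \<in> C"
  shows "cg (nf d C * xp k) (nf (add_mset k d) (C \<inter> gd (XPlus k)))"
proof -
  have "cg (nf d C * xp k) (nf d (C \<inter> gd (XPlus k)) * xp k)" unfolding nf_def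
    by (rule prod_absorb) (use d k tau_cut_right[OF v _ k] in auto)
  moreover have "tau (C \<inter> gd (XPlus k)) k = XPlus k" by (simp add: tau_def)
  ultimately show ?thesis by (simp add: mult.commute)
qed

lemma nf_cut_left:
  assumes d: "set_mset d \<subseteq> Z" and k: "k \<in> Z" and v: "Vx \<lfloor>k\<rfloor> \<in> C"
  shows "cg (nf d C * xm k) (nf (add_mset k d) (C \<inter> gd (XMinus k)))"
proof -
  have "cg (nf d C * xm k) (nf d (C \<inter> gd (XMinus k)) * xm k)" unfolding nf_def
    by (rule prod_absorb) (use d k tau_cut_left[OF v _ k] in auto)
  moreover have "tau (C \<inter> gd (XMinus k)) k = XMinus k" using v by (intro tau_left[of "\<lfloor>k\<rfloor>"]) auto
  ultimately show ?thesis by (simp add: mult.commute)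
qed

lemma strg_cut:
  assumes "strg (d, C)" "k \<in> Z" "pos g = k" "con (C \<inter> gd g)"
  shows "strg (add_mset k d, C \<inter> gd g)"
  using bdiag_Int[of "flo d" C "{\<lfloor>k\<rfloor>}" "gd g"] bdiag_gd[of g] assms by (auto simp: strg_def)

text \<open>If the string lies on one side of \<open>k\<close>, its end facing \<open>k\<close> is
  at a zero \<open>l\<close> of the degree, with factor \<open>xp l\<close> or \<open>xm l\<close>;
  by the relations this factor decides what the new factor at \<open>k\<close> amounts to, possibly
  zero. If the string crosses \<open>k\<close>, then \<open>xp k\<close> and \<open>xm k\<close> cut
  it, while \<open>yp k\<close> and \<open>ym k\<close> remove an arrow or repeat a removal already
  made.\<close>

lemma nf_gvar:
  assumes st: "strg (d, C)" and g: "g \<in> gvars Z"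
  shows "NFS (nf d C * gvar g)"
proof -
  define k where "k = pos g"
  have k: "k \<in> Z" and gk: "g \<in> {XPlus k, XMinus k, YPlus k, YMinus k}" using g by (auto simp: gvars_def k_def)
  have d: "set_mset d \<subseteq> Z" and C: "con C" and b: "bdiag (flo d) C" using st by (auto simp: strg_def)
  have rest: "nf e C \<in> carrier P" if "e \<subseteq># d" for e using set_mset_mono[OF that] d by (intro nf_P) blast
  obtain w where w: "Vx w \<in> C" using C by (auto simp: con_def)
  have ins: "strg (add_mset k d, C)" if "\<not> (Up \<lfloor>k\<rfloor> \<in> C \<and> Dn \<lfloor>k\<rfloor> \<in> C)"
    using bdiag_insert[OF b that] st k by (auto simp: strg_def)
  have e: "\<And>l. Up l \<in> C \<or> Dn l \<in> C ==> Vx l \<in> C \<and> Vx (l + 1) \<in> C" using C unfolding con_def by blast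
  consider (right) "\<forall>u. Vx u \<in> C --> \<lfloor>k\<rfloor> < u" | (left) "\<forall>u. Vx u \<in> C --> u \<le> \<lfloor>k\<rfloor>"
    | (inside) u w where "Vx u \<in> C" "u \<le> \<lfloor>k\<rfloor>" "Vx w \<in> C" "\<lfloor>k\<rfloor> < w" by (meson linorder_not_less)
  then show ?thesis
  proof cases
    case right
    have "Vx \<lfloor>k\<rfloor> \<notin> C" "\<lfloor>k\<rfloor> < w" using right w by auto
    \<comment> \<open>The left end of the string is at a zero \<open>l\<close> not before
      \<open>k\<close>, so \<open>xp l\<close> is a factor of the normal form.\<close>
    then obtain l where l: "l \<in># d" "\<lfloor>k\<rfloor> \<le> \<lfloor>l\<rfloor>" "\<forall>u. Vx u \<in> C --> \<lfloor>l\<rfloor> < u" using string_left_end[OF C b w] by blast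
    have lZ: "l \<in> Z" using l d by blast
    have kl: "k \<le> l" using floor_le_iff'[OF k lZ] l by blast
    have tl: "tau C l = XPlus l" and tk: "tau C k = XPlus k" using l(3) right by (simp_all add: tau_def)
    obtain d' where d': "d = add_mset l d'" using l(1) by (metis insert_DiffM)
    have nfd: "nf d C = xp l * nf d' C" using d' tl by simp
    have nn: "NFS (nf d C * xp k)"
      using NFS_nf[OF ins] right e[of "\<lfloor>k\<rfloor>"] tk by (auto simp: mult.commute)
    have r: "nf d' C \<in> carrier P" by (rule rest) (simp add: d')
    have "cg (nf d C * gvar g) (nf d C * xp k)" if "g \<in> {YPlus k, YMinus k}"
    proof -
      have "cg (gvar g * xp l) (xp k * xp l)" using rel_cg[OF k lZ kl] that by auto
      from cg_mult[OF this r] show ?thesis by (simp add: nfd mult_ac)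
    qed
    moreover have "cg (nf d C * xm k) 0" using cg_mult[OF rel_cg(5)[OF k lZ kl] r] by (simp add: nfd mult_ac)
    ultimately show ?thesis using gk nn NFS_cg[OF _ nn] NFS_cg[OF _ NFS_0] by blast
  next
    case left
    have "Vx (\<lfloor>k\<rfloor> + 1) \<notin> C" "w < \<lfloor>k\<rfloor> + 1" using left w by fastforce+
    then obtain l where l: "l \<in># d" "\<lfloor>l\<rfloor> < \<lfloor>k\<rfloor> + 1" "\<forall>u. Vx u \<in> C --> u \<le> \<lfloor>l\<rfloor>" using string_right_end[OF C b w] by blast
    have lZ: "l \<in> Z" using l d by blast
    have kl: "l \<le> k" using floor_le_iff'[OF lZ k] l by simp
    have "\<not> \<lfloor>l\<rfloor> < w" "\<not> \<lfloor>k\<rfloor> < w" using l(3) left w by (simp_all add: linorder_not_less)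
    then have n: "\<not> (\<forall>u. Vx u \<in> C --> \<lfloor>l\<rfloor> < u)" "\<not> (\<forall>u. Vx u \<in> C --> \<lfloor>k\<rfloor> < u)" using w by blast+
    have tl: "tau C l = XMinus l" and tk: "tau C k = XMinus k" using l(3) left by (auto intro: tau_left[OF w])
    obtain d' where d': "d = add_mset l d'" using l(1) by (metis insert_DiffM)
    have nfd: "nf d C = xm l * nf d' C" using d' tl by simp
    have "Vx (\<lfloor>k\<rfloor> + 1) \<notin> C" using left by force
    then have nn: "NFS (nf d C * xm k)"
      using NFS_nf[OF ins] e[of "\<lfloor>k\<rfloor>"] tk by (auto simp: mult.commute)
    have r: "nf d' C \<in> carrier P" by (rule rest) (simp add: d')
    have "cg (nf d C * gvar g) (nf d C * xm k)" if "g \<in> {YPlus k, YMinus k}"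
    proof -
      have "cg (xm l * gvar g) (xm l * xm k)" using rel_cg[OF lZ k kl] that by auto
      from cg_mult[OF this r] show ?thesis by (simp add: nfd mult_ac)
    qed
    moreover have "cg (nf d C * xp k) 0" using cg_mult[OF rel_cg(5)[OF lZ k kl] r] by (simp add: nfd mult_ac)
    ultimately show ?thesis using gk nn NFS_cg[OF _ nn] NFS_cg[OF _ NFS_0] by blast
  next
    case (inside u w)
    have v: "Vx \<lfloor>k\<rfloor> \<in> C" "Vx (\<lfloor>k\<rfloor> + 1) \<in> C" by (rule con_inside[OF C inside])+
    have R: "strg (add_mset k d, C \<inter> gd (XPlus k))" using strg_cut[OF st k _ con_cut(1)[OF C v(2)]] by simp
    have L: "strg (add_mset k d, C \<inter> gd (XMinus k))" using strg_cut[OF st k _ con_cut(2)[OF C v(1)]] by simp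
    have ud: "Up \<lfloor>k\<rfloor> \<in> C \<or> Dn \<lfloor>k\<rfloor> \<in> C" by (rule con_edge[OF C v])
    have tk: "tau D k = (if Up \<lfloor>k\<rfloor> \<in> D then YPlus k else YMinus k)" if "Vx \<lfloor>k\<rfloor> \<in> D" "Vx (\<lfloor>k\<rfloor> + 1) \<in> D" for D
      using tau_inside[of "\<lfloor>k\<rfloor>" D k "\<lfloor>k\<rfloor> + 1"] that by simp
    have X: "NFS (nf d C * xp k)" "NFS (nf d C * xm k)"
      using NFS_cg[OF nf_cut_right[OF d k v(2)] NFS_nf[OF R]] NFS_cg[OF nf_cut_left[OF d k v(1)] NFS_nf[OF L]] by auto
    have same: "NFS (nf d C * gvar (tau C k))" if "\<lfloor>k\<rfloor> \<in> flo d"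
      using NFS_nf[OF ins] that b by (auto simp: bdiag_def mult.commute)
    have Y: "NFS (nf d C * gvar g)" if gY: "g \<in> {YPlus k, YMinus k}"
    proof (cases "\<lfloor>k\<rfloor> \<in> flo d")
      \<comment> \<open>There is no zero at \<open>k\<close> so far: the string has both arrows
        there, and the new factor removes one of them.\<close>
      case False
      have UD: "Up \<lfloor>k\<rfloor> \<in> C" "Dn \<lfloor>k\<rfloor> \<in> C" using b False v unfolding bdiag_def by blast+
      have st': "strg (add_mset k d, C \<inter> gd g)"
        using gY strg_cut[OF st k _ con_cut(3)[OF C UD(1)]] strg_cut[OF st k _ con_cut(4)[OF C UD(2)]] by auto
      have "tau (C \<inter> gd g) l = tau C l" if l: "l \<in># d" for l
      proof -
        have "\<lfloor>l\<rfloor> \<noteq> \<lfloor>k\<rfloor>" using False l by (metis imageI)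
        then have U: "Up \<lfloor>l\<rfloor> \<in> C \<inter> gd g \<longleftrightarrow> Up \<lfloor>l\<rfloor> \<in> C" using gY by auto
        have V: "Vx u \<in> C \<inter> gd g \<longleftrightarrow> Vx u \<in> C" for u using gY by auto
        show ?thesis unfolding tau_def U V by (rule refl)
      qed
      then have "nf d (C \<inter> gd g) = nf d C" unfolding nf_def by (intro arg_cong[where f = prod_mset] image_mset_cong) simp
      moreover have "tau (C \<inter> gd g) k = g" using gY UD v tk[of "C \<inter> gd g"] by auto
      ultimately have "nf (add_mset k d) (C \<inter> gd g) = nf d C * gvar g" by (simp add: mult.commute)
      then show ?thesis using NFS_nf[OF st'] by simp
    next
      case True
      \<comment> \<open>Elements of \<open>\<int> + 1/2\<close> with equal floor are equal, so
        \<open>k\<close> itself is already a zero.\<close>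
      then obtain k' where k': "k' \<in># d" "\<lfloor>k\<rfloor> = \<lfloor>k'\<rfloor>" by blast
      then have "k' = k" using floor_half k d by (metis subsetD)
      then obtain d' where d': "d = add_mset k d'" using k'(1) by (metis insert_DiffM)
      have d'Z: "set_mset d' \<subseteq> Z" using d d' by simp
      have r: "nf d' C \<in> carrier P" by (rule rest) (simp add: d')
      show ?thesis
      proof (cases "g = tau C k")
        case True then show ?thesis using same \<open>\<lfloor>k\<rfloor> \<in> flo d\<close> by simp
      next
        case False
        \<comment> \<open>The new factor removes the only arrow left at the break, so by
          \<open>rel_YY\<close> the string falls apart into its two halves.\<close>
        then have "gvar (tau C k) * gvar g = yp k * ym k" using tk[OF v] gY by (auto simp: mult.commute)
        then have e: "nf d' C * (gvar (tau C k) * gvar g) = nf d' C * (yp k * ym k)" by simp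
        have "nf d C * gvar g = nf d' C * (yp k * ym k)" unfolding e[symmetric] by (simp add: d' mult_ac)
        also have "cg \<dots> (nf d' C * (xp k * xp k + xm k * xm k))" by (rule cg_mult_left[OF rel_YY[OF k] r])
        also have "nf d' C * (xp k * xp k + xm k * xm k) = (nf d' C * xp k) * xp k + (nf d' C * xm k) * xm k"
          by (simp add: distrib_left mult_ac)
        also have "cg \<dots> (nf (add_mset k d') (C \<inter> gd (XPlus k)) * xp k + nf (add_mset k d') (C \<inter> gd (XMinus k)) * xm k)"
          using k by (intro cg_add cg_mult nf_cut_right[OF d'Z k v(2)] nf_cut_left[OF d'Z k v(1)]) auto
        \<comment> \<open>A second cut at \<open>k\<close> raises the degree and leaves the diagram
          as it is.\<close>
        also have "cg \<dots> (nf (add_mset k d) (C \<inter> gd (XPlus k)) + nf (add_mset k d) (C \<inter> gd (XMinus k)))"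
          using nf_cut_right[OF d k, of "C \<inter> gd (XPlus k)"] nf_cut_left[OF d k, of "C \<inter> gd (XMinus k)"] v
          by (intro cg_add) (simp_all add: d' Int_assoc)
        finally show ?thesis by (rule NFS_cg) (intro NFS_add NFS_nf R L)
      qed
    qed
    show ?thesis using gk X Y by blast
  qed
qed

lemma NFS_all: "p \<in> carrier P ==> NFS p"
proof (induction rule: P_induct)
  case one
  have "strg ({#}, UNIV)" by (simp add: strg_def con_gd bdiag_UNIV)
  then show ?case using NFS_nf by force
next
  case (gvar g p)
  then obtain A c where A: "finite A" "\<forall>x\<in>A. strg x" "cg p (sum (nfs c) A)" by (auto simp: NFS_def)
  have "NFS (\<Sum>x\<in>B. cst (c x) * (nf (fst x) (snd x) * gvar g))" if "finite B" "B \<subseteq> A" for B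
    using that
  proof (induction B rule: finite_induct)
    case (insert x B)
    have "NFS (nf (fst x) (snd x) * gvar g)" using A(2) insert gvar by (intro nf_gvar) auto
    then show ?case using insert NFS_add NFS_cst by simp
  qed (simp add: NFS_0)
  then have "NFS (sum (nfs c) A * gvar g)" using A(1) by (simp add: sum_distrib_right mult.assoc)
  then show ?case using NFS_cg[OF cg_mult[OF A(3), of "gvar g"]] gvar by auto
qed (auto intro: NFS_add NFS_cst)

text \<open>Modulo the ideal, \<open>p\<close> is a combination of normal forms. The ranks of
  distinct pairs of degree and string are independent, so all its coefficients vanish.\<close>

theorem EE_kernel: assumes p: "p \<in> carrier P" and z: "\<And>s. EE s p = 0" shows "p \<in> J"
proof -
  obtain A c where A: "finite A" "\<forall>x\<in>A. strg x" "cg p (sum (nfs c) A)" using NFS_all[OF p] by (auto simp: NFS_def)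
  have E: "EE s (sum (nfs c) A) = (\<Sum>x\<in>A. single (fst x) (c x * of_nat (ind s (snd x))))" for s
    unfolding EE_sum using A(2) by (intro sum.cong) (auto simp: EE_cst EE_nf strg_def mult_single)
  have "c x = 0" if "x \<in> A" for x
  proof (rule ind_independent[OF A(1), of fst snd])
    show "(\<Sum>x\<in>A. single (fst x) (c x * of_nat (ind s (snd x)))) = 0" for s
      using E[of s] EE_cg[OF A(3), of s] z by simp
  qed (use A that in \<open>auto simp: strg_def prod_eq_iff\<close>)
  then have "sum (nfs c) A = 0" by (intro sum.neutral) simp
  then show ?thesis using A(3) by (simp add: cg_def)
qed

end

section \<open>Simple and indecomposable modules\<close>

text \<open>\<open>Int_tau\<close> for the empty multiset; for a single position it gives
  \<open>string_one_break\<close>. These determine the indecomposable objects over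
  \<open>A(1)\<close> and \<open>A(z - k)\<close>.\<close>

lemma string_no_break: "con D ==> bdiag {} D ==> D = UNIV"
  using Int_tau[of D "{#}"] by simp

lemma string_one_break: "con D ==> bdiag {\<lfloor>k\<rfloor>} D ==> D = gd (tau D k)"
  using Int_tau[of D "{#k#}"] by simp

lemma ev_nonzero [simp]: "ev i l \<noteq> 0"
  unfolding ev_def by (metis lookup_single_eq lookup_zero zero_neq_one)

lemma keys_ev [simp]: "keys (ev i l) = {enc i l}" by (simp add: ev_def)

lemma fact_ev:
  "Up l \<in> S ==> fact t [S] (gwa_letter LPlus) (ev 0 l) = ev 0 (l + 1)"
  "Dn l \<in> S ==> fact t [S] (gwa_letter LMinus) (ev 0 (l + 1)) = cst (hatl t l) * ev 0 l"
  by (simp_all add: fact_letter ev_def lext_single mult_single)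

lemma NM_uminus: "v \<in> Nc Ds ==> \<ominus>\<^bsub>NM t Ds\<^esub> v = - v"
proof -
  assume v: "v \<in> Nc Ds"
  interpret abelian_group "NM t Ds" by (rule abelian_group_NM)
  show ?thesis using v Nc_uminus[OF v] minus_equality[of "- v" v] by simp
qed

lemma submodule_NM:
  assumes bd: "bds t Ds" and B: "\<And>k l. k \<in> B ==> k \<in> Nb Ds ==> keys (lop t Ds l k) \<subseteq> B"
  shows "submodule {v \<in> Nc Ds. keys v \<subseteq> B} (GWA t) (NM t Ds)"
proof (intro submodule.intro subgroup.intro submodule_axioms.intro)
  let ?H = "{v \<in> Nc Ds. keys v \<subseteq> B}"
  show "?H \<subseteq> carrier (add_monoid (NM t Ds))" by auto
  show "\<one>\<^bsub>add_monoid (NM t Ds)\<^esub> \<in> ?H" by simp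
  have add: "x + y \<in> ?H" if "x \<in> ?H" "y \<in> ?H" for x y
    using that Nc_add Poly_Mapping.keys_add[of x y] by blast
  show "x \<otimes>\<^bsub>add_monoid (NM t Ds)\<^esub> y \<in> ?H" if "x \<in> ?H" "y \<in> ?H" for x y using add[OF that] by simp
  show "inv\<^bsub>add_monoid (NM t Ds)\<^esub> x \<in> ?H" if "x \<in> ?H" for x
    using that NM_uminus[of x Ds t] Nc_uminus[of x Ds] by (simp add: a_inv_def keys_minus)
  show "a \<odot>\<^bsub>NM t Ds\<^esub> v \<in> ?H" if a: "a \<in> carrier (GWA t)" and v: "v \<in> ?H" for a v
  proof -
    obtain q where q: "a = gq t q" using a by (auto simp: carrier_GWA)
    have "fact t Ds q v \<in> ?H"
    proof (induction q rule: gwa_free_induct)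
      case (const c)
      show ?case using v Nc_cst[of v Ds c] keys_cst_mult[of c v] by (auto simp: fact_cst)
    next
      case (add p q) then show ?case using \<open>\<And>y x. x \<in> ?H ==> y \<in> ?H ==> x + y \<in> ?H\<close> unfolding fact_add by blast
    next
      case (letter l p)
      let ?w = "fact t Ds p v"
      have w: "keys ?w \<subseteq> Nb Ds" "keys ?w \<subseteq> B" using letter by (auto simp: Nc_def)
      have "lext (lop t Ds l) ?w \<in> Nc Ds" using w by (intro lext_Nc lop_Nc[OF bd]) blast
      moreover have "keys (lext (lop t Ds l) ?w) \<subseteq> B" using keys_lext[of "lop t Ds l" ?w] B w by blast
      ultimately show ?case by (simp add: fact_letter_mult)
    qed
    then show ?thesis using v NM_smult[OF bd, of v q] by (simp add: q)
  qed
qed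

section \<open>Submodules of a string module\<close>

locale string_module =
  fixes t :: "complex poly" and S :: diag
  assumes t: "t \<noteq> 0" and S: "bdiag (brk t) S" "con S"
begin

abbreviation "N \<equiv> NM t [S]"

lemma bd: "bds t [S]" using S by (simp add: bds_def)

lemma keysN: "v \<in> Nc [S] ==> k \<in> keys v ==> k = enc 0 (wt k) \<and> Vx (wt k) \<in> S"
  using Nc_D[of v "[S]" k] enc_ix_wt[of k] by (cases "ix k") auto

context
  fixes H assumes H: "submodule H (GWA t) N"
begin

interpretation H: submodule H "GWA t" N by (rule H)

lemma H_Nc: "H \<subseteq> Nc [S]" using H.subset by simp

lemma H_0: "0 \<in> H" using H.one_closed by simp

lemma H_add: "x \<in> H ==> y \<in> H ==> x + y \<in> H" using H.m_closed by simp

lemma H_fact: "v \<in> H ==> fact t [S] q v \<in> H"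
  using H.smult_closed[of "gq t q" v] NM_smult[OF bd, of v q] H_Nc by (simp add: subsetD)

lemma H_cst: "v \<in> H ==> cst c * v \<in> H" using H_fact[of v "cst c"] by (simp add: fact_cst)

text \<open>A weight component of \<open>v\<close> is a polynomial multiple of \<open>v\<close>, and
  the weight spaces of a string have dimension at most one.\<close>

lemma H_basis: assumes v: "v \<in> H" and l: "lkp v (enc 0 l) \<noteq> 0" shows "ev 0 l \<in> H"
proof -
  obtain r where r: "fact t [S] (gwa_poly r) v = wpart v (of_int l)" using wpart_poly[of v "of_int l"] by blast
  have vN: "v \<in> Nc [S]" using v H_Nc by blast
  have "wpart v (of_int l) = single (enc 0 l) (lkp v (enc 0 l))"
  proof (rule poly_mapping_eqI)
    fix k show "lkp (wpart v (of_int l)) k = lkp (single (enc 0 l) (lkp v (enc 0 l))) k"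
      using keysN[OF vN, of k] by (cases "lkp v k = 0") (auto simp: lookup_wpart lookup_single when_def in_keys_iff)
  qed
  then have "single (enc 0 l) (lkp v (enc 0 l)) \<in> H" using H_fact[OF v, of "gwa_poly r"] r by simp
  from H_cst[OF this, of "1 / lkp v (enc 0 l)"] show ?thesis using l by (simp add: cst_mult_single ev_def)
qed

lemma H_nonzero: assumes "H \<noteq> {0}" shows "\<exists>l. Vx l \<in> S \<and> ev 0 l \<in> H"
proof -
  obtain v where v: "v \<in> H" "v \<noteq> 0" using assms H_0 by blast
  then obtain k where k: "k \<in> keys v" by fastforce
  have "k = enc 0 (wt k) \<and> Vx (wt k) \<in> S" using keysN k v H_Nc by blast
  then show ?thesis using H_basis[OF v(1), of "wt k"] k by (metis in_keys_iff)
qed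

lemma H_all: assumes "\<And>l. Vx l \<in> S ==> ev 0 l \<in> H" shows "H = Nc [S]"
proof
  show "Nc [S] \<subseteq> H"
  proof
    fix v assume v: "v \<in> Nc [S]"
    have "(\<Sum>k\<in>A. single k (lkp v k)) \<in> H" if "finite A" "A \<subseteq> keys v" for A
      using that
    proof (induction A rule: finite_induct)
      case (insert k A)
      have "k = enc 0 (wt k) \<and> Vx (wt k) \<in> S" using keysN[OF v] insert by blast
      then have "cst (lkp v k) * ev 0 (wt k) \<in> H" using assms H_cst by blast
      then have "single k (lkp v k) \<in> H" using \<open>k = enc 0 (wt k) \<and> Vx (wt k) \<in> S\<close>
        by (simp add: ev_def cst_mult_single)
      then show ?case using insert H_add by simp
    qed (simp add: H_0)
    then have "(\<Sum>k\<in>keys v. single k (lkp v k)) \<in> H" by simp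
    then show "v \<in> H" by (simp only: poly_mapping_sum_single[symmetric])
  qed
qed (rule H_Nc)

lemma H_up: "Up l \<in> S ==> ev 0 l \<in> H ==> ev 0 (l + 1) \<in> H"
  using H_fact[of "ev 0 l" "gwa_letter LPlus"] by (simp add: fact_ev)

lemma H_dn: "Dn l \<in> S ==> ev 0 (l + 1) \<in> H ==> ev 0 l \<in> H"
  using H_cst[OF H_fact[of "ev 0 (l + 1)" "gwa_letter LMinus"], of "1 / hatl t l"] hat_nonzero[OF t]
  by (simp add: fact_ev mult.assoc[symmetric] mult_single)

end

lemma S_ne: "Nc [S] \<noteq> {0}"
proof -
  obtain l where "Vx l \<in> S" using S by (auto simp: con_def)
  then have "ev 0 l \<in> Nc [S]" by simp
  moreover have "ev 0 l \<noteq> 0" by simp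
  ultimately show ?thesis by blast
qed

lemma propagate:
  assumes e: "\<And>l. Vx l \<in> S ==> Vx (l + 1) \<in> S ==> P l \<longleftrightarrow> P (l + 1)" and l: "Vx l \<in> S" "P l" and m: "Vx m \<in> S"
  shows "P m"
proof (rule ccontr)
  assume n: "\<not> P m"
  then have "l < m \<or> m < l" using l by (metis linorder_neqE)
  then show False
  proof
    assume "l < m"
    then obtain j where j: "l \<le> j" "j < m" "P j" "\<not> P (j + 1)" using int_step_left[of l m "\<lambda>x. \<not> P x"] n l by auto
    then show False using e[of j] con_convex[OF S(2) l(1) m, of j] con_convex[OF S(2) l(1) m, of "j + 1"] by simp
  next
    assume "m < l"
    then obtain j where j: "m \<le> j" "j < l" "\<not> P j" "P (j + 1)" using int_step_left[of m l P] n l by auto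
    then show False using e[of j] con_convex[OF S(2) m l(1), of j] con_convex[OF S(2) m l(1), of "j + 1"] by simp
  qed
qed

text \<open>With both arrows on every edge, each basis vector generates its neighbours up to nonzero
  scalars.\<close>

lemma simple:
  assumes e: "\<And>l. Vx l \<in> S ==> Vx (l + 1) \<in> S ==> Up l \<in> S \<and> Dn l \<in> S"
  shows "simple_module (GWA t) N"
  unfolding simple_module_def
proof (intro conjI allI impI)
  fix H assume H: "submodule H (GWA t) N"
  show "H = {\<zero>\<^bsub>N\<^esub>} \<or> H = carrier N"
  proof (cases "H = {0}")
    case False
    then obtain l where l: "Vx l \<in> S" "ev 0 l \<in> H" using H_nonzero[OF H] by blast
    have "ev 0 m \<in> H" if "Vx m \<in> S" for m
      by (rule propagate[of "\<lambda>m. ev 0 m \<in> H", OF _ l that]) (use e H_up[OF H] H_dn[OF H] in blast)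
    then show ?thesis using H_all[OF H] by simp
  qed simp
qed (use S_ne in simp)

text \<open>Every basis vector lies in exactly one of the two summands, and an arrow, in whichever
  direction, keeps neighbouring basis vectors in the same one.\<close>

lemma indecomposable: "indecomposable_module (GWA t) N"
  unfolding indecomposable_module_def
proof (intro conjI allI impI)
  fix H K assume "submodule H (GWA t) N \<and> submodule K (GWA t) N \<and> H \<inter> K = {\<zero>\<^bsub>N\<^esub>} \<and> carrier N = H <+>\<^bsub>N\<^esub> K"
  then have H: "submodule H (GWA t) N" and K: "submodule K (GWA t) N"
    and HK: "H \<inter> K = {\<zero>\<^bsub>N\<^esub>}" "carrier N = H <+>\<^bsub>N\<^esub> K" by blast+
  have dis: "\<not> (ev 0 l \<in> H \<and> ev 0 l \<in> K)" for l
  proof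
    assume "ev 0 l \<in> H \<and> ev 0 l \<in> K"
    then have "ev 0 l \<in> {\<zero>\<^bsub>N\<^esub>}" using HK(1) by blast
    then show False by simp
  qed
  have or: "ev 0 l \<in> H \<or> ev 0 l \<in> K" if "Vx l \<in> S" for l
  proof -
    have "ev 0 l \<in> H <+>\<^bsub>N\<^esub> K" unfolding HK(2)[symmetric] using that by simp
    then obtain x y where xy: "x \<in> H" "y \<in> K" "ev 0 l = x + y" by (auto simp: set_add_def')
    have "lkp (ev 0 l) (enc 0 l) = 1" by (simp add: ev_def)
    then have "lkp x (enc 0 l) \<noteq> 0 \<or> lkp y (enc 0 l) \<noteq> 0" unfolding xy(3) by (auto simp: lookup_add)
    then show ?thesis using H_basis[OF H xy(1)] H_basis[OF K xy(2)] by blast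
  qed
  have e: "ev 0 l \<in> H \<longleftrightarrow> ev 0 (l + 1) \<in> H" if "Vx l \<in> S" "Vx (l + 1) \<in> S" for l
    using con_edge[OF S(2) that] or[OF that(1)] or[OF that(2)] dis[of l] dis[of "l + 1"]
      H_up[OF H, of l] H_up[OF K, of l] H_dn[OF H, of l] H_dn[OF K, of l] by blast
  show "H = {\<zero>\<^bsub>N\<^esub>} \<or> K = {\<zero>\<^bsub>N\<^esub>}"
  proof (rule ccontr)
    assume "\<not> ?thesis"
    then obtain l m where l: "Vx l \<in> S" "ev 0 l \<in> H" and m: "Vx m \<in> S" "ev 0 m \<in> K"
      using H_nonzero[OF H] H_nonzero[OF K] by auto
    have "ev 0 m \<in> H" by (rule propagate[of "\<lambda>m. ev 0 m \<in> H", OF e l m(1)])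
    then show False using dis m by blast
  qed
qed (use S_ne in simp)

text \<open>The basis vectors on the side of the edge \<open>h\<close> that no arrow leaves span a
  proper nonzero submodule.\<close>

lemma not_simple:
  assumes v: "Vx h \<in> S" "Vx (h + 1) \<in> S" and e: "Up h \<notin> S \<or> Dn h \<notin> S"
  shows "\<not> simple_module (GWA t) N"
proof
  assume s: "simple_module (GWA t) N"
  have sub: False if "submodule {v \<in> Nc [S]. keys v \<subseteq> B} (GWA t) N" "enc 0 a \<in> B" "enc 0 b \<notin> B" "Vx a \<in> S" "Vx b \<in> S" for B a b
  proof -
    have "{v \<in> Nc [S]. keys v \<subseteq> B} = {0} \<or> {v \<in> Nc [S]. keys v \<subseteq> B} = Nc [S]"
      using s that(1) by (simp add: simple_module_def)
    moreover have "ev 0 a \<in> {v \<in> Nc [S]. keys v \<subseteq> B}" "ev 0 a \<noteq> 0" using that by auto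
    moreover have "ev 0 b \<notin> {v \<in> Nc [S]. keys v \<subseteq> B}" "ev 0 b \<in> Nc [S]" using that by auto
    ultimately show False by blast
  qed
  show False using e
  proof
    assume U: "Up h \<notin> S"
    have "keys (lop t [S] l k) \<subseteq> {k. wt k \<le> h}" if "k \<in> {k. wt k \<le> h}" "k \<in> Nb [S]" for k l
    proof -
      have "Up (wt k) \<in> S ==> wt k \<noteq> h" using U by auto
      then have "Up (wt k) \<in> S ==> wt k + 1 \<le> h" using that by force
      then show ?thesis using that by (cases l) (auto simp: Nb_def ev_def cst_mult_single)
    qed
    from submodule_NM[OF bd this] show False by (rule sub[of _ h "h + 1"]) (use v in auto)
  next
    assume D: "Dn h \<notin> S"
    have "keys (lop t [S] l k) \<subseteq> {k. h < wt k}" if "k \<in> {k. h < wt k}" "k \<in> Nb [S]" for k l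
    proof -
      have "Dn (wt k - 1) \<in> S ==> wt k - 1 \<noteq> h" using D by auto
      then have "Dn (wt k - 1) \<in> S ==> h < wt k - 1" using that by force
      then show ?thesis using that by (cases l) (auto simp: Nb_def ev_def cst_mult_single)
    qed
    from submodule_NM[OF bd this] show False by (rule sub[of _ "h + 1" h]) (use v in auto)
  qed
qed

lemma W_string: "weight_space t N (weight_ideal c) = {v \<in> Nc [S]. \<forall>k\<in>keys v. of_int (wt k) = c}"
  by (rule NM_weight_space[OF bd])

lemma weights_string: "weights t N = {of_int l | l. Vx l \<in> S}"
proof (intro equalityI subsetI)
  fix c assume "c \<in> weights t N"
  then obtain v where v: "v \<in> weight_space t N (weight_ideal c)" "v \<noteq> 0"
    using W_string[of c] by (auto simp: weights_def)
  then obtain k where k: "k \<in> keys v" by fastforce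
  then show "c \<in> {of_int l | l. Vx l \<in> S}" using v keysN[of v k] unfolding W_string by force
next
  fix c :: complex assume "c \<in> {of_int l | l. Vx l \<in> S}"
  then obtain l where l: "c = of_int l" "Vx l \<in> S" by blast
  then have "ev 0 l \<in> weight_space t N (weight_ideal c)" "ev 0 l \<noteq> 0" unfolding W_string by auto
  then show "c \<in> weights t N" by (auto simp: weights_def)
qed

lemma W_ev: "weight_space t N (weight_ideal (of_int l)) = {cst c * ev 0 l | c. Vx l \<in> S \<or> c = 0}"
proof (intro equalityI subsetI)
  fix v assume v: "v \<in> weight_space t N (weight_ideal (of_int l))"
  have k: "k = enc 0 l \<and> Vx l \<in> S" if "k \<in> keys v" for k
    using v that keysN[of v k] unfolding W_string by force
  have "v = cst (lkp v (enc 0 l)) * ev 0 l"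
    using k by (intro poly_mapping_eqI) (auto simp: ev_def cst_mult_single lookup_single when_def in_keys_iff)
  moreover have "Vx l \<in> S \<or> lkp v (enc 0 l) = 0" using k by (auto simp: in_keys_iff)
  ultimately show "v \<in> {cst c * ev 0 l | c. Vx l \<in> S \<or> c = 0}" by blast
next
  fix v assume "v \<in> {cst c * ev 0 l | c. Vx l \<in> S \<or> c = 0}"
  then show "v \<in> weight_space t N (weight_ideal (of_int l))" unfolding W_string
    by (cases "v = 0") (auto simp: ev_def cst_mult_single split: if_splits intro!: Nc_single)
qed

lemma one_dim: "one_dim_weights t N"
  unfolding one_dim_weights_def
proof
  fix c assume "c \<in> weights t N"
  then obtain l where l: "c = of_int l" "Vx l \<in> S" unfolding weights_string by blast
  have "weight_space t N (weight_ideal c) = {v \<in> Nc [S]. \<forall>k\<in>keys v. k \<in> {enc 0 l}}"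
    unfolding W_string using keysN by (auto simp: l)
  from has_dim_NM[OF bd this] show "has_dim t N (weight_space t N (weight_ideal c)) 1" using l by simp
qed

lemma X_ev:
  assumes "Vx l \<in> S"
  shows "gwa_X t LPlus \<odot>\<^bsub>N\<^esub> (cst c * ev 0 l) = (if Up l \<in> S then cst c * ev 0 (l + 1) else 0)"
    and "gwa_X t LMinus \<odot>\<^bsub>N\<^esub> (cst c * ev 0 l) = (if Dn (l - 1) \<in> S then cst (c * hatl t (l - 1)) * ev 0 (l - 1) else 0)"
proof -
  have "cst c * ev 0 l \<in> Nc [S]" using assms by (intro Nc_cst) simp
  note X = NM_X[OF bd this]
  show "gwa_X t LPlus \<odot>\<^bsub>N\<^esub> (cst c * ev 0 l) = (if Up l \<in> S then cst c * ev 0 (l + 1) else 0)"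
    "gwa_X t LMinus \<odot>\<^bsub>N\<^esub> (cst c * ev 0 l) = (if Dn (l - 1) \<in> S then cst (c * hatl t (l - 1)) * ev 0 (l - 1) else 0)"
    unfolding X lext_cst by (simp_all add: ev_def lext_single cst_mult_single)
qed

end

subsection \<open>Transport along isomorphisms\<close>

context
  fixes t :: "complex poly" and N :: "'v gwa_module" and M :: "'w gwa_module" and f
  assumes N: "left_module (GWA t) N" and M: "left_module (GWA t) M" and f: "f \<in> module_iso (GWA t) N M"
begin

interpretation N: gwa_mod t N using N by (rule gwa_modI)
interpretation M: gwa_mod t M using M by (rule gwa_modI)

lemma iso_0: "f \<zero>\<^bsub>N\<^esub> = \<zero>\<^bsub>M\<^esub>" by (rule module_iso_zero[OF N M f])

lemma iso_carrier: "carrier M = f ` carrier N" using module_iso_D(1)[OF f] by (simp add: bij_betw_def)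

lemma iso_inj: "x \<in> carrier N ==> y \<in> carrier N ==> f x = f y \<longleftrightarrow> x = y"
  using module_iso_D(1)[OF f] by (auto simp: bij_betw_def inj_on_def)

lemma iso_eq_0: "x \<in> carrier N ==> f x = \<zero>\<^bsub>M\<^esub> \<longleftrightarrow> x = \<zero>\<^bsub>N\<^esub>"
  using iso_inj[of x "\<zero>\<^bsub>N\<^esub>"] by (simp add: iso_0)

lemma iso_ps: "x \<in> carrier N ==> f (N.ps r x) = M.ps r (f x)"
  by (simp add: module_iso_D(4)[OF f] gwa_of_poly_gq)

lemma iso_X: "x \<in> carrier N ==> f (N.X l x) = M.X l (f x)"
  by (simp add: module_iso_D(4)[OF f] gwa_X_gq)

lemma iso_W: "M.W l = f ` N.W l"
proof -
  have "f x \<in> M.W l \<longleftrightarrow> x \<in> N.W l" if "x \<in> carrier N" for x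
    using that module_iso_D(2)[OF f that] by (simp add: M.W_iff N.W_iff iso_ps[symmetric] iso_eq_0)
  then show ?thesis using M.W_carrier N.W_carrier unfolding iso_carrier by blast
qed

lemma iso_weights: "weights t M = weights t N"
proof -
  have "M.W l = {\<zero>\<^bsub>M\<^esub>} \<longleftrightarrow> N.W l = {\<zero>\<^bsub>N\<^esub>}" for l
  proof -
    have "x \<in> N.W l ==> f x = \<zero>\<^bsub>M\<^esub> \<longleftrightarrow> x = \<zero>\<^bsub>N\<^esub>" for x using iso_eq_0 N.W_carrier by blast
    then show ?thesis unfolding iso_W using N.W_zero[of l] iso_0 by (auto simp: image_iff)
  qed
  then show ?thesis by (simp add: weights_def)
qed

lemma iso_X_nonzero: "X_nonzero_at t M l a \<longleftrightarrow> X_nonzero_at t N l a"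
  unfolding X_nonzero_at_def iso_W ball_simps
  using N.W_carrier by (intro ball_cong refl) (simp add: iso_eq_0 iso_X[symmetric])

lemma iso_submodule: assumes H: "submodule H (GWA t) N" shows "submodule (f ` H) (GWA t) M"
proof -
  interpret H: submodule H "GWA t" N by (rule H)
  have sub: "H \<subseteq> carrier N" using H.subset by simp
  show ?thesis
  proof (intro submodule.intro subgroup.intro submodule_axioms.intro)
    show "f ` H \<subseteq> carrier (add_monoid M)" using sub iso_carrier by auto
    show "\<one>\<^bsub>add_monoid M\<^esub> \<in> f ` H" using H.one_closed iso_0 by (auto simp: image_iff intro: bexI[of _ "\<zero>\<^bsub>N\<^esub>"])
    show "x \<otimes>\<^bsub>add_monoid M\<^esub> y \<in> f ` H" if xy: "x \<in> f ` H" "y \<in> f ` H" for x y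
    proof -
      obtain a b where ab: "a \<in> H" "b \<in> H" "x = f a" "y = f b" using xy by blast
      have "a \<in> carrier N" "b \<in> carrier N" using ab sub by blast+
      from module_iso_D(3)[OF f this] have "x \<otimes>\<^bsub>add_monoid M\<^esub> y = f (a \<oplus>\<^bsub>N\<^esub> b)" by (simp add: ab)
      then show ?thesis using H.m_closed[OF ab(1,2)] by simp
    qed
    show "inv\<^bsub>add_monoid M\<^esub> x \<in> f ` H" if x: "x \<in> f ` H" for x
    proof -
      obtain a where a: "a \<in> H" "x = f a" using x by blast
      have aN: "a \<in> carrier N" using a sub by blast
      have "f (\<ominus>\<^bsub>N\<^esub> a) \<oplus>\<^bsub>M\<^esub> f a = \<zero>\<^bsub>M\<^esub>" using aN by (simp add: module_iso_D(3)[OF f, symmetric] N.l_neg iso_0)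
      then have "\<ominus>\<^bsub>M\<^esub> x = f (\<ominus>\<^bsub>N\<^esub> a)" using aN a(2) by (intro M.minus_equality) (auto simp: module_iso_D(2)[OF f])
      then show ?thesis using H.m_inv_closed[OF a(1)] by (simp add: a_inv_def)
    qed
    show "a \<odot>\<^bsub>M\<^esub> x \<in> f ` H" if a: "a \<in> carrier (GWA t)" and x: "x \<in> f ` H" for a x
    proof -
      obtain b where b: "b \<in> H" "x = f b" using x by blast
      then have "a \<odot>\<^bsub>M\<^esub> x = f (a \<odot>\<^bsub>N\<^esub> b)" using module_iso_D(4)[OF f a, of b] sub by auto
      then show ?thesis using H.smult_closed[OF a b(1)] by simp
    qed
  qed
qed

lemma iso_indecomposable: assumes ind: "indecomposable_module (GWA t) M" shows "indecomposable_module (GWA t) N"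
  unfolding indecomposable_module_def
proof (intro conjI allI impI)
  show "carrier N \<noteq> {\<zero>\<^bsub>N\<^esub>}" using ind iso_carrier iso_0 by (auto simp: indecomposable_module_def)
  fix H K assume "submodule H (GWA t) N \<and> submodule K (GWA t) N \<and> H \<inter> K = {\<zero>\<^bsub>N\<^esub>} \<and> carrier N = H <+>\<^bsub>N\<^esub> K"
  then have H: "submodule H (GWA t) N" and K: "submodule K (GWA t) N"
    and HK: "H \<inter> K = {\<zero>\<^bsub>N\<^esub>}" "carrier N = H <+>\<^bsub>N\<^esub> K" by blast+
  have sub: "H \<subseteq> carrier N" "K \<subseteq> carrier N"
    using subgroup.subset[OF submodule.axioms(1)[OF H]] subgroup.subset[OF submodule.axioms(1)[OF K]] by simp_all
  have inj: "inj_on f (carrier N)" using module_iso_D(1)[OF f] by (simp add: bij_betw_def)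
  have "f ` H \<inter> f ` K = {\<zero>\<^bsub>M\<^esub>}" using inj_on_image_Int[OF inj sub] HK(1) iso_0 by simp
  moreover have "carrier M = f ` H <+>\<^bsub>M\<^esub> f ` K"
  proof -
    have "f ` (H <+>\<^bsub>N\<^esub> K) = f ` H <+>\<^bsub>M\<^esub> f ` K"
    proof -
      have "f ` (H <+>\<^bsub>N\<^esub> K) = (\<Union>h\<in>H. \<Union>k\<in>K. {f (h \<oplus>\<^bsub>N\<^esub> k)})" by (auto simp: set_add_def')
      also have "\<dots> = (\<Union>h\<in>H. \<Union>k\<in>K. {f h \<oplus>\<^bsub>M\<^esub> f k})"
        using sub by (intro SUP_cong refl) (simp add: module_iso_D(3)[OF f] subsetD)
      finally show ?thesis by (simp add: set_add_def')
    qed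
    then show ?thesis using HK(2) iso_carrier by simp
  qed
  ultimately have "f ` H = {\<zero>\<^bsub>M\<^esub>} \<or> f ` K = {\<zero>\<^bsub>M\<^esub>}"
    using ind iso_submodule[OF H] iso_submodule[OF K] unfolding indecomposable_module_def by blast
  moreover have "L = {\<zero>\<^bsub>N\<^esub>}" if L: "f ` L = {\<zero>\<^bsub>M\<^esub>}" "L \<subseteq> carrier N" for L
  proof -
    have "x = \<zero>\<^bsub>N\<^esub>" if "x \<in> L" for x using L that iso_eq_0[of x] by blast
    moreover have "L \<noteq> {}" using L by blast
    ultimately show ?thesis by blast
  qed
  ultimately show "H = {\<zero>\<^bsub>N\<^esub>} \<or> K = {\<zero>\<^bsub>N\<^esub>}" using sub by blast
qed

end

lemma simple_indecomposable: "simple_module R M ==> indecomposable_module R M"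
  unfolding simple_module_def indecomposable_module_def
proof (elim conjE, intro conjI allI impI, assumption)
  fix H K
  assume s: "\<forall>H. submodule H R M --> H = {\<zero>\<^bsub>M\<^esub>} \<or> H = carrier M"
    and HK: "submodule H R M \<and> submodule K R M \<and> H \<inter> K = {\<zero>\<^bsub>M\<^esub>} \<and> carrier M = H <+>\<^bsub>M\<^esub> K"
  have "K \<subseteq> carrier M" using subgroup.subset[OF submodule.axioms(1), of K R M] HK by simp
  then show "H = {\<zero>\<^bsub>M\<^esub>} \<or> K = {\<zero>\<^bsub>M\<^esub>}" using s HK by blast
qed

text \<open>The first diagram of a list splits off as a direct summand, and the modules of strings
  are nonzero.\<close>

lemma indecomposable_length:
  assumes bd: "bds t Ds" and con: "\<forall>D\<in>set Ds. con D" and ind: "indecomposable_module (GWA t) (NM t Ds)"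
  shows "\<exists>D. Ds = [D]"
proof (rule ccontr)
  assume n: "\<nexists>D. Ds = [D]"
  show False
  proof (cases Ds)
    case Nil
    have "v = 0" if "v \<in> Nc []" for v
    proof -
      have "keys v = {}" using that by (auto simp: Nc_def Nb_def)
      then show ?thesis by simp
    qed
    then have "Nc [] = {0}" by auto
    then show False using ind by (simp add: indecomposable_module_def Nil)
  next
    case (Cons D Ds')
    then have len: "1 < length Ds" using n by (cases Ds') auto
    let ?H = "{v \<in> Nc Ds. keys v \<subseteq> {k. ix k = 0}}" and ?K = "{v \<in> Nc Ds. keys v \<subseteq> {k. ix k \<noteq> 0}}"
    have keys: "keys (lop t Ds l k) \<subseteq> {j. ix j = ix k}" for l k
      by (cases l) (auto simp: ev_def cst_mult_single)
    have H: "submodule ?H (GWA t) (NM t Ds)" and K: "submodule ?K (GWA t) (NM t Ds)"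
      using keys by (intro submodule_NM[OF bd]; fastforce)+
    have int: "?H \<inter> ?K = {\<zero>\<^bsub>NM t Ds\<^esub>}"
    proof -
      have "v = 0" if "v \<in> ?H \<inter> ?K" for v
      proof -
        have "keys v = {}" using that by blast
        then show ?thesis by simp
      qed
      then show ?thesis by auto
    qed
    have "carrier (NM t Ds) = ?H <+>\<^bsub>NM t Ds\<^esub> ?K"
    proof (intro equalityI subsetI)
      fix v assume "v \<in> carrier (NM t Ds)"
      then have v: "keys v \<subseteq> Nb Ds" by (simp add: Nc_def)
      let ?p = "\<lambda>A. \<Sum>k\<in>keys v \<inter> A. single k (lkp v k)"
      have kp: "keys (?p A) \<subseteq> keys v \<inter> A" for A
        using keys_sum[of "\<lambda>k. single k (lkp v k)" "keys v \<inter> A"] by (auto split: if_splits)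
      have p1: "?p {k. ix k = 0} \<in> ?H" "?p {k. ix k \<noteq> 0} \<in> ?K" using kp v unfolding Nc_def by blast+
      have "v = ?p {k. ix k = 0} + ?p {k. ix k \<noteq> 0}"
      proof -
        have "(\<Sum>k\<in>keys v. single k (lkp v k)) = ?p {k. ix k = 0} + ?p {k. ix k \<noteq> 0}"
          by (subst sum.union_disjoint[symmetric]) (auto intro: sum.cong)
        then show ?thesis by (simp only: poly_mapping_sum_single[symmetric])
      qed
      then show "v \<in> ?H <+>\<^bsub>NM t Ds\<^esub> ?K" using p1 by (force simp: set_add_def')
    qed (auto simp: set_add_def' intro: Nc_add)
    with H K int have "?H = {\<zero>\<^bsub>NM t Ds\<^esub>} \<or> ?K = {\<zero>\<^bsub>NM t Ds\<^esub>}"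
      using ind[unfolded indecomposable_module_def, THEN conjunct2, THEN spec, THEN spec, of ?H ?K] by blast
    then have "?H = {0} \<or> ?K = {0}" by (simp only: NM_simps)
    moreover have "con (Ds ! 0)" "con (Ds ! 1)" using con len by (auto simp: Cons)
    then obtain l m where lm: "Vx l \<in> Ds ! 0" "Vx m \<in> Ds ! 1" by (auto simp: con_def)
    have "ev 0 l \<in> ?H" "ev 1 m \<in> ?K" using lm len by (auto simp: ev_def intro!: Nc_single)
    ultimately show False using ev_nonzero by blast
  qed
qed

lemma indecomposable_string:
  assumes t: "t \<noteq> 0" and M: "M \<in> wmod_O t" and ind: "indecomposable_module (GWA t) M"
  shows "\<exists>D f. string_module t D \<and> f \<in> module_iso (GWA t) (NM t [D]) M"
proof -
  obtain Ds where Ds: "bds t Ds" "\<forall>D\<in>set Ds. con D" "module_iso (GWA t) (NM t Ds) M \<noteq> {}"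
    using wmod_decomposition[of t M] M t by (auto simp: wmod_O_def)
  then obtain f where f: "f \<in> module_iso (GWA t) (NM t Ds) M" by blast
  have "indecomposable_module (GWA t) (NM t Ds)"
    by (rule iso_indecomposable[OF left_module_NM[OF Ds(1)] wmod_O_left_module[OF M] f ind])
  then obtain D where "Ds = [D]" using indecomposable_length[OF Ds(1,2)] by blast
  then show ?thesis using Ds f t by (auto simp: string_module_def bds_def)
qed

section \<open>The isomorphism\<close>

sublocale presentation \<subseteq> split Z .

context presentation
begin

lemma brk_Gam: assumes t: "t \<in> G" shows "brk t = flo (dg t)"
proof (intro equalityI subsetI)
  fix l assume "l \<in> brk t"
  then have "of_int l + 1/2 \<in># proots t" using Gam_nonzero[OF t] by (simp add: brk_def)
  then have "Re (of_int l + 1/2) \<in># dg t" unfolding dg_def by (metis imageI set_image_mset)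
  moreover have "\<lfloor>Re (of_int l + 1/2)\<rfloor> = l" by (simp add: floor_eq_iff)
  ultimately show "l \<in> flo (dg t)" by force
next
  fix l assume "l \<in> flo (dg t)"
  then obtain x where x: "poly t x = 0" "l = \<lfloor>Re x\<rfloor>" using Gam_nonzero[OF t] by (auto simp: dg_def)
  then obtain k where k: "k \<in> Z" "x = of_real k" using t by (auto simp: Gam_def)
  have "x = of_int l + 1/2" using floor_half[OF k(1)] x(2) k(2) by (metis Re_complex_of_real of_real_add of_real_divide of_real_numeral of_real_of_int_eq of_real_1)
  then show "l \<in> brk t" using x by (simp add: brk_def)
qed

lemma brk_lin: "k \<in> Z ==> brk (lin k) = {\<lfloor>k\<rfloor>}" using brk_Gam[OF Gam_lin] by simp

lemma brk_1: "brk 1 = {}" by (simp add: brk_def)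

lemma string_gd: "pos g \<in> Z ==> string_module (lin (pos g)) (gd g)"
  using Gam_nonzero[OF Gam_lin] bdiag_gd[of g] con_gd by (simp add: string_module_def brk_lin)

lemma FF_string:
  assumes "t \<in> G" "bdiag (brk t) C"
  shows "FF (split_class Z t (NM t [C])) s = single (dg t) (of_nat (ind s C))"
  using FF_gen[OF assms, of 1 s] FF_smult[OF split_class_closed[OF assms(1) is_wmod_string[OF assms(2)]], of 1 s] by simp

subsection \<open>Equality of images\<close>

lemma EE_image: assumes p: "p \<in> carrier P" shows "\<exists>a\<in>carrier V. \<forall>s. FF a s = EE s p"
proof -
  obtain A c where A: "finite A" "\<forall>x\<in>A. strg x" "cg p (sum (nfs c) A)" using NFS_all[OF p] by (auto simp: NFS_def)
  have "\<exists>a\<in>carrier V. \<forall>s. FF a s = EE s (sum (nfs c) B)" if "finite B" "B \<subseteq> A" for B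
    using that
  proof (induction B rule: finite_induct)
    case empty then show ?case by (intro bexI[of _ "\<zero>\<^bsub>V\<^esub>"]) (simp_all add: FF_zero)
  next
    case (insert x B)
    then obtain b where b: "b \<in> carrier V" "\<forall>s. FF b s = EE s (sum (nfs c) B)" by blast
    have x: "set_mset (fst x) \<subseteq> Z" "con (snd x)" "bdiag (flo (fst x)) (snd x)" using insert A(2) by (auto simp: strg_def)
    define t where "t = (\<Prod>k\<in>#fst x. lin k)"
    have t: "t \<in> G" "dg t = fst x" using Gam_prod[OF x(1)] by (simp_all add: t_def)
    have bd: "bdiag (brk t) (snd x)" using x(3) t by (simp add: brk_Gam)
    let ?a = "c x \<odot>\<^bsub>V\<^esub> split_class Z t (NM t [snd x])"
    have a: "?a \<in> carrier V" using bd t by (intro smult_closed split_class_closed is_wmod_string)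
    have "FF (?a \<oplus>\<^bsub>V\<^esub> b) s = EE s (sum (nfs c) (insert x B))" for s
      using insert(1,2) a b FF_gen[OF t(1) bd, of "c x" s] x
      by (simp add: FF_add EE_add EE_cst EE_nf t mult_single)
    then show ?case using a b(1) by blast
  qed
  then show ?thesis using A(1) EE_cg[OF A(3)] by simp
qed

lemma FF_image: "a \<in> carrier V ==> \<exists>p\<in>carrier P. \<forall>s. EE s p = FF a s"
proof (induction rule: V_induct)
  case zero then show ?case by (intro bexI[of _ 0]) (simp_all add: FF_zero)
next
  case (gen c t C)
  have "EE s (cst c * nf (dg t) C) = FF (c \<odot>\<^bsub>V\<^esub> split_class Z t (NM t [C])) s" for s
    using gen by (simp add: FF_gen EE_cst EE_nf brk_Gam[symmetric] mult_single)
  moreover have "cst c * nf (dg t) C \<in> carrier P" using nf_P[OF set_dg[OF gen(1)]] by blast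
  ultimately show ?case by blast
next
  case (add a b)
  then obtain p q where "p \<in> carrier P" "\<forall>s. EE s p = FF a s" "q \<in> carrier P" "\<forall>s. EE s q = FF b s" by blast
  then show ?case using add by (intro bexI[of _ "p + q"]) (auto simp: EE_add FF_add)
qed

text \<open>Polynomials and elements of the split algebra have ranks in the same algebra, and the
  ranks of the latter are faithful. So every property of \<open>psi\<close> is checked on
  ranks.\<close>

definition psi :: "gpoly => complex poly => ck0" where
  "psi p = (SOME a. a \<in> carrier V \<and> (\<forall>s. FF a s = EE s p))"

lemma psi: "p \<in> carrier P ==> psi p \<in> carrier V \<and> (\<forall>s. FF (psi p) s = EE s p)"
  unfolding psi_def by (rule someI_ex[of "\<lambda>a. a \<in> carrier V \<and> (\<forall>s. FF a s = EE s p)"]) (use EE_image in blast)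

lemma psi_closed: "p \<in> carrier P ==> psi p \<in> carrier V" and FF_psi: "p \<in> carrier P ==> FF (psi p) s = EE s p"
  using psi by blast+

lemma psi_eqI: "p \<in> carrier P ==> a \<in> carrier V ==> (\<And>s. FF a s = EE s p) ==> psi p = a"
  by (rule FF_inj) (simp_all add: psi_closed FF_psi)

lemma psi_eq_iff: "p \<in> carrier P ==> q \<in> carrier P ==> psi p = psi q \<longleftrightarrow> p - q \<in> J"
proof
  assume pq: "p \<in> carrier P" "q \<in> carrier P" "psi p = psi q"
  then have "EE s p = EE s q" for s using FF_psi by metis
  then show "p - q \<in> J" using pq by (intro EE_kernel) (auto simp: EE_diff)
next
  assume pq: "p \<in> carrier P" "q \<in> carrier P" "p - q \<in> J"
  then show "psi p = psi q" using EE_J[of "p - q"] by (intro psi_eqI psi_closed) (auto simp: EE_diff FF_psi)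
qed

lemma psi_surj: "a \<in> carrier V ==> \<exists>p\<in>carrier P. psi p = a"
  using FF_image psi_eqI by metis

subsection \<open>The unit\<close>

lemma split_class_iso:
  assumes "t \<in> G" "string_module t D" "f \<in> module_iso (GWA t) (NM t [D]) M"
  shows "split_class Z t M = split_class Z t (NM t [D])"
proof -
  have "K0_class t M = K0_class t (NM t [D])"
    using assms by (intro K0_group.K0_class_iso[OF K0_group_Gam string_module.bd]) auto
  then show ?thesis by (simp add: split_class_emb assms(1))
qed

lemma string_1: "string_module 1 UNIV" by (simp add: string_module_def brk_1 bdiag_UNIV con_gd)

text \<open>Over \<open>A(1)\<close> there are no breaks, so a simple object is given by the single
  string \<open>UNIV\<close>; this makes the definite description meaningful.\<close>

lemma split_one_eq: "split_one Z = split_class Z 1 (NM 1 [UNIV])"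
  unfolding split_one_def
proof (rule the_equality)
  show "\<exists>M\<in>wmod_O 1. simple_module (GWA 1) M \<and> split_class Z 1 (NM 1 [UNIV]) = split_class Z 1 M"
    using NM_wmod[OF string_module.bd[OF string_1]] string_module.simple[OF string_1] by blast
next
  fix u assume "\<exists>M\<in>wmod_O 1. simple_module (GWA 1) M \<and> u = split_class Z 1 M"
  then obtain M where M: "M \<in> wmod_O 1" "simple_module (GWA 1) M" "u = split_class Z 1 M" by blast
  obtain D f where D: "string_module 1 D" "f \<in> module_iso (GWA 1) (NM 1 [D]) M"
    using indecomposable_string[OF _ M(1) simple_indecomposable[OF M(2)]] by auto
  then have "D = UNIV" using string_no_break[of D] by (simp add: string_module_def brk_1)
  then show "u = split_class Z 1 (NM 1 [UNIV])" using split_class_iso[OF Gam_1 D] M(3) by simp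
qed

lemma bdiag_1: "bdiag (brk 1) UNIV" by (simp add: brk_1 bdiag_UNIV)

lemma split_one_closed: "split_one Z \<in> carrier V"
  unfolding split_one_eq by (rule split_class_closed[OF Gam_1 is_wmod_string[OF bdiag_1]])

lemma FF_one: "FF (split_one Z) s = EE s 1"
proof -
  have "EE s (nf {#} UNIV) = single {#} (of_nat (ind s UNIV))" by (rule EE_nf) (simp_all add: con_gd bdiag_UNIV)
  then show ?thesis unfolding split_one_eq FF_string[OF Gam_1 bdiag_1] by simp
qed

lemma psi_1: "psi 1 = split_one Z" by (rule psi_eqI) (simp_all add: split_one_closed FF_one)

lemma psi_add: "p \<in> carrier P ==> q \<in> carrier P ==> psi (p + q) = psi p \<oplus>\<^bsub>V\<^esub> psi q"
  by (rule psi_eqI) (auto simp: psi_closed FF_add FF_psi EE_add)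

lemma psi_mult: "p \<in> carrier P ==> q \<in> carrier P ==> psi (p * q) = split_mult Z (psi p) (psi q)"
  by (rule psi_eqI) (auto simp: psi_closed split_mult_closed FF_mult FF_psi EE_mult)

lemma psi_cst: "p \<in> carrier P ==> psi (cst c * p) = c \<odot>\<^bsub>V\<^esub> psi p"
  by (rule psi_eqI) (auto simp: psi_closed smult_closed FF_smult FF_psi EE_cst)

subsection \<open>The two algebras\<close>

lemma split_simps [simp]:
  "carrier (split_algebra Z) = carrier V" "monoid.mult (split_algebra Z) = split_mult Z"
  "monoid.one (split_algebra Z) = split_one Z" "ring.zero (split_algebra Z) = \<zero>\<^bsub>V\<^esub>"
  "ring.add (split_algebra Z) = ring.add V" "smult (split_algebra Z) = smult V"
  by (simp_all add: split_algebra_def)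

lemma cring_split: "cring (split_algebra Z)"
proof (rule cringI)
  show "abelian_group (split_algebra Z)"
    by (rule abelian_groupI) (auto simp: V.a_ac intro: bexI[of _ "\<ominus>\<^bsub>V\<^esub> x" for x] V.l_neg)
  have one: "split_mult Z (split_one Z) a = a" if a: "a \<in> carrier V" for a
  proof -
    obtain p where p: "p \<in> carrier P" "psi p = a" using psi_surj[OF a] by blast
    show ?thesis using psi_mult[OF P_1 p(1)] p(2) by (simp add: psi_1)
  qed
  show "comm_monoid (split_algebra Z)"
  proof (rule comm_monoidI)
    fix x y z assume xyz: "x \<in> carrier (split_algebra Z)" "y \<in> carrier (split_algebra Z)" "z \<in> carrier (split_algebra Z)"
    show "x \<otimes>\<^bsub>split_algebra Z\<^esub> y \<otimes>\<^bsub>split_algebra Z\<^esub> z = x \<otimes>\<^bsub>split_algebra Z\<^esub> (y \<otimes>\<^bsub>split_algebra Z\<^esub> z)"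
      using xyz by (auto intro!: FF_inj simp: FF_mult split_mult_closed mult.assoc)
  next
    fix x y assume xy: "x \<in> carrier (split_algebra Z)" "y \<in> carrier (split_algebra Z)"
    show "x \<otimes>\<^bsub>split_algebra Z\<^esub> y = y \<otimes>\<^bsub>split_algebra Z\<^esub> x"
      using xy by (auto intro!: FF_inj simp: FF_mult split_mult_closed mult.commute)
  qed (auto simp: split_mult_closed split_one_closed one)
  show "(x \<oplus>\<^bsub>split_algebra Z\<^esub> y) \<otimes>\<^bsub>split_algebra Z\<^esub> z = x \<otimes>\<^bsub>split_algebra Z\<^esub> z \<oplus>\<^bsub>split_algebra Z\<^esub> y \<otimes>\<^bsub>split_algebra Z\<^esub> z"
    if "x \<in> carrier (split_algebra Z)" "y \<in> carrier (split_algebra Z)" "z \<in> carrier (split_algebra Z)" for x y z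
    using that by (auto intro!: FF_inj simp: FF_mult FF_add split_mult_closed distrib_right)
qed

lemma algebra_split: "algebra CC (split_algebra Z)"
proof (rule algebraI[OF cring_UNIV_ring cring_split])
  fix a b :: complex and x y assume xy: "x \<in> carrier (split_algebra Z)" "y \<in> carrier (split_algebra Z)"
  show "(a \<odot>\<^bsub>split_algebra Z\<^esub> x) \<otimes>\<^bsub>split_algebra Z\<^esub> y = a \<odot>\<^bsub>split_algebra Z\<^esub> (x \<otimes>\<^bsub>split_algebra Z\<^esub> y)"
    using xy by (auto intro!: FF_inj simp: FF_mult FF_smult split_mult_closed smult_closed mult.assoc)
  show "a \<odot>\<^bsub>split_algebra Z\<^esub> (x \<oplus>\<^bsub>split_algebra Z\<^esub> y) = a \<odot>\<^bsub>split_algebra Z\<^esub> x \<oplus>\<^bsub>split_algebra Z\<^esub> a \<odot>\<^bsub>split_algebra Z\<^esub> y"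
    using xy by (auto intro!: FF_inj simp: FF_add FF_smult smult_closed distrib_left)
next
  fix a b :: complex and x assume x: "x \<in> carrier (split_algebra Z)"
  show "(a \<oplus>\<^bsub>CC\<^esub> b) \<odot>\<^bsub>split_algebra Z\<^esub> x = a \<odot>\<^bsub>split_algebra Z\<^esub> x \<oplus>\<^bsub>split_algebra Z\<^esub> b \<odot>\<^bsub>split_algebra Z\<^esub> x"
    using x by (auto intro!: FF_inj simp: FF_add FF_smult smult_closed distrib_right single_add)
  show "(a \<otimes>\<^bsub>CC\<^esub> b) \<odot>\<^bsub>split_algebra Z\<^esub> x = a \<odot>\<^bsub>split_algebra Z\<^esub> (b \<odot>\<^bsub>split_algebra Z\<^esub> x)"
    using x by (auto intro!: FF_inj simp: FF_smult smult_closed mult.assoc[symmetric] mult_single)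
  show "\<one>\<^bsub>CC\<^esub> \<odot>\<^bsub>split_algebra Z\<^esub> x = x"
    using x by (auto intro!: FF_inj simp: FF_smult smult_closed)
qed (simp add: smult_closed)

abbreviation "Q \<equiv> P Quot J"
abbreviation "pe \<equiv> pres_elem Z"

lemma pe_hom: "pe \<in> ring_hom P Q"
  using J.rcos_ring_hom by (simp add: pres_elem_def[abs_def])

lemma pe_simps:
  "p \<in> carrier P ==> q \<in> carrier P ==> pe p \<oplus>\<^bsub>Q\<^esub> pe q = pe (p + q)"
  "p \<in> carrier P ==> q \<in> carrier P ==> pe p \<otimes>\<^bsub>Q\<^esub> pe q = pe (p * q)"
  "\<one>\<^bsub>Q\<^esub> = pe 1" "p \<in> carrier P ==> pe p \<in> carrier Q"
  using ring_hom_add[OF pe_hom] ring_hom_mult[OF pe_hom] ring_hom_one[OF pe_hom] ring_hom_closed[OF pe_hom] by simp_all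

lemma carrier_Q: "carrier Q = pe ` carrier P"
  by (auto simp: FactRing_def A_RCOSETS_def' pres_elem_def)

lemma pres_simps [simp]:
  "carrier (pres_algebra Z) = carrier Q" "monoid.mult (pres_algebra Z) = monoid.mult Q"
  "monoid.one (pres_algebra Z) = monoid.one Q" "ring.zero (pres_algebra Z) = ring.zero Q"
  "ring.add (pres_algebra Z) = ring.add Q" "c \<odot>\<^bsub>pres_algebra Z\<^esub> a = pe (cst c) \<otimes>\<^bsub>Q\<^esub> a"
  by (simp_all add: pres_algebra_def Let_def)

lemma algebra_pres: "algebra CC (pres_algebra Z)"
proof -
  interpret Q: cring Q by (rule J.quotient_is_cring[OF cring_P])
  have cr: "cring (pres_algebra Z)"
  proof (rule cringI)
    show "abelian_group (pres_algebra Z)"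
      by (rule abelian_groupI) (auto simp: Q.a_ac intro: bexI[of _ "\<ominus>\<^bsub>Q\<^esub> x" for x] Q.l_neg)
    show "comm_monoid (pres_algebra Z)" by (rule comm_monoidI) (auto simp: Q.m_ac)
  qed (auto simp: Q.l_distr)
  have c: "pe (cst c) \<in> carrier Q" for c by (rule pe_simps(4)) simp
  have cm: "pe (cst (a + b)) = pe (cst a) \<oplus>\<^bsub>Q\<^esub> pe (cst b)" "pe (cst (a * b)) = pe (cst a) \<otimes>\<^bsub>Q\<^esub> pe (cst b)" for a b
    by (simp_all add: pe_simps single_add mult_single)
  have c1: "pe (cst 1) = \<one>\<^bsub>Q\<^esub>" by (simp add: pe_simps)
  show ?thesis
  proof (rule algebraI[OF cring_UNIV_ring cr])
    show "\<one>\<^bsub>CC\<^esub> \<odot>\<^bsub>pres_algebra Z\<^esub> x = x" if "x \<in> carrier (pres_algebra Z)" for x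
      using that c1 by (simp del: single_one)
  qed (use c cm in \<open>auto simp: Q.l_distr Q.r_distr Q.m_assoc\<close>)
qed

lemma pe_eq_iff: "p \<in> carrier P ==> q \<in> carrier P ==> pe p = pe q \<longleftrightarrow> p - q \<in> J"
proof
  assume pq: "p \<in> carrier P" "q \<in> carrier P" "pe p = pe q"
  have "p \<in> J +>\<^bsub>P\<^esub> p" using J.a_rcos_self[OF pq(1)] .
  then have "p \<in> J +>\<^bsub>P\<^esub> q" using pq(3) by (simp add: pres_elem_def)
  then obtain j where "j \<in> J" "p = j + q" by (auto simp: a_r_coset_def')
  then show "p - q \<in> J" by simp
next
  assume pq: "p \<in> carrier P" "q \<in> carrier P" "p - q \<in> J"
  then have "p \<in> J +>\<^bsub>P\<^esub> q" by (auto simp: a_r_coset_def' intro: bexI[of _ "p - q"])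
  then show "pe p = pe q" using P.a_repr_independence[OF _ pq(2) J.a_subgroup, of p] by (simp add: pres_elem_def)
qed

definition phi :: "gpoly set => complex poly => ck0" where
  "phi S = psi (SOME p. p \<in> carrier P \<and> pe p = S)"

lemma phi_pe: assumes p: "p \<in> carrier P" shows "phi (pe p) = psi p"
proof -
  have "(SOME q. q \<in> carrier P \<and> pe q = pe p) \<in> carrier P \<and> pe (SOME q. q \<in> carrier P \<and> pe q = pe p) = pe p"
    by (rule someI[of "\<lambda>q. q \<in> carrier P \<and> pe q = pe p" p]) (simp add: p)
  then show ?thesis unfolding phi_def using p pe_eq_iff psi_eq_iff by blast
qed

lemma phi_iso: "phi \<in> calgebra_iso (pres_algebra Z) (split_algebra Z)"
proof -
  have "phi \<in> ring_iso (pres_algebra Z) (split_algebra Z)"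
  proof (rule ring_iso_memI)
    show "bij_betw phi (carrier (pres_algebra Z)) (carrier (split_algebra Z))"
      unfolding bij_betw_def pres_simps split_simps carrier_Q
    proof
      show "inj_on phi (pe ` carrier P)" by (auto simp: inj_on_def phi_pe psi_eq_iff pe_eq_iff)
      show "phi ` pe ` carrier P = carrier V" using psi_surj psi_closed phi_pe by (auto simp: image_iff) metis+
    qed
  qed (auto simp: carrier_Q phi_pe psi_closed pe_simps psi_mult psi_add psi_1 P_mult P_add)
  moreover have "phi (c \<odot>\<^bsub>pres_algebra Z\<^esub> a) = c \<odot>\<^bsub>split_algebra Z\<^esub> phi a" if "a \<in> carrier (pres_algebra Z)" for c a
    using that by (auto simp: carrier_Q pe_simps phi_pe psi_cst P_mult)
  ultimately show ?thesis using algebra_pres algebra_split by (simp add: calgebra_iso_def)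
qed

subsection \<open>The generators\<close>

lemma phi_gvar: assumes g: "g \<in> gvars Z" shows "phi (pe (gvar g)) = split_class Z (lin (pos g)) (NM (lin (pos g)) [gd g])"
proof -
  have pz: "pos g \<in> Z" using g by (auto simp: gvars_def)
  have bd: "bdiag (brk (lin (pos g))) (gd g)" using pz bdiag_gd[of g] by (simp add: brk_lin)
  have "psi (gvar g) = split_class Z (lin (pos g)) (NM (lin (pos g)) [gd g])"
    using FF_string[OF Gam_lin[OF pz] bd] split_class_closed[OF Gam_lin[OF pz] is_wmod_string[OF bd]] P_gvar[OF g]
    by (intro psi_eqI) (simp_all add: EE_gvar)
  then show ?thesis using phi_pe[OF P_gvar[OF g]] by simp
qed

context
  fixes k assumes k: "k \<in> Z"
begin

lemma k_half: "complex_of_real (k - 1/2) = of_int \<lfloor>k\<rfloor>" "complex_of_real (k + 1/2) = of_int (\<lfloor>k\<rfloor> + 1)"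
proof -
  have "k - 1/2 = of_int \<lfloor>k\<rfloor>" "k + 1/2 = of_int (\<lfloor>k\<rfloor> + 1)" using floor_half[OF k] by simp_all
  then show "complex_of_real (k - 1/2) = of_int \<lfloor>k\<rfloor>" "complex_of_real (k + 1/2) = of_int (\<lfloor>k\<rfloor> + 1)"
    by (simp_all only: of_real_of_int_eq)
qed

lemma less_k: "k < of_int n \<longleftrightarrow> \<lfloor>k\<rfloor> < n" "of_int n < k \<longleftrightarrow> n \<le> \<lfloor>k\<rfloor>"
  using floor_half[OF k] by linarith+

lemma string_k: "pos g = k ==> string_module (lin k) (gd g)" using string_gd[of g] k by auto

lemma gd_wmod: "pos g = k ==> NM (lin k) [gd g] \<in> wmod_O (lin k)"
  by (rule NM_wmod[OF string_module.bd[OF string_k]])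

lemma weights_gd: "pos g = k ==> weights (lin k) (NM (lin k) [gd g]) = {of_int l | l. Vx l \<in> gd g}"
  by (rule string_module.weights_string[OF string_k])

lemma X_nonzero_gd:
  assumes "pos g = k" "Vx \<lfloor>k\<rfloor> \<in> gd g" "Vx (\<lfloor>k\<rfloor> + 1) \<in> gd g"
  shows "X_nonzero_at (lin k) (NM (lin k) [gd g]) LPlus (k - 1/2) \<longleftrightarrow> Up \<lfloor>k\<rfloor> \<in> gd g"
    "X_nonzero_at (lin k) (NM (lin k) [gd g]) LMinus (k + 1/2) \<longleftrightarrow> Dn \<lfloor>k\<rfloor> \<in> gd g"
    "X_zero_at (lin k) (NM (lin k) [gd g]) LPlus (k - 1/2) \<longleftrightarrow> Up \<lfloor>k\<rfloor> \<notin> gd g"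
    "X_zero_at (lin k) (NM (lin k) [gd g]) LMinus (k + 1/2) \<longleftrightarrow> Dn \<lfloor>k\<rfloor> \<notin> gd g"
proof -
  interpret string_module "lin k" "gd g" by (rule string_k[OF assms(1)])
  have nz: "cst c * ev i l = 0 \<longleftrightarrow> c = 0" for c i l
    by (simp add: ev_def cst_mult_single) (metis lookup_single_eq lookup_zero single_zero)
  \<comment> \<open>On the line spanned by \<open>ev 0 l\<close> the operator is injective or zero,
    according to the presence of the arrow.\<close>
  have gen: "((\<forall>v\<in>A. v \<noteq> 0 --> F v \<noteq> 0) \<longleftrightarrow> B) \<and> ((\<forall>v\<in>A. F v = 0) \<longleftrightarrow> \<not> B)"
    if A: "A = {cst c * ev 0 l | c. True}" and F: "\<And>c. F (cst c * ev 0 l) = (if B then cst (c * a) * ev 0 m else 0)" and a: "a \<noteq> 0"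
    for A F B l a m
  proof -
    have 1: "cst 1 * ev 0 l \<in> A" "cst 1 * ev 0 l \<noteq> 0" unfolding A nz by (blast, simp)
    show ?thesis
    proof (cases B)
      case True
      have "F v \<noteq> 0" if v: "v \<in> A" "v \<noteq> 0" for v
      proof -
        obtain c where c: "v = cst c * ev 0 l" using v(1) A by blast
        then have "c \<noteq> 0" using v(2) nz by blast
        then show ?thesis unfolding c F using True a nz[of "c * a" 0 m] by simp
      qed
      then show ?thesis using True 1 by blast
    next
      case False
      then have "F v = 0" if "v \<in> A" for v using that F unfolding A by auto
      then show ?thesis using False 1 by blast
    qed
  qed
  have h: "hatl (lin k) \<lfloor>k\<rfloor> \<noteq> 0" by (rule hat_nonzero[OF t])
  have U: "gwa_X (lin k) LPlus \<odot>\<^bsub>N\<^esub> (cst c * ev 0 \<lfloor>k\<rfloor>) = (if Up \<lfloor>k\<rfloor> \<in> gd g then cst (c * 1) * ev 0 (\<lfloor>k\<rfloor> + 1) else 0)" for c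
    unfolding X_ev(1)[OF assms(2)] by simp
  have D: "gwa_X (lin k) LMinus \<odot>\<^bsub>N\<^esub> (cst c * ev 0 (\<lfloor>k\<rfloor> + 1)) = (if Dn \<lfloor>k\<rfloor> \<in> gd g then cst (c * hatl (lin k) \<lfloor>k\<rfloor>) * ev 0 \<lfloor>k\<rfloor> else 0)" for c
    unfolding X_ev(2)[OF assms(3)] by simp
  have W: "weight_space (lin k) N (weight_ideal (of_int \<lfloor>k\<rfloor>)) = {cst c * ev 0 \<lfloor>k\<rfloor> | c. True}"
    "weight_space (lin k) N (weight_ideal (of_int (\<lfloor>k\<rfloor> + 1))) = {cst c * ev 0 (\<lfloor>k\<rfloor> + 1) | c. True}"
    unfolding W_ev using assms(2,3) by simp_all
  show "X_nonzero_at (lin k) N LPlus (k - 1/2) \<longleftrightarrow> Up \<lfloor>k\<rfloor> \<in> gd g"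
    "X_zero_at (lin k) N LPlus (k - 1/2) \<longleftrightarrow> Up \<lfloor>k\<rfloor> \<notin> gd g"
    using gen[OF W(1) U] unfolding X_nonzero_at_def X_zero_at_def k_half NM_simps by simp_all
  show "X_nonzero_at (lin k) N LMinus (k + 1/2) \<longleftrightarrow> Dn \<lfloor>k\<rfloor> \<in> gd g"
    "X_zero_at (lin k) N LMinus (k + 1/2) \<longleftrightarrow> Dn \<lfloor>k\<rfloor> \<notin> gd g"
    using gen[OF W(2) D h] unfolding X_nonzero_at_def X_zero_at_def k_half NM_simps by blast+
qed

text \<open>An indecomposable object over \<open>A(z - k)\<close> is given by the string of one of
  the four generators at \<open>k\<close>, by \<open>string_one_break\<close>; \<open>uniq\<close>
  says that the invariants defining the class exclude the other three.\<close>

lemma class_image: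
  assumes g: "pos g = k" and mem: "NM (lin k) [gd g] \<in> \<M>"
    and sub: "\<And>M. M \<in> \<M> ==> M \<in> wmod_O (lin k) \<and> indecomposable_module (GWA (lin k)) M"
    and uniq: "\<And>M g' f. M \<in> \<M> ==> pos g' = k ==> f \<in> module_iso (GWA (lin k)) (NM (lin k) [gd g']) M ==> g' = g"
  shows "split_class Z (lin k) ` \<M> = {phi (pe (gvar g))}"
proof -
  have gv: "g \<in> gvars Z" using g k by (cases g) auto
  have "split_class Z (lin k) M = split_class Z (lin k) (NM (lin k) [gd g])" if M: "M \<in> \<M>" for M
  proof -
    obtain D f where D: "string_module (lin k) D" "f \<in> module_iso (GWA (lin k)) (NM (lin k) [D]) M"
      using indecomposable_string[OF Gam_nonzero[OF Gam_lin[OF k]]] sub[OF M] by blast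
    have "bdiag {\<lfloor>k\<rfloor>} D" "con D" using D(1) k by (simp_all add: string_module_def brk_lin)
    then obtain h where h: "pos h = k" "D = gd h" using that[OF pos_tau string_one_break] by blast
    have "h = g" by (rule uniq[OF M h(1) D(2)[unfolded h(2)]])
    then show ?thesis using split_class_iso[OF Gam_lin[OF k] D] h(2) by simp
  qed
  then have "split_class Z (lin k) ` \<M> = (\<lambda>_. split_class Z (lin k) (NM (lin k) [gd g])) ` \<M>" by (intro image_cong refl)
  also have "\<dots> = {split_class Z (lin k) (NM (lin k) [gd g])}" using mem by (rule image_constant)
  finally show ?thesis unfolding phi_gvar[OF gv, unfolded g] .
qed

lemma iso_invariants:
  assumes M: "M \<in> wmod_O (lin k)" and g: "pos g = k" and f: "f \<in> module_iso (GWA (lin k)) (NM (lin k) [gd g]) M"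
  shows "weights (lin k) M = {of_int l | l. Vx l \<in> gd g}"
    "X_nonzero_at (lin k) M l a \<longleftrightarrow> X_nonzero_at (lin k) (NM (lin k) [gd g]) l a"
  using iso_weights[OF wmod_O_left_module[OF gd_wmod[OF g]] wmod_O_left_module[OF M] f] weights_gd[OF g]
    iso_X_nonzero[OF wmod_O_left_module[OF gd_wmod[OF g]] wmod_O_left_module[OF M] f] by simp_all

lemma weights_eq_iff: "{of_int l :: complex | l. A l} = {of_int l | l. B l} \<longleftrightarrow> (\<forall>l. A l \<longleftrightarrow> B l)"
  by (auto simp: set_eq_iff) (metis of_int_eq_iff)+

lemma class_right: "split_class Z (lin k) ` M_right k = {phi (pe (xp k))}"
proof (rule class_image)
  let ?g = "XPlus k"
  interpret string_module "lin k" "gd ?g" by (rule string_k) simp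
  have "weights (lin k) N = {of_int n | n. real_of_int n > k}"
    unfolding weights_string weights_eq_iff less_k by simp
  moreover have "simple_module (GWA (lin k)) N" by (rule simple) auto
  ultimately show "N \<in> M_right k"
    using gd_wmod[of ?g] one_dim unfolding M_right_def pos.simps by blast
  show "g' = ?g" if "M \<in> M_right k" "pos g' = k" "f \<in> module_iso (GWA (lin k)) (NM (lin k) [gd g']) M" for M g' f
  proof -
    have "\<forall>l. Vx l \<in> gd g' \<longleftrightarrow> \<lfloor>k\<rfloor> < l"
      using iso_invariants(1)[OF _ that(2,3)] that(1) by (simp add: M_right_def weights_eq_iff less_k)
    then have "Vx \<lfloor>k\<rfloor> \<notin> gd g'" by simp
    then show ?thesis using that(2) by (cases g') auto
  qed
qed (auto simp: M_right_def simple_indecomposable)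

lemma class_left: "split_class Z (lin k) ` M_left k = {phi (pe (xm k))}"
proof (rule class_image)
  let ?g = "XMinus k"
  interpret string_module "lin k" "gd ?g" by (rule string_k) simp
  have "weights (lin k) N = {of_int n | n. real_of_int n < k}"
    unfolding weights_string weights_eq_iff less_k by simp
  moreover have "simple_module (GWA (lin k)) N" by (rule simple) auto
  ultimately show "N \<in> M_left k"
    using gd_wmod[of ?g] one_dim unfolding M_left_def pos.simps by blast
  show "g' = ?g" if "M \<in> M_left k" "pos g' = k" "f \<in> module_iso (GWA (lin k)) (NM (lin k) [gd g']) M" for M g' f
  proof -
    have "\<forall>l. Vx l \<in> gd g' \<longleftrightarrow> l \<le> \<lfloor>k\<rfloor>"
      using iso_invariants(1)[OF _ that(2,3)] that(1) by (simp add: M_left_def weights_eq_iff less_k)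
    then have "Vx (\<lfloor>k\<rfloor> + 1) \<notin> gd g'" by simp
    then show ?thesis using that(2) by (cases g') auto
  qed
qed (auto simp: M_left_def simple_indecomposable)

lemma Ints_weights: "(\<int> :: complex set) = {of_int l | l. True}" by (auto simp: Ints_def)

lemma full_cases:
  assumes "M \<in> wmod_O (lin k)" "pos g = k" "f \<in> module_iso (GWA (lin k)) (NM (lin k) [gd g]) M" "weights (lin k) M = \<int>"
  shows "g = YPlus k \<or> g = YMinus k"
proof -
  have "\<forall>l. Vx l \<in> gd g"
    using trans[OF assms(4)[symmetric] iso_invariants(1)[OF assms(1-3)]] unfolding Ints_weights weights_eq_iff by simp
  then have "Vx \<lfloor>k\<rfloor> \<in> gd g" "Vx (\<lfloor>k\<rfloor> + 1) \<in> gd g" by simp_all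
  then show ?thesis using assms(2) by (cases g) auto
qed

lemma class_full_plus: "split_class Z (lin k) ` M_full_plus k = {phi (pe (yp k))}"
proof (rule class_image)
  let ?g = "YPlus k"
  interpret string_module "lin k" "gd ?g" by (rule string_k) simp
  have "weights (lin k) N = \<int>" unfolding weights_string Ints_weights weights_eq_iff by simp
  moreover have "\<not> simple_module (GWA (lin k)) N" by (rule not_simple[of "\<lfloor>k\<rfloor>"]) auto
  moreover have "Vx \<lfloor>k\<rfloor> \<in> gd ?g" "Vx (\<lfloor>k\<rfloor> + 1) \<in> gd ?g" "Up \<lfloor>k\<rfloor> \<in> gd ?g" "Dn \<lfloor>k\<rfloor> \<notin> gd ?g" by simp_all
  ultimately show "N \<in> M_full_plus k"
    using gd_wmod[of ?g] indecomposable one_dim X_nonzero_gd[of ?g] unfolding M_full_plus_def pos.simps by blast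
  \<comment> \<open>The weights leave only the two \<open>Y\<close> strings, and these are told
    apart by the action of \<open>LPlus\<close> at \<open>k - 1/2\<close>.\<close>
  show "g' = ?g" if M: "M \<in> M_full_plus k" and g': "pos g' = k" "f \<in> module_iso (GWA (lin k)) (NM (lin k) [gd g']) M" for M g' f
  proof -
    have w: "M \<in> wmod_O (lin k)" "X_nonzero_at (lin k) M LPlus (k - 1/2)" using M unfolding M_full_plus_def by blast+
    have "g' \<noteq> YMinus k"
    proof
      assume e: "g' = YMinus k"
      have "X_nonzero_at (lin k) (NM (lin k) [gd g']) LPlus (k - 1/2)" using iso_invariants(2)[OF w(1) g'] w(2) by blast
      then show False using X_nonzero_gd(1)[OF g'(1)] unfolding e by simp
    qed
    then show ?thesis using full_cases[OF _ g'] M by (auto simp: M_full_plus_def)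
  qed
qed (auto simp: M_full_plus_def)

lemma class_full_minus: "split_class Z (lin k) ` M_full_minus k = {phi (pe (ym k))}"
proof (rule class_image)
  let ?g = "YMinus k"
  interpret string_module "lin k" "gd ?g" by (rule string_k) simp
  have "weights (lin k) N = \<int>" unfolding weights_string Ints_weights weights_eq_iff by simp
  moreover have "\<not> simple_module (GWA (lin k)) N" by (rule not_simple[of "\<lfloor>k\<rfloor>"]) auto
  moreover have "Vx \<lfloor>k\<rfloor> \<in> gd ?g" "Vx (\<lfloor>k\<rfloor> + 1) \<in> gd ?g" "Dn \<lfloor>k\<rfloor> \<in> gd ?g" "Up \<lfloor>k\<rfloor> \<notin> gd ?g" by simp_all
  ultimately show "N \<in> M_full_minus k"
    using gd_wmod[of ?g] indecomposable one_dim X_nonzero_gd[of ?g] unfolding M_full_minus_def pos.simps by blast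
  show "g' = ?g" if M: "M \<in> M_full_minus k" and g': "pos g' = k" "f \<in> module_iso (GWA (lin k)) (NM (lin k) [gd g']) M" for M g' f
  proof -
    have w: "M \<in> wmod_O (lin k)" "X_nonzero_at (lin k) M LMinus (k + 1/2)" using M unfolding M_full_minus_def by blast+
    have "g' \<noteq> YPlus k"
    proof
      assume e: "g' = YPlus k"
      have "X_nonzero_at (lin k) (NM (lin k) [gd g']) LMinus (k + 1/2)" using iso_invariants(2)[OF w(1) g'] w(2) by blast
      then show False using X_nonzero_gd(2)[OF g'(1)] unfolding e by simp
    qed
    then show ?thesis using full_cases[OF _ g'] M by (auto simp: M_full_minus_def)
  qed
qed (auto simp: M_full_minus_def)

end

end

theorem theorem4p13:
  fixes Z :: "real set"
  assumes "Z \<subseteq> {of_int n + 1/2 | n::int. True}"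
  shows "\<exists>\<phi> \<in> calgebra_iso (pres_algebra Z) (split_algebra Z). \<forall>k\<in>Z.
      split_class Z (lin k) ` M_right k = {\<phi> (pres_elem Z (xp k))}
    \<and> split_class Z (lin k) ` M_left k = {\<phi> (pres_elem Z (xm k))}
    \<and> split_class Z (lin k) ` M_full_plus k = {\<phi> (pres_elem Z (yp k))}
    \<and> split_class Z (lin k) ` M_full_minus k = {\<phi> (pres_elem Z (ym k))}"
proof -
  interpret presentation Z by (rule presentation.intro[OF assms])
  show ?thesis
    by (intro bexI[of _ phi] ballI conjI class_right class_left class_full_plus class_full_minus phi_iso)
qed

end
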